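(* Let $X$ be a compact connected Riemann surface with a Kähler form $\omega_X$ satisfying $\int_X\omega_X=1$. Let $(L,\overline\partial_L)$ be a holomorphic line bundle over $X$. Let $E$ be a holomorphic bundle over $X\times\mathbb{C}$ which is an extension of $\underline{\mathbb{C}}_{X\times\mathbb{C}}$ by $p^\ast L\otimes q^\ast L_{-1}$, and let $\overline\partial_E$ be the Dolbeault operator of $E$; identify $E$ with $p^\ast L\otimes q^\ast L_{-1}\oplus\underline{\mathbb{C}}_{X\times\mathbb{C}}$ by a smooth splitting, with the $SE(2)$-action described in the context. On $X\times\mathbb{C}$ consider the Kähler form $\Omega=p^\ast\omega_X\oplus q^\ast\omega_{\mathrm{can}}$. (i) If $(E,\overline\partial_E)$ is an $SE(2)$-equivariant holomorphic bundle, then there exists a holomorphic section $\phi$ of $(L,\overline\partial_L)$ such that $$\overline\partial_E=\begin{pmatrix}p^\ast\overline\partial_L\otimes\mathrm{Id}+\mathrm{Id}\otimes q^\ast\overline\partial_{\mathbb{C}}&\frac{1}{2\sqrt2}\cdot p^\ast\phi\otimes q^\ast\alpha\\0&\overline\partial_{X\times\mathbb{C}}\end{pmatrix}.$$ (ii) Let $h_E$ be a pseudo-Hermitian metric of signature $(1,1)$ on $E$. If $h_E$ is $SE(2)$-invariant, then there exist Hermitian metrics $h_L$ on $L$ and $h_X$ on $\underline{\mathbb{C}}_X$ such that $$h_E=\begin{pmatrix}C_0\cdot p^\ast(h_Xh_L)\otimes q^\ast h^{(-1)}&0\\0&C_1\cdot p^\ast h_X\end{pmatrix}$$ where $(C_0,C_1)=(1,-1)$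 or $(-1,1)$. (iii) Let $(E,\overline\partial_E)$ be an $SE(2)$-equivariant holomorphic bundle and $h_E$ an $SE(2)$-invariant pseudo-Hermitian metric of signature $(1,1)$ on $E$, with $\phi$ and $h_L$ as in the displayed forms of $\overline\partial_E$ and $h_E$ in (i) and (ii), and let $\nabla_{h_E}$ be the connection compatible with $h_E$ with $\nabla^{0,1}_{h_E}=\overline\partial_E$. If $h_E$ is a pseudo-Hermitian-Einstein metric of $(E,\overline\partial_E)$ with respect to $\Omega$, or equivalently, if $\nabla_{h_E}$ is a pseudo-Hermitian-Yang-Mills connection, then: - the triple $((L,\overline\partial_L),\phi,h_L)$ satisfies Manton's exotic $\tau$-vortex equation with $\tau=0$; - the constant $\lambda$ in the equation $\sqrt{-1}\Lambda_\Omega F_{h_E}=\lambda\,\mathrm{Id}_E$ satisfies $\lambda=\pi\deg L$.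
   Context: Vortex equation: for $\tau\in\mathbb{R}$, $((L,\overline\partial_L),\phi,h_L)$ satisfies Manton's exotic $\tau$-vortex equation if $\sqrt{-1}\Lambda_{\omega_X}F_{h_L}-\frac12|\phi|^2_{h_L}-\frac\tau2=0$, where $F_{h_L}$ is the curvature of the Chern connection of $(\overline\partial_L,h_L)$ and $\Lambda_{\omega_X}$ is contraction with $\omega_X$. Notation: $p:X\times\mathbb{C}\to X$, $q:X\times\mathbb{C}\to\mathbb{C}$ are the projections; $\underline{\mathbb{C}}_M$ is the trivial holomorphic line bundle over $M$, and a Hermitian metric on it is a smooth positive function; $\overline\partial_{X\times\mathbb{C}}$, $\overline\partial_{\mathbb{C}}$ are the standard Dolbeault operators. $SE(2)=\mathbb{C}\rtimes U(1)$ acts on $\mathbb{C}$ by $(a,e^{i\theta})\cdot z=a+e^{i\theta}z$. For $n\in\mathbb{Z}$, $L_n$ is the trivial holomorphic line bundle $(\underline{\mathbb{C}}_{\mathbb{C}},\overline\partial_{\mathbb{C}})$ over $\mathbb{C}$ with canonical frame $e_n$ and $SE(2)$-action $(a,e^{i\theta})\cdot(e_n)_z=e^{in\theta}(e_n)_{a+e^{i\theta}z}$; $h^{(n)}$ is the $SE(2)$-invariant Hermitian metric on $L_n$ with $h^{(n)}(e_n,e_n)=1$. $\alpha:=d\overline z\otimes e_{-1}\in A^{0,1}(L_{-1})$. $\omega_{\mathrm{can}}=\frac{\sqrt{-1}}{2}dz\wedge d\overline z$ is the Kähler form of the Euclidean metric. The bundle $E$ and its action: the holomorphic extension $0\to p^\ast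 L\otimes q^\ast L_{-1}\to E\to\underline{\mathbb{C}}_{X\times\mathbb{C}}\to0$ splits smoothly, and $E$ is identified as a smooth bundle with $p^\ast L\otimes q^\ast L_{-1}\oplus\underline{\mathbb{C}}_{X\times\mathbb{C}}$. $SE(2)$ acts on $X\times\mathbb{C}$ trivially on $X$ and on $\mathbb{C}$ by $(a,e^{i\theta})\cdot z=a+e^{i\theta}z$; it acts on $E$ (via this identification) through the action on $L_{-1}$, trivially on the factors pulled back from $X$ (and on $\underline{\mathbb{C}}_{X\times\mathbb{C}}$ by the action on the base). $(E,\overline\partial_E)$ is an $SE(2)$-equivariant holomorphic bundle if every $g\in SE(2)$ acts by a biholomorphic map of the total space of $(E,\overline\partial_E)$. A Hermitian form $h$ on $E$ is $SE(2)$-invariant if $h_{gx}(g\cdot,g\cdot)=h_x(\cdot,\cdot)$ for all $g$ and $x$. Pseudo-Hermitian metrics: a pseudo-Hermitian metric of signature $(p,q)$ on a complex vector bundle $E$ is a smooth non-degenerate Hermitian form on $E$ of signature $(p,q)$ on every fibre. A connection $D$ is compatible with $h$ if $dh(\cdot,\cdot)=h(D\cdot,\cdot)+h(\cdot,D\cdot)$. For a holomorphic structure $\overline\partial_E$ there is a unique connection $\nabla_h$ compatible with $h$ with $\nabla_h^{0,1}=\overline\partial_E$; put $F_h=(\nabla_h)^2$. For a Kähler form $\omega$ on the base, $h$ is a pseudo-Hermitian-Einstein metric of $(E,\overline\partial_E)$ with respect to $\omega$, and $\nabla_h$ is a pseudo-Hermitian-Yang-Mills connection, if $\sqrt{-1}\Lambda_\omega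 F_h=\lambda\,\mathrm{Id}_E$ for some constant $\lambda$. *)

theory Defs
  imports "HOL-Analysis.Analysis"
begin

section \<open>Smooth and holomorphic maps between open subsets of coordinate spaces\<close>

primrec k_smooth_on ::
  "nat \<Rightarrow> 'a::euclidean_space set \<Rightarrow> ('a \<Rightarrow> 'b::real_normed_vector) \<Rightarrow> bool" where
  "k_smooth_on 0 S f \<longleftrightarrow> continuous_on S f"
| "k_smooth_on (Suc k) S f \<longleftrightarrow>
     (\<forall>x\<in>S. f differentiable (at x)) \<and>
     (\<forall>v. k_smooth_on k S (\<lambda>x. frechet_derivative f (at x) v))"

definition smooth_on :: "'a::euclidean_space set \<Rightarrow> ('a \<Rightarrow> 'b::real_normed_vector) \<Rightarrow> bool" where
  "smooth_on S f \<longleftrightarrow> (\<forall>k. k_smooth_on k S f)"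

definition cholomorphic_on :: "(complex^'n) set \<Rightarrow> (complex^'n \<Rightarrow> complex^'m) \<Rightarrow> bool" where
  "cholomorphic_on S f \<longleftrightarrow>
     (\<forall>x\<in>S. \<exists>f'. (f has_derivative f') (at x) \<and> (\<forall>c v. f' (c *s v) = c *s f' v))"


section \<open>Complex manifolds\<close>

text \<open>
  A chart is a pair of a domain \<open>U\<close> and a coordinate map; only the values of the map on \<open>U\<close> matter.
  Complex dimension is the index type \<open>'n\<close>.
\<close>

type_synonym ('m, 'n) chart = "'m set \<times> ('m \<Rightarrow> complex^'n)"

definition in_chart :: "('m, 'n::finite) chart \<Rightarrow> ('m \<Rightarrow> 'b) \<Rightarrow> complex^'n \<Rightarrow> 'b" where
  "in_chart c f = (\<lambda>y. f (inv_into (fst c) (snd c) y))"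

definition complex_atlas :: "('m::topological_space, 'n::finite) chart set \<Rightarrow> bool" where
  "complex_atlas A \<longleftrightarrow>
     (\<Union>c\<in>A. fst c) = UNIV \<and>
     (\<forall>(U, \<phi>)\<in>A. open U \<and> open (\<phi> ` U) \<and> (\<exists>\<psi>. homeomorphism U (\<phi> ` U) \<phi> \<psi>)) \<and>
     (\<forall>(U, \<phi>)\<in>A. \<forall>(V, \<psi>)\<in>A. cholomorphic_on (\<phi> ` (U \<inter> V)) (in_chart (U, \<phi>) \<psi>))"

definition smooth_fun ::
  "('m, 'n::finite) chart set \<Rightarrow> 'm set \<Rightarrow> ('m \<Rightarrow> 'b::real_normed_vector) \<Rightarrow> bool" where
  "smooth_fun A W f \<longleftrightarrow> (\<forall>(U, \<phi>)\<in>A. smooth_on (\<phi> ` (U \<inter> W)) (in_chart (U, \<phi>) f))"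

definition holo_fun ::
  "('m, 'n::finite) chart set \<Rightarrow> 'm set \<Rightarrow> ('m \<Rightarrow> complex^'r) \<Rightarrow> bool" where
  "holo_fun A W f \<longleftrightarrow> (\<forall>(U, \<phi>)\<in>A. cholomorphic_on (\<phi> ` (U \<inter> W)) (in_chart (U, \<phi>) f))"

text \<open>
  Maps between manifolds whose topology is the one given by their charts; openness of the
  coordinate images of \<open>U \<inter> F -` V\<close> is continuity of \<open>F\<close>.
\<close>

definition holo_map ::
  "('m, 'n::finite) chart set \<Rightarrow> ('k, 'l::finite) chart set \<Rightarrow> ('m \<Rightarrow> 'k) \<Rightarrow> bool" where
  "holo_map A B F \<longleftrightarrow>
     (\<forall>(U, \<phi>)\<in>A. \<forall>(V, \<psi>)\<in>B.
        open (\<phi> ` (U \<inter> F -` V)) \<and>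
        cholomorphic_on (\<phi> ` (U \<inter> F -` V)) (in_chart (U, \<phi>) (\<psi> \<circ> F)))"

definition biholomorphic ::
  "('m, 'n::finite) chart set \<Rightarrow> ('k, 'l::finite) chart set \<Rightarrow> ('m \<Rightarrow> 'k) \<Rightarrow> bool" where
  "biholomorphic A B F \<longleftrightarrow> bij F \<and> holo_map A B F \<and> holo_map B A (inv F)"


section \<open>Differential forms\<close>

text \<open>
  In a chart \<open>c\<close> around \<open>p\<close> a tangent vector at \<open>p\<close> is represented by its coordinate vector in
  \<open>complex^'n\<close>, regarded as a real vector space with complex structure \<open>v \<mapsto> \<i> *s v\<close>.
  A (real) \<open>k\<close>-form is represented by a function of the chart, the point and \<open>k\<close> such coordinate
  vectors.  \<open>dir_deriv c v f p\<close> is \<open>df\<^sub>p(v)\<close>.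
\<close>

definition dir_deriv ::
  "('m, 'n::finite) chart \<Rightarrow> complex^'n \<Rightarrow> ('m \<Rightarrow> 'b::real_normed_vector) \<Rightarrow> 'm \<Rightarrow> 'b" where
  "dir_deriv c v f p = frechet_derivative (in_chart c f) (at (snd c p)) v"

type_synonym ('m, 'n, 'b) two_form =
  "('m, 'n) chart \<Rightarrow> 'm \<Rightarrow> complex^'n \<Rightarrow> complex^'n \<Rightarrow> 'b"

definition kaehler_form :: "('m, 'n::finite) chart set \<Rightarrow> ('m, 'n, real) two_form \<Rightarrow> bool" where
  "kaehler_form A \<omega> \<longleftrightarrow>
     (\<forall>c\<in>A. \<forall>p\<in>fst c.
        (\<forall>v. linear (\<lambda>u. \<omega> c p u v)) \<and>
        (\<forall>u v. \<omega> c p u v = - \<omega> c p v u) \<and>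
        (\<forall>u v. \<omega> c p (\<i> *s u) (\<i> *s v) = \<omega> c p u v) \<and>
        (\<forall>v. v \<noteq> 0 \<longrightarrow> \<omega> c p v (\<i> *s v) > 0) \<and>
        (\<forall>u v w. dir_deriv c u (\<lambda>q. \<omega> c q v w) p + dir_deriv c v (\<lambda>q. \<omega> c q w u) p
                 + dir_deriv c w (\<lambda>q. \<omega> c q u v) p = 0)) \<and>
     (\<forall>c\<in>A. \<forall>u v. smooth_on (snd c ` fst c) (in_chart c (\<lambda>p. \<omega> c p u v))) \<and>
     (\<forall>c\<in>A. \<forall>c'\<in>A. \<forall>p\<in>fst c \<inter> fst c'. \<forall>u v.
        \<omega> c' p (dir_deriv c u (snd c') p) (dir_deriv c v (snd c') p) = \<omega> c p u v)"

definition pullback2 ::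
  "('k, 'l::finite) chart set \<Rightarrow> ('m \<Rightarrow> 'k) \<Rightarrow> ('k, 'l, 'b) two_form \<Rightarrow> ('m, 'n::finite, 'b) two_form" where
  "pullback2 B f \<omega> c p u v =
     (let d = (SOME d. d \<in> B \<and> f p \<in> fst d)
      in \<omega> d (f p) (dir_deriv c u (snd d \<circ> f) p) (dir_deriv c v (snd d \<circ> f) p))"

text \<open>
  Contraction \<open>\<Lambda>\<^sub>\<omega>F\<close> of a 2-form at a point with a positive \<open>(1,1)\<close>-form:
  \<open>\<Sum>\<^sub>j F(b\<^sub>j, J b\<^sub>j)\<close> for a complex basis \<open>b\<close> that is unitary for \<open>\<omega>\<close>, so that
  \<open>\<Lambda>\<^sub>\<omega>\<omega>\<close> is the complex dimension and, for a local coordinate \<open>x + \<i>y\<close> in dimension one,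
  \<open>\<Lambda>\<^sub>\<omega>(f dx \<and> dy) = f / \<rho>\<close> if \<open>\<omega> = \<rho> dx \<and> dy\<close>.  The value does not depend on \<open>b\<close>.
\<close>

definition unitary_basis ::
  "(complex^'n \<Rightarrow> complex^'n \<Rightarrow> real) \<Rightarrow> ('n::finite \<Rightarrow> complex^'n) \<Rightarrow> bool" where
  "unitary_basis \<omega> b \<longleftrightarrow>
     (\<forall>j k. \<omega> (b j) (b k) = 0 \<and> \<omega> (b j) (\<i> *s b k) = (if j = k then 1 else 0))"

definition contraction ::
  "(complex^'n \<Rightarrow> complex^'n \<Rightarrow> real) \<Rightarrow> (complex^'n \<Rightarrow> complex^'n \<Rightarrow> 'b::comm_monoid_add) \<Rightarrow> 'b" where
  "contraction \<omega> F = (let b = (SOME b. unitary_basis \<omega> b) in \<Sum>j\<in>UNIV. F (b j) (\<i> *s b j))"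

definition partition_of_unity ::
  "('m::topological_space, 'n::finite) chart set \<Rightarrow> nat \<Rightarrow> (nat \<Rightarrow> ('m, 'n) chart) \<Rightarrow>
   (nat \<Rightarrow> 'm \<Rightarrow> real) \<Rightarrow> bool" where
  "partition_of_unity A N c f \<longleftrightarrow>
     (\<forall>k<N. c k \<in> A \<and> smooth_fun A UNIV (f k) \<and> (\<forall>p. f k p \<ge> 0) \<and>
            closure {p. f k p \<noteq> 0} \<subseteq> fst (c k)) \<and>
     (\<forall>p. (\<Sum>k<N. f k p) = 1)"

text \<open>
  Integral of a 2-form over a compact Riemann surface, with its complex orientation; the
  coordinate vectors \<open>axis 1 1\<close> and \<open>axis 1 \<i>\<close> are \<open>\<partial>/\<partial>x\<close> and \<open>\<partial>/\<partial>y\<close>.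
\<close>

definition surface_integral ::
  "('m::topological_space, 1) chart set \<Rightarrow> ('m, 1, real) two_form \<Rightarrow> real" where
  "surface_integral A \<eta> =
     (THE I. \<exists>N c f. partition_of_unity A N c f \<and>
        I = (\<Sum>k<N. set_lebesgue_integral lborel (snd (c k) ` fst (c k))
               (in_chart (c k) (\<lambda>p. f k p * \<eta> (c k) p (axis 1 1) (axis 1 \<i>)))))"


section \<open>Vector bundles\<close>

text \<open>
  A bundle of rank \<open>CARD('r)\<close> with total space the type \<open>'e\<close>.  Addition is meaningful only for
  two elements of the same fibre.  A local trivialization over \<open>W\<close> is given by its
  \<open>complex^'r\<close>-component, a function on the total space that matters only over \<open>W\<close>.
\<close>

record ('e, 'm, 'r::finite) vbundle =
  bproj :: "'e \<Rightarrow> 'm"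
  badd :: "'e \<Rightarrow> 'e \<Rightarrow> 'e"
  bscale :: "complex \<Rightarrow> 'e \<Rightarrow> 'e"
  btriv :: "('m set \<times> ('e \<Rightarrow> complex^'r)) set"

definition fibre :: "('e, 'm, 'r::finite) vbundle \<Rightarrow> 'm \<Rightarrow> 'e set" where
  "fibre E p = {e. bproj E e = p}"

definition bzero :: "('e, 'm, 'r::finite) vbundle \<Rightarrow> 'm \<Rightarrow> 'e" where
  "bzero E p = bscale E 0 (SOME e. e \<in> fibre E p)"

text \<open>The element of the fibre over \<open>p\<close> with component \<open>v\<close> in the trivialization \<open>\<tau>\<close>.\<close>

definition of_triv :: "('e, 'm, 'r::finite) vbundle \<Rightarrow> ('e \<Rightarrow> complex^'r) \<Rightarrow> complex^'r \<Rightarrow> 'm \<Rightarrow> 'e" where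
  "of_triv E \<tau> v p = inv_into (fibre E p) \<tau> v"

definition vector_bundle :: "('e, 'm::topological_space, 'r::finite) vbundle \<Rightarrow> bool" where
  "vector_bundle E \<longleftrightarrow>
     (\<Union>w\<in>btriv E. fst w) = UNIV \<and>
     (\<forall>(W, \<tau>)\<in>btriv E. open W \<and>
        (\<forall>p\<in>W. bij_betw \<tau> (fibre E p) UNIV \<and>
           (\<forall>e\<in>fibre E p. \<forall>e'\<in>fibre E p.
              badd E e e' \<in> fibre E p \<and> \<tau> (badd E e e') = \<tau> e + \<tau> e') \<and>
           (\<forall>e\<in>fibre E p. \<forall>a.
              bscale E a e \<in> fibre E p \<and> \<tau> (bscale E a e) = a *s \<tau> e)))"

definition smooth_bundle ::
  "('m::topological_space, 'n::finite) chart set \<Rightarrow> ('e, 'm, 'r::finite) vbundle \<Rightarrow> bool" where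
  "smooth_bundle A E \<longleftrightarrow> vector_bundle E \<and>
     (\<forall>(W, \<tau>)\<in>btriv E. \<forall>(W', \<tau>')\<in>btriv E. \<forall>v.
        smooth_fun A (W \<inter> W') (\<lambda>p. \<tau>' (of_triv E \<tau> v p)))"

definition holomorphic_bundle ::
  "('m::topological_space, 'n::finite) chart set \<Rightarrow> ('e, 'm, 'r::finite) vbundle \<Rightarrow> bool" where
  "holomorphic_bundle A E \<longleftrightarrow> vector_bundle E \<and>
     (\<forall>(W, \<tau>)\<in>btriv E. \<forall>(W', \<tau>')\<in>btriv E. \<forall>v.
        holo_fun A (W \<inter> W') (\<lambda>p. \<tau>' (of_triv E \<tau> v p)))"

text \<open>\<open>E\<close> is a holomorphic bundle whose underlying smooth vector bundle is \<open>V\<close>.\<close>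

definition holomorphic_structure_on ::
  "('m::topological_space, 'n::finite) chart set \<Rightarrow> ('e, 'm, 'r::finite) vbundle \<Rightarrow>
   ('e, 'm, 'r) vbundle \<Rightarrow> bool" where
  "holomorphic_structure_on A V E \<longleftrightarrow>
     smooth_bundle A V \<and> holomorphic_bundle A E \<and>
     bproj E = bproj V \<and> badd E = badd V \<and> bscale E = bscale V \<and>
     (\<forall>(W, \<tau>)\<in>btriv V. \<forall>(W', \<tau>')\<in>btriv E. \<forall>v.
        smooth_fun A (W \<inter> W') (\<lambda>p. \<tau>' (of_triv V \<tau> v p)) \<and>
        smooth_fun A (W \<inter> W') (\<lambda>p. \<tau> (of_triv E \<tau>' v p)))"

definition smooth_section ::
  "('m::topological_space, 'n::finite) chart set \<Rightarrow> ('e, 'm, 'r::finite) vbundle \<Rightarrow>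
   'm set \<Rightarrow> ('m \<Rightarrow> 'e) \<Rightarrow> bool" where
  "smooth_section A E W s \<longleftrightarrow>
     open W \<and> (\<forall>p\<in>W. s p \<in> fibre E p) \<and>
     (\<forall>(W', \<tau>)\<in>btriv E. smooth_fun A (W \<inter> W') (\<tau> \<circ> s))"

definition holomorphic_section ::
  "('m, 'n::finite) chart set \<Rightarrow> ('e, 'm, 'r::finite) vbundle \<Rightarrow> ('m \<Rightarrow> 'e) \<Rightarrow> bool" where
  "holomorphic_section A E s \<longleftrightarrow>
     (\<forall>p. s p \<in> fibre E p) \<and> (\<forall>(W, \<tau>)\<in>btriv E. holo_fun A W (\<tau> \<circ> s))"

definition holomorphic_bundle_map ::
  "('m, 'n::finite) chart set \<Rightarrow> ('e, 'm, 'r::finite) vbundle \<Rightarrow> ('f, 'm, 's::finite) vbundle \<Rightarrow>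
   ('e \<Rightarrow> 'f) \<Rightarrow> bool" where
  "holomorphic_bundle_map A E F f \<longleftrightarrow>
     (\<forall>e. bproj F (f e) = bproj E e) \<and>
     (\<forall>e e'. bproj E e = bproj E e' \<longrightarrow> f (badd E e e') = badd F (f e) (f e')) \<and>
     (\<forall>a e. f (bscale E a e) = bscale F a (f e)) \<and>
     (\<forall>(W, \<tau>)\<in>btriv E. \<forall>(W', \<tau>')\<in>btriv F. \<forall>v.
        holo_fun A (W \<inter> W') (\<lambda>p. \<tau>' (f (of_triv E \<tau> v p))))"

definition holomorphic_extension ::
  "('m, 'n::finite) chart set \<Rightarrow> ('f, 'm, 's::finite) vbundle \<Rightarrow> ('e, 'm, 'r::finite) vbundle \<Rightarrow>
   ('g, 'm, 't::finite) vbundle \<Rightarrow> ('f \<Rightarrow> 'e) \<Rightarrow> ('e \<Rightarrow> 'g) \<Rightarrow> bool" where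
  "holomorphic_extension A N E Q i q \<longleftrightarrow>
     holomorphic_bundle_map A N E i \<and> holomorphic_bundle_map A E Q q \<and>
     inj i \<and> surj q \<and> range i = {e. q e = bzero Q (bproj E e)}"

definition total_atlas ::
  "('m, 'n::finite) chart set \<Rightarrow> ('e, 'm, 'r::finite) vbundle \<Rightarrow> ('e, 'n + 'r) chart set" where
  "total_atlas A E =
     {(bproj E -` (U \<inter> W),
       \<lambda>e. \<chi> i. case i of Inl j \<Rightarrow> \<phi> (bproj E e) $ j | Inr k \<Rightarrow> \<tau> e $ k) | U \<phi> W \<tau>.
      (U, \<phi>) \<in> A \<and> (W, \<tau>) \<in> btriv E}"

text \<open>
  The Dolbeault operator of a holomorphic bundle is, in holomorphic trivializations, the
  \<open>(0,1)\<close>-part of the differential of the components; the \<open>(0,1)\<close>-part of a 1-form \<open>\<beta>\<close>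
  is \<open>v \<mapsto> (\<beta>(v) + \<i> \<beta>(J v)) / 2\<close>.  \<open>dolbeault E c v s p\<close> is the value at \<open>p\<close> of
  the resulting \<open>E\<close>-valued \<open>(0,1)\<close>-form on the tangent vector \<open>v\<close>.
\<close>

definition dolbeault ::
  "('e, 'm, 'r::finite) vbundle \<Rightarrow> ('m, 'n::finite) chart \<Rightarrow> complex^'n \<Rightarrow> ('m \<Rightarrow> 'e) \<Rightarrow> 'm \<Rightarrow> 'e" where
  "dolbeault E c v s p =
     (THE e. e \<in> fibre E p \<and>
        (\<forall>(W, \<tau>)\<in>btriv E. p \<in> W \<longrightarrow>
           \<tau> e = (1/2) *s (dir_deriv c v (\<tau> \<circ> s) p + \<i> *s dir_deriv c (\<i> *s v) (\<tau> \<circ> s) p)))"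


section \<open>Pseudo-Hermitian metrics and connections\<close>

text \<open>Forms are complex linear in the first argument and conjugate linear in the second.\<close>

definition hermitian_form ::
  "('m::topological_space, 'n::finite) chart set \<Rightarrow> ('e, 'm, 'r::finite) vbundle \<Rightarrow>
   ('e \<Rightarrow> 'e \<Rightarrow> complex) \<Rightarrow> bool" where
  "hermitian_form A E h \<longleftrightarrow>
     (\<forall>p. \<forall>e\<in>fibre E p. \<forall>e'\<in>fibre E p. \<forall>f\<in>fibre E p. \<forall>a.
        h (badd E e e') f = h e f + h e' f \<and> h (bscale E a e) f = a * h e f \<and>
        h f e = cnj (h e f)) \<and>
     (\<forall>W s t. smooth_section A E W s \<longrightarrow> smooth_section A E W t \<longrightarrow>
        smooth_fun A W (\<lambda>p. h (s p) (t p)))"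

definition hermitian_metric ::
  "('m::topological_space, 'n::finite) chart set \<Rightarrow> ('e, 'm, 'r::finite) vbundle \<Rightarrow>
   ('e \<Rightarrow> 'e \<Rightarrow> complex) \<Rightarrow> bool" where
  "hermitian_metric A E h \<longleftrightarrow>
     hermitian_form A E h \<and> (\<forall>e. e \<noteq> bzero E (bproj E e) \<longrightarrow> Re (h e e) > 0)"

definition fibre_basis :: "('e, 'm, 'r::finite) vbundle \<Rightarrow> 'm \<Rightarrow> ('r \<Rightarrow> 'e) \<Rightarrow> bool" where
  "fibre_basis E p b \<longleftrightarrow>
     (\<forall>i. b i \<in> fibre E p) \<and>
     (\<forall>(W, \<tau>)\<in>btriv E. p \<in> W \<longrightarrow> invertible (\<chi> i. \<tau> (b i)))"

definition pseudo_hermitian_metric ::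
  "('m::topological_space, 'n::finite) chart set \<Rightarrow> ('e, 'm, 'r::finite) vbundle \<Rightarrow> nat \<Rightarrow> nat \<Rightarrow>
   ('e \<Rightarrow> 'e \<Rightarrow> complex) \<Rightarrow> bool" where
  "pseudo_hermitian_metric A E m n h \<longleftrightarrow>
     hermitian_form A E h \<and>
     (\<forall>e. (\<forall>f. bproj E f = bproj E e \<longrightarrow> h e f = 0) \<longrightarrow> e = bzero E (bproj E e)) \<and>
     (\<forall>p. \<exists>b. fibre_basis E p b \<and> (\<forall>i j. i \<noteq> j \<longrightarrow> h (b i) (b j) = 0) \<and>
        card {i. Re (h (b i) (b i)) > 0} = m \<and> card {i. Re (h (b i) (b i)) < 0} = n)"

text \<open>
  A connection is given by its covariant derivatives: \<open>D c v s p\<close> is the value at \<open>p\<close> of the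
  covariant derivative of the local section \<open>s\<close> along the vector field with constant coordinates
  \<open>v\<close> in the chart \<open>c\<close>.
\<close>

type_synonym ('e, 'm, 'n) conn =
  "('m, 'n) chart \<Rightarrow> complex^'n \<Rightarrow> ('m \<Rightarrow> 'e) \<Rightarrow> 'm \<Rightarrow> 'e"

definition connection ::
  "('m::topological_space, 'n::finite) chart set \<Rightarrow> ('e, 'm, 'r::finite) vbundle \<Rightarrow>
   ('e, 'm, 'n) conn \<Rightarrow> bool" where
  "connection A E D \<longleftrightarrow>
     (\<forall>c\<in>A. \<forall>W s. smooth_section A E W s \<longrightarrow>
        (\<forall>v. smooth_section A E (fst c \<inter> W) (D c v s)) \<and>
        (\<forall>p\<in>fst c \<inter> W.
           (\<forall>u v. D c (u + v) s p = badd E (D c u s p) (D c v s p)) \<and>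
           (\<forall>r v. D c (r *\<^sub>R v) s p = bscale E (of_real r) (D c v s p)) \<and>
           (\<forall>t v. smooth_section A E W t \<longrightarrow>
              D c v (\<lambda>q. badd E (s q) (t q)) p = badd E (D c v s p) (D c v t p)) \<and>
           (\<forall>f v. smooth_fun A W f \<longrightarrow>
              D c v (\<lambda>q. bscale E (f q) (s q)) p =
                badd E (bscale E (dir_deriv c v f p) (s p)) (bscale E (f p) (D c v s p))) \<and>
           (\<forall>t v. (\<forall>q\<in>W. t q = s q) \<longrightarrow> D c v t p = D c v s p) \<and>
           (\<forall>c'\<in>A. \<forall>v. p \<in> fst c' \<longrightarrow> D c' (dir_deriv c v (snd c') p) s p = D c v s p)))"

definition compatible ::
  "('m::topological_space, 'n::finite) chart set \<Rightarrow> ('e, 'm, 'r::finite) vbundle \<Rightarrow>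
   ('e \<Rightarrow> 'e \<Rightarrow> complex) \<Rightarrow> ('e, 'm, 'n) conn \<Rightarrow> bool" where
  "compatible A E h D \<longleftrightarrow>
     (\<forall>c\<in>A. \<forall>W s t. smooth_section A E W s \<longrightarrow> smooth_section A E W t \<longrightarrow>
        (\<forall>p\<in>fst c \<inter> W. \<forall>v.
           dir_deriv c v (\<lambda>q. h (s q) (t q)) p = h (D c v s p) (t p) + h (s p) (D c v t p)))"

definition has_dolbeault_part ::
  "('m::topological_space, 'n::finite) chart set \<Rightarrow> ('e, 'm, 'r::finite) vbundle \<Rightarrow>
   ('e, 'm, 'n) conn \<Rightarrow> bool" where
  "has_dolbeault_part A E D \<longleftrightarrow>
     (\<forall>c\<in>A. \<forall>W s. smooth_section A E W s \<longrightarrow>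
        (\<forall>p\<in>fst c \<inter> W. \<forall>v.
           bscale E (1/2) (badd E (D c v s p) (bscale E \<i> (D c (\<i> *s v) s p)))
             = dolbeault E c v s p))"

text \<open>Unique up to the irrelevant values of \<open>D c v s p\<close> for \<open>s\<close> not smooth near \<open>p\<close>.\<close>

definition chern_connection ::
  "('m::topological_space, 'n::finite) chart set \<Rightarrow> ('e, 'm, 'r::finite) vbundle \<Rightarrow>
   ('e \<Rightarrow> 'e \<Rightarrow> complex) \<Rightarrow> ('e, 'm, 'n) conn" where
  "chern_connection A E h =
     (SOME D. connection A E D \<and> compatible A E h D \<and> has_dolbeault_part A E D)"

text \<open>
  The curvature \<open>D\<^sup>2\<close> as an endomorphism-valued 2-form; coordinate vector fields commute, so
  \<open>D\<^sup>2(u, v) = D\<^sub>u D\<^sub>v - D\<^sub>v D\<^sub>u\<close>, evaluated on any section through \<open>e\<close>.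
\<close>

definition curvature ::
  "('m::topological_space, 'n::finite) chart set \<Rightarrow> ('e, 'm, 'r::finite) vbundle \<Rightarrow>
   ('e, 'm, 'n) conn \<Rightarrow> ('m, 'n, 'e \<Rightarrow> 'e) two_form" where
  "curvature A E D c p u v e =
     (THE f. \<exists>W s. p \<in> W \<and> smooth_section A E W s \<and> s p = e \<and>
        f = badd E (D c u (D c v s) p) (bscale E (-1) (D c v (D c u s) p)))"

definition hermitian_yang_mills ::
  "('m::topological_space, 'n::finite) chart set \<Rightarrow> ('m, 'n, real) two_form \<Rightarrow>
   ('e, 'm, 'r::finite) vbundle \<Rightarrow> ('e, 'm, 'n) conn \<Rightarrow> complex \<Rightarrow> bool" where
  "hermitian_yang_mills A \<omega> E D lam \<longleftrightarrow>
     (\<forall>c\<in>A. \<forall>(W, \<tau>)\<in>btriv E. \<forall>p\<in>fst c \<inter> W. \<forall>e\<in>fibre E p.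
        \<i> *s contraction (\<omega> c p) (\<lambda>u v. \<tau> (curvature A E D c p u v e)) = lam *s \<tau> e)"

definition pseudo_hermitian_einstein ::
  "('m::topological_space, 'n::finite) chart set \<Rightarrow> ('m, 'n, real) two_form \<Rightarrow>
   ('e, 'm, 'r::finite) vbundle \<Rightarrow> ('e \<Rightarrow> 'e \<Rightarrow> complex) \<Rightarrow> complex \<Rightarrow> bool" where
  "pseudo_hermitian_einstein A \<omega> E h lam \<longleftrightarrow>
     hermitian_yang_mills A \<omega> E (chern_connection A E h) lam"


section \<open>Line bundles: degree and the vortex equation\<close>

text \<open>For a line bundle the curvature is a scalar 2-form.\<close>

definition line_curvature ::
  "('m::topological_space, 'n::finite) chart set \<Rightarrow> ('e, 'm, 1) vbundle \<Rightarrow>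
   ('e \<Rightarrow> 'e \<Rightarrow> complex) \<Rightarrow> ('m, 'n, complex) two_form" where
  "line_curvature A L h c p u v =
     (THE k. \<forall>e\<in>fibre L p. curvature A L (chern_connection A L h) c p u v e = bscale L k e)"

text \<open>
  \<open>deg L = \<integral>\<^sub>X c\<^sub>1(L)\<close> by Chern--Weil theory; it is independent of the metric, and the
  first Chern form of a Chern connection is real.
\<close>

definition degree_of ::
  "('m::topological_space, 1) chart set \<Rightarrow> ('e, 'm, 1) vbundle \<Rightarrow> real" where
  "degree_of A L =
     (THE d. \<exists>h. hermitian_metric A L h \<and>
        d = surface_integral A (\<lambda>c p u v. Re (\<i> / (2 * of_real pi) * line_curvature A L h c p u v)))"

definition exotic_vortex ::
  "('m::topological_space, 1) chart set \<Rightarrow> ('m, 1, real) two_form \<Rightarrow> ('e, 'm, 1) vbundle \<Rightarrow>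
   ('m \<Rightarrow> 'e) \<Rightarrow> ('e \<Rightarrow> 'e \<Rightarrow> complex) \<Rightarrow> real \<Rightarrow> bool" where
  "exotic_vortex A \<omega> L \<phi> h \<tau> \<longleftrightarrow>
     (\<forall>c\<in>A. \<forall>p\<in>fst c.
        \<i> * contraction (\<omega> c p) (line_curvature A L h c p)
          - (1/2) * h (\<phi> p) (\<phi> p) - of_real \<tau> / 2 = 0)"


section \<open>The product with the complex line and its \<open>SE(2)\<close>-action\<close>

definition complex_line_atlas :: "(complex, 1) chart set" where
  "complex_line_atlas = {(UNIV, \<lambda>z. \<chi> i. z)}"

definition times_line_atlas :: "('x, 1) chart set \<Rightarrow> ('x \<times> complex, 2) chart set" where
  "times_line_atlas A = (\<lambda>(U, \<phi>). (U \<times> UNIV, \<lambda>(x, z). vector [\<phi> x $ 1, z])) ` A"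

text \<open>\<open>(\<i>/2) dz \<and> d(cnj z)\<close>, which is real-valued.\<close>

definition omega_can :: "(complex, 1, real) two_form" where
  "omega_can c z u v = Re (\<i> / 2 * (u $ 1 * cnj (v $ 1) - v $ 1 * cnj (u $ 1)))"

definition product_form ::
  "('x, 1) chart set \<Rightarrow> ('x, 1, real) two_form \<Rightarrow> ('x \<times> complex, 2, real) two_form" where
  "product_form A \<omega> c p u v =
     pullback2 A fst \<omega> c p u v + pullback2 complex_line_atlas snd omega_can c p u v"

text \<open>
  \<open>p\<^sup>*L \<otimes> q\<^sup>*L\<^sub>n\<close>: the pair \<open>(l, z)\<close> stands for \<open>l \<otimes> (e\<^sub>n)\<^sub>z\<close>, which
  identifies the fibre over \<open>(x, z)\<close> with the fibre of \<open>L\<close> over \<open>x\<close>.  As a holomorphic bundle it does not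
  depend on \<open>n\<close>, which enters only through the group action.  Its Dolbeault operator is
  the tensor product of the pulled-back Dolbeault operators of \<open>L\<close> and \<open>L\<^sub>n\<close>.
\<close>

definition tensor_Ln :: "('l, 'x, 1) vbundle \<Rightarrow> ('l \<times> complex, 'x \<times> complex, 1) vbundle" where
  "tensor_Ln L = \<lparr>
     bproj = (\<lambda>(l, z). (bproj L l, z)),
     badd = (\<lambda>(l, z) (l', _). (badd L l l', z)),
     bscale = (\<lambda>a (l, z). (bscale L a l, z)),
     btriv = (\<lambda>(W, \<tau>). (W \<times> UNIV, \<lambda>(l, z). \<tau> l)) ` btriv L \<rparr>"

definition trivial_line :: "('m \<times> complex, 'm, 1) vbundle" where
  "trivial_line = \<lparr>
     bproj = fst,
     badd = (\<lambda>(p, w) (_, w'). (p, w + w')),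
     bscale = (\<lambda>a (p, w). (p, a * w)),
     btriv = {(UNIV, \<lambda>(p, w). \<chi> i. w)} \<rparr>"

text \<open>
  The smooth bundle \<open>p\<^sup>*L \<otimes> q\<^sup>*L\<^sub>-\<^sub>1 \<oplus> C\<close> over \<open>X \<times> C\<close>: the triple \<open>(l, z, w)\<close> stands for
  \<open>(l \<otimes> (e\<^sub>-\<^sub>1)\<^sub>z, w)\<close> in the fibre over \<open>(x, z)\<close>, \<open>x\<close> the base point of \<open>l\<close>.
\<close>

definition sum_bundle ::
  "('l, 'x, 1) vbundle \<Rightarrow> ('l \<times> complex \<times> complex, 'x \<times> complex, 2) vbundle" where
  "sum_bundle L = \<lparr>
     bproj = (\<lambda>(l, z, w). (bproj L l, z)),
     badd = (\<lambda>(l, z, w) (l', _, w'). (badd L l l', z, w + w')),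
     bscale = (\<lambda>a (l, z, w). (bscale L a l, z, a * w)),
     btriv = (\<lambda>(W, \<tau>). (W \<times> UNIV, \<lambda>(l, z, w). vector [\<tau> l $ 1, w])) ` btriv L \<rparr>"

definition sum_incl :: "'l \<times> complex \<Rightarrow> 'l \<times> complex \<times> complex" where
  "sum_incl = (\<lambda>(l, z). (l, z, 0))"

definition sum_fst :: "'l \<times> complex \<times> complex \<Rightarrow> 'l \<times> complex" where
  "sum_fst = (\<lambda>(l, z, w). (l, z))"

definition sum_snd ::
  "('l, 'x, 1) vbundle \<Rightarrow> 'l \<times> complex \<times> complex \<Rightarrow> ('x \<times> complex) \<times> complex" where
  "sum_snd L = (\<lambda>(l, z, w). ((bproj L l, z), w))"

text \<open>
  A holomorphic extension of the trivial line bundle by \<open>p\<^sup>*L \<otimes> q\<^sup>*L\<^sub>-\<^sub>1\<close>, identified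
  with the direct sum by a smooth splitting: the maps of the extension are the inclusion and
  the projection of the direct sum.
\<close>

definition split_extension ::
  "('x::topological_space, 1) chart set \<Rightarrow> ('l, 'x, 1) vbundle \<Rightarrow>
   ('l \<times> complex \<times> complex, 'x \<times> complex, 2) vbundle \<Rightarrow> bool" where
  "split_extension A L E \<longleftrightarrow>
     holomorphic_structure_on (times_line_atlas A) (sum_bundle L) E \<and>
     holomorphic_extension (times_line_atlas A) (tensor_Ln L) E trivial_line sum_incl (sum_snd L)"

text \<open>\<open>(a, u)\<close> with \<open>u = e\<^sup>i\<^sup>\<theta>\<close>.\<close>

definition SE2 :: "(complex \<times> complex) set" where
  "SE2 = {(a, u). cmod u = 1}"

definition se2_act ::
  "('l, 'x, 1) vbundle \<Rightarrow> complex \<times> complex \<Rightarrow> 'l \<times> complex \<times> complex \<Rightarrow> 'l \<times> complex \<times> complex" where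
  "se2_act L = (\<lambda>(a, u) (l, z, w). (bscale L (u powi (-1)) l, a + u * z, w))"

definition se2_equivariant ::
  "('x, 1) chart set \<Rightarrow> ('l, 'x, 1) vbundle \<Rightarrow>
   ('l \<times> complex \<times> complex, 'x \<times> complex, 2) vbundle \<Rightarrow> bool" where
  "se2_equivariant A L E \<longleftrightarrow>
     (\<forall>g\<in>SE2. biholomorphic (total_atlas (times_line_atlas A) E)
                              (total_atlas (times_line_atlas A) E) (se2_act L g))"

definition se2_invariant ::
  "('l, 'x, 1) vbundle \<Rightarrow> ('l \<times> complex \<times> complex \<Rightarrow> 'l \<times> complex \<times> complex \<Rightarrow> complex) \<Rightarrow> bool" where
  "se2_invariant L h \<longleftrightarrow>
     (\<forall>g\<in>SE2. \<forall>e e'. bproj (sum_bundle L) e = bproj (sum_bundle L) e' \<longrightarrow>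
        h (se2_act L g e) (se2_act L g e') = h e e')"

text \<open>
  \<open>p\<^sup>*\<phi> \<otimes> q\<^sup>*\<alpha>\<close> evaluated on \<open>v\<close>, where \<open>\<alpha> = d(cnj z) \<otimes> e\<^sub>-\<^sub>1\<close>.
\<close>

definition phi_alpha ::
  "('l, 'x, 1) vbundle \<Rightarrow> ('x \<Rightarrow> 'l) \<Rightarrow> ('x \<times> complex, 2) chart \<Rightarrow> complex^2 \<Rightarrow>
   'x \<times> complex \<Rightarrow> 'l \<times> complex" where
  "phi_alpha L \<phi> c v p =
     bscale (tensor_Ln L) (dir_deriv c v (\<lambda>(x, z). cnj z) p) (\<phi> (fst p), snd p)"

definition dolbeault_matrix ::
  "('x::topological_space, 1) chart set \<Rightarrow> ('l, 'x, 1) vbundle \<Rightarrow>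
   ('l \<times> complex \<times> complex, 'x \<times> complex, 2) vbundle \<Rightarrow> ('x \<Rightarrow> 'l) \<Rightarrow> bool" where
  "dolbeault_matrix A L E \<phi> \<longleftrightarrow>
     (\<forall>c\<in>times_line_atlas A. \<forall>W s. smooth_section (times_line_atlas A) (sum_bundle L) W s \<longrightarrow>
        (\<forall>p\<in>fst c \<inter> W. \<forall>v.
           sum_fst (dolbeault E c v s p) =
             badd (tensor_Ln L)
               (dolbeault (tensor_Ln L) c v (sum_fst \<circ> s) p)
               (bscale (tensor_Ln L) (of_real (1 / (2 * sqrt 2)) * snd (sum_snd L (s p)))
                  (phi_alpha L \<phi> c v p)) \<and>
           sum_snd L (dolbeault E c v s p) = dolbeault trivial_line c v (sum_snd L \<circ> s) p))"

text \<open>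
  A Hermitian metric on the trivial line bundle over \<open>X\<close> is a smooth positive function \<open>h\<^sub>X\<close>.
  Since \<open>h\<^sup>(\<^sup>-\<^sup>1\<^sup>)(e\<^sub>-\<^sub>1, e\<^sub>-\<^sub>1) = 1\<close>, the form \<open>p\<^sup>*h\<^sub>L \<otimes> q\<^sup>*h\<^sup>(\<^sup>-\<^sup>1\<^sup>)\<close> takes the value
  \<open>h\<^sub>L(l, l')\<close> on \<open>l \<otimes> e\<^sub>-\<^sub>1\<close> and \<open>l' \<otimes> e\<^sub>-\<^sub>1\<close>.
\<close>

definition positive_smooth :: "('x, 1) chart set \<Rightarrow> ('x \<Rightarrow> real) \<Rightarrow> bool" where
  "positive_smooth A hX \<longleftrightarrow> smooth_fun A UNIV hX \<and> (\<forall>x. hX x > 0)"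

definition metric_matrix ::
  "('l, 'x, 1) vbundle \<Rightarrow> ('l \<Rightarrow> 'l \<Rightarrow> complex) \<Rightarrow> ('x \<Rightarrow> real) \<Rightarrow> real \<Rightarrow> real \<Rightarrow>
   ('l \<times> complex \<times> complex \<Rightarrow> 'l \<times> complex \<times> complex \<Rightarrow> complex) \<Rightarrow> bool" where
  "metric_matrix L hL hX C0 C1 h \<longleftrightarrow>
     (\<forall>l l' z w w'. bproj L l = bproj L l' \<longrightarrow>
        h (l, z, w) (l', z, w') =
          of_real (C0 * hX (bproj L l)) * hL l l' + of_real (C1 * hX (bproj L l)) * (w * cnj w'))"

end

theory Submission
  imports Defs "HOL-Complex_Analysis.Cauchy_Integral_Formula"
begin

text \<open>
  The group \<open>SE(2)\<close> acts transitively on the factor \<open>\<complex>\<close>, so invariant objects on \<open>X \<times> \<complex>\<close> are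
  determined by data on \<open>X\<close>, and the rotations, which act on \<open>L\<^sub>-\<^sub>1\<close> with weight \<open>-1\<close> and trivially on the other
  summand, decide which components vanish.

  The holomorphic structure of an extension is determined by its second fundamental form, the
  image under the Dolbeault operator of the smooth lift of the section \<open>1\<close> of the quotient
  (lemma \<open>dolbeault_decomp\<close>). Equivariance makes it invariant, an invariant \<open>(0,1)\<close>-form with values in
  \<open>p\<^sup>*L \<otimes> q\<^sup>*L\<^sub>-\<^sub>1\<close> is a section \<open>\<phi>\<close> of \<open>L\<close> times \<open>\<alpha>\<close>, and integrability makes \<open>\<phi>\<close> holomorphic
  (\<open>equivariant_dolbeault\<close>). An invariant metric is diagonal for the same reason of weights, with entries of
  opposite signs, each of constant sign on the connected surface (\<open>invariant_metric\<close>).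

  For such data the curvature is computed in holomorphic frames of \<open>L\<close>. With \<open>F\<close> the curvature of \<open>h\<^sub>L\<close> and
  \<open>G\<close> that of \<open>h\<^sub>X\<close>, the diagonal entries of the Einstein equation read
  \<open>\<i> \<Lambda>(G + F) - \<bar>\<phi>\<bar>\<^sup>2 / 4 = lam\<close> and \<open>\<i> \<Lambda> G + \<bar>\<phi>\<bar>\<^sup>2 / 4 = lam\<close> (\<open>einstein_equations\<close>).
  Their difference is the vortex equation. Their sum says that \<open>\<i> F\<close> equals \<open>2 lam \<omega>\<close> up to the
  Laplacian of a function on \<open>X\<close>, and integration over \<open>X\<close> gives \<open>2 pi deg L = 2 lam\<close> (\<open>degree_eq\<close>).

  The integral and the degree are defined by descriptions, so the last step includes that integrals do
  not depend on the partition of unity (\<open>total_integral_unique\<close>, by change of variables), that partitions of unity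
  exist, that Laplacians integrate to zero (\<open>total_integral_laplace\<close>), and that the Chern forms of two
  metrics differ by a Laplacian (\<open>metric_ratio\<close>).
\<close>

section \<open>Calculus of smooth maps\<close>

lemma k_smooth_on_subset:
  "k_smooth_on k S f \<Longrightarrow> T \<subseteq> S \<Longrightarrow> k_smooth_on k T f"
  by (induction k arbitrary: f) (auto intro: continuous_on_subset)

lemma smooth_on_subset: "smooth_on S f \<Longrightarrow> T \<subseteq> S \<Longrightarrow> smooth_on T f"
  by (auto simp: smooth_on_def intro: k_smooth_on_subset)

lemma frechet_derivative_eq:
  "(f has_derivative f') (at x) \<Longrightarrow> frechet_derivative f (at x) v = f' v"
  by (metis frechet_derivative_at)

lemma frechet_derivative_cong:
  assumes "open S" "x \<in> S" "\<And>y. y \<in> S \<Longrightarrow> f y = g y"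
  shows "frechet_derivative f (at x) = frechet_derivative g (at x)"
    and "f differentiable (at x) \<longleftrightarrow> g differentiable (at x)"
proof -
  have "(f has_derivative f') (at x) \<longleftrightarrow> (g has_derivative f') (at x)" for f'
    using has_derivative_transform_within_open[of f f' x UNIV S g]
      has_derivative_transform_within_open[of g f' x UNIV S f] assms by auto
  then show "frechet_derivative f (at x) = frechet_derivative g (at x)"
     "f differentiable (at x) \<longleftrightarrow> g differentiable (at x)"
    by (auto simp: frechet_derivative_def differentiable_def)
qed

lemma k_smooth_on_cong:
  assumes "open S" "\<And>y. y \<in> S \<Longrightarrow> f y = g y"
  shows "k_smooth_on k S f \<longleftrightarrow> k_smooth_on k S g"
  using assms(2)
proof (induction k arbitrary: f g)
  case 0 then show ?case by (simp cong: continuous_on_cong)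
next
  case (Suc k)
  have "k_smooth_on k S (\<lambda>x. frechet_derivative f (at x) v) = k_smooth_on k S (\<lambda>x. frechet_derivative g (at x) v)" for v
    by (rule Suc.IH) (use frechet_derivative_cong(1)[OF assms(1) _ Suc.prems] in auto)
  moreover have "f differentiable (at x) \<longleftrightarrow> g differentiable (at x)" if "x \<in> S" for x
    using frechet_derivative_cong(2)[OF assms(1) that Suc.prems] by auto
  ultimately show ?case by auto
qed

lemma k_smooth_on_SucI:
  assumes "open S" "\<And>x. x \<in> S \<Longrightarrow> (f has_derivative f' x) (at x)"
    and "\<And>v. k_smooth_on k S (\<lambda>x. f' x v)"
  shows "k_smooth_on (Suc k) S f"
proof -
  have "k_smooth_on k S (\<lambda>x. frechet_derivative f (at x) v) = k_smooth_on k S (\<lambda>x. f' x v)" for v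
    by (rule k_smooth_on_cong[OF assms(1)]) (use frechet_derivative_eq[OF assms(2)] in auto)
  then show ?thesis using assms(2,3) unfolding k_smooth_on.simps differentiable_def by blast
qed

lemma smooth_on_cong:
  assumes "open S" "\<And>y. y \<in> S \<Longrightarrow> f y = g y"
  shows "smooth_on S f \<longleftrightarrow> smooth_on S g"
  using k_smooth_on_cong[OF assms] by (simp add: smooth_on_def)

lemma k_smooth_on_Suc_imp: "k_smooth_on (Suc k) S f \<Longrightarrow> k_smooth_on k S f"
proof (induction k arbitrary: f)
  case 0
  then show ?case
    by (auto intro!: continuous_at_imp_continuous_on differentiable_imp_continuous_within)
next
  case (Suc k) then show ?case by auto
qed

lemma smooth_on_imp_differentiable: "smooth_on S f \<Longrightarrow> x \<in> S \<Longrightarrow> f differentiable (at x)"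
  unfolding smooth_on_def by (metis k_smooth_on.simps(2))

lemma smooth_on_imp_has_derivative:
  "smooth_on S f \<Longrightarrow> x \<in> S \<Longrightarrow> (f has_derivative frechet_derivative f (at x)) (at x)"
  using smooth_on_imp_differentiable frechet_derivative_works by blast

lemma smooth_on_frechet_derivative:
  "smooth_on S f \<Longrightarrow> smooth_on S (\<lambda>x. frechet_derivative f (at x) v)"
  unfolding smooth_on_def by (metis k_smooth_on.simps(2))

lemma smooth_on_imp_continuous_on: "smooth_on S f \<Longrightarrow> continuous_on S f"
  unfolding smooth_on_def by (metis k_smooth_on.simps(1))

lemma k_smooth_on_open_Union:
  "(\<And>x. x \<in> S \<Longrightarrow> \<exists>T. open T \<and> x \<in> T \<and> k_smooth_on k (S \<inter> T) f) \<Longrightarrow> open S \<Longrightarrow> k_smooth_on k S f"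
proof (induction k arbitrary: f)
  case 0
  have "isCont f x" if x: "x \<in> S" for x
  proof -
    obtain T where "open T" "x \<in> T" "continuous_on (S \<inter> T) f" using 0(1)[OF x] unfolding k_smooth_on.simps(1) by blast
    then show ?thesis using x 0(2) continuous_on_eq_continuous_at[of "S \<inter> T" f] by auto
  qed
  then show ?case by (auto intro: continuous_at_imp_continuous_on)
next
  case (Suc k)
  have "\<exists>T. open T \<and> x \<in> T \<and> k_smooth_on k (S \<inter> T) (\<lambda>x. frechet_derivative f (at x) v)" if "x \<in> S" for x v
    using Suc.prems(1)[OF that] unfolding k_smooth_on.simps by blast
  moreover have "f differentiable at x" if "x \<in> S" for x
    using Suc.prems(1)[OF that] that unfolding k_smooth_on.simps by blast
  ultimately show ?case using Suc.IH Suc.prems(2) unfolding k_smooth_on.simps by blast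
qed

lemma smooth_on_open_Union:
  assumes "open S" "\<And>x. x \<in> S \<Longrightarrow> \<exists>T. open T \<and> x \<in> T \<and> smooth_on (S \<inter> T) f"
  shows "smooth_on S f"
  unfolding smooth_on_def
  by (intro allI k_smooth_on_open_Union assms(1)) (use assms(2) in \<open>auto simp: smooth_on_def\<close>)

lemma k_smooth_on_const: "k_smooth_on k S (\<lambda>x. c)"
  by (induction k arbitrary: c) (auto simp: frechet_derivative_const)

lemma smooth_on_const [simp]: "smooth_on S (\<lambda>x. c)"
  by (simp add: smooth_on_def k_smooth_on_const)

lemma smooth_on_bounded_linear:
  assumes "bounded_linear f" shows "smooth_on S f"
  unfolding smooth_on_def
proof
  fix k
  have *: "(f has_derivative f) (at x)" for x using assms by (rule bounded_linear_imp_has_derivative)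
  show "k_smooth_on k S f"
  proof (cases k)
    case 0 then show ?thesis using assms by (simp add: linear_continuous_on)
  next
    case (Suc k) then show ?thesis using * frechet_derivative_eq[OF *]
      by (auto simp: k_smooth_on_const differentiable_def)
  qed
qed

lemma k_smooth_on_add:
  "k_smooth_on k S f \<Longrightarrow> k_smooth_on k S g \<Longrightarrow> open S \<Longrightarrow> k_smooth_on k S (\<lambda>x. f x + g x)"
proof (induction k arbitrary: f g)
  case 0 then show ?case by (auto intro: continuous_intros)
next
  case (Suc k)
  have "frechet_derivative (\<lambda>x. f x + g x) (at x) v = frechet_derivative f (at x) v + frechet_derivative g (at x) v"
    if "x \<in> S" for x v
    by (rule frechet_derivative_eq)
       (use Suc.prems that in \<open>auto intro!: derivative_eq_intros simp: frechet_derivative_works[symmetric]\<close>)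
  then have "k_smooth_on k S (\<lambda>x. frechet_derivative (\<lambda>x. f x + g x) (at x) v)" for v
    using Suc.IH[of "\<lambda>x. frechet_derivative f (at x) v" "\<lambda>x. frechet_derivative g (at x) v"] Suc.prems
      k_smooth_on_cong[OF Suc.prems(3), of "\<lambda>x. frechet_derivative (\<lambda>x. f x + g x) (at x) v"] by simp
  with Suc.prems show ?case by (auto intro: differentiable_add)
qed

lemma smooth_on_add: "smooth_on S f \<Longrightarrow> smooth_on S g \<Longrightarrow> open S \<Longrightarrow> smooth_on S (\<lambda>x. f x + g x)"
  by (auto simp: smooth_on_def k_smooth_on_add)

lemma k_smooth_on_sum:
  "(\<And>i. i \<in> I \<Longrightarrow> k_smooth_on k S (f i)) \<Longrightarrow> open S \<Longrightarrow> k_smooth_on k S (\<lambda>x. \<Sum>i\<in>I. f i x)"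
  by (induction I rule: infinite_finite_induct) (auto simp: k_smooth_on_const k_smooth_on_add)

lemma smooth_on_sum:
  "(\<And>i. i \<in> I \<Longrightarrow> smooth_on S (f i)) \<Longrightarrow> open S \<Longrightarrow> smooth_on S (\<lambda>x. \<Sum>i\<in>I. f i x)"
  by (auto simp: smooth_on_def k_smooth_on_sum)

lemma (in bounded_bilinear) k_smooth_on_prod:
  "k_smooth_on k S f \<Longrightarrow> k_smooth_on k S g \<Longrightarrow> open S \<Longrightarrow> k_smooth_on k S (\<lambda>x. prod (f x) (g x))"
proof (induction k arbitrary: f g)
  case 0 then show ?case by (auto intro: continuous_on)
next
  case (Suc k)
  have d: "((\<lambda>x. prod (f x) (g x)) has_derivative 
       (\<lambda>v. prod (f x) (frechet_derivative g (at x) v) + prod (frechet_derivative f (at x) v) (g x))) (at x)"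
    if "x \<in> S" for x
    by (rule FDERIV) (use Suc.prems that in \<open>auto simp: frechet_derivative_works[symmetric]\<close>)
  have "k_smooth_on k S (\<lambda>x. prod (f x) (frechet_derivative g (at x) v) + prod (frechet_derivative f (at x) v) (g x))" for v
    using Suc.prems by (intro k_smooth_on_add Suc.IH) (auto simp del: k_smooth_on.simps intro: k_smooth_on_Suc_imp, auto)
  then have "k_smooth_on k S (\<lambda>x. frechet_derivative (\<lambda>x. prod (f x) (g x)) (at x) v)" for v
    using frechet_derivative_eq[OF d]
      k_smooth_on_cong[OF Suc.prems(3), of "\<lambda>x. frechet_derivative (\<lambda>x. prod (f x) (g x)) (at x) v"] by simp
  with d show ?case by (auto simp: differentiable_def)
qed

lemma smooth_on_bilinear:
  "bounded_bilinear B \<Longrightarrow> smooth_on S f \<Longrightarrow> smooth_on S g \<Longrightarrow> open S \<Longrightarrow> smooth_on S (\<lambda>x. B (f x) (g x))"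
  by (auto simp: smooth_on_def intro: bounded_bilinear.k_smooth_on_prod)

lemmas smooth_on_mult = smooth_on_bilinear[OF bounded_bilinear_mult]
lemmas smooth_on_inner = smooth_on_bilinear[OF bounded_bilinear_inner]

text \<open>
  By the chain rule the derivative of the composite is a finite sum, over a basis, of products of functions that are smooth to one order less, so that induction on the order applies.
\<close>

lemma k_smooth_on_compose:
  fixes f :: "'b::euclidean_space \<Rightarrow> 'c::real_normed_vector" and u :: "'a::euclidean_space \<Rightarrow> 'b"
  assumes "open S" "u ` S \<subseteq> T"
  shows "k_smooth_on k S u \<Longrightarrow> k_smooth_on k T f \<Longrightarrow> k_smooth_on k S (\<lambda>x. f (u x))"
proof (induction k arbitrary: f)
  case 0 then show ?case using assms by (auto intro: continuous_on_compose2)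
next
  case (Suc k)
  have d: "((\<lambda>x. f (u x)) has_derivative (\<lambda>v. frechet_derivative f (at (u x)) (frechet_derivative u (at x) v))) (at x)"
    if "x \<in> S" for x
    using diff_chain_at[of u "frechet_derivative u (at x)" x f "frechet_derivative f (at (u x))"]
       Suc.prems that assms by (auto simp: frechet_derivative_works[symmetric] o_def)
  have e: "frechet_derivative f (at (u x)) w = (\<Sum>b\<in>Basis. (w \<bullet> b) *\<^sub>R frechet_derivative f (at (u x)) b)" 
    if "x \<in> S" for x w
  proof -
    have "f differentiable at (u x)" using Suc.prems(2) that assms(2) unfolding k_smooth_on.simps by blast
    then have lin: "linear (frechet_derivative f (at (u x)))"
      by (rule linear_frechet_derivative)
    have "frechet_derivative f (at (u x)) (\<Sum>b\<in>Basis. (w \<bullet> b) *\<^sub>R b) =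
        (\<Sum>b\<in>Basis. (w \<bullet> b) *\<^sub>R frechet_derivative f (at (u x)) b)"
      by (simp only: linear_sum[OF lin] linear_cmul[OF lin])
    then show ?thesis by (simp only: euclidean_representation)
  qed
  have "k_smooth_on k S (\<lambda>x. \<Sum>b\<in>Basis. (frechet_derivative u (at x) v \<bullet> b) *\<^sub>R frechet_derivative f (at (u x)) b)" for v
    using Suc.prems assms(1) k_smooth_on_Suc_imp[OF Suc.prems(1)]
    by (intro k_smooth_on_sum bounded_bilinear.k_smooth_on_prod[OF bounded_bilinear_scaleR] 
       bounded_bilinear.k_smooth_on_prod[OF bounded_bilinear_inner] k_smooth_on_const Suc.IH) auto
  moreover have "((\<lambda>x. f (u x)) has_derivative 
      (\<lambda>v. \<Sum>b\<in>Basis. (frechet_derivative u (at x) v \<bullet> b) *\<^sub>R frechet_derivative f (at (u x)) b)) (at x)"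
    if "x \<in> S" for x
    using d[OF that] unfolding e[OF that, symmetric] .
  ultimately show ?case by (intro k_smooth_on_SucI[OF assms(1)])
qed

lemma smooth_on_compose:
  fixes f :: "'b::euclidean_space \<Rightarrow> 'c::real_normed_vector" and u :: "'a::euclidean_space \<Rightarrow> 'b"
  assumes "smooth_on T f" "smooth_on S u" "open S" "u ` S \<subseteq> T"
  shows "smooth_on S (\<lambda>x. f (u x))"
  using assms by (auto simp: smooth_on_def intro: k_smooth_on_compose)

lemma smooth_on_linear_compose:
  fixes u :: "'a::euclidean_space \<Rightarrow> 'b::euclidean_space"
  assumes "bounded_linear f" "smooth_on S u" "open S"
  shows "smooth_on S (\<lambda>x. f (u x))"
  using smooth_on_compose[OF smooth_on_bounded_linear[OF assms(1), of UNIV] assms(2,3)] by simp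

lemmas smooth_on_vec_nth = smooth_on_linear_compose[OF bounded_linear_vec_nth]

lemma smooth_on_minus:
  fixes f :: "'a::euclidean_space \<Rightarrow> 'b::euclidean_space"
  shows "smooth_on S f \<Longrightarrow> open S \<Longrightarrow> smooth_on S (\<lambda>x. - f x)"
  using smooth_on_linear_compose[OF bounded_linear_minus[OF bounded_linear_ident]] by blast

lemma smooth_on_diff:
  fixes f :: "'a::euclidean_space \<Rightarrow> 'b::euclidean_space"
  shows "smooth_on S f \<Longrightarrow> smooth_on S g \<Longrightarrow> open S \<Longrightarrow> smooth_on S (\<lambda>x. f x - g x)"
  using smooth_on_add[OF _ smooth_on_minus] by fastforce

lemma smooth_on_vec_lambda:
  fixes f :: "'i::finite \<Rightarrow> 'a::euclidean_space \<Rightarrow> 'b::euclidean_space"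
  assumes "\<And>i. smooth_on S (f i)" "open S"
  shows "smooth_on S (\<lambda>x. \<chi> i. f i x)"
proof -
  have bl: "bounded_linear (axis i :: 'b \<Rightarrow> 'b^'i)" for i
    by (rule linear_conv_bounded_linear[THEN iffD1]) (auto simp: linear_iff axis_def vec_eq_iff)
  have "(\<chi> i. f i x) = (\<Sum>i\<in>UNIV. axis i (f i x))" for x
    by (simp add: vec_eq_iff axis_def if_distrib sum.delta cong: if_cong)
  then show ?thesis using assms 
    by (auto intro!: smooth_on_sum smooth_on_linear_compose[OF bl])
qed

lemma smooth_on_vec_iff:
  fixes f :: "'a::euclidean_space \<Rightarrow> 'b::euclidean_space^'i::finite"
  assumes "open S"
  shows "smooth_on S f \<longleftrightarrow> (\<forall>i. smooth_on S (\<lambda>x. f x $ i))"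
proof
  assume "\<forall>i. smooth_on S (\<lambda>x. f x $ i)"
  then have "smooth_on S (\<lambda>x. \<chi> i. f x $ i)" using assms by (intro smooth_on_vec_lambda) auto
  then show "smooth_on S f" by simp
qed (use assms smooth_on_vec_nth in auto)

lemma k_smooth_on_inverse:
  "k_smooth_on k (- {0}) (inverse :: 'a::{euclidean_space,real_normed_field} \<Rightarrow> 'a)"
proof (induction k)
  case 0 show ?case by (auto intro!: continuous_intros)
next
  case (Suc k)
  have d: "((inverse :: 'a \<Rightarrow> 'a) has_derivative (\<lambda>v. inverse x * (- v) * inverse x)) (at x)" if "x \<in> -{0}" for x
    using has_derivative_inverse'[of x UNIV] that by auto
  show ?case
  proof (rule k_smooth_on_SucI[OF _ d])
    fix v
    show "k_smooth_on k (- {0}) (\<lambda>x. inverse x * (- v) * (inverse x :: 'a))"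
      by (intro bounded_bilinear.k_smooth_on_prod[OF bounded_bilinear_mult] Suc k_smooth_on_const) auto
  qed auto
qed

lemma smooth_on_inverse:
  fixes f :: "'b::euclidean_space \<Rightarrow> 'a::{euclidean_space,real_normed_field}"
  assumes "smooth_on S f" "open S" "\<And>x. x \<in> S \<Longrightarrow> f x \<noteq> 0"
  shows "smooth_on S (\<lambda>x. inverse (f x))"
  by (rule smooth_on_compose[of "-{0}"]) (use assms k_smooth_on_inverse in \<open>auto simp: smooth_on_def\<close>)

lemma smooth_on_divide:
  fixes f :: "'b::euclidean_space \<Rightarrow> 'a::{euclidean_space,real_normed_field}"
  assumes "smooth_on S g" "smooth_on S f" "open S" "\<And>x. x \<in> S \<Longrightarrow> f x \<noteq> 0"
  shows "smooth_on S (\<lambda>x. g x / f x)"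
  unfolding divide_inverse by (intro smooth_on_mult smooth_on_inverse assms) auto

lemma smooth_on_ln_aux: "smooth_on {0<..} (ln :: real \<Rightarrow> real)"
  unfolding smooth_on_def
proof
  fix k
  have d: "((ln :: real \<Rightarrow> real) has_derivative (\<lambda>v. inverse x * v)) (at x)" if "x \<in> {0<..}" for x
    using DERIV_ln[of x] that by (simp add: has_field_derivative_def)
  show "k_smooth_on k {0<..} (ln :: real \<Rightarrow> real)"
  proof (cases k)
    case 0 then show ?thesis by (auto intro!: continuous_intros)
  next
    case (Suc k)
    have "k_smooth_on k {0<..} (\<lambda>x::real. inverse x * v)" for v
      by (intro bounded_bilinear.k_smooth_on_prod[OF bounded_bilinear_mult] k_smooth_on_const
          k_smooth_on_subset[OF k_smooth_on_inverse]) auto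
    then show ?thesis unfolding Suc by (intro k_smooth_on_SucI[OF _ d]) auto
  qed
qed

lemma smooth_on_ln:
  assumes "smooth_on S f" "open S" "\<And>x. x \<in> S \<Longrightarrow> f x > (0::real)"
  shows "smooth_on S (\<lambda>x. ln (f x))"
  by (rule smooth_on_compose[OF smooth_on_ln_aux assms(1,2)]) (use assms in auto)

lemma smooth_on_prod:
  fixes f :: "'i \<Rightarrow> 'b::euclidean_space \<Rightarrow> 'a::{euclidean_space,real_normed_field}"
  shows "(\<And>i. i \<in> I \<Longrightarrow> smooth_on S (f i)) \<Longrightarrow> open S \<Longrightarrow> smooth_on S (\<lambda>x. \<Prod>i\<in>I. f i x)"
  by (induction I rule: infinite_finite_induct) (auto intro: smooth_on_mult)

lemma smooth_on_det:
  fixes M :: "'b::euclidean_space \<Rightarrow> complex^'n^'n"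
  assumes "\<And>i j. smooth_on S (\<lambda>x. M x $ i $ j)" "open S"
  shows "smooth_on S (\<lambda>x. det (M x))"
  unfolding det_def
  by (intro smooth_on_sum smooth_on_mult smooth_on_prod assms smooth_on_const)

text \<open>
  The second difference is symmetric in \<open>u\<close> and \<open>v\<close>. Writing it as a value of a mixed second derivative, by the mean value theorem applied in each direction, and shrinking \<open>t\<close> gives the symmetry of second derivatives.
\<close>

lemma second_difference_mvt:
  fixes f :: "'a::euclidean_space \<Rightarrow> real"
  assumes sm: "smooth_on (ball x r) f" and t: "t > 0" "t * (norm u + norm v) < r"
  shows "\<exists>\<xi> \<eta>. 0 < \<xi> \<and> \<xi> < t \<and> 0 < \<eta> \<and> \<eta> < t \<and>
     f (x + t *\<^sub>R u + t *\<^sub>R v) - f (x + t *\<^sub>R u) - f (x + t *\<^sub>R v) + f x =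
       t * t * frechet_derivative (\<lambda>y. frechet_derivative f (at y) u) (at (x + \<xi> *\<^sub>R u + \<eta> *\<^sub>R v)) v"
proof -
  have inb: "x + a *\<^sub>R u + b *\<^sub>R v \<in> ball x r" if "0 \<le> a" "a \<le> t" "0 \<le> b" "b \<le> t" for a b
  proof -
    have "norm (a *\<^sub>R u + b *\<^sub>R v) \<le> a * norm u + b * norm v"
      using that norm_triangle_ineq[of "a *\<^sub>R u" "b *\<^sub>R v"] by simp
    also have "\<dots> \<le> t * norm u + t * norm v"
      using that by (intro add_mono mult_right_mono) auto
    finally have "norm (a *\<^sub>R u + b *\<^sub>R v) < r" using t(2) by (simp add: algebra_simps)
    then have "dist (x + a *\<^sub>R u + b *\<^sub>R v) x < r" by (simp add: dist_norm add.assoc)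
    then show ?thesis by (simp add: dist_commute)
  qed
  let ?fu = "\<lambda>y. frechet_derivative f (at y) u"
  have d1: "((\<lambda>s. f (x + s *\<^sub>R u + b *\<^sub>R v)) has_real_derivative ?fu (x + s *\<^sub>R u + b *\<^sub>R v)) (at s)"
    if "0 \<le> s" "s \<le> t" "0 \<le> b" "b \<le> t" for s b
  proof -
    have "linear (frechet_derivative f (at (x + s *\<^sub>R u + b *\<^sub>R v)))"
      by (rule linear_frechet_derivative[OF smooth_on_imp_differentiable[OF sm inb[OF that]]])
    moreover have "((\<lambda>s. f (x + s *\<^sub>R u + b *\<^sub>R v)) has_derivative
        (\<lambda>h. frechet_derivative f (at (x + s *\<^sub>R u + b *\<^sub>R v)) (h *\<^sub>R u))) (at s)"
      by (rule has_derivative_compose[where f="\<lambda>s. x + s *\<^sub>R u + b *\<^sub>R v" and f'="\<lambda>h. h *\<^sub>R u", 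
          OF _ smooth_on_imp_has_derivative[OF sm inb[OF that]]])
        (auto intro!: derivative_eq_intros)
    ultimately show ?thesis
      by (simp add: has_field_derivative_def linear_cmul mult_commute_abs)
  qed
  let ?g = "\<lambda>s. f (x + s *\<^sub>R u + t *\<^sub>R v) - f (x + s *\<^sub>R u + 0 *\<^sub>R v)"
  have "\<exists>z>0. z < t \<and> ?g t - ?g 0 = (t - 0) * (?fu (x + z *\<^sub>R u + t *\<^sub>R v) - ?fu (x + z *\<^sub>R u + 0 *\<^sub>R v))"
    by (rule MVT2[OF t(1)], rule DERIV_diff[OF d1 d1]) (use t in auto)
  then obtain \<xi> where xi: "0 < \<xi>" "\<xi> < t"
    "?g t - ?g 0 = t * (?fu (x + \<xi> *\<^sub>R u + t *\<^sub>R v) - ?fu (x + \<xi> *\<^sub>R u + 0 *\<^sub>R v))" by auto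
  have sm2: "smooth_on (ball x r) ?fu" by (rule smooth_on_frechet_derivative[OF sm])
  let ?fvu = "\<lambda>y. frechet_derivative ?fu (at y) v"
  have d2: "((\<lambda>s. ?fu (x + \<xi> *\<^sub>R u + s *\<^sub>R v)) has_real_derivative ?fvu (x + \<xi> *\<^sub>R u + s *\<^sub>R v)) (at s)"
    if "0 \<le> s" "s \<le> t" for s
  proof -
    have i: "x + \<xi> *\<^sub>R u + s *\<^sub>R v \<in> ball x r" using inb[of \<xi> s] that xi by auto
    have "linear (frechet_derivative ?fu (at (x + \<xi> *\<^sub>R u + s *\<^sub>R v)))"
      by (rule linear_frechet_derivative[OF smooth_on_imp_differentiable[OF sm2 i]])
    moreover have "((\<lambda>s. ?fu (x + \<xi> *\<^sub>R u + s *\<^sub>R v)) has_derivative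
        (\<lambda>h. frechet_derivative ?fu (at (x + \<xi> *\<^sub>R u + s *\<^sub>R v)) (h *\<^sub>R v))) (at s)"
      by (rule has_derivative_compose[where f="\<lambda>s. x + \<xi> *\<^sub>R u + s *\<^sub>R v" and f'="\<lambda>h. h *\<^sub>R v", 
          OF _ smooth_on_imp_has_derivative[OF sm2 i]])
        (auto intro!: derivative_eq_intros)
    ultimately show ?thesis
      by (simp add: has_field_derivative_def linear_cmul mult_commute_abs)
  qed
  have "\<exists>z>0. z < t \<and> ?fu (x + \<xi> *\<^sub>R u + t *\<^sub>R v) - ?fu (x + \<xi> *\<^sub>R u + 0 *\<^sub>R v) = (t - 0) * ?fvu (x + \<xi> *\<^sub>R u + z *\<^sub>R v)"
    by (rule MVT2[OF t(1)], rule d2) auto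
  then obtain \<eta> where "0 < \<eta>" "\<eta> < t"
    "?fu (x + \<xi> *\<^sub>R u + t *\<^sub>R v) - ?fu (x + \<xi> *\<^sub>R u + 0 *\<^sub>R v) = t * ?fvu (x + \<xi> *\<^sub>R u + \<eta> *\<^sub>R v)" by auto
  with xi show ?thesis by (intro exI[of _ \<xi>] exI[of _ \<eta>]) (simp add: algebra_simps)
qed

lemma frechet_derivative_commute_real:
  fixes f :: "'a::euclidean_space \<Rightarrow> real"
  assumes sm: "smooth_on S f" and S: "open S" "x \<in> S"
  shows "frechet_derivative (\<lambda>y. frechet_derivative f (at y) v) (at x) u =
         frechet_derivative (\<lambda>y. frechet_derivative f (at y) u) (at x) v"
proof -
  let ?F = "\<lambda>u v y. frechet_derivative (\<lambda>y. frechet_derivative f (at y) u) (at y) v"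
  have cont: "isCont (?F u v) x" for u v
    using smooth_on_imp_continuous_on[OF smooth_on_frechet_derivative[OF smooth_on_frechet_derivative[OF sm]]] S
      continuous_on_eq_continuous_at by blast
  have "\<bar>?F v u x - ?F u v x\<bar> \<le> e" if e: "e > 0" for e
  proof -
    obtain r where r: "r > 0" "ball x r \<subseteq> S" using S open_contains_ball by blast
    obtain d1 where d1: "d1 > 0" "\<And>y. dist y x < d1 \<Longrightarrow> dist (?F u v y) (?F u v x) < e/2"
      using cont[of u v, unfolded continuous_at_eps_delta, rule_format, of "e/2"] e by auto
    obtain d2 where d2: "d2 > 0" "\<And>y. dist y x < d2 \<Longrightarrow> dist (?F v u y) (?F v u x) < e/2"
      using cont[of v u, unfolded continuous_at_eps_delta, rule_format, of "e/2"] e by auto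
    define m where "m = min r (min d1 d2)"
    have m: "m > 0" using r d1 d2 by (auto simp: m_def)
    define t where "t = m / (2 * (norm u + norm v + 1))"
    have t: "t > 0" using m by (simp add: t_def add_nonneg_pos)
    have n1: "norm u + norm v + 1 > 0" by (simp add: add_nonneg_pos)
    have "t * (norm u + norm v) \<le> t * (norm u + norm v + 1)" using t by simp
    also have "\<dots> = m / 2" using n1 by (simp add: t_def field_simps)
    finally have tm: "t * (norm u + norm v) < m" using m by simp
    have smb: "smooth_on (ball x r) f" using sm r smooth_on_subset by blast
    have near: "dist (x + a *\<^sub>R u + b *\<^sub>R v) x < m" if "0 < a" "a < t" "0 < b" "b < t" for a b
    proof -
      have "norm (a *\<^sub>R u + b *\<^sub>R v) \<le> a * norm u + b * norm v"
        using that norm_triangle_ineq[of "a *\<^sub>R u" "b *\<^sub>R v"] by simp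
      also have "\<dots> \<le> t * norm u + t * norm v"
        using that by (intro add_mono mult_right_mono) auto
      finally have "norm (a *\<^sub>R u + b *\<^sub>R v) < m" using tm by (simp add: algebra_simps)
      then show ?thesis by (simp add: dist_norm add.assoc)
    qed
    obtain a b where ab: "0 < a" "a < t" "0 < b" "b < t" and 
      e1: "f (x + t *\<^sub>R u + t *\<^sub>R v) - f (x + t *\<^sub>R u) - f (x + t *\<^sub>R v) + f x = t * t * ?F u v (x + a *\<^sub>R u + b *\<^sub>R v)"
      using second_difference_mvt[OF smb t, of u v] tm by (auto simp: m_def)
    obtain a' b' where ab': "0 < a'" "a' < t" "0 < b'" "b' < t" and 
      e2: "f (x + t *\<^sub>R v + t *\<^sub>R u) - f (x + t *\<^sub>R v) - f (x + t *\<^sub>R u) + f x = t * t * ?F v u (x + a' *\<^sub>R v + b' *\<^sub>R u)"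
      using second_difference_mvt[OF smb t, of v u] tm by (auto simp: m_def add.commute)
    have "f (x + t *\<^sub>R v + t *\<^sub>R u) = f (x + t *\<^sub>R u + t *\<^sub>R v)" by (simp add: algebra_simps)
    then have "t * t * ?F u v (x + a *\<^sub>R u + b *\<^sub>R v) = t * t * ?F v u (x + a' *\<^sub>R v + b' *\<^sub>R u)"
      using e1 e2 by linarith
    then have eq: "?F u v (x + a *\<^sub>R u + b *\<^sub>R v) = ?F v u (x + a' *\<^sub>R v + b' *\<^sub>R u)" using t by simp
    have "dist (?F u v (x + a *\<^sub>R u + b *\<^sub>R v)) (?F u v x) < e/2"
      using near[OF ab] by (intro d1) (auto simp: m_def)
    moreover have "dist (?F v u (x + a' *\<^sub>R v + b' *\<^sub>R u)) (?F v u x) < e/2"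
      using near[OF ab'(3,4,1,2)] by (intro d2) (auto simp: m_def add.assoc add.commute[of "a' *\<^sub>R v"])
    ultimately show ?thesis using eq unfolding dist_real_def by linarith
  qed
  then have "\<bar>?F v u x - ?F u v x\<bar> \<le> 0" using field_le_epsilon[of "\<bar>?F v u x - ?F u v x\<bar>" 0] by simp
  then show ?thesis by simp
qed

lemma frechet_derivative_linear_compose:
  assumes "bounded_linear g" "f differentiable (at x)"
  shows "frechet_derivative (\<lambda>y. g (f y)) (at x) v = g (frechet_derivative f (at x) v)"
  by (rule frechet_derivative_eq, rule bounded_linear.has_derivative[OF assms(1)])
     (use assms(2) frechet_derivative_works in blast)

lemma frechet_derivative_commute:
  fixes f :: "'a::euclidean_space \<Rightarrow> 'b::euclidean_space"
  assumes sm: "smooth_on S f" and S: "open S" "x \<in> S"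
  shows "frechet_derivative (\<lambda>y. frechet_derivative f (at y) v) (at x) u =
         frechet_derivative (\<lambda>y. frechet_derivative f (at y) u) (at x) v"
proof (rule euclidean_eqI)
  fix b :: 'b assume "b \<in> Basis"
  have bl: "bounded_linear (\<lambda>y::'b. y \<bullet> b)" by (rule bounded_linear_inner_left)
  have smb: "smooth_on S (\<lambda>y. f y \<bullet> b)" by (rule smooth_on_linear_compose[OF bl sm S(1)])
  have "frechet_derivative (\<lambda>y. frechet_derivative f (at y) v) (at x) u \<bullet> b =
     frechet_derivative (\<lambda>y. frechet_derivative (\<lambda>y. f y \<bullet> b) (at y) v) (at x) u" for u v
  proof -
    have "frechet_derivative (\<lambda>y. frechet_derivative (\<lambda>y. f y \<bullet> b) (at y) v) (at x) =
          frechet_derivative (\<lambda>y. frechet_derivative f (at y) v \<bullet> b) (at x)"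
      by (rule frechet_derivative_cong(1)[OF S])
        (rule frechet_derivative_linear_compose[OF bl smooth_on_imp_differentiable[OF sm]])
    moreover have "frechet_derivative (\<lambda>y. frechet_derivative f (at y) v \<bullet> b) (at x) u = frechet_derivative (\<lambda>y. frechet_derivative f (at y) v) (at x) u \<bullet> b"
      by (rule frechet_derivative_linear_compose[OF bl 
          smooth_on_imp_differentiable[OF smooth_on_frechet_derivative[OF sm] S(2)]])
    ultimately show ?thesis by simp
  qed
  then show "frechet_derivative (\<lambda>y. frechet_derivative f (at y) v) (at x) u \<bullet> b =
         frechet_derivative (\<lambda>y. frechet_derivative f (at y) u) (at x) v \<bullet> b"
    using frechet_derivative_commute_real[OF smb S, of v u] by simp
qed

text \<open>
  The derivative of a holomorphic function is again holomorphic, which closes the induction on the order of differentiability.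
\<close>

lemma holomorphic_imp_k_smooth_on:
  "f holomorphic_on S \<Longrightarrow> open S \<Longrightarrow> k_smooth_on k S f"
proof (induction k arbitrary: f)
  case 0 then show ?case by (simp add: holomorphic_on_imp_continuous_on)
next
  case (Suc k)
  have d: "(f has_derivative (\<lambda>v. deriv f x * v)) (at x)" if "x \<in> S" for x
    using holomorphic_derivI[OF Suc.prems that] by (simp add: has_field_derivative_def)
  show ?case
  proof (rule k_smooth_on_SucI[OF Suc.prems(2) d])
    fix v show "k_smooth_on k S (\<lambda>x. deriv f x * v)"
      by (intro Suc.IH holomorphic_on_mult holomorphic_on_const holomorphic_deriv Suc.prems)
  qed
qed

lemma cholomorphic_on_imp_smooth_on:
  fixes f :: "complex^1 \<Rightarrow> complex^'m"
  assumes f: "cholomorphic_on S f" and S: "open S"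
  shows "smooth_on S f"
  unfolding smooth_on_vec_iff[OF S]
proof
  fix j
  let ?v = "\<lambda>z. \<chi> i::1. (z::complex)"
  have blv: "bounded_linear ?v"
    by (rule linear_conv_bounded_linear[THEN iffD1]) (auto simp: linear_iff vec_eq_iff)
  have op: "open (?v -` S)" 
    by (rule open_vimage[OF S linear_continuous_on[OF blv]])
  have "((\<lambda>z. f (?v z) $ j) has_field_derivative f' (?v 1) $ j) (at z)"
    if "(f has_derivative f') (at (?v z))" "\<forall>c v. f' (c *s v) = c *s f' v" for f' z
  proof -
    have d: "((\<lambda>z. f (?v z) $ j) has_derivative (\<lambda>h. f' (?v h) $ j)) (at z)"
      by (rule bounded_linear.has_derivative[OF bounded_linear_vec_nth])
        (rule has_derivative_compose[where f="?v" and f'="?v" and g=f and g'=f', 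
          OF bounded_linear_imp_has_derivative[OF blv] that(1)])
    have "f' (?v h) $ j = f' (?v 1) $ j * h" for h
    proof -
      have "?v h = h *s ?v 1" by (simp add: vec_eq_iff)
      then show ?thesis using that(2) by (metis vector_smult_component mult.commute)
    qed
    then have "(\<lambda>h. f' (?v h) $ j) = (*) (f' (?v 1) $ j)" by (rule ext)
    then show ?thesis using d unfolding has_field_derivative_def by (simp only:)
  qed
  moreover have "\<exists>f'. (f has_derivative f') (at (?v z)) \<and> (\<forall>c v. f' (c *s v) = c *s f' v)" if "z \<in> ?v -` S" for z
    using f that unfolding cholomorphic_on_def by blast
  ultimately have "\<exists>d. ((\<lambda>z. f (?v z) $ j) has_field_derivative d) (at z)" if "z \<in> ?v -` S" for z
    using that by blast
  then have "(\<lambda>z. f (?v z) $ j) holomorphic_on (?v -` S)"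
    using holomorphic_on_open[OF op] by blast
  then have "smooth_on (?v -` S) (\<lambda>z. f (?v z) $ j)"
    using op by (auto simp: smooth_on_def holomorphic_imp_k_smooth_on)
  moreover have ev: "?v (x $ 1) = x" for x :: "complex^1" by (simp add: vec_eq_iff forall_1)
  ultimately have "smooth_on S (\<lambda>x. f (?v (x $ 1)) $ j)"
    by (intro smooth_on_compose[OF _ smooth_on_bounded_linear[OF bounded_linear_vec_nth[of 1]] S, of "?v -` S"]) auto
  then show "smooth_on S (\<lambda>x. f x $ j)" by (simp only: ev)
qed

section \<open>Functions on manifolds\<close>

text \<open>
  Smoothness of the transition maps is an assumption of its own: it follows from holomorphy through the Cauchy integral formula in one variable, and for the product with \<open>\<complex>\<close> from the product structure.
\<close>

locale smooth_atlas =
  fixes A :: "('m::topological_space, 'n::finite) chart set"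
  assumes atlas: "complex_atlas A"
    and smooth_transition: "c \<in> A \<Longrightarrow> c' \<in> A \<Longrightarrow> smooth_on (snd c ` (fst c \<inter> fst c')) (in_chart c (snd c'))"
begin

lemma chart_open: "c \<in> A \<Longrightarrow> open (fst c)"
  using atlas unfolding complex_atlas_def by auto

lemma chart_cover: "\<exists>c\<in>A. p \<in> fst c"
proof -
  have "p \<in> (\<Union>c\<in>A. fst c)" using atlas unfolding complex_atlas_def by simp
  then show ?thesis by blast
qed

lemma chart_homeo: "c \<in> A \<Longrightarrow> \<exists>\<psi>. homeomorphism (fst c) (snd c ` fst c) (snd c) \<psi>"
  using atlas unfolding complex_atlas_def by (auto split: prod.splits)

lemma chart_inj: "c \<in> A \<Longrightarrow> inj_on (snd c) (fst c)"
  using chart_homeo unfolding homeomorphism_def by (metis inj_on_inverseI)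

lemma inv_chart [simp]: "c \<in> A \<Longrightarrow> p \<in> fst c \<Longrightarrow> inv_into (fst c) (snd c) (snd c p) = p"
  using chart_inj by (rule inv_into_f_f)

lemma in_chart_at [simp]: "c \<in> A \<Longrightarrow> p \<in> fst c \<Longrightarrow> in_chart c f (snd c p) = f p"
  by (simp add: in_chart_def)

lemma open_chart_image:
  assumes c: "c \<in> A" and W: "open W"
  shows "open (snd c ` (fst c \<inter> W))"
proof -
  obtain \<psi> where h: "homeomorphism (fst c) (snd c ` fst c) (snd c) \<psi>" using chart_homeo[OF c] by blast
  have "openin (top_of_set (snd c ` fst c)) (snd c ` (fst c \<inter> W))"
    by (rule homeomorphism_imp_open_map[OF h]) (use W in \<open>auto simp: openin_open\<close>)
  moreover have "open (snd c ` fst c)" using atlas c unfolding complex_atlas_def by auto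
  ultimately show ?thesis using openin_open_eq by blast
qed

lemma open_chart_image': "c \<in> A \<Longrightarrow> open (snd c ` fst c)"
  using open_chart_image[of c UNIV] by simp

lemma continuous_on_chart: "c \<in> A \<Longrightarrow> continuous_on (fst c) (snd c)"
  using chart_homeo unfolding homeomorphism_def by blast

lemma continuous_on_inv_chart: 
  assumes "c \<in> A" shows "continuous_on (snd c ` fst c) (inv_into (fst c) (snd c))"
proof -
  obtain \<psi> where h: "homeomorphism (fst c) (snd c ` fst c) (snd c) \<psi>" using chart_homeo[OF assms] by blast
  then have "continuous_on (snd c ` fst c) \<psi>" by (simp add: homeomorphism_def)
  moreover have "\<psi> y = inv_into (fst c) (snd c) y" if "y \<in> snd c ` fst c" for y
    using h that assms by (auto simp: homeomorphism_def)
  ultimately show ?thesis by (simp cong: continuous_on_cong)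
qed

lemma transition_has_derivative:
  assumes "c \<in> A" "c' \<in> A" "p \<in> fst c" "p \<in> fst c'"
  shows "(in_chart c (snd c') has_derivative (\<lambda>v. dir_deriv c v (snd c') p)) (at (snd c p))"
    and "dir_deriv c (k *s v) (snd c') p = k *s dir_deriv c v (snd c') p"
proof -
  have "cholomorphic_on (snd c ` (fst c \<inter> fst c')) (in_chart c (snd c'))"
    using atlas assms(1,2) unfolding complex_atlas_def by (cases c, cases c') fastforce
  then obtain T where T: "(in_chart c (snd c') has_derivative T) (at (snd c p))" "\<And>k v. T (k *s v) = k *s T v"
    using assms(3,4) unfolding cholomorphic_on_def by blast
  have "dir_deriv c v (snd c') p = T v" for v
    unfolding dir_deriv_def by (rule frechet_derivative_eq[OF T(1)])
  with T show "(in_chart c (snd c') has_derivative (\<lambda>v. dir_deriv c v (snd c') p)) (at (snd c p))"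
    "dir_deriv c (k *s v) (snd c') p = k *s dir_deriv c v (snd c') p" by simp_all
qed

lemma smooth_funD: "smooth_fun A W f \<Longrightarrow> c \<in> A \<Longrightarrow> smooth_on (snd c ` (fst c \<inter> W)) (in_chart c f)"
  unfolding smooth_fun_def by auto

lemma smooth_funI: "(\<And>c. c \<in> A \<Longrightarrow> smooth_on (snd c ` (fst c \<inter> W)) (in_chart c f)) \<Longrightarrow> smooth_fun A W f"
  unfolding smooth_fun_def by auto

lemma smooth_on_change_chart:
  assumes c: "c \<in> A" "c' \<in> A" and N: "open N" "N \<subseteq> fst c" and f: "smooth_on (snd c ` N) (in_chart c f)"
  shows "smooth_on (snd c' ` (fst c' \<inter> N)) (in_chart c' f)"
proof -
  have op: "open (snd c' ` (fst c' \<inter> N))" by (rule open_chart_image[OF c(2) N(1)])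
  have sm: "smooth_on (snd c' ` (fst c' \<inter> N)) (in_chart c' (snd c))"
    by (rule smooth_on_subset[OF smooth_transition[OF c(2,1)]]) (use N in auto)
  have *: "smooth_on (snd c' ` (fst c' \<inter> N)) (\<lambda>y. in_chart c f (in_chart c' (snd c) y))"
    by (rule smooth_on_compose[OF f sm op]) (use c N in auto)
  have e: "in_chart c f (in_chart c' (snd c) y) = in_chart c' f y" if y: "y \<in> snd c' ` (fst c' \<inter> N)" for y
  proof -
    obtain q where "y = snd c' q" "q \<in> fst c'" "q \<in> N" using y by blast
    then show ?thesis using c N by auto
  qed
  show ?thesis by (rule iffD1[OF smooth_on_cong[OF op e] *])
qed

lemma smooth_funI_local:
  assumes W: "open W" and
   l: "\<And>p. p \<in> W \<Longrightarrow> \<exists>c\<in>A. \<exists>N. open N \<and> p \<in> N \<and> N \<subseteq> fst c \<inter> W \<and> smooth_on (snd c ` N) (in_chart c f)"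
  shows "smooth_fun A W f"
proof (rule smooth_funI, rule smooth_on_open_Union)
  fix c assume c: "c \<in> A"
  show "open (snd c ` (fst c \<inter> W))" by (rule open_chart_image[OF c W])
  fix y assume "y \<in> snd c ` (fst c \<inter> W)"
  then obtain p where p: "p \<in> fst c" "p \<in> W" "y = snd c p" by blast
  obtain c' N where c': "c' \<in> A" "open N" "p \<in> N" "N \<subseteq> fst c' \<inter> W" "smooth_on (snd c' ` N) (in_chart c' f)"
    using l[OF p(2)] by blast
  have "smooth_on (snd c ` (fst c \<inter> N)) (in_chart c f)"
    by (rule smooth_on_change_chart[OF c'(1) c]) (use c' in auto)
  then have "smooth_on (snd c ` (fst c \<inter> W) \<inter> snd c ` (fst c \<inter> N)) (in_chart c f)"
    by (rule smooth_on_subset) auto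
  then show "\<exists>T. open T \<and> y \<in> T \<and> smooth_on (snd c ` (fst c \<inter> W) \<inter> T) (in_chart c f)"
    using open_chart_image[OF c c'(2)] p c'(3) by blast
qed

lemma smooth_fun_subset: "smooth_fun A W f \<Longrightarrow> V \<subseteq> W \<Longrightarrow> smooth_fun A V f"
  by (rule smooth_funI, rule smooth_on_subset[OF smooth_funD]) auto

lemma smooth_fun_Union:
  assumes W: "open W" and l: "\<And>p. p \<in> W \<Longrightarrow> \<exists>N. open N \<and> p \<in> N \<and> smooth_fun A (W \<inter> N) f"
  shows "smooth_fun A W f"
proof (rule smooth_funI_local[OF W])
  fix p assume "p \<in> W"
  then obtain N where N: "open N" "p \<in> N" "smooth_fun A (W \<inter> N) f" using l by blast
  obtain c where c: "c \<in> A" "p \<in> fst c" using chart_cover by blast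
  have "smooth_on (snd c ` (fst c \<inter> (W \<inter> N))) (in_chart c f)" by (rule smooth_funD[OF N(3) c(1)])
  then show "\<exists>c\<in>A. \<exists>N. open N \<and> p \<in> N \<and> N \<subseteq> fst c \<inter> W \<and> smooth_on (snd c ` N) (in_chart c f)"
    using c N(1,2) W \<open>p \<in> W\<close> chart_open[OF c(1)]
    by (intro bexI[of _ c] exI[of _ "fst c \<inter> (W \<inter> N)"]) auto
qed

lemma smooth_fun_cong:
  assumes W: "open W" and eq: "\<And>p. p \<in> W \<Longrightarrow> f p = g p" shows "smooth_fun A W f \<longleftrightarrow> smooth_fun A W g"
proof -
  have "smooth_on (snd c ` (fst c \<inter> W)) (in_chart c f) = smooth_on (snd c ` (fst c \<inter> W)) (in_chart c g)" if "c \<in> A" for c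
    by (rule smooth_on_cong[OF open_chart_image[OF that W]]) (use eq that in auto)
  then show ?thesis unfolding smooth_fun_def by (auto split: prod.splits)
qed

lemma smooth_fun_const [simp]: "smooth_fun A W (\<lambda>p. k)"
  by (intro smooth_funI) (simp add: in_chart_def)

lemma smooth_fun_add: "smooth_fun A W f \<Longrightarrow> smooth_fun A W g \<Longrightarrow> open W \<Longrightarrow> smooth_fun A W (\<lambda>p. f p + g p)"
  by (rule smooth_funI, unfold in_chart_def, rule smooth_on_add)
    (auto intro: smooth_funD[unfolded in_chart_def] open_chart_image)

lemma smooth_fun_bilinear:
  "bounded_bilinear B \<Longrightarrow> smooth_fun A W f \<Longrightarrow> smooth_fun A W g \<Longrightarrow> open W \<Longrightarrow> smooth_fun A W (\<lambda>p. B (f p) (g p))"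
  by (rule smooth_funI, unfold in_chart_def, rule smooth_on_bilinear)
    (auto intro: smooth_funD[unfolded in_chart_def] open_chart_image)

lemmas smooth_fun_mult = smooth_fun_bilinear[OF bounded_bilinear_mult]

lemma smooth_fun_linear:
  fixes f :: "'m \<Rightarrow> 'b::euclidean_space"
  shows "bounded_linear L \<Longrightarrow> smooth_fun A W f \<Longrightarrow> open W \<Longrightarrow> smooth_fun A W (\<lambda>p. L (f p))"
  by (rule smooth_funI, unfold in_chart_def, rule smooth_on_linear_compose)
    (auto intro: smooth_funD[unfolded in_chart_def] open_chart_image)

lemmas smooth_fun_vec_nth = smooth_fun_linear[OF bounded_linear_vec_nth]
lemmas smooth_fun_cnj = smooth_fun_linear[OF bounded_linear_cnj]
lemmas smooth_fun_of_real = smooth_fun_linear[OF bounded_linear_of_real]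
lemmas smooth_fun_Re = smooth_fun_linear[OF bounded_linear_Re]

lemma smooth_fun_minus:
  fixes f :: "'m \<Rightarrow> 'b::euclidean_space"
  shows "smooth_fun A W f \<Longrightarrow> open W \<Longrightarrow> smooth_fun A W (\<lambda>p. - f p)"
  using smooth_fun_linear[OF bounded_linear_minus[OF bounded_linear_ident]] by blast

lemma smooth_fun_diff:
  fixes f :: "'m \<Rightarrow> 'b::euclidean_space"
  shows "smooth_fun A W f \<Longrightarrow> smooth_fun A W g \<Longrightarrow> open W \<Longrightarrow> smooth_fun A W (\<lambda>p. f p - g p)"
  using smooth_fun_add[OF _ smooth_fun_minus] by fastforce

lemma smooth_fun_sum:
  "(\<And>i. i \<in> I \<Longrightarrow> smooth_fun A W (f i)) \<Longrightarrow> open W \<Longrightarrow> smooth_fun A W (\<lambda>p. \<Sum>i\<in>I. f i p)"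
  by (induction I rule: infinite_finite_induct) (auto intro: smooth_fun_add)

lemma smooth_fun_divide:
  fixes f g :: "'m \<Rightarrow> 'b::{euclidean_space,real_normed_field}"
  assumes "smooth_fun A W f" "smooth_fun A W g" "open W" "\<And>p. p \<in> W \<Longrightarrow> g p \<noteq> 0"
  shows "smooth_fun A W (\<lambda>p. f p / g p)"
proof (rule smooth_funI)
  fix c assume c: "c \<in> A"
  have "smooth_on (snd c ` (fst c \<inter> W)) (\<lambda>y. in_chart c f y / in_chart c g y)"
    by (rule smooth_on_divide) (use assms c in \<open>auto intro!: smooth_funD open_chart_image\<close>)
  then show "smooth_on (snd c ` (fst c \<inter> W)) (in_chart c (\<lambda>p. f p / g p))" by (simp add: in_chart_def)
qed

lemma smooth_fun_ln:
  assumes "smooth_fun A W f" "open W" "\<And>p. p \<in> W \<Longrightarrow> f p > (0::real)"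
  shows "smooth_fun A W (\<lambda>p. ln (f p))"
proof (rule smooth_funI)
  fix c assume c: "c \<in> A"
  have "smooth_on (snd c ` (fst c \<inter> W)) (\<lambda>y. ln (in_chart c f y))"
    by (rule smooth_on_ln) (use assms c in \<open>auto intro!: smooth_funD open_chart_image\<close>)
  then show "smooth_on (snd c ` (fst c \<inter> W)) (in_chart c (\<lambda>p. ln (f p)))" by (simp add: in_chart_def)
qed

lemma smooth_fun_vec_iff:
  fixes f :: "'m \<Rightarrow> 'b::euclidean_space^'i::finite"
  assumes "open W"
  shows "smooth_fun A W f \<longleftrightarrow> (\<forall>i. smooth_fun A W (\<lambda>p. f p $ i))"
proof -
  have "smooth_on (snd c ` (fst c \<inter> W)) (in_chart c f) \<longleftrightarrow> (\<forall>i. smooth_on (snd c ` (fst c \<inter> W)) (in_chart c (\<lambda>p. f p $ i)))" 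
    if "c \<in> A" for c
    using smooth_on_vec_iff[OF open_chart_image[OF that assms], of "in_chart c f"] by (simp add: in_chart_def)
  then show ?thesis unfolding smooth_fun_def by (auto split: prod.splits)
qed

lemma smooth_fun_det:
  fixes M :: "'m \<Rightarrow> complex^'r^'r"
  assumes "\<And>i j. smooth_fun A W (\<lambda>p. M p $ i $ j)" "open W"
  shows "smooth_fun A W (\<lambda>p. det (M p))"
proof (rule smooth_funI)
  fix c assume c: "c \<in> A"
  show "smooth_on (snd c ` (fst c \<inter> W)) (in_chart c (\<lambda>p. det (M p)))"
    unfolding in_chart_def
    by (rule smooth_on_det[OF smooth_funD[OF assms(1) c, unfolded in_chart_def] open_chart_image[OF c assms(2)]])
qed

lemma has_dir_deriv:
  assumes "smooth_fun A W f" "c \<in> A" "p \<in> fst c" "p \<in> W"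
  shows "(in_chart c f has_derivative (\<lambda>v. dir_deriv c v f p)) (at (snd c p))"
  unfolding dir_deriv_def
  by (rule smooth_on_imp_has_derivative[OF smooth_funD[OF assms(1,2)]]) (use assms in auto)

lemma dir_derivI: "(in_chart c f has_derivative f') (at (snd c p)) \<Longrightarrow> dir_deriv c v f p = f' v"
  unfolding dir_deriv_def by (rule frechet_derivative_eq)

lemma dir_deriv_linear:
  assumes "smooth_fun A W f" "c \<in> A" "p \<in> fst c" "p \<in> W"
  shows "linear (\<lambda>v. dir_deriv c v f p)"
  using has_derivative_linear[OF has_dir_deriv[OF assms]] .

lemma dir_deriv_cong:
  assumes "open W" "c \<in> A" "p \<in> fst c" "p \<in> W" "\<And>q. q \<in> W \<Longrightarrow> f q = g q"
  shows "dir_deriv c v f p = dir_deriv c v g p"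
proof -
  have "frechet_derivative (in_chart c f) (at (snd c p)) = frechet_derivative (in_chart c g) (at (snd c p))"
    by (rule frechet_derivative_cong(1)[OF open_chart_image[OF assms(2,1)]]) (use assms in auto)
  then show ?thesis by (simp add: dir_deriv_def)
qed

lemma dir_deriv_const [simp]: "dir_deriv c v (\<lambda>p. k) p = 0"
  by (simp add: dir_deriv_def in_chart_def)

lemma dir_deriv_add:
  assumes "smooth_fun A W f" "smooth_fun A W g" "c \<in> A" "p \<in> fst c" "p \<in> W"
  shows "dir_deriv c v (\<lambda>q. f q + g q) p = dir_deriv c v f p + dir_deriv c v g p"
  by (rule dir_derivI)
    (use has_derivative_add[OF has_dir_deriv[OF assms(1,3-5)] has_dir_deriv[OF assms(2,3-5)]] in \<open>simp add: in_chart_def\<close>)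

lemma dir_deriv_bilinear:
  assumes "bounded_bilinear B" "smooth_fun A W f" "smooth_fun A W g" "c \<in> A" "p \<in> fst c" "p \<in> W"
  shows "dir_deriv c v (\<lambda>q. B (f q) (g q)) p = B (f p) (dir_deriv c v g p) + B (dir_deriv c v f p) (g p)"
  using bounded_bilinear.FDERIV[OF assms(1) has_dir_deriv[OF assms(2,4-6)] has_dir_deriv[OF assms(3,4-6)]] assms(4,5)
  by (intro dir_derivI) (simp add: in_chart_def)

lemmas dir_deriv_mult = dir_deriv_bilinear[OF bounded_bilinear_mult]

lemma dir_deriv_linear_compose:
  assumes "bounded_linear L" "smooth_fun A W f" "c \<in> A" "p \<in> fst c" "p \<in> W"
  shows "dir_deriv c v (\<lambda>q. L (f q)) p = L (dir_deriv c v f p)"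
  using bounded_linear.has_derivative[OF assms(1) has_dir_deriv[OF assms(2-5)]]
  by (intro dir_derivI) (simp add: in_chart_def)

lemma dir_deriv_compose_real:
  fixes f :: "'m \<Rightarrow> real"
  assumes "smooth_fun A W f" "c \<in> A" "p \<in> fst c" "p \<in> W" "(g has_real_derivative d) (at (f p))"
  shows "dir_deriv c v (\<lambda>q. g (f q)) p = d * dir_deriv c v f p"
proof -
  have "((\<lambda>y. g (in_chart c f y)) has_derivative (\<lambda>v. d * dir_deriv c v f p)) (at (snd c p))"
    by (rule has_derivative_compose[OF has_dir_deriv[OF assms(1-4)]])
      (use assms in \<open>auto simp: has_field_derivative_def\<close>)
  then show ?thesis by (intro dir_derivI) (simp add: in_chart_def)
qed

lemma dir_deriv_sum:
  assumes "\<And>i. i \<in> I \<Longrightarrow> smooth_fun A W (f i)" "c \<in> A" "p \<in> fst c" "p \<in> W" "open W"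
  shows "dir_deriv c v (\<lambda>q. \<Sum>i\<in>I. f i q) p = (\<Sum>i\<in>I. dir_deriv c v (f i) p)"
  using assms(1)
proof (induction I rule: infinite_finite_induct)
  case (insert x F)
  then show ?case using dir_deriv_add[of W "f x" "\<lambda>q. \<Sum>i\<in>F. f i q" c p v] smooth_fun_sum[of F W f] assms by simp
qed auto

lemma dir_deriv_change_chart:
  assumes f: "smooth_fun A W f" and c: "c \<in> A" "c' \<in> A" and p: "p \<in> fst c" "p \<in> fst c'" "p \<in> W" and W: "open W"
  shows "dir_deriv c' (dir_deriv c v (snd c') p) f p = dir_deriv c v f p"
proof -
  have "((\<lambda>y. in_chart c' f (in_chart c (snd c') y)) has_derivative (\<lambda>v. dir_deriv c' (dir_deriv c v (snd c') p) f p)) (at (snd c p))"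
    by (rule has_derivative_compose[OF transition_has_derivative(1)[OF c p(1,2)]])
      (use has_dir_deriv[OF f c(2) p(2,3)] c p in simp)
  moreover have "in_chart c' f (in_chart c (snd c') y) = in_chart c f y" if y: "y \<in> snd c ` (fst c \<inter> fst c')" for y
    using y c by auto
  ultimately have "(in_chart c f has_derivative (\<lambda>v. dir_deriv c' (dir_deriv c v (snd c') p) f p)) (at (snd c p))"
    using has_derivative_transform_within_open[OF _ open_chart_image[OF c(1) chart_open[OF c(2)]]] p by blast
  from dir_derivI[OF this] show ?thesis by simp
qed

lemma in_chart_dir_deriv:
  assumes "c \<in> A" "y \<in> snd c ` fst c"
  shows "in_chart c (dir_deriv c v f) y = frechet_derivative (in_chart c f) (at y) v"
  using assms by (auto simp: dir_deriv_def)

lemma smooth_fun_dir_deriv: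
  assumes f: "smooth_fun A W f" and c: "c \<in> A" and W: "open W"
  shows "smooth_fun A (fst c \<inter> W) (dir_deriv c v f)"
proof (rule smooth_funI_local)
  show op: "open (fst c \<inter> W)" using W chart_open[OF c] by auto
  have "smooth_on (snd c ` (fst c \<inter> W)) (\<lambda>y. frechet_derivative (in_chart c f) (at y) v)"
    by (rule smooth_on_frechet_derivative[OF smooth_funD[OF f c]])
  then have "smooth_on (snd c ` (fst c \<inter> W)) (in_chart c (dir_deriv c v f))"
    by (subst smooth_on_cong[OF open_chart_image[OF c W]]) (use c in \<open>auto simp: dir_deriv_def\<close>)
  then show "\<exists>d\<in>A. \<exists>N. open N \<and> p \<in> N \<and> N \<subseteq> fst d \<inter> (fst c \<inter> W) \<and> smooth_on (snd d ` N) (in_chart d (dir_deriv c v f))"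
    if "p \<in> fst c \<inter> W" for p
    using c op that by (intro bexI[of _ c] exI[of _ "fst c \<inter> W"]) auto
qed

lemma dir_deriv_commute:
  fixes f :: "'m \<Rightarrow> 'b::euclidean_space"
  assumes f: "smooth_fun A W f" and c: "c \<in> A" and p: "p \<in> fst c" "p \<in> W" and W: "open W"
  shows "dir_deriv c u (dir_deriv c v f) p = dir_deriv c v (dir_deriv c u f) p"
proof -
  have "frechet_derivative (in_chart c (dir_deriv c v f)) (at (snd c p)) u =
        frechet_derivative (\<lambda>y. frechet_derivative (in_chart c f) (at y) v) (at (snd c p)) u" for u v
    by (rule arg_cong[of _ _ "\<lambda>g. g u"], rule frechet_derivative_cong(1)[OF open_chart_image[OF c W]])
      (use c p in \<open>auto simp: dir_deriv_def\<close>)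
  then show ?thesis 
    using frechet_derivative_commute[OF smooth_funD[OF f c] open_chart_image[OF c W], of "snd c p" v u] p
    by (simp add: dir_deriv_def[of c _ "dir_deriv c _ f"])
qed

lemma holo_fun_dir_deriv:
  assumes f: "holo_fun A W f" and c: "c \<in> A" and p: "p \<in> fst c" "p \<in> W"
  shows "dir_deriv c (k *s v) f p = k *s dir_deriv c v f p"
proof -
  have "cholomorphic_on (snd c ` (fst c \<inter> W)) (in_chart c f)" using f c unfolding holo_fun_def by auto
  then obtain f' where f': "(in_chart c f has_derivative f') (at (snd c p))" "\<And>k v. f' (k *s v) = k *s f' v"
    using p unfolding cholomorphic_on_def by blast
  show ?thesis unfolding dir_derivI[OF f'(1)] by (rule f'(2))
qed

end

section \<open>The operators del and delbar, and frames of vector bundles\<close>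

definition delbar ::
  "('m, 'n::finite) chart \<Rightarrow> complex^'n \<Rightarrow> ('m \<Rightarrow> complex) \<Rightarrow> 'm \<Rightarrow> complex" where
  "delbar c v f p = (dir_deriv c v f p + \<i> * dir_deriv c (\<i> *s v) f p) / 2"

definition del ::
  "('m, 'n::finite) chart \<Rightarrow> complex^'n \<Rightarrow> ('m \<Rightarrow> complex) \<Rightarrow> 'm \<Rightarrow> complex" where
  "del c v f p = (dir_deriv c v f p - \<i> * dir_deriv c (\<i> *s v) f p) / 2"

lemma del_plus_delbar: "del c v f p + delbar c v f p = dir_deriv c v f p"
  by (simp add: del_def delbar_def field_simps)

lemma vector_smult_complex:
  "(k::complex) *s (v :: complex^'n) = Re k *\<^sub>R v + Im k *\<^sub>R (\<i> *s v)"
  by (simp add: vec_eq_iff complex_eq_iff)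

lemma vector_smult_real: "complex_of_real r *s (v :: complex^'n) = r *\<^sub>R v"
  by (simp add: vec_eq_iff complex_eq_iff)

context smooth_atlas begin

lemma dir_deriv_smult:
  assumes "smooth_fun A W f" "c \<in> A" "p \<in> fst c" "p \<in> W"
  shows "dir_deriv c (k *s v) f p = Re k *\<^sub>R dir_deriv c v f p + Im k *\<^sub>R dir_deriv c (\<i> *s v) f p"
  by (subst vector_smult_complex) (simp only: linear_add[OF dir_deriv_linear[OF assms]] linear_scale[OF dir_deriv_linear[OF assms]])

lemma del_smult:
  assumes "smooth_fun A W f" "c \<in> A" "p \<in> fst c" "p \<in> W"
  shows "del c (k *s v) f p = k * del c v f p"
proof -
  have "dir_deriv c (\<i> *s (k *s v)) f p = dir_deriv c ((\<i> * k) *s v) f p" by (simp add: vector_smult_assoc)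
  then show ?thesis
    by (simp add: del_def dir_deriv_smult[OF assms, of k] dir_deriv_smult[OF assms, of "\<i> * k"] complex_eq_iff field_simps)
qed

lemma delbar_smult:
  assumes "smooth_fun A W f" "c \<in> A" "p \<in> fst c" "p \<in> W"
  shows "delbar c (k *s v) f p = cnj k * delbar c v f p"
proof -
  have "dir_deriv c (\<i> *s (k *s v)) f p = dir_deriv c ((\<i> * k) *s v) f p" by (simp add: vector_smult_assoc)
  then show ?thesis
    by (simp add: delbar_def dir_deriv_smult[OF assms, of k] dir_deriv_smult[OF assms, of "\<i> * k"] complex_eq_iff field_simps)
qed

lemma del_vadd:
  assumes "smooth_fun A W f" "c \<in> A" "p \<in> fst c" "p \<in> W"
  shows "del c (u + v) f p = del c u f p + del c v f p" "delbar c (u + v) f p = delbar c u f p + delbar c v f p"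
  by (simp_all add: del_def delbar_def vector_add_ldistrib linear_add[OF dir_deriv_linear[OF assms]] field_simps)

lemma del_add:
  assumes "smooth_fun A W f" "smooth_fun A W g" "c \<in> A" "p \<in> fst c" "p \<in> W"
  shows "del c v (\<lambda>q. f q + g q) p = del c v f p + del c v g p"
    "delbar c v (\<lambda>q. f q + g q) p = delbar c v f p + delbar c v g p"
  by (simp_all add: del_def delbar_def dir_deriv_add[OF assms] field_simps)

lemma del_mult:
  assumes "smooth_fun A W f" "smooth_fun A W g" "c \<in> A" "p \<in> fst c" "p \<in> W"
  shows "del c v (\<lambda>q. f q * g q) p = f p * del c v g p + del c v f p * g p"
    "delbar c v (\<lambda>q. f q * g q) p = f p * delbar c v g p + delbar c v f p * g p"
  by (simp_all add: del_def delbar_def dir_deriv_mult[OF assms] field_simps)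

lemma del_sum:
  assumes "\<And>i. i \<in> I \<Longrightarrow> smooth_fun A W (f i)" "c \<in> A" "p \<in> fst c" "p \<in> W" "open W"
  shows "del c v (\<lambda>q. \<Sum>i\<in>I. f i q) p = (\<Sum>i\<in>I. del c v (f i) p)"
    "delbar c v (\<lambda>q. \<Sum>i\<in>I. f i q) p = (\<Sum>i\<in>I. delbar c v (f i) p)"
  by (simp_all add: del_def delbar_def dir_deriv_sum[OF assms] sum_divide_distrib[symmetric] sum.distrib
      sum_subtractf sum_distrib_left)

lemma del_const [simp]: "del c v (\<lambda>q. k) p = 0" "delbar c v (\<lambda>q. k) p = 0"
  by (simp_all add: del_def delbar_def)

lemma del_cmult:
  assumes "smooth_fun A W g" "c \<in> A" "p \<in> fst c" "p \<in> W"
  shows "del c v (\<lambda>q. k * g q) p = k * del c v g p"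
    "delbar c v (\<lambda>q. k * g q) p = k * delbar c v g p"
  using del_mult[OF smooth_fun_const assms] by auto

lemma del_cnj:
  assumes "smooth_fun A W f" "c \<in> A" "p \<in> fst c" "p \<in> W"
  shows "del c v (\<lambda>q. cnj (f q)) p = cnj (delbar c v f p)"
    "delbar c v (\<lambda>q. cnj (f q)) p = cnj (del c v f p)"
  by (simp_all add: del_def delbar_def dir_deriv_linear_compose[OF bounded_linear_cnj assms])

lemma del_cong:
  assumes "open W" "c \<in> A" "p \<in> fst c" "p \<in> W" "\<And>q. q \<in> W \<Longrightarrow> f q = g q"
  shows "del c v f p = del c v g p" "delbar c v f p = delbar c v g p"
  using dir_deriv_cong[OF assms] by (simp_all add: del_def delbar_def)

lemma del_change_chart:
  assumes f: "smooth_fun A W f" and c: "c \<in> A" "c' \<in> A" and p: "p \<in> fst c" "p \<in> fst c'" "p \<in> W" and W: "open W"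
  shows "del c' (dir_deriv c v (snd c') p) f p = del c v f p" "delbar c' (dir_deriv c v (snd c') p) f p = delbar c v f p"
  by (simp_all add: del_def delbar_def transition_has_derivative(2)[OF c p(1,2), symmetric] dir_deriv_change_chart[OF assms])

lemma smooth_fun_del:
  assumes f: "smooth_fun A W f" and c: "c \<in> A" and W: "open W"
  shows "smooth_fun A (fst c \<inter> W) (del c v f)" "smooth_fun A (fst c \<inter> W) (delbar c v f)"
proof -
  have op: "open (fst c \<inter> W)" using W chart_open[OF c] by auto
  show "smooth_fun A (fst c \<inter> W) (del c v f)" "smooth_fun A (fst c \<inter> W) (delbar c v f)"
    unfolding del_def[abs_def] delbar_def[abs_def]
    by (intro smooth_fun_divide smooth_fun_diff smooth_fun_add smooth_fun_mult smooth_fun_const 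
        smooth_fun_dir_deriv f c W op; simp)+
qed

lemma dir_deriv_vec_nth:
  fixes f :: "'m \<Rightarrow> 'b::euclidean_space^'i::finite"
  assumes "smooth_fun A W f" "c \<in> A" "p \<in> fst c" "p \<in> W"
  shows "dir_deriv c v (\<lambda>q. f q $ j) p = dir_deriv c v f p $ j"
  by (rule dir_deriv_linear_compose[OF bounded_linear_vec_nth assms])

lemma delbar_holo:
  assumes f: "holo_fun A W f" "smooth_fun A W f" and c: "c \<in> A" and p: "p \<in> fst c" "p \<in> W"
  shows "delbar c v (\<lambda>q. f q $ j) p = 0"
  by (simp add: delbar_def dir_deriv_vec_nth[OF f(2) c p] holo_fun_dir_deriv[OF f(1) c p])

lemma holo_funI:
  assumes f: "smooth_fun A W f" and h: "\<And>c p v j. c \<in> A \<Longrightarrow> p \<in> fst c \<Longrightarrow> p \<in> W \<Longrightarrow> delbar c v (\<lambda>q. f q $ j) p = 0"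
  shows "holo_fun A W f"
proof -
  have "cholomorphic_on (snd c ` (fst c \<inter> W)) (in_chart c f)" if c: "c \<in> A" for c
    unfolding cholomorphic_on_def
  proof (intro ballI exI conjI allI)
    fix y assume "y \<in> snd c ` (fst c \<inter> W)"
    then obtain p where p: "p \<in> fst c" "p \<in> W" "y = snd c p" by blast
    show "(in_chart c f has_derivative (\<lambda>v. dir_deriv c v f (inv_into (fst c) (snd c) y))) (at y)"
      using has_dir_deriv[OF f c p(1,2)] p c by simp
    have pc: "inv_into (fst c) (snd c) y = p" using p c by simp
    fix k v
    have i: "dir_deriv c (\<i> *s v) f p $ j = \<i> * dir_deriv c v f p $ j" for v j
    proof -
      have "dir_deriv c v f p $ j + \<i> * dir_deriv c (\<i> *s v) f p $ j = 0" 
        using h[OF c p(1,2), of v j] by (simp add: delbar_def dir_deriv_vec_nth[OF f c p(1,2)])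
      then have "\<i> * (dir_deriv c v f p $ j + \<i> * dir_deriv c (\<i> *s v) f p $ j) = 0" by simp
      then show ?thesis by (simp add: algebra_simps)
    qed
    show "dir_deriv c (k *s v) f (inv_into (fst c) (snd c) y) = k *s dir_deriv c v f (inv_into (fst c) (snd c) y)"
      unfolding pc by (simp add: vec_eq_iff dir_deriv_smult[OF f c p(1,2), of k] i complex_eq_iff)
  qed
  then show ?thesis unfolding holo_fun_def by auto
qed

end

lemma clinear_expand:
  fixes T :: "complex^'r::finite \<Rightarrow> complex^'s"
  assumes "\<And>u v. T (u + v) = T u + T v" "\<And>a v. T (a *s v) = a *s T v"
  shows "T v = (\<Sum>k\<in>UNIV. v $ k *s T (axis k 1))"
proof -
  have T0: "T 0 = 0" using assms(2)[of 0 0] by simp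
  have S: "T (\<Sum>k\<in>I. v $ k *s axis k 1) = (\<Sum>k\<in>I. v $ k *s T (axis k 1))" if "finite I" for I
    using that by induction (auto simp: assms T0)
  show ?thesis using S[OF finite_class.finite_UNIV] unfolding basis_expansion .
qed

locale smooth_vbundle = smooth_atlas A
  for A :: "('m::topological_space, 'n::finite) chart set" +
  fixes E :: "('e, 'm, 'r::finite) vbundle"
  assumes smooth_bundle: "smooth_bundle A E"
begin

lemma vbundle: "vector_bundle E" using smooth_bundle by (simp add: smooth_bundle_def)

lemma triv_open: "(W, \<tau>) \<in> btriv E \<Longrightarrow> open W"
  using vbundle unfolding vector_bundle_def by auto

lemma triv_cover: "\<exists>W \<tau>. (W, \<tau>) \<in> btriv E \<and> p \<in> W"
proof -
  have "p \<in> (\<Union>w\<in>btriv E. fst w)" using vbundle unfolding vector_bundle_def by simp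
  then show ?thesis by auto
qed

lemma triv_bij: "(W, \<tau>) \<in> btriv E \<Longrightarrow> p \<in> W \<Longrightarrow> bij_betw \<tau> (fibre E p) UNIV"
  using vbundle unfolding vector_bundle_def by auto

lemma triv_add: 
  assumes "(W, \<tau>) \<in> btriv E" "p \<in> W" "e \<in> fibre E p" "e' \<in> fibre E p"
  shows "badd E e e' \<in> fibre E p" "\<tau> (badd E e e') = \<tau> e + \<tau> e'"
  using vbundle assms unfolding vector_bundle_def by fastforce+

lemma triv_scale: 
  assumes "(W, \<tau>) \<in> btriv E" "p \<in> W" "e \<in> fibre E p"
  shows "bscale E a e \<in> fibre E p" "\<tau> (bscale E a e) = a *s \<tau> e"
  using vbundle assms unfolding vector_bundle_def by fastforce+

lemma badd_fibre [intro]: "e \<in> fibre E p \<Longrightarrow> e' \<in> fibre E p \<Longrightarrow> badd E e e' \<in> fibre E p"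
  using triv_add(1) triv_cover by metis

lemma bscale_fibre [intro]: "e \<in> fibre E p \<Longrightarrow> bscale E a e \<in> fibre E p"
  using triv_scale(1) triv_cover by metis

lemma triv_inj:
  assumes "(W, \<tau>) \<in> btriv E" "p \<in> W" "e \<in> fibre E p" "e' \<in> fibre E p" "\<tau> e = \<tau> e'"
  shows "e = e'"
  using triv_bij[OF assms(1,2)] assms(3-5) by (auto simp: bij_betw_def inj_on_def)

lemma of_triv:
  assumes "(W, \<tau>) \<in> btriv E" "p \<in> W"
  shows "of_triv E \<tau> v p \<in> fibre E p" "\<tau> (of_triv E \<tau> v p) = v"
proof -
  have v: "v \<in> \<tau> ` fibre E p" using triv_bij[OF assms] by (simp add: bij_betw_def)
  show "of_triv E \<tau> v p \<in> fibre E p" "\<tau> (of_triv E \<tau> v p) = v"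
    unfolding of_triv_def using inv_into_into[OF v] f_inv_into_f[OF v] by auto
qed

lemma of_triv_triv:
  assumes "(W, \<tau>) \<in> btriv E" "p \<in> W" "e \<in> fibre E p"
  shows "of_triv E \<tau> (\<tau> e) p = e"
  using triv_inj[OF assms(1,2) of_triv(1)[OF assms(1,2)] assms(3) of_triv(2)[OF assms(1,2)]] .

lemma of_triv_add:
  assumes "(W, \<tau>) \<in> btriv E" "p \<in> W"
  shows "of_triv E \<tau> (u + v) p = badd E (of_triv E \<tau> u p) (of_triv E \<tau> v p)"
  using assms by (intro triv_inj[OF assms]) (auto simp: of_triv triv_add[OF assms])

lemma of_triv_scale:
  assumes "(W, \<tau>) \<in> btriv E" "p \<in> W"
  shows "of_triv E \<tau> (a *s v) p = bscale E a (of_triv E \<tau> v p)"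
  using assms by (intro triv_inj[OF assms]) (auto simp: of_triv triv_scale[OF assms])

lemma bzero_fibre: "bzero E p \<in> fibre E p"
proof -
  obtain W \<tau> where w: "(W, \<tau>) \<in> btriv E" "p \<in> W" using triv_cover by blast
  have "(SOME e. e \<in> fibre E p) \<in> fibre E p" by (rule someI[of "\<lambda>e. e \<in> fibre E p", OF of_triv(1)[OF w]])
  then show ?thesis unfolding bzero_def by blast
qed

lemma triv_bzero:
  assumes w: "(W, \<tau>) \<in> btriv E" "p \<in> W" shows "\<tau> (bzero E p) = 0"
proof -
  have "(SOME e. e \<in> fibre E p) \<in> fibre E p" by (rule someI[of "\<lambda>e. e \<in> fibre E p", OF of_triv(1)[OF w]])
  then show ?thesis unfolding bzero_def by (simp add: triv_scale(2)[OF w])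
qed

lemma triv_transition:
  assumes "(W, \<tau>) \<in> btriv E" "p \<in> W" "e \<in> fibre E p"
    and T: "\<And>u v. u \<in> fibre E p \<Longrightarrow> v \<in> fibre E p \<Longrightarrow> T (badd E u v) = T u + T v" 
      "\<And>a v. v \<in> fibre E p \<Longrightarrow> T (bscale E a v) = a *s T v"
  shows "T e = (\<Sum>k\<in>UNIV. \<tau> e $ k *s T (of_triv E \<tau> (axis k 1) p))"
  using clinear_expand[of "\<lambda>v. T (of_triv E \<tau> v p)" "\<tau> e"] of_triv_triv[OF assms(1-3)]
  by (simp add: of_triv_add[OF assms(1,2)] of_triv_scale[OF assms(1,2)] T of_triv[OF assms(1,2)])

lemma triv_change:
  assumes "(W, \<tau>) \<in> btriv E" "(W', \<tau>') \<in> btriv E" "p \<in> W" "p \<in> W'" "e \<in> fibre E p"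
  shows "\<tau>' e = (\<Sum>k\<in>UNIV. \<tau> e $ k *s \<tau>' (of_triv E \<tau> (axis k 1) p))"
  by (rule triv_transition[OF assms(1,3,5)]) (auto simp: triv_add[OF assms(2,4)] triv_scale[OF assms(2,4)])

lemma smooth_transition_triv:
  "(W, \<tau>) \<in> btriv E \<Longrightarrow> (W', \<tau>') \<in> btriv E \<Longrightarrow> smooth_fun A (W \<inter> W') (\<lambda>p. \<tau>' (of_triv E \<tau> v p))"
  using smooth_bundle unfolding smooth_bundle_def by fastforce

lemma smooth_sectionD:
  assumes "smooth_section A E V s"
  shows "open V" "\<And>p. p \<in> V \<Longrightarrow> s p \<in> fibre E p"
    "\<And>W \<tau>. (W, \<tau>) \<in> btriv E \<Longrightarrow> smooth_fun A (V \<inter> W) (\<lambda>p. \<tau> (s p))"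
  using assms unfolding smooth_section_def by (auto simp: o_def)

lemma smooth_fun_smult:
  fixes f :: "'m \<Rightarrow> complex" and g :: "'m \<Rightarrow> complex^'s::finite"
  assumes "smooth_fun A W f" "smooth_fun A W g" "open W"
  shows "smooth_fun A W (\<lambda>p. f p *s g p)"
  unfolding smooth_fun_vec_iff[OF assms(3)] vector_smult_component
  by (intro allI smooth_fun_mult assms smooth_fun_vec_nth)

lemma smooth_sectionI:
  assumes "(W, \<tau>) \<in> btriv E" "open V" "V \<subseteq> W" "\<And>p. p \<in> V \<Longrightarrow> s p \<in> fibre E p" 
    "smooth_fun A V (\<lambda>p. \<tau> (s p))"
  shows "smooth_section A E V s"
  unfolding smooth_section_def
proof (rule conjI[OF assms(2)], rule conjI, safe)
  fix p assume "p \<in> V" then show "s p \<in> fibre E p" by (rule assms(4))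
next
  fix W' \<tau>' assume w': "(W', \<tau>') \<in> btriv E"
  have op: "open (V \<inter> W')" using assms(2) triv_open[OF w'] by auto
  have "smooth_fun A (V \<inter> W') (\<lambda>p. \<Sum>k\<in>UNIV. \<tau> (s p) $ k *s \<tau>' (of_triv E \<tau> (axis k 1) p))"
    by (intro smooth_fun_sum smooth_fun_smult smooth_fun_vec_nth op smooth_fun_subset[OF assms(5)]
        smooth_fun_subset[OF smooth_transition_triv[OF assms(1) w']]) (use assms(3) in auto)
  then show "smooth_fun A (V \<inter> W') (\<tau>' \<circ> s)"
    by (rule smooth_fun_cong[OF op, THEN iffD1, rotated])
      (use triv_change[OF assms(1) w'] assms(3,4) in auto)
qed

lemma smooth_section_subset:
  "smooth_section A E V s \<Longrightarrow> open U \<Longrightarrow> U \<subseteq> V \<Longrightarrow> smooth_section A E U s"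
  unfolding smooth_section_def by (auto intro: smooth_fun_subset)

lemma smooth_section_Union:
  assumes "open V" "\<And>p. p \<in> V \<Longrightarrow> \<exists>N. open N \<and> p \<in> N \<and> smooth_section A E (V \<inter> N) s"
  shows "smooth_section A E V s"
  unfolding smooth_section_def
proof (rule conjI[OF assms(1)], rule conjI, safe)
  fix p assume "p \<in> V" then show "s p \<in> fibre E p" using assms(2) smooth_sectionD(2) by blast
next
  fix W \<tau> assume w: "(W, \<tau>) \<in> btriv E"
  show "smooth_fun A (V \<inter> W) (\<tau> \<circ> s)"
  proof (rule smooth_fun_Union)
    fix p assume p: "p \<in> V \<inter> W"
    then obtain N where N: "open N" "p \<in> N" "smooth_section A E (V \<inter> N) s" using assms(2) by blast
    have "smooth_fun A (V \<inter> W \<inter> N) (\<tau> \<circ> s)"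
      unfolding o_def by (rule smooth_fun_subset[OF smooth_sectionD(3)[OF N(3) w]]) auto
    then show "\<exists>N. open N \<and> p \<in> N \<and> smooth_fun A (V \<inter> W \<inter> N) (\<tau> \<circ> s)" using N by blast
  qed (use assms(1) triv_open[OF w] in auto)
qed

lemma smooth_section_cong:
  "smooth_section A E V s \<Longrightarrow> (\<And>p. p \<in> V \<Longrightarrow> t p = s p) \<Longrightarrow> smooth_section A E V t"
proof -
  assume s: "smooth_section A E V s" and eq: "\<And>p. p \<in> V \<Longrightarrow> t p = s p"
  have "smooth_fun A (V \<inter> W) (\<lambda>p. \<tau> (t p))" if "(W, \<tau>) \<in> btriv E" for W \<tau>
    by (rule smooth_fun_cong[THEN iffD1, OF _ _ smooth_sectionD(3)[OF s that]])
      (use smooth_sectionD(1)[OF s] triv_open[OF that] eq in auto)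
  then show "smooth_section A E V t"
    using smooth_sectionD(1,2)[OF s] eq unfolding smooth_section_def by (auto simp: o_def)
qed

lemma smooth_section_of_triv:
  assumes "(W, \<tau>) \<in> btriv E" "open V" "V \<subseteq> W" "smooth_fun A V F"
  shows "smooth_section A E V (\<lambda>q. of_triv E \<tau> (F q) q)"
proof (rule smooth_sectionI[OF assms(1-3)])
  show "smooth_fun A V (\<lambda>p. \<tau> (of_triv E \<tau> (F p) p))"
    by (rule smooth_fun_cong[OF assms(2), THEN iffD1, OF _ assms(4)]) (use of_triv[OF assms(1)] assms(3) in auto)
qed (use of_triv[OF assms(1)] assms(3) in auto)

lemma smooth_section_frame:
  "(W, \<tau>) \<in> btriv E \<Longrightarrow> smooth_section A E W (of_triv E \<tau> a)"
  using smooth_section_of_triv[of W \<tau> W "\<lambda>q. a"] triv_open by auto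

lemma smooth_section_through:
  assumes "e \<in> fibre E p" shows "\<exists>W s. p \<in> W \<and> smooth_section A E W s \<and> s p = e"
proof -
  obtain W \<tau> where w: "(W, \<tau>) \<in> btriv E" "p \<in> W" using triv_cover by blast
  then show ?thesis using smooth_section_frame[OF w(1), of "\<tau> e"] of_triv_triv[OF w assms] by blast
qed

end

section \<open>Connections and Dolbeault operators in frames\<close>

definition conn_coeff ::
  "('e, 'm, 'r::finite) vbundle \<Rightarrow> ('e \<Rightarrow> complex^'r) \<Rightarrow> ('e, 'm, 'n) conn \<Rightarrow>
   ('m, 'n::finite) chart \<Rightarrow> complex^'n \<Rightarrow> 'r \<Rightarrow> 'm \<Rightarrow> complex^'r" where
  "conn_coeff E \<tau> D c v i q = \<tau> (D c v (of_triv E \<tau> (axis i 1)) q)"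

definition curv_coeff ::
  "('e, 'm, 'r::finite) vbundle \<Rightarrow> ('e \<Rightarrow> complex^'r) \<Rightarrow> ('e, 'm, 'n) conn \<Rightarrow>
   ('m, 'n::finite) chart \<Rightarrow> complex^'n \<Rightarrow> complex^'n \<Rightarrow> 'r \<Rightarrow> 'r \<Rightarrow> 'm \<Rightarrow> complex" where
  "curv_coeff E \<tau> D c u v i m p =
     dir_deriv c u (\<lambda>q. conn_coeff E \<tau> D c v i q $ m) p - dir_deriv c v (\<lambda>q. conn_coeff E \<tau> D c u i q $ m) p +
     (\<Sum>k\<in>UNIV. conn_coeff E \<tau> D c v i p $ k * conn_coeff E \<tau> D c u k p $ m
                - conn_coeff E \<tau> D c u i p $ k * conn_coeff E \<tau> D c v k p $ m)"

context smooth_vbundle begin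

lemma connectionD:
  assumes "connection A E D" "c \<in> A" "smooth_section A E W s"
  shows "smooth_section A E (fst c \<inter> W) (D c v s)"
    "p \<in> fst c \<Longrightarrow> p \<in> W \<Longrightarrow> smooth_section A E W t \<Longrightarrow>
      D c v (\<lambda>q. badd E (s q) (t q)) p = badd E (D c v s p) (D c v t p)"
    "p \<in> fst c \<Longrightarrow> p \<in> W \<Longrightarrow> smooth_fun A W f \<Longrightarrow>
      D c v (\<lambda>q. bscale E (f q) (s q)) p =
                badd E (bscale E (dir_deriv c v f p) (s p)) (bscale E (f p) (D c v s p))"
    "p \<in> fst c \<Longrightarrow> p \<in> W \<Longrightarrow> (\<And>q. q \<in> W \<Longrightarrow> t q = s q) \<Longrightarrow> D c v t p = D c v s p"
proof -
  note D = assms(1)[unfolded connection_def, rule_format, OF assms(2,3)]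
  show "smooth_section A E (fst c \<inter> W) (D c v s)" using conjunct1[OF D] by blast
  note P = bspec[OF conjunct2[OF D], of p]
  show "p \<in> fst c \<Longrightarrow> p \<in> W \<Longrightarrow> smooth_section A E W t \<Longrightarrow>
      D c v (\<lambda>q. badd E (s q) (t q)) p = badd E (D c v s p) (D c v t p)"
    by (rule P[THEN conjunct2, THEN conjunct2, THEN conjunct1, rule_format]) auto
  show "p \<in> fst c \<Longrightarrow> p \<in> W \<Longrightarrow> smooth_fun A W f \<Longrightarrow>
      D c v (\<lambda>q. bscale E (f q) (s q)) p =
                badd E (bscale E (dir_deriv c v f p) (s p)) (bscale E (f p) (D c v s p))"
    by (rule P[THEN conjunct2, THEN conjunct2, THEN conjunct2, THEN conjunct1, rule_format]) auto
  show "p \<in> fst c \<Longrightarrow> p \<in> W \<Longrightarrow> (\<And>q. q \<in> W \<Longrightarrow> t q = s q) \<Longrightarrow> D c v t p = D c v s p"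
    by (rule P[THEN conjunct2, THEN conjunct2, THEN conjunct2, THEN conjunct2, THEN conjunct1, rule_format]) auto
qed

lemma connection_fibre:
  assumes "connection A E D" "c \<in> A" "smooth_section A E W s" "p \<in> fst c" "p \<in> W"
  shows "D c v s p \<in> fibre E p"
  using smooth_sectionD(2)[OF connectionD(1)[OF assms(1-3)]] assms(4,5) by auto

text \<open>
  The Leibniz rule reduces a covariant derivative to those of the frame, so that a connection is a matrix of smooth coefficients acting together with the derivative of the components.
\<close>

lemma connection_triv:
  assumes D: "connection A E D" and w: "(W0, \<tau>) \<in> btriv E" and s: "smooth_section A E W s"
    and c: "c \<in> A" and p: "p \<in> fst c" "p \<in> W" "p \<in> W0"
  shows "\<tau> (D c v s p) = dir_deriv c v (\<lambda>q. \<tau> (s q)) p + (\<Sum>i\<in>UNIV. \<tau> (s p) $ i *s conn_coeff E \<tau> D c v i p)"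
proof -
  define V where "V = W \<inter> W0"
  have V: "open V" "V \<subseteq> W" "V \<subseteq> W0" "p \<in> V"
    using smooth_sectionD(1)[OF s] triv_open[OF w] p by (auto simp: V_def)
  have sV: "smooth_section A E V s" by (rule smooth_section_subset[OF s V(1,2)])
  have sF: "smooth_fun A V (\<lambda>q. \<tau> (s q))" using smooth_sectionD(3)[OF s w] by (simp add: V_def)
  define F where "F i q = \<tau> (s q) $ i" for i q
  have F: "smooth_fun A V (F i)" for i unfolding F_def[abs_def] by (rule smooth_fun_vec_nth[OF sF V(1)])
  define f where "f i = of_triv E \<tau> (axis i 1)" for i
  have f: "smooth_section A E V (f i)" for i
    unfolding f_def by (rule smooth_section_subset[OF smooth_section_frame[OF w] V(1,3)])
  define T where "T I q = of_triv E \<tau> (\<Sum>i\<in>I. F i q *s axis i 1) q" for I q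
  have T: "smooth_section A E V (T I)" for I
    unfolding T_def[abs_def]
    by (rule smooth_section_of_triv[OF w V(1,3)]) (intro smooth_fun_sum smooth_fun_smult F smooth_fun_const V(1))
  have Fs: "smooth_section A E V (\<lambda>q. bscale E (F i q) (f i q))" for i
  proof (rule smooth_section_cong)
    show "smooth_section A E V (\<lambda>q. of_triv E \<tau> (F i q *s axis i 1) q)"
      by (rule smooth_section_of_triv[OF w V(1,3)]) (intro smooth_fun_smult F smooth_fun_const V(1))
  qed (use V(3) in \<open>auto simp: f_def of_triv_scale[OF w]\<close>)
  have Dfib: "D c v t p \<in> fibre E p" if "smooth_section A E V t" for t
    by (rule connection_fibre[OF D c that p(1) V(4)])
  have claim: "\<tau> (D c v (T I) p) = (\<Sum>i\<in>I. dir_deriv c v (F i) p *s axis i 1 + F i p *s \<tau> (D c v (f i) p))" if "finite I" for I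
    using that
  proof (induction I)
    case empty
    have "D c v (\<lambda>q. bscale E 0 (T {} q)) p = badd E (bscale E (dir_deriv c v (\<lambda>q. 0) p) (T {} p)) (bscale E 0 (D c v (T {}) p))"
      by (rule connectionD(3)[OF D c T p(1) V(4) smooth_fun_const])
    moreover have "T {} p \<in> fibre E p" using smooth_sectionD(2)[OF T V(4)] .
    ultimately have "\<tau> (D c v (\<lambda>q. bscale E 0 (T {} q)) p) = 0"
      by (simp add: triv_add[OF w p(3)] triv_scale[OF w p(3)] bscale_fibre Dfib[OF T])
    moreover have "D c v (\<lambda>q. bscale E 0 (T {} q)) p = D c v (T {}) p"
      by (rule connectionD(4)[OF D c T p(1) V(4)])
        (use V(3) of_triv_scale[OF w, of _ 0 0] in \<open>auto simp: T_def\<close>)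
    ultimately show ?case by simp
  next
    case (insert i I)
    have "D c v (T (insert i I)) p = D c v (\<lambda>q. badd E (bscale E (F i q) (f i q)) (T I q)) p"
    proof (rule connectionD(4)[OF D c T p(1) V(4), symmetric])
      fix q assume "q \<in> V"
      then have q: "q \<in> W0" using V(3) by auto
      show "badd E (bscale E (F i q) (f i q)) (T I q) = T (insert i I) q"
        using insert.hyps by (simp add: T_def f_def of_triv_add[OF w q] of_triv_scale[OF w q])
    qed
    also have "\<dots> = badd E (D c v (\<lambda>q. bscale E (F i q) (f i q)) p) (D c v (T I) p)"
      by (rule connectionD(2)[OF D c Fs p(1) V(4) T])
    also have "D c v (\<lambda>q. bscale E (F i q) (f i q)) p = 
        badd E (bscale E (dir_deriv c v (F i) p) (f i p)) (bscale E (F i p) (D c v (f i) p))"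
      by (rule connectionD(3)[OF D c f p(1) V(4) F])
    finally have e: "D c v (T (insert i I)) p = badd E (badd E (bscale E (dir_deriv c v (F i) p) (f i p)) 
        (bscale E (F i p) (D c v (f i) p))) (D c v (T I) p)" .
    have fi: "f i p \<in> fibre E p" "\<tau> (f i p) = axis i 1" using of_triv[OF w p(3)] by (auto simp: f_def)
    show ?case unfolding e using insert
      by (simp add: triv_add[OF w p(3)] triv_scale[OF w p(3)] bscale_fibre badd_fibre fi Dfib[OF T] Dfib[OF f])
  qed
  have "D c v (T UNIV) p = D c v s p"
  proof (rule connectionD(4)[OF D c sV p(1) V(4)])
    fix q assume q: "q \<in> V"
    have "(\<Sum>i\<in>UNIV. F i q *s axis i 1) = \<tau> (s q)" unfolding F_def by (rule basis_expansion)
    then show "T UNIV q = s q" using q V(3) of_triv_triv[OF w _ smooth_sectionD(2)[OF sV q]] by (auto simp: T_def)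
  qed
  then have "\<tau> (D c v s p) = (\<Sum>i\<in>UNIV. dir_deriv c v (F i) p *s axis i 1 + F i p *s \<tau> (D c v (f i) p))"
    using claim[of UNIV] by simp
  also have "\<dots> = (\<Sum>i\<in>UNIV. dir_deriv c v (\<lambda>q. \<tau> (s q)) p $ i *s axis i 1) + (\<Sum>i\<in>UNIV. \<tau> (s p) $ i *s \<tau> (D c v (f i) p))"
    by (simp add: sum.distrib F_def[abs_def] dir_deriv_vec_nth[OF sF c p(1) V(4)])
  finally show ?thesis by (simp add: basis_expansion conn_coeff_def f_def[abs_def])
qed

lemma conn_coeff_smooth:
  assumes D: "connection A E D" and w: "(W0, \<tau>) \<in> btriv E" and c: "c \<in> A"
  shows "smooth_fun A (fst c \<inter> W0) (\<lambda>q. conn_coeff E \<tau> D c v i q)"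
  using smooth_sectionD(3)[OF connectionD(1)[OF D c smooth_section_frame[OF w]] w]
  by (simp add: conn_coeff_def)

lemma curvature_section:
  assumes D: "connection A E D" and w: "(W0, \<tau>) \<in> btriv E" and s: "smooth_section A E W s"
    and c: "c \<in> A" and p: "p \<in> fst c" "p \<in> W" "p \<in> W0"
  shows "\<tau> (D c u (D c v s) p) $ m - \<tau> (D c v (D c u s) p) $ m = 
     (\<Sum>i\<in>UNIV. \<tau> (s p) $ i * curv_coeff E \<tau> D c u v i m p)"
proof -
  define V where "V = fst c \<inter> (W \<inter> W0)"
  have V: "open V" "V \<subseteq> W" "V \<subseteq> W0" "V \<subseteq> fst c" "p \<in> V"
    using smooth_sectionD(1)[OF s] triv_open[OF w] chart_open[OF c] p by (auto simp: V_def)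
  define F where "F i q = \<tau> (s q) $ i" for i q
  have sF: "smooth_fun A V (\<lambda>q. \<tau> (s q))" 
    by (rule smooth_fun_subset[OF smooth_sectionD(3)[OF s w]]) (auto simp: V_def)
  have F: "smooth_fun A V (F i)" for i unfolding F_def[abs_def] by (rule smooth_fun_vec_nth[OF sF V(1)])
  define G where "G v i m q = conn_coeff E \<tau> D c v i q $ m" for v i m q
  have G: "smooth_fun A V (G v i m)" for v i m 
    unfolding G_def[abs_def] 
    by (rule smooth_fun_vec_nth[OF smooth_fun_subset[OF conn_coeff_smooth[OF D w c]] V(1)]) (auto simp: V_def)
  have dF: "smooth_fun A V (dir_deriv c v (F i))" for v i 
    using smooth_fun_dir_deriv[OF F c V(1)] V(4) by (simp add: Int_absorb1)
  have Dv: "\<tau> (D c v s q) $ m = dir_deriv c v (F m) q + (\<Sum>i\<in>UNIV. F i q * G v i m q)" if q: "q \<in> V" for v q m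
  proof -
    have q': "q \<in> fst c" "q \<in> W" "q \<in> W0" using q V by auto
    show ?thesis
      using connection_triv[OF D w s c q', of v]
      by (simp add: F_def[abs_def] G_def dir_deriv_vec_nth[OF sF c q'(1) q])
  qed
  have sD: "smooth_section A E (fst c \<inter> W) (D c v s)" for v by (rule connectionD(1)[OF D c s])
  have sT: "smooth_fun A V (\<lambda>q. \<tau> (D c v s q))" for v
    by (rule smooth_fun_subset[OF smooth_sectionD(3)[OF sD w]]) (auto simp: V_def)
  have X: "\<tau> (D c u (D c v s) p) $ m = dir_deriv c u (dir_deriv c v (F m)) p 
     + (\<Sum>i\<in>UNIV. F i p * dir_deriv c u (G v i m) p + dir_deriv c u (F i) p * G v i m p)
     + (\<Sum>k\<in>UNIV. (dir_deriv c v (F k) p + (\<Sum>i\<in>UNIV. F i p * G v i k p)) * G u k m p)" for u v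
  proof -
    have "p \<in> fst c \<inter> W" using p by simp
    then have "\<tau> (D c u (D c v s) p) $ m = dir_deriv c u (\<lambda>q. \<tau> (D c v s q)) p $ m + (\<Sum>k\<in>UNIV. \<tau> (D c v s p) $ k * G u k m p)"
      using connection_triv[OF D w sD[of v] c p(1) _ p(3), of u] by (simp add: G_def)
    also have "dir_deriv c u (\<lambda>q. \<tau> (D c v s q)) p $ m = dir_deriv c u (\<lambda>q. \<tau> (D c v s q) $ m) p"
      by (rule dir_deriv_vec_nth[OF sT c p(1) V(5), symmetric])
    also have "\<dots> = dir_deriv c u (\<lambda>q. dir_deriv c v (F m) q + (\<Sum>i\<in>UNIV. F i q * G v i m q)) p"
      by (rule dir_deriv_cong[OF V(1) c p(1) V(5) Dv])
    also have "\<dots> = dir_deriv c u (dir_deriv c v (F m)) p + dir_deriv c u (\<lambda>q. \<Sum>i\<in>UNIV. F i q * G v i m q) p"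
      by (rule dir_deriv_add[OF dF _ c p(1) V(5)]) (intro smooth_fun_sum smooth_fun_mult F G V(1))
    also have "dir_deriv c u (\<lambda>q. \<Sum>i\<in>UNIV. F i q * G v i m q) p = 
       (\<Sum>i\<in>UNIV. dir_deriv c u (\<lambda>q. F i q * G v i m q) p)"
      by (rule dir_deriv_sum[OF _ c p(1) V(5,1)]) (intro smooth_fun_mult F G V(1))
    also have "\<dots> = (\<Sum>i\<in>UNIV. F i p * dir_deriv c u (G v i m) p + dir_deriv c u (F i) p * G v i m p)"
      by (simp add: dir_deriv_mult[OF F G c p(1) V(5)])
    finally show ?thesis by (simp add: Dv[OF V(5)])
  qed
  have sw: "(\<Sum>k\<in>UNIV. (dir_deriv c v (F k) p + (\<Sum>i\<in>UNIV. F i p * G v i k p)) * G u k m p)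
     = (\<Sum>k\<in>UNIV. dir_deriv c v (F k) p * G u k m p) + (\<Sum>i\<in>UNIV. F i p * (\<Sum>k\<in>UNIV. G v i k p * G u k m p))" for u v
  proof -
    have "(\<Sum>k\<in>UNIV. (\<Sum>i\<in>UNIV. F i p * G v i k p) * G u k m p) = (\<Sum>i\<in>UNIV. F i p * (\<Sum>k\<in>UNIV. G v i k p * G u k m p))"
      unfolding sum_distrib_right sum_distrib_left by (subst sum.swap) (simp add: mult.assoc)
    then show ?thesis by (simp add: distrib_right sum.distrib)
  qed
  have comm: "dir_deriv c u (dir_deriv c v (F m)) p = dir_deriv c v (dir_deriv c u (F m)) p"
    by (rule dir_deriv_commute[OF F c p(1) V(5,1)])
  show ?thesis
    unfolding X sw comm curv_coeff_def G_def[symmetric] F_def[symmetric] G_def[abs_def, symmetric]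
    by (simp add: sum.distrib sum_subtractf distrib_left right_diff_distrib)
qed

text \<open>
  The second derivatives of the components cancel because coordinate vector fields commute, and the first derivatives cancel against each other. What remains depends only on the value of the section at the point, so that the description defining the curvature is proper.
\<close>

lemma curvature_triv:
  assumes D: "connection A E D" and w: "(W0, \<tau>) \<in> btriv E" and e: "e \<in> fibre E p"
    and c: "c \<in> A" and p: "p \<in> fst c" "p \<in> W0"
  shows "curvature A E D c p u v e \<in> fibre E p"
    "\<tau> (curvature A E D c p u v e) $ m = (\<Sum>i\<in>UNIV. \<tau> e $ i * curv_coeff E \<tau> D c u v i m p)"
proof -
  let ?X = "\<lambda>s. badd E (D c u (D c v s) p) (bscale E (-1) (D c v (D c u s) p))"
  have X: "?X s \<in> fibre E p \<and> (\<forall>m. \<tau> (?X s) $ m = (\<Sum>i\<in>UNIV. \<tau> e $ i * curv_coeff E \<tau> D c u v i m p))"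
    if s: "smooth_section A E W s" "p \<in> W" "s p = e" for W s
  proof -
    have "D c u (D c v s) p \<in> fibre E p" for u v
      by (rule connection_fibre[OF D c connectionD(1)[OF D c s(1)] p(1)]) (use p s in auto)
    then show ?thesis
      using curvature_section[OF D w s(1) c p(1) s(2) p(2), of u v] s(3)
      by (auto simp: triv_add[OF w p(2)] triv_scale[OF w p(2)] bscale_fibre badd_fibre)
  qed
  obtain W s where s: "smooth_section A E W s" "p \<in> W" "s p = e" using smooth_section_through[OF e] by blast
  have "curvature A E D c p u v e = ?X s"
    unfolding curvature_def
  proof (rule the_equality)
    fix f assume "\<exists>W s. p \<in> W \<and> smooth_section A E W s \<and> s p = e \<and> f = ?X s"
    then obtain W' s' where s': "p \<in> W'" "smooth_section A E W' s'" "s' p = e" "f = ?X s'" by blast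
    show "f = ?X s" unfolding s'(4)
      by (rule triv_inj[OF w p(2)]) (use X[OF s] X[OF s'(2,1,3)] in \<open>auto simp: vec_eq_iff\<close>)
  qed (use s in blast)
  then show "curvature A E D c p u v e \<in> fibre E p"
    "\<tau> (curvature A E D c p u v e) $ m = (\<Sum>i\<in>UNIV. \<tau> e $ i * curv_coeff E \<tau> D c u v i m p)"
    using X[OF s] by auto
qed

end

locale hol_vbundle = smooth_vbundle A E
  for A :: "('m::topological_space, 'n::finite) chart set" and E :: "('e, 'm, 'r::finite) vbundle" +
  assumes hol_bundle: "holomorphic_bundle A E"
begin

lemma holo_transition_triv:
  "(W, \<tau>) \<in> btriv E \<Longrightarrow> (W', \<tau>') \<in> btriv E \<Longrightarrow> holo_fun A (W \<inter> W') (\<lambda>p. \<tau>' (of_triv E \<tau> v p))"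
  using hol_bundle unfolding holomorphic_bundle_def by fastforce

lemma delbar_transition:
  assumes "(W, \<tau>) \<in> btriv E" "(W', \<tau>') \<in> btriv E" "c \<in> A" "p \<in> fst c" "p \<in> W" "p \<in> W'"
  shows "delbar c v (\<lambda>q. \<tau>' (of_triv E \<tau> a q) $ j) p = 0"
  by (rule delbar_holo[OF holo_transition_triv[OF assms(1,2)] smooth_transition_triv[OF assms(1,2)] assms(3,4)])
    (use assms in auto)

lemma delbar_change_triv:
  assumes w: "(W0, \<tau>) \<in> btriv E" "(W', \<tau>') \<in> btriv E" and s: "smooth_section A E W s"
    and c: "c \<in> A" and p: "p \<in> fst c" "p \<in> W" "p \<in> W0" "p \<in> W'"
  shows "delbar c v (\<lambda>q. \<tau>' (s q) $ j) p = (\<Sum>k\<in>UNIV. delbar c v (\<lambda>q. \<tau> (s q) $ k) p * \<tau>' (of_triv E \<tau> (axis k 1) p) $ j)"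
proof -
  define V where "V = W \<inter> (W0 \<inter> W')"
  have V: "open V" "p \<in> V" using smooth_sectionD(1)[OF s] triv_open[OF w(1)] triv_open[OF w(2)] p by (auto simp: V_def)
  have F: "smooth_fun A V (\<lambda>q. \<tau> (s q) $ k)" for k
    by (rule smooth_fun_vec_nth[OF smooth_fun_subset[OF smooth_sectionD(3)[OF s w(1)]] V(1)]) (auto simp: V_def)
  have g: "smooth_fun A V (\<lambda>q. \<tau>' (of_triv E \<tau> (axis k 1) q) $ j)" for k
    by (rule smooth_fun_vec_nth[OF smooth_fun_subset[OF smooth_transition_triv[OF w]] V(1)]) (auto simp: V_def)
  have "delbar c v (\<lambda>q. \<tau>' (s q) $ j) p = delbar c v (\<lambda>q. \<Sum>k\<in>UNIV. \<tau> (s q) $ k * \<tau>' (of_triv E \<tau> (axis k 1) q) $ j) p"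
  proof (rule del_cong(2)[OF V(1) c p(1) V(2)])
    fix q assume q: "q \<in> V"
    then have "q \<in> W0" "q \<in> W'" "s q \<in> fibre E q" using smooth_sectionD(2)[OF s] by (auto simp: V_def)
    from triv_change[OF w this]
    show "\<tau>' (s q) $ j = (\<Sum>k\<in>UNIV. \<tau> (s q) $ k * \<tau>' (of_triv E \<tau> (axis k 1) q) $ j)"
      by simp
  qed
  also have "\<dots> = (\<Sum>k\<in>UNIV. delbar c v (\<lambda>q. \<tau> (s q) $ k * \<tau>' (of_triv E \<tau> (axis k 1) q) $ j) p)"
    by (rule del_sum(2)[OF _ c p(1) V(2,1)]) (intro smooth_fun_mult F g V(1))
  finally show ?thesis by (simp add: del_mult(2)[OF F g c p(1) V(2)] delbar_transition[OF w c p(1,3,4)])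
qed

text \<open>
  The transition functions between holomorphic trivializations are annihilated by delbar; hence the componentwise formula does not depend on the trivialization, and one of them suffices to compute the operator.
\<close>

lemma dolbeault_triv:
  assumes s: "smooth_section A E W s" and c: "c \<in> A" and p: "p \<in> fst c" "p \<in> W"
  shows "dolbeault E c v s p \<in> fibre E p"
   "\<And>W0 \<tau>. (W0, \<tau>) \<in> btriv E \<Longrightarrow> p \<in> W0 \<Longrightarrow> \<tau> (dolbeault E c v s p) $ j = delbar c v (\<lambda>q. \<tau> (s q) $ j) p"
proof -
  obtain W0 \<tau> where w: "(W0, \<tau>) \<in> btriv E" "p \<in> W0" using triv_cover by blast
  define e where "e = of_triv E \<tau> (\<chi> j. delbar c v (\<lambda>q. \<tau> (s q) $ j) p) p"
  have e: "e \<in> fibre E p" "\<tau> e = (\<chi> j. delbar c v (\<lambda>q. \<tau> (s q) $ j) p)" using of_triv[OF w] by (auto simp: e_def)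
  have d: "((1/2) *s (dir_deriv c v (\<tau>' \<circ> s) p + \<i> *s dir_deriv c (\<i> *s v) (\<tau>' \<circ> s) p)) $ j = delbar c v (\<lambda>q. \<tau>' (s q) $ j) p"
    if w': "(W', \<tau>') \<in> btriv E" "p \<in> W'" for W' \<tau>' j
    using dir_deriv_vec_nth[OF smooth_sectionD(3)[OF s w'(1)] c p(1)] p(2) w'(2)
    by (simp add: delbar_def o_def)
  have ej: "\<tau>' e $ j = delbar c v (\<lambda>q. \<tau>' (s q) $ j) p" if w': "(W', \<tau>') \<in> btriv E" "p \<in> W'" for W' \<tau>' j
    using triv_change[OF w(1) w'(1) w(2) w'(2) e(1)] delbar_change_triv[OF w(1) w'(1) s c p w(2) w'(2)]
    by (simp add: e(2))
  have "dolbeault E c v s p = e"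
    unfolding dolbeault_def
  proof (rule the_equality)
    show "e \<in> fibre E p \<and> (\<forall>(W, \<tau>)\<in>btriv E. p \<in> W \<longrightarrow>
           \<tau> e = (1/2) *s (dir_deriv c v (\<tau> \<circ> s) p + \<i> *s dir_deriv c (\<i> *s v) (\<tau> \<circ> s) p))"
      using e(1) d ej by (auto simp: vec_eq_iff)
    fix e' assume "e' \<in> fibre E p \<and> (\<forall>(W, \<tau>)\<in>btriv E. p \<in> W \<longrightarrow>
           \<tau> e' = (1/2) *s (dir_deriv c v (\<tau> \<circ> s) p + \<i> *s dir_deriv c (\<i> *s v) (\<tau> \<circ> s) p))"
    then have e': "e' \<in> fibre E p" "\<tau> e' = (1/2) *s (dir_deriv c v (\<tau> \<circ> s) p + \<i> *s dir_deriv c (\<i> *s v) (\<tau> \<circ> s) p)"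
      using w by auto
    show "e' = e" by (rule triv_inj[OF w e'(1) e(1)]) (use d[OF w] ej[OF w] e'(2) in \<open>simp add: vec_eq_iff\<close>)
  qed
  then show "dolbeault E c v s p \<in> fibre E p"
   "\<And>W0 \<tau>. (W0, \<tau>) \<in> btriv E \<Longrightarrow> p \<in> W0 \<Longrightarrow> \<tau> (dolbeault E c v s p) $ j = delbar c v (\<lambda>q. \<tau> (s q) $ j) p"
    using e(1) ej by auto
qed

end

section \<open>The Chern connection of a pseudo-Hermitian metric\<close>

lemma clinear_expand_scalar:
  fixes T :: "complex^'r::finite \<Rightarrow> complex"
  assumes "\<And>u v. T (u + v) = T u + T v" "\<And>a v. T (a *s v) = a * T v"
  shows "T v = (\<Sum>k\<in>UNIV. v $ k * T (axis k 1))"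
proof -
  have "(\<lambda>v. \<chi> i::1. T v) v = (\<Sum>k\<in>UNIV. v $ k *s (\<lambda>v. \<chi> i::1. T v) (axis k 1))"
    by (rule clinear_expand) (auto simp: vec_eq_iff assms)
  then show ?thesis by (simp add: vec_eq_iff)
qed

context smooth_vbundle begin

lemma smooth_section_badd:
  assumes s: "smooth_section A E W s" and t: "smooth_section A E W t"
  shows "smooth_section A E W (\<lambda>q. badd E (s q) (t q))"
proof (rule smooth_section_Union[OF smooth_sectionD(1)[OF s]])
  fix p assume p: "p \<in> W"
  obtain W0 \<tau> where w: "(W0, \<tau>) \<in> btriv E" "p \<in> W0" using triv_cover by blast
  have op: "open (W \<inter> W0)" using smooth_sectionD(1)[OF s] triv_open[OF w(1)] by auto
  have "smooth_section A E (W \<inter> W0) (\<lambda>q. badd E (s q) (t q))"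
  proof (rule smooth_sectionI[OF w(1) op])
    show "smooth_fun A (W \<inter> W0) (\<lambda>q. \<tau> (badd E (s q) (t q)))"
      by (rule smooth_fun_cong[OF op, THEN iffD1, OF _ smooth_fun_add[OF smooth_sectionD(3)[OF s w(1)] smooth_sectionD(3)[OF t w(1)] op]])
       (use triv_add(2)[OF w(1) _ smooth_sectionD(2)[OF s] smooth_sectionD(2)[OF t]] in force)
  qed (use smooth_sectionD(2)[OF s] smooth_sectionD(2)[OF t] in auto)
  then show "\<exists>N. open N \<and> p \<in> N \<and> smooth_section A E (W \<inter> N) (\<lambda>q. badd E (s q) (t q))"
    using triv_open[OF w(1)] w by blast
qed

lemma smooth_section_bscale:
  assumes s: "smooth_section A E W s" and t: "smooth_fun A W f"
  shows "smooth_section A E W (\<lambda>q. bscale E (f q) (s q))"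
proof (rule smooth_section_Union[OF smooth_sectionD(1)[OF s]])
  fix p assume p: "p \<in> W"
  obtain W0 \<tau> where w: "(W0, \<tau>) \<in> btriv E" "p \<in> W0" using triv_cover by blast
  have op: "open (W \<inter> W0)" using smooth_sectionD(1)[OF s] triv_open[OF w(1)] by auto
  have "smooth_section A E (W \<inter> W0) (\<lambda>q. bscale E (f q) (s q))"
  proof (rule smooth_sectionI[OF w(1) op])
    show "smooth_fun A (W \<inter> W0) (\<lambda>q. \<tau> (bscale E (f q) (s q)))"
      by (rule smooth_fun_cong[OF op, THEN iffD1, OF _ smooth_fun_smult[OF smooth_fun_subset[OF t] smooth_sectionD(3)[OF s w(1)] op]])
       (use triv_scale(2)[OF w(1) _ smooth_sectionD(2)[OF s]] in force)+
  qed (use smooth_sectionD(2)[OF s] in auto)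
  then show "\<exists>N. open N \<and> p \<in> N \<and> smooth_section A E (W \<inter> N) (\<lambda>q. bscale E (f q) (s q))"
    using triv_open[OF w(1)] w by blast
qed

end

context hol_vbundle begin

lemma dolbeault_rules:
  assumes s: "smooth_section A E W s" and c: "c \<in> A" and p: "p \<in> fst c" "p \<in> W" and w: "(W0, \<tau>) \<in> btriv E" "p \<in> W0"
  shows "\<tau> (dolbeault E c (u + v) s p) = \<tau> (dolbeault E c u s p) + \<tau> (dolbeault E c v s p)"
    "\<tau> (dolbeault E c (a *s v) s p) = cnj a *s \<tau> (dolbeault E c v s p)"
    "smooth_section A E W t \<Longrightarrow> smooth_section A E W (\<lambda>q. badd E (s q) (t q)) \<Longrightarrow> 
       \<tau> (dolbeault E c v (\<lambda>q. badd E (s q) (t q)) p) = \<tau> (dolbeault E c v s p) + \<tau> (dolbeault E c v t p)"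
    "smooth_fun A W f \<Longrightarrow> smooth_section A E W (\<lambda>q. bscale E (f q) (s q)) \<Longrightarrow> 
       \<tau> (dolbeault E c v (\<lambda>q. bscale E (f q) (s q)) p) = delbar c v f p *s \<tau> (s p) + f p *s \<tau> (dolbeault E c v s p)"
    "(\<And>q. q \<in> W \<Longrightarrow> t q = s q) \<Longrightarrow> \<tau> (dolbeault E c v t p) = \<tau> (dolbeault E c v s p)"
    "c' \<in> A \<Longrightarrow> p \<in> fst c' \<Longrightarrow> \<tau> (dolbeault E c' (dir_deriv c v (snd c') p) s p) = \<tau> (dolbeault E c v s p)"
proof -
  define V where "V = W \<inter> W0"
  have V: "open V" "p \<in> V" "V \<subseteq> W" "V \<subseteq> W0" using smooth_sectionD(1)[OF s] triv_open[OF w(1)] p w by (auto simp: V_def)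
  have F: "smooth_fun A V (\<lambda>q. \<tau> (s q) $ k)" if s: "smooth_section A E W s" for k s
    by (rule smooth_fun_vec_nth[OF smooth_fun_subset[OF smooth_sectionD(3)[OF s w(1)]] V(1)]) (auto simp: V_def)
  note d = dolbeault_triv(2)[OF _ c p w]
  show "\<tau> (dolbeault E c (u + v) s p) = \<tau> (dolbeault E c u s p) + \<tau> (dolbeault E c v s p)"
    by (simp add: vec_eq_iff d[OF s] del_vadd[OF F[OF s] c p(1) V(2)])
  show "\<tau> (dolbeault E c (a *s v) s p) = cnj a *s \<tau> (dolbeault E c v s p)"
    by (simp add: vec_eq_iff d[OF s] delbar_smult[OF F[OF s] c p(1) V(2)])
  show "\<tau> (dolbeault E c v (\<lambda>q. badd E (s q) (t q)) p) = \<tau> (dolbeault E c v s p) + \<tau> (dolbeault E c v t p)"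
    if t: "smooth_section A E W t" and st: "smooth_section A E W (\<lambda>q. badd E (s q) (t q))"
  proof -
    have "delbar c v (\<lambda>q. \<tau> (badd E (s q) (t q)) $ j) p = delbar c v (\<lambda>q. \<tau> (s q) $ j + \<tau> (t q) $ j) p" for j
      by (rule del_cong(2)[OF V(1) c p(1) V(2)])
        (use triv_add(2)[OF w(1) _ smooth_sectionD(2)[OF s] smooth_sectionD(2)[OF t]] V(3,4) in force)
    then show ?thesis by (simp add: vec_eq_iff d[OF s] d[OF t] d[OF st] del_add[OF F[OF s] F[OF t] c p(1) V(2)])
  qed
  show "\<tau> (dolbeault E c v (\<lambda>q. bscale E (f q) (s q)) p) = delbar c v f p *s \<tau> (s p) + f p *s \<tau> (dolbeault E c v s p)"
    if f: "smooth_fun A W f" and st: "smooth_section A E W (\<lambda>q. bscale E (f q) (s q))"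
  proof -
    have "delbar c v (\<lambda>q. \<tau> (bscale E (f q) (s q)) $ j) p = delbar c v (\<lambda>q. f q * \<tau> (s q) $ j) p" for j
      by (rule del_cong(2)[OF V(1) c p(1) V(2)])
        (use triv_scale(2)[OF w(1) _ smooth_sectionD(2)[OF s]] V(3,4) in force)
    then show ?thesis by (simp add: vec_eq_iff d[OF s] d[OF st] 
          del_mult[OF smooth_fun_subset[OF f V(3)] F[OF s] c p(1) V(2)])
  qed
  show "\<tau> (dolbeault E c v t p) = \<tau> (dolbeault E c v s p)" if eq: "\<And>q. q \<in> W \<Longrightarrow> t q = s q"
  proof -
    have t: "smooth_section A E W t" by (rule smooth_section_cong[OF s eq])
    have "delbar c v (\<lambda>q. \<tau> (t q) $ j) p = delbar c v (\<lambda>q. \<tau> (s q) $ j) p" for j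
      by (rule del_cong(2)[OF V(1) c p(1) V(2)]) (use eq V(3) in auto)
    then show ?thesis by (simp add: vec_eq_iff d[OF s] d[OF t])
  qed
  show "\<tau> (dolbeault E c' (dir_deriv c v (snd c') p) s p) = \<tau> (dolbeault E c v s p)" if c': "c' \<in> A" "p \<in> fst c'"
    by (simp add: vec_eq_iff d[OF s] dolbeault_triv(2)[OF s c'(1,2) p(2) w] del_change_chart[OF F[OF s] c c'(1) p(1) c'(2) V(2,1)])
qed

end

locale pseudo_hermitian_bundle = hol_vbundle A E
  for A :: "('m::topological_space, 'n::finite) chart set" and E :: "('e, 'm, 'r::finite) vbundle" +
  fixes h :: "'e \<Rightarrow> 'e \<Rightarrow> complex"
  assumes herm: "hermitian_form A E h"
    and nondegenerate: "(\<forall>f. bproj E f = bproj E e \<longrightarrow> h e f = 0) \<Longrightarrow> e = bzero E (bproj E e)"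
begin

lemma h_sym: "e \<in> fibre E p \<Longrightarrow> f \<in> fibre E p \<Longrightarrow> h f e = cnj (h e f)"
  using herm unfolding hermitian_form_def by blast

lemma h_add: "e \<in> fibre E p \<Longrightarrow> e' \<in> fibre E p \<Longrightarrow> f \<in> fibre E p \<Longrightarrow> h (badd E e e') f = h e f + h e' f"
  using herm unfolding hermitian_form_def by blast

lemma h_scale: "e \<in> fibre E p \<Longrightarrow> f \<in> fibre E p \<Longrightarrow> h (bscale E a e) f = a * h e f"
  using herm unfolding hermitian_form_def by blast

lemma h_add_right: "e \<in> fibre E p \<Longrightarrow> e' \<in> fibre E p \<Longrightarrow> f \<in> fibre E p \<Longrightarrow> h f (badd E e e') = h f e + h f e'"
  using h_sym[of "badd E e e'" p f] h_add[of e p e' f] h_sym[of e p f] h_sym[of e' p f] badd_fibre[of e p e'] by simp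

lemma h_scale_right: "e \<in> fibre E p \<Longrightarrow> f \<in> fibre E p \<Longrightarrow> h f (bscale E a e) = cnj a * h f e"
  using h_sym[of "bscale E a e" p f] h_scale[of e p f a] h_sym[of e p f] bscale_fibre[of e p a] by simp

lemma h_smooth: "smooth_section A E W s \<Longrightarrow> smooth_section A E W t \<Longrightarrow> smooth_fun A W (\<lambda>p. h (s p) (t p))"
  using herm unfolding hermitian_form_def by blast

lemma h_expand:
  assumes "(W, \<tau>) \<in> btriv E" "p \<in> W" "e \<in> fibre E p" "f \<in> fibre E p"
  shows "h e f = (\<Sum>k\<in>UNIV. \<tau> e $ k * h (of_triv E \<tau> (axis k 1) p) f)"
proof -
  have "h (of_triv E \<tau> (\<tau> e) p) f = (\<Sum>k\<in>UNIV. \<tau> e $ k * h (of_triv E \<tau> (axis k 1) p) f)"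
    by (rule clinear_expand_scalar[of "\<lambda>v. h (of_triv E \<tau> v p) f"])
     (use assms(4) in \<open>simp_all add: of_triv_add[OF assms(1,2)] of_triv_scale[OF assms(1,2)] h_add[of _ p] h_scale[of _ p] of_triv[OF assms(1,2)]\<close>)
  then show ?thesis by (simp add: of_triv_triv[OF assms(1,2,3)])
qed

lemma h_expand_right:
  assumes "(W, \<tau>) \<in> btriv E" "p \<in> W" "e \<in> fibre E p" "f \<in> fibre E p"
  shows "h e f = (\<Sum>k\<in>UNIV. cnj (\<tau> f $ k) * h e (of_triv E \<tau> (axis k 1) p))"
proof -
  have "h e f = cnj (h f e)" using h_sym assms(3,4) by blast
  also have "\<dots> = (\<Sum>k\<in>UNIV. cnj (\<tau> f $ k) * cnj (h (of_triv E \<tau> (axis k 1) p) e))"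
    by (subst h_expand[OF assms(1,2,4,3)]) (simp add: cnj_sum)
  also have "\<dots> = (\<Sum>k\<in>UNIV. cnj (\<tau> f $ k) * h e (of_triv E \<tau> (axis k 1) p))"
    using h_sym[OF of_triv(1)[OF assms(1,2)] assms(3)] by simp
  finally show ?thesis .
qed

lemma h_eqI:
  assumes w: "(W, \<tau>) \<in> btriv E" "p \<in> W" and e: "e \<in> fibre E p" "e' \<in> fibre E p"
    and eq: "\<And>j. h e (of_triv E \<tau> (axis j 1) p) = h e' (of_triv E \<tau> (axis j 1) p)"
  shows "e = e'"
proof -
  define d where "d = badd E e (bscale E (-1) e')"
  have d: "d \<in> fibre E p" using e unfolding d_def by blast
  have "h d f = 0" if f: "f \<in> fibre E p" for f
  proof -
    have "h d f = h e f - h e' f" using e f by (simp add: d_def h_add[of _ p] h_scale[of _ p] bscale_fibre)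
    also have "\<dots> = 0" unfolding h_expand_right[OF w e(1) f] h_expand_right[OF w e(2) f] by (simp add: eq)
    finally show ?thesis .
  qed
  then have "d = bzero E p" using nondegenerate[of d] d by (auto simp: fibre_def)
  then have "\<tau> d = 0" using triv_bzero[OF w] by simp
  then have "\<tau> e = \<tau> e'" using e by (simp add: d_def triv_add[OF w] triv_scale[OF w] bscale_fibre)
  then show ?thesis using triv_inj[OF w e] by blast
qed

definition gram :: "('e \<Rightarrow> complex^'r) \<Rightarrow> 'm \<Rightarrow> complex^'r^'r" where
  "gram \<tau> p = (\<chi> i j. h (of_triv E \<tau> (axis j 1) p) (of_triv E \<tau> (axis i 1) p))"

lemma gram_mult:
  assumes "(W, \<tau>) \<in> btriv E" "p \<in> W" "e \<in> fibre E p"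
  shows "(gram \<tau> p *v \<tau> e) $ i = h e (of_triv E \<tau> (axis i 1) p)"
  by (subst h_expand[OF assms of_triv(1)[OF assms(1,2)]]) (simp add: matrix_vector_mult_def gram_def mult.commute)

lemma det_gram:
  assumes w: "(W, \<tau>) \<in> btriv E" "p \<in> W"
  shows "det (gram \<tau> p) \<noteq> 0"
proof -
  have "x = 0" if x: "gram \<tau> p *v x = 0" for x
  proof -
    have "of_triv E \<tau> x p = of_triv E \<tau> 0 p"
    proof (rule h_eqI[OF w of_triv(1)[OF w] of_triv(1)[OF w]])
      fix j
      have "h (of_triv E \<tau> x p) (of_triv E \<tau> (axis j 1) p) = 0"
        using gram_mult[OF w of_triv(1)[OF w], of x j] x by (simp add: of_triv[OF w])
      moreover have "h (of_triv E \<tau> 0 p) (of_triv E \<tau> (axis j 1) p) = 0"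
        using gram_mult[OF w of_triv(1)[OF w], of 0 j] by (simp add: of_triv[OF w])
      ultimately show "h (of_triv E \<tau> x p) (of_triv E \<tau> (axis j 1) p) = h (of_triv E \<tau> 0 p) (of_triv E \<tau> (axis j 1) p)"
        by simp
    qed
    then have "\<tau> (of_triv E \<tau> x p) = \<tau> (of_triv E \<tau> 0 p)" by simp
    then show ?thesis by (simp add: of_triv[OF w])
  qed
  then show ?thesis
    unfolding invertible_det_nz[symmetric] invertible_left_inverse matrix_left_invertible_ker by blast
qed

lemma smooth_gram:
  assumes w: "(W, \<tau>) \<in> btriv E"
  shows "smooth_fun A W (\<lambda>p. gram \<tau> p $ i $ j)"
  unfolding gram_def vec_lambda_beta by (rule h_smooth[OF smooth_section_frame[OF w] smooth_section_frame[OF w]])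

text \<open>
  The only candidate for the \<open>(1,0)\<close>-part: compatibility prescribes the pairing of it with every local section, and non-degeneracy of the form lets one solve for it by inverting the Gram matrix of a frame.
\<close>

definition chern_del :: "('m, 'n) chart \<Rightarrow> complex^'n \<Rightarrow> ('m \<Rightarrow> 'e) \<Rightarrow> 'm \<Rightarrow> 'e" where
  "chern_del c v s p = (THE e. e \<in> fibre E p \<and>
     (\<forall>(W, \<tau>)\<in>btriv E. p \<in> W \<longrightarrow> 
       (\<forall>j. h e (of_triv E \<tau> (axis j 1) p) = del c v (\<lambda>q. h (s q) (of_triv E \<tau> (axis j 1) q)) p)))"

lemma del_h_frame:
  assumes w: "(W0, \<tau>) \<in> btriv E" and s: "smooth_section A E W s" and t: "smooth_section A E W t"
    and c: "c \<in> A" and p: "p \<in> fst c" "p \<in> W" "p \<in> W0"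
  shows "del c v (\<lambda>q. h (s q) (t q)) p = (\<Sum>k\<in>UNIV. cnj (\<tau> (t p) $ k) * del c v (\<lambda>q. h (s q) (of_triv E \<tau> (axis k 1) q)) p)
     + (\<Sum>k\<in>UNIV. cnj (delbar c v (\<lambda>q. \<tau> (t q) $ k) p) * h (s p) (of_triv E \<tau> (axis k 1) p))"
proof -
  define V where "V = W \<inter> W0"
  have V: "open V" "p \<in> V" "V \<subseteq> W" "V \<subseteq> W0" using smooth_sectionD(1)[OF s] triv_open[OF w(1)] p by (auto simp: V_def)
  have F: "smooth_fun A V (\<lambda>q. \<tau> (t q) $ k)" for k
    by (rule smooth_fun_vec_nth[OF smooth_fun_subset[OF smooth_sectionD(3)[OF t w(1)]] V(1)]) (auto simp: V_def)
  have F': "smooth_fun A V (\<lambda>q. cnj (\<tau> (t q) $ k))" for k by (rule smooth_fun_cnj[OF F V(1)])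
  have H: "smooth_fun A V (\<lambda>q. h (s q) (of_triv E \<tau> (axis k 1) q))" for k
    by (rule h_smooth[OF smooth_section_subset[OF s V(1,3)] smooth_section_subset[OF smooth_section_frame[OF w] V(1,4)]])
  have "del c v (\<lambda>q. h (s q) (t q)) p = del c v (\<lambda>q. \<Sum>k\<in>UNIV. cnj (\<tau> (t q) $ k) * h (s q) (of_triv E \<tau> (axis k 1) q)) p"
  proof (rule del_cong(1)[OF V(1) c p(1) V(2)])
    fix q assume q: "q \<in> V"
    then have "q \<in> W0" "s q \<in> fibre E q" "t q \<in> fibre E q" using smooth_sectionD(2)[OF s] smooth_sectionD(2)[OF t] by (auto simp: V_def)
    from h_expand_right[OF w this]
    show "h (s q) (t q) = (\<Sum>k\<in>UNIV. cnj (\<tau> (t q) $ k) * h (s q) (of_triv E \<tau> (axis k 1) q))" .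
  qed
  also have "\<dots> = (\<Sum>k\<in>UNIV. del c v (\<lambda>q. cnj (\<tau> (t q) $ k) * h (s q) (of_triv E \<tau> (axis k 1) q)) p)"
    by (rule del_sum(1)[OF _ c p(1) V(2,1)]) (intro smooth_fun_mult F' H V(1))
  finally show ?thesis by (simp add: del_mult(1)[OF F' H c p(1) V(2)] del_cnj(1)[OF F c p(1) V(2)] sum.distrib)
qed

lemma chern_del_char:
  assumes s: "smooth_section A E W s" and c: "c \<in> A" and p: "p \<in> fst c" "p \<in> W"
  shows "chern_del c v s p \<in> fibre E p"
   "\<And>W0 \<tau>. (W0, \<tau>) \<in> btriv E \<Longrightarrow> p \<in> W0 \<Longrightarrow> 
      h (chern_del c v s p) (of_triv E \<tau> (axis j 1) p) = del c v (\<lambda>q. h (s q) (of_triv E \<tau> (axis j 1) q)) p"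
   "\<And>W0 \<tau>. (W0, \<tau>) \<in> btriv E \<Longrightarrow> p \<in> W0 \<Longrightarrow> 
      \<tau> (chern_del c v s p) = (\<chi> k. det (\<chi> i j. if j = k then del c v (\<lambda>q. h (s q) (of_triv E \<tau> (axis i 1) q)) p else gram \<tau> p $ i $ j) / det (gram \<tau> p))"
proof -
  obtain W0 \<tau> where w: "(W0, \<tau>) \<in> btriv E" "p \<in> W0" using triv_cover by blast
  define b where "b \<tau> = (\<chi> i. del c v (\<lambda>q. h (s q) (of_triv E \<tau> (axis i 1) q)) p)" for \<tau> :: "'e \<Rightarrow> complex^'r"
  define x where "x = (\<chi> k. det (\<chi> i j. if j = k then b \<tau> $ i else gram \<tau> p $ i $ j) / det (gram \<tau> p))"
  have x: "gram \<tau> p *v x = b \<tau>" using cramer[OF det_gram[OF w]] x_def by blast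
  define e where "e = of_triv E \<tau> x p"
  have e: "e \<in> fibre E p" "\<tau> e = x" using of_triv[OF w] by (auto simp: e_def)
  have hw: "h e (of_triv E \<tau> (axis j 1) p) = del c v (\<lambda>q. h (s q) (of_triv E \<tau> (axis j 1) q)) p" for j
    using gram_mult[OF w e(1), of j] x by (simp add: e(2) b_def)
  have hw': "h e (of_triv E \<tau>' (axis j 1) p) = del c v (\<lambda>q. h (s q) (of_triv E \<tau>' (axis j 1) q)) p"
    if w': "(W', \<tau>') \<in> btriv E" "p \<in> W'" for W' \<tau>' j
  proof -
    have op: "open (W \<inter> W')" using smooth_sectionD(1)[OF s] triv_open[OF w'(1)] by auto
    have pV: "p \<in> W \<inter> W'" using p w' by auto
    have "del c v (\<lambda>q. h (s q) (of_triv E \<tau>' (axis j 1) q)) p = 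
      (\<Sum>k\<in>UNIV. cnj (\<tau> (of_triv E \<tau>' (axis j 1) p) $ k) * del c v (\<lambda>q. h (s q) (of_triv E \<tau> (axis k 1) q)) p)"
      using del_h_frame[OF w(1) smooth_section_subset[OF s op] smooth_section_subset[OF smooth_section_frame[OF w'(1)] op] c p(1) pV w(2), of v "axis j 1"]
      by (simp add: delbar_transition[OF w'(1) w(1) c p(1) w'(2) w(2)])
    also have "\<dots> = h e (of_triv E \<tau>' (axis j 1) p)"
      unfolding h_expand_right[OF w e(1) of_triv(1)[OF w']] hw ..
    finally show ?thesis by simp
  qed
  have ce: "chern_del c v s p = e"
    unfolding chern_del_def
  proof (rule the_equality)
    show "e \<in> fibre E p \<and> (\<forall>(W, \<tau>)\<in>btriv E. p \<in> W \<longrightarrow> 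
       (\<forall>j. h e (of_triv E \<tau> (axis j 1) p) = del c v (\<lambda>q. h (s q) (of_triv E \<tau> (axis j 1) q)) p))"
      using e(1) hw' by auto
    fix e' assume "e' \<in> fibre E p \<and> (\<forall>(W, \<tau>)\<in>btriv E. p \<in> W \<longrightarrow> 
       (\<forall>j. h e' (of_triv E \<tau> (axis j 1) p) = del c v (\<lambda>q. h (s q) (of_triv E \<tau> (axis j 1) q)) p))"
    then have e': "e' \<in> fibre E p" "\<And>j. h e' (of_triv E \<tau> (axis j 1) p) = del c v (\<lambda>q. h (s q) (of_triv E \<tau> (axis j 1) q)) p"
      using w by auto
    show "e' = e" by (rule h_eqI[OF w e'(1) e(1)]) (use e'(2) hw in simp)
  qed
  show "chern_del c v s p \<in> fibre E p" using ce e by simp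
  show c2: "h (chern_del c v s p) (of_triv E \<tau> (axis j 1) p) = del c v (\<lambda>q. h (s q) (of_triv E \<tau> (axis j 1) q)) p"
    if "(W0, \<tau>) \<in> btriv E" "p \<in> W0" for W0 \<tau> j using hw'[OF that] ce by simp
  show "\<tau> (chern_del c v s p) = (\<chi> k. det (\<chi> i j. if j = k then del c v (\<lambda>q. h (s q) (of_triv E \<tau> (axis i 1) q)) p else gram \<tau> p $ i $ j) / det (gram \<tau> p))"
    if w': "(W0, \<tau>) \<in> btriv E" "p \<in> W0" for W0 \<tau>
  proof -
    have "gram \<tau> p *v \<tau> (chern_del c v s p) = b \<tau>"
      using gram_mult[OF w', of "chern_del c v s p"] c2[OF w'] e(1) ce by (simp add: vec_eq_iff b_def)
    then show ?thesis unfolding cramer[OF det_gram[OF w']] b_def vec_lambda_beta .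
  qed
qed

lemma h_chern_del:
  assumes s: "smooth_section A E W s" and t: "smooth_section A E W t" and c: "c \<in> A" and p: "p \<in> fst c" "p \<in> W"
  shows "del c v (\<lambda>q. h (s q) (t q)) p = h (chern_del c v s p) (t p) + h (s p) (dolbeault E c v t p)"
proof -
  obtain W0 \<tau> where w: "(W0, \<tau>) \<in> btriv E" "p \<in> W0" using triv_cover by blast
  show ?thesis
    unfolding del_h_frame[OF w(1) s t c p w(2)] 
      h_expand_right[OF w chern_del_char(1)[OF s c p] smooth_sectionD(2)[OF t p(2)]]
      h_expand_right[OF w smooth_sectionD(2)[OF s p(2)] dolbeault_triv(1)[OF t c p]]
    by (simp add: chern_del_char(2)[OF s c p w] dolbeault_triv(2)[OF t c p w])
qed

definition chern_conn :: "('m, 'n) chart \<Rightarrow> complex^'n \<Rightarrow> ('m \<Rightarrow> 'e) \<Rightarrow> 'm \<Rightarrow> 'e" where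
  "chern_conn c v s p = badd E (dolbeault E c v s p) (chern_del c v s p)"

lemma smooth_chern_conn:
  assumes s: "smooth_section A E W s" and c: "c \<in> A"
  shows "smooth_section A E (fst c \<inter> W) (chern_conn c v s)"
proof (rule smooth_section_Union)
  show op: "open (fst c \<inter> W)" using chart_open[OF c] smooth_sectionD(1)[OF s] by auto
  fix p assume p: "p \<in> fst c \<inter> W"
  obtain W0 \<tau> where w: "(W0, \<tau>) \<in> btriv E" "p \<in> W0" using triv_cover by blast
  define V where "V = W \<inter> W0"
  have V: "open V" "p \<in> V" "V \<subseteq> W" "V \<subseteq> W0" using smooth_sectionD(1)[OF s] triv_open[OF w(1)] p w by (auto simp: V_def)
  let ?N = "fst c \<inter> V"
  have opN: "open ?N" using V(1) chart_open[OF c] by auto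
  have F: "smooth_fun A V (\<lambda>q. \<tau> (s q) $ k)" for k
    by (rule smooth_fun_vec_nth[OF smooth_fun_subset[OF smooth_sectionD(3)[OF s w(1)]] V(1)]) (auto simp: V_def)
  have H: "smooth_fun A V (\<lambda>q. h (s q) (of_triv E \<tau> (axis k 1) q))" for k
    by (rule h_smooth[OF smooth_section_subset[OF s V(1,3)] smooth_section_subset[OF smooth_section_frame[OF w(1)] V(1,4)]])
  have dH: "smooth_fun A ?N (del c v (\<lambda>q. h (s q) (of_triv E \<tau> (axis k 1) q)))" for k
    by (rule smooth_fun_del(1)[OF H c V(1)])
  have G: "smooth_fun A ?N (\<lambda>q. gram \<tau> q $ i $ j)" for i j
    by (rule smooth_fun_subset[OF smooth_gram[OF w(1)]]) (use V(4) in auto)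
  have comp: "\<tau> (chern_conn c v s q) $ k = delbar c v (\<lambda>q. \<tau> (s q) $ k) q + 
     det (\<chi> i j. if j = k then del c v (\<lambda>q. h (s q) (of_triv E \<tau> (axis i 1) q)) q else gram \<tau> q $ i $ j) / det (gram \<tau> q)"
    if q: "q \<in> ?N" for q k
  proof -
    have q': "q \<in> fst c" "q \<in> W" "q \<in> W0" using q V by auto
    show ?thesis
      by (simp add: chern_conn_def triv_add(2)[OF w(1) q'(3) dolbeault_triv(1)[OF s c q'(1,2)] chern_del_char(1)[OF s c q'(1,2)]]
        dolbeault_triv(2)[OF s c q'(1,2) w(1) q'(3)] chern_del_char(3)[OF s c q'(1,2) w(1) q'(3)])
  qed
  have "smooth_section A E ?N (chern_conn c v s)"
  proof (rule smooth_sectionI[OF w(1) opN])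
    show "smooth_fun A ?N (\<lambda>p. \<tau> (chern_conn c v s p))"
      unfolding smooth_fun_vec_iff[OF opN]
    proof
      fix k
      have "smooth_fun A ?N (\<lambda>q. delbar c v (\<lambda>q. \<tau> (s q) $ k) q + 
        det (\<chi> i j. if j = k then del c v (\<lambda>q. h (s q) (of_triv E \<tau> (axis i 1) q)) q else gram \<tau> q $ i $ j) / det (gram \<tau> q))"
      proof (intro smooth_fun_add smooth_fun_divide smooth_fun_det opN smooth_fun_del(2)[OF F c V(1)])
        fix i j show "smooth_fun A ?N (\<lambda>p. (\<chi> i j. if j = k then del c v (\<lambda>q. h (s q) (of_triv E \<tau> (axis i 1) q)) p else gram \<tau> p $ i $ j) $ i $ j)"
          using dH G by (cases "j = k") auto
        show "smooth_fun A ?N (\<lambda>p. gram \<tau> p $ i $ j)" by (rule G)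
      next
        fix q assume "q \<in> ?N" then show "det (gram \<tau> q) \<noteq> 0" using det_gram[OF w(1)] V(4) by auto
      qed
      then show "smooth_fun A ?N (\<lambda>q. \<tau> (chern_conn c v s q) $ k)"
        by (rule smooth_fun_cong[OF opN, THEN iffD1, rotated]) (simp add: comp)
    qed
    fix q assume "q \<in> ?N"
    then have q': "q \<in> fst c" "q \<in> W" "q \<in> W0" using V by auto
    show "chern_conn c v s q \<in> fibre E q" unfolding chern_conn_def
      by (rule badd_fibre[OF dolbeault_triv(1)[OF s c q'(1,2)] chern_del_char(1)[OF s c q'(1,2)]])
  qed (use V in auto)
  then have "smooth_section A E (fst c \<inter> W \<inter> W0) (chern_conn c v s)" by (simp add: V_def Int_assoc)
  then show "\<exists>N. open N \<and> p \<in> N \<and> smooth_section A E (fst c \<inter> W \<inter> N) (chern_conn c v s)"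
    using w triv_open[OF w(1)] by blast
qed

lemma chern_conn_triv:
  assumes s: "smooth_section A E W s" and c: "c \<in> A" and p: "p \<in> fst c" "p \<in> W" and w: "(W0, \<tau>) \<in> btriv E" "p \<in> W0"
  shows "chern_conn c v s p \<in> fibre E p"
   "\<tau> (chern_conn c v s p) = \<tau> (dolbeault E c v s p) + \<tau> (chern_del c v s p)"
  unfolding chern_conn_def using dolbeault_triv(1)[OF s c p] chern_del_char(1)[OF s c p]
  by (auto simp: triv_add(2)[OF w])

lemma chern_del_rules:
  assumes s: "smooth_section A E W s" and c: "c \<in> A" and p: "p \<in> fst c" "p \<in> W" and w: "(W0, \<tau>) \<in> btriv E" "p \<in> W0"
  shows "\<tau> (chern_del c (u + v) s p) = \<tau> (chern_del c u s p) + \<tau> (chern_del c v s p)"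
    "\<tau> (chern_del c (a *s v) s p) = a *s \<tau> (chern_del c v s p)"
    "smooth_section A E W t \<Longrightarrow> smooth_section A E W (\<lambda>q. badd E (s q) (t q)) \<Longrightarrow> 
       \<tau> (chern_del c v (\<lambda>q. badd E (s q) (t q)) p) = \<tau> (chern_del c v s p) + \<tau> (chern_del c v t p)"
    "smooth_fun A W f \<Longrightarrow> smooth_section A E W (\<lambda>q. bscale E (f q) (s q)) \<Longrightarrow> 
       \<tau> (chern_del c v (\<lambda>q. bscale E (f q) (s q)) p) = del c v f p *s \<tau> (s p) + f p *s \<tau> (chern_del c v s p)"
    "(\<And>q. q \<in> W \<Longrightarrow> t q = s q) \<Longrightarrow> \<tau> (chern_del c v t p) = \<tau> (chern_del c v s p)"
    "c' \<in> A \<Longrightarrow> p \<in> fst c' \<Longrightarrow> \<tau> (chern_del c' (dir_deriv c v (snd c') p) s p) = \<tau> (chern_del c v s p)"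
proof -
  define V where "V = W \<inter> W0"
  have V: "open V" "p \<in> V" "V \<subseteq> W" "V \<subseteq> W0" using smooth_sectionD(1)[OF s] triv_open[OF w(1)] p w by (auto simp: V_def)
  have H: "smooth_fun A V (\<lambda>q. h (s q) (of_triv E \<tau> (axis k 1) q))" if s: "smooth_section A E W s" for k s
    by (rule h_smooth[OF smooth_section_subset[OF s V(1,3)] smooth_section_subset[OF smooth_section_frame[OF w(1)] V(1,4)]])
  note d = chern_del_char(2)[OF _ c p w]
  note f = chern_del_char(1)[OF _ c p]
  note fr = of_triv(1)[OF w]
  show "\<tau> (chern_del c (u + v) s p) = \<tau> (chern_del c u s p) + \<tau> (chern_del c v s p)"
    unfolding triv_add(2)[OF w f[OF s] f[OF s], symmetric]
    by (rule arg_cong[of _ _ \<tau>], rule h_eqI[OF w f[OF s] badd_fibre[OF f[OF s] f[OF s]]])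
      (simp add: d[OF s] h_add[OF f[OF s] f[OF s] fr] del_vadd[OF H[OF s] c p(1) V(2)])
  show "\<tau> (chern_del c (a *s v) s p) = a *s \<tau> (chern_del c v s p)"
    unfolding triv_scale(2)[OF w f[OF s], symmetric]
    by (rule arg_cong[of _ _ \<tau>], rule h_eqI[OF w f[OF s] bscale_fibre[OF f[OF s]]])
      (simp add: d[OF s] h_scale[OF f[OF s] fr] del_smult[OF H[OF s] c p(1) V(2)])
  show "\<tau> (chern_del c v (\<lambda>q. badd E (s q) (t q)) p) = \<tau> (chern_del c v s p) + \<tau> (chern_del c v t p)"
    if t: "smooth_section A E W t" and st: "smooth_section A E W (\<lambda>q. badd E (s q) (t q))"
  proof -
    have *: "del c v (\<lambda>q. h (badd E (s q) (t q)) (of_triv E \<tau> (axis k 1) q)) p = 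
      del c v (\<lambda>q. h (s q) (of_triv E \<tau> (axis k 1) q) + h (t q) (of_triv E \<tau> (axis k 1) q)) p" for k
    proof (rule del_cong(1)[OF V(1) c p(1) V(2)])
      fix q assume "q \<in> V"
      then have "q \<in> W" "q \<in> W0" using V by auto
      then show "h (badd E (s q) (t q)) (of_triv E \<tau> (axis k 1) q) = h (s q) (of_triv E \<tau> (axis k 1) q) + h (t q) (of_triv E \<tau> (axis k 1) q)"
        using h_add[OF smooth_sectionD(2)[OF s] smooth_sectionD(2)[OF t] of_triv(1)[OF w(1)]] by blast
    qed
    show ?thesis
      unfolding triv_add(2)[OF w f[OF s] f[OF t], symmetric]
      by (rule arg_cong[of _ _ \<tau>], rule h_eqI[OF w f[OF st] badd_fibre[OF f[OF s] f[OF t]]])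
        (simp add: d[OF s] d[OF t] d[OF st] * h_add[OF f[OF s] f[OF t] fr] del_add[OF H[OF s] H[OF t] c p(1) V(2)])
  qed
  show "\<tau> (chern_del c v (\<lambda>q. bscale E (g q) (s q)) p) = del c v g p *s \<tau> (s p) + g p *s \<tau> (chern_del c v s p)"
    if g: "smooth_fun A W g" and st: "smooth_section A E W (\<lambda>q. bscale E (g q) (s q))" for g
  proof -
    have *: "del c v (\<lambda>q. h (bscale E (g q) (s q)) (of_triv E \<tau> (axis k 1) q)) p = 
      del c v (\<lambda>q. g q * h (s q) (of_triv E \<tau> (axis k 1) q)) p" for k
    proof (rule del_cong(1)[OF V(1) c p(1) V(2)])
      fix q assume "q \<in> V"
      then have "q \<in> W" "q \<in> W0" using V by auto
      then show "h (bscale E (g q) (s q)) (of_triv E \<tau> (axis k 1) q) = g q * h (s q) (of_triv E \<tau> (axis k 1) q)"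
        using h_scale[OF smooth_sectionD(2)[OF s] of_triv(1)[OF w(1)]] by blast
    qed
    note sp = smooth_sectionD(2)[OF s p(2)]
    show ?thesis
      unfolding triv_scale(2)[OF w f[OF s], symmetric] triv_scale(2)[OF w sp, symmetric] 
        triv_add(2)[OF w bscale_fibre[OF sp] bscale_fibre[OF f[OF s]], symmetric]
      by (rule arg_cong[of _ _ \<tau>], rule h_eqI[OF w f[OF st] badd_fibre[OF bscale_fibre[OF sp] bscale_fibre[OF f[OF s]]]])
        (simp add: d[OF s] d[OF st] * h_add[OF bscale_fibre[OF sp] bscale_fibre[OF f[OF s]] fr] h_scale[OF f[OF s] fr] 
          h_scale[OF sp fr] del_mult[OF smooth_fun_subset[OF g V(3)] H[OF s] c p(1) V(2)])
  qed
  show "\<tau> (chern_del c v t p) = \<tau> (chern_del c v s p)" if eq: "\<And>q. q \<in> W \<Longrightarrow> t q = s q"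
  proof -
    have t: "smooth_section A E W t" by (rule smooth_section_cong[OF s eq])
    have *: "del c v (\<lambda>q. h (t q) (of_triv E \<tau> (axis j 1) q)) p = del c v (\<lambda>q. h (s q) (of_triv E \<tau> (axis j 1) q)) p" for j
      by (rule del_cong(1)[OF V(1) c p(1) V(2)]) (use eq V(3) in auto)
    show ?thesis by (rule arg_cong[of _ _ \<tau>], rule h_eqI[OF w f[OF t] f[OF s]]) (simp add: d[OF s] d[OF t] *)
  qed
  show "\<tau> (chern_del c' (dir_deriv c v (snd c') p) s p) = \<tau> (chern_del c v s p)" if c': "c' \<in> A" "p \<in> fst c'"
    by (rule arg_cong[of _ _ \<tau>], rule h_eqI[OF w chern_del_char(1)[OF s c' p(2)] f[OF s]])
     (simp add: d[OF s] chern_del_char(2)[OF s c' p(2) w] del_change_chart[OF H[OF s] c c'(1) p(1) c'(2) V(2,1)])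
qed

lemma connection_chern_conn: "connection A E chern_conn"
  unfolding connection_def
proof (intro ballI allI impI)
  fix c W s assume c: "c \<in> A" and s: "smooth_section A E W s"
  have "(\<forall>u v. chern_conn c (u + v) s p = badd E (chern_conn c u s p) (chern_conn c v s p)) \<and>
           (\<forall>r v. chern_conn c (r *\<^sub>R v) s p = bscale E (of_real r) (chern_conn c v s p)) \<and>
           (\<forall>t v. smooth_section A E W t \<longrightarrow>
              chern_conn c v (\<lambda>q. badd E (s q) (t q)) p = badd E (chern_conn c v s p) (chern_conn c v t p)) \<and>
           (\<forall>f v. smooth_fun A W f \<longrightarrow>
              chern_conn c v (\<lambda>q. bscale E (f q) (s q)) p =
                badd E (bscale E (dir_deriv c v f p) (s p)) (bscale E (f p) (chern_conn c v s p))) \<and>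
           (\<forall>t v. (\<forall>q\<in>W. t q = s q) \<longrightarrow> chern_conn c v t p = chern_conn c v s p) \<and>
           (\<forall>c'\<in>A. \<forall>v. p \<in> fst c' \<longrightarrow> chern_conn c' (dir_deriv c v (snd c') p) s p = chern_conn c v s p)"
    if pp: "p \<in> fst c \<inter> W" for p
  proof -
    have p: "p \<in> fst c" "p \<in> W" using pp by auto
    obtain W0 \<tau> where w: "(W0, \<tau>) \<in> btriv E" "p \<in> W0" using triv_cover by blast
    note f = chern_conn_triv(1)[OF _ c p w] and d = chern_conn_triv(2)[OF _ c p w]
    note R = dolbeault_rules[OF s c p w] chern_del_rules[OF s c p w]
    note sp = smooth_sectionD(2)[OF s p(2)]
    show ?thesis
    proof (intro conjI allI ballI impI)
      fix u v
      show "chern_conn c (u + v) s p = badd E (chern_conn c u s p) (chern_conn c v s p)"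
        by (rule triv_inj[OF w f[OF s] badd_fibre[OF f[OF s] f[OF s]]])
          (simp add: triv_add(2)[OF w f[OF s] f[OF s]] d[OF s] R(1,7))
    next
      fix r :: real and v
      show "chern_conn c (r *\<^sub>R v) s p = bscale E (of_real r) (chern_conn c v s p)"
        by (rule triv_inj[OF w f[OF s] bscale_fibre[OF f[OF s]]])
          (simp add: triv_scale(2)[OF w f[OF s]] d[OF s] R(2,8) vector_smult_real[symmetric] vector_add_ldistrib)
    next
      fix t v assume t: "smooth_section A E W t"
      note st = smooth_section_badd[OF s t]
      show "chern_conn c v (\<lambda>q. badd E (s q) (t q)) p = badd E (chern_conn c v s p) (chern_conn c v t p)"
        by (rule triv_inj[OF w f[OF st] badd_fibre[OF f[OF s] f[OF t]]])
          (simp add: triv_add(2)[OF w f[OF s] f[OF t]] d[OF s] d[OF t] d[OF st] R(3,9)[OF t st])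
    next
      fix g :: "'m \<Rightarrow> complex" and v assume g: "smooth_fun A W g"
      note st = smooth_section_bscale[OF s g]
      show "chern_conn c v (\<lambda>q. bscale E (g q) (s q)) p =
                badd E (bscale E (dir_deriv c v g p) (s p)) (bscale E (g p) (chern_conn c v s p))"
        by (rule triv_inj[OF w f[OF st] badd_fibre[OF bscale_fibre[OF sp] bscale_fibre[OF f[OF s]]]])
          (simp add: triv_add(2)[OF w bscale_fibre[OF sp] bscale_fibre[OF f[OF s]]] triv_scale(2)[OF w f[OF s]] 
            triv_scale(2)[OF w sp] d[OF s] d[OF st] R(4,10)[OF g st] del_plus_delbar[symmetric] vector_add_ldistrib 
            vector_sadd_rdistrib algebra_simps)
    next
      fix t v assume eq: "\<forall>q\<in>W. t q = s q"
      have t: "smooth_section A E W t" by (rule smooth_section_cong[OF s]) (use eq in auto)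
      show "chern_conn c v t p = chern_conn c v s p"
        by (rule triv_inj[OF w f[OF t] f[OF s]]) (use R(5,11)[of t v] eq in \<open>simp add: d[OF s] d[OF t]\<close>)
    next
      fix c' v assume c': "c' \<in> A" "p \<in> fst c'"
      show "chern_conn c' (dir_deriv c v (snd c') p) s p = chern_conn c v s p"
        by (rule triv_inj[OF w chern_conn_triv(1)[OF s c' p(2) w] f[OF s]]) 
          (simp add: d[OF s] chern_conn_triv(2)[OF s c' p(2) w] R(6,12)[OF c'])
    qed
  qed
  then show "(\<forall>v. smooth_section A E (fst c \<inter> W) (chern_conn c v s)) \<and> (\<forall>p\<in>fst c \<inter> W.
           (\<forall>u v. chern_conn c (u + v) s p = badd E (chern_conn c u s p) (chern_conn c v s p)) \<and>
           (\<forall>r v. chern_conn c (r *\<^sub>R v) s p = bscale E (of_real r) (chern_conn c v s p)) \<and>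
           (\<forall>t v. smooth_section A E W t \<longrightarrow>
              chern_conn c v (\<lambda>q. badd E (s q) (t q)) p = badd E (chern_conn c v s p) (chern_conn c v t p)) \<and>
           (\<forall>f v. smooth_fun A W f \<longrightarrow>
              chern_conn c v (\<lambda>q. bscale E (f q) (s q)) p =
                badd E (bscale E (dir_deriv c v f p) (s p)) (bscale E (f p) (chern_conn c v s p))) \<and>
           (\<forall>t v. (\<forall>q\<in>W. t q = s q) \<longrightarrow> chern_conn c v t p = chern_conn c v s p) \<and>
           (\<forall>c'\<in>A. \<forall>v. p \<in> fst c' \<longrightarrow> chern_conn c' (dir_deriv c v (snd c') p) s p = chern_conn c v s p))"
    using smooth_chern_conn[OF s c] by blast
qed

lemma compatible_chern_conn: "compatible A E h chern_conn"
  unfolding compatible_def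
proof (intro ballI allI impI)
  fix c W s t p v assume c: "c \<in> A" and s: "smooth_section A E W s" and t: "smooth_section A E W t" 
    and "p \<in> fst c \<inter> W"
  then have p: "p \<in> fst c" "p \<in> W" by auto
  note sp = smooth_sectionD(2)[OF s p(2)] and tp = smooth_sectionD(2)[OF t p(2)]
  note ds = dolbeault_triv(1)[OF s c p] chern_del_char(1)[OF s c p] 
  note dt = dolbeault_triv(1)[OF t c p] chern_del_char(1)[OF t c p] 
  have op: "open W" using smooth_sectionD(1)[OF s] .
  have 1: "del c v (\<lambda>q. h (s q) (t q)) p = h (chern_del c v s p) (t p) + h (s p) (dolbeault E c v t p)"
    by (rule h_chern_del[OF s t c p])
  have "delbar c v (\<lambda>q. h (s q) (t q)) p = delbar c v (\<lambda>q. cnj (h (t q) (s q))) p"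
    by (rule del_cong(2)[OF op c p]) (use h_sym[OF smooth_sectionD(2)[OF t] smooth_sectionD(2)[OF s]] in blast)
  also have "\<dots> = cnj (del c v (\<lambda>q. h (t q) (s q)) p)"
    by (rule del_cnj(2)[OF h_smooth[OF t s] c p])
  also have "\<dots> = h (s p) (chern_del c v t p) + h (dolbeault E c v s p) (t p)"
    unfolding h_chern_del[OF t s c p] by (simp add: h_sym[OF dt(2) sp] h_sym[OF tp ds(1)])
  finally show "dir_deriv c v (\<lambda>q. h (s q) (t q)) p = h (chern_conn c v s p) (t p) + h (s p) (chern_conn c v t p)"
    unfolding del_plus_delbar[symmetric] 1 chern_conn_def h_add[OF ds tp] h_add_right[OF dt sp] by simp
qed

lemma dolbeault_chern_conn: "has_dolbeault_part A E chern_conn"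
  unfolding has_dolbeault_part_def
proof (intro ballI allI impI)
  fix c W s p v assume c: "c \<in> A" and s: "smooth_section A E W s" and "p \<in> fst c \<inter> W"
  then have p: "p \<in> fst c" "p \<in> W" by auto
  obtain W0 \<tau> where w: "(W0, \<tau>) \<in> btriv E" "p \<in> W0" using triv_cover by blast
  note f = chern_conn_triv(1)[OF s c p w] and d = chern_conn_triv(2)[OF s c p w]
  show "bscale E (1/2) (badd E (chern_conn c v s p) (bscale E \<i> (chern_conn c (\<i> *s v) s p))) = dolbeault E c v s p"
    by (rule triv_inj[OF w bscale_fibre[OF badd_fibre[OF f bscale_fibre[OF f]]] dolbeault_triv(1)[OF s c p]])
     (simp add: triv_scale(2)[OF w badd_fibre[OF f bscale_fibre[OF f]]] triv_add(2)[OF w f bscale_fibre[OF f]]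
       triv_scale(2)[OF w f] d dolbeault_rules(2)[OF s c p w] chern_del_rules(2)[OF s c p w] vec_eq_iff algebra_simps)
qed

text \<open>
  The Chern connection is introduced by a choice operator; its existence is what gives access to the three defining properties.
\<close>

lemma chern_connection:
  shows "connection A E (chern_connection A E h)" "compatible A E h (chern_connection A E h)"
    "has_dolbeault_part A E (chern_connection A E h)"
proof -
  have "connection A E (chern_connection A E h) \<and> compatible A E h (chern_connection A E h) \<and>
    has_dolbeault_part A E (chern_connection A E h)"
    unfolding chern_connection_def
    by (rule someI[of "\<lambda>D. connection A E D \<and> compatible A E h D \<and> has_dolbeault_part A E D" chern_conn])
      (intro conjI connection_chern_conn compatible_chern_conn dolbeault_chern_conn)
  then show "connection A E (chern_connection A E h)" "compatible A E h (chern_connection A E h)"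
    "has_dolbeault_part A E (chern_connection A E h)" by auto
qed

lemma h_connection:
  assumes comp: "compatible A E h D" and dol: "has_dolbeault_part A E D" and con: "connection A E D"
    and s: "smooth_section A E W s" and t: "smooth_section A E W t" and c: "c \<in> A" and p: "p \<in> fst c" "p \<in> W"
  shows "h (D c v s p) (t p) = h (dolbeault E c v s p) (t p) + del c v (\<lambda>q. h (s q) (t q)) p - h (s p) (dolbeault E c v t p)"
proof -
  have pp: "p \<in> fst c \<inter> W" using p by simp
  note sp = smooth_sectionD(2)[OF s p(2)] and tp = smooth_sectionD(2)[OF t p(2)]
  have 1: "dir_deriv c v (\<lambda>q. h (s q) (t q)) p = h (D c v s p) (t p) + h (s p) (D c v t p)" for v
    using comp c s t pp unfolding compatible_def by blast
  have 2: "dolbeault E c v s p = bscale E (1/2) (badd E (D c v s p) (bscale E \<i> (D c (\<i> *s v) s p)))" 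
    if "smooth_section A E W s" for s
    using dol c that pp unfolding has_dolbeault_part_def by metis
  have f: "D c v s p \<in> fibre E p" if "smooth_section A E W s" for s v by (rule connection_fibre[OF con c that p])
  have fi: "bscale E \<i> (D c v s p) \<in> fibre E p" if "smooth_section A E W s" for s v using f[OF that] by blast
  have fa: "badd E (D c v s p) (bscale E \<i> (D c u s p)) \<in> fibre E p" if "smooth_section A E W s" for s u v 
    using f[OF that] by blast
  show ?thesis
    unfolding 2[OF s] 2[OF t] del_def 1 h_scale[OF fa[OF s] tp] h_add[OF f[OF s] fi[OF s] tp] h_scale[OF f[OF s] tp]
      h_scale_right[OF fa[OF t] sp] h_add_right[OF f[OF t] fi[OF t] sp] h_scale_right[OF f[OF t] sp]
    by (simp add: field_simps)
qed

end

section \<open>The product of a Riemann surface with the complex line\<close>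

lemma vec_nth_1 [simp]: "vec (v $ 1) = (v :: complex^1)"
  by (simp add: vec_eq_iff forall_1)

lemma vector_2_eta [simp]: "vector [v $ 1, v $ 2] = (v :: complex^2)"
  by (simp add: vec_eq_iff forall_2)

lemma vec2_eq_iff: "(u :: complex^2) = v \<longleftrightarrow> u $ 1 = v $ 1 \<and> u $ 2 = v $ 2"
  by (simp add: vec_eq_iff forall_2)

lemma bounded_linear_vec1: "bounded_linear (\<lambda>y::complex^2. vec (y $ 1) :: complex^1)"
  by (rule linear_conv_bounded_linear[THEN iffD1]) (auto simp: linear_iff vec_eq_iff)

lemma vector_2_sum: "(vector [a, b] :: complex^2) = vector [a, 0] + vector [0, b]"
  by (simp add: vec2_eq_iff)

lemma bounded_linear_axes: 
  "bounded_linear (\<lambda>a. vector [a, 0] :: complex^2)" "bounded_linear (\<lambda>a. vector [0, a] :: complex^2)"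
  by (rule linear_conv_bounded_linear[THEN iffD1], auto simp: linear_iff vec2_eq_iff)+

lemma has_derivative_vector_2:
  assumes "(f has_derivative f') F" "(g has_derivative g') F"
  shows "((\<lambda>x. vector [f x, g x] :: complex^2) has_derivative (\<lambda>h. vector [f' h, g' h])) F"
proof -
  have "((\<lambda>x. vector [f x, 0] + vector [0, g x] :: complex^2) has_derivative (\<lambda>h. vector [f' h, 0] + vector [0, g' h])) F"
    by (intro has_derivative_add bounded_linear.has_derivative[OF bounded_linear_axes(1)] 
      bounded_linear.has_derivative[OF bounded_linear_axes(2)] assms)
  then show ?thesis by (simp only: vector_2_sum[symmetric])
qed

lemma smooth_on_vector_2:
  fixes f :: "'a::euclidean_space \<Rightarrow> complex"
  assumes "smooth_on S f" "smooth_on S g" "open S"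
  shows "smooth_on S (\<lambda>x. vector [f x, g x] :: complex^2)"
  using assms by (simp add: smooth_on_vec_iff forall_2)

lemma continuous_on_vector_2:
  assumes "continuous_on S f" "continuous_on S g"
  shows "continuous_on S (\<lambda>x. vector [f x, g x] :: complex^2)"
proof -
  have "continuous_on S (\<lambda>x. vector [f x, 0] + vector [0, g x] :: complex^2)"
    by (intro continuous_on_add bounded_linear.continuous_on[OF bounded_linear_axes(1)] 
      bounded_linear.continuous_on[OF bounded_linear_axes(2)] assms)
  then show ?thesis by (simp only: vector_2_sum[symmetric])
qed

definition prod_chart :: "('x, 1) chart \<Rightarrow> ('x \<times> complex, 2) chart" where
  "prod_chart c = (fst c \<times> UNIV, \<lambda>(x, z). vector [snd c x $ 1, z])"

lemma times_line_atlas_eq: "times_line_atlas A = prod_chart ` A"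
  by (auto simp: times_line_atlas_def prod_chart_def case_prod_beta image_iff)

lemma fst_prod_chart [simp]: "fst (prod_chart c) = fst c \<times> UNIV"
  and snd_prod_chart: "snd (prod_chart c) = (\<lambda>(x, z). vector [snd c x $ 1, z])"
  by (simp_all add: prod_chart_def)

lemma prod_chart_image: "snd (prod_chart c) ` (V \<times> UNIV) = (\<lambda>y::complex^2. vec (y $ 1)) -` (snd c ` V)"
proof (intro equalityI subsetI)
  fix y :: "complex^2" assume "y \<in> (\<lambda>y. vec (y $ 1)) -` (snd c ` V)"
  then obtain x where x: "x \<in> V" "vec (y $ 1) = snd c x" by auto
  then have "snd c x $ 1 = y $ 1" by (metis vec_component)
  then have "y = snd (prod_chart c) (x, y $ 2)" by (simp add: snd_prod_chart)
  then show "y \<in> snd (prod_chart c) ` (V \<times> UNIV)" using x by blast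
qed (auto simp: snd_prod_chart)

locale riemann_surface = smooth_atlas A for A :: "('x::topological_space, 1) chart set"
begin

lemma inv_prod_chart:
  fixes y :: "complex^2"
  assumes c: "c \<in> A" and y: "vec (y $ 1) \<in> snd c ` fst c"
  shows "inv_into (fst (prod_chart c)) (snd (prod_chart c)) y = (inv_into (fst c) (snd c) (vec (y $ 1)), y $ 2)"
proof (rule inv_into_f_eq)
  show "inj_on (snd (prod_chart c)) (fst (prod_chart c))"
  proof (rule inj_onI)
    fix p q assume pq: "p \<in> fst (prod_chart c)" "q \<in> fst (prod_chart c)" "snd (prod_chart c) p = snd (prod_chart c) q"
    then have "snd c (fst p) $ 1 = snd c (fst q) $ 1" "snd p = snd q"
      by (auto simp: snd_prod_chart vec2_eq_iff case_prod_beta)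
    then have "snd c (fst p) = snd c (fst q)" by (simp add: vec_eq_iff forall_1)
    then have "fst p = fst q" using chart_inj[OF c] pq by (auto simp: inj_on_def mem_Times_iff)
    then show "p = q" using \<open>snd p = snd q\<close> by (simp add: prod_eq_iff)
  qed
  show "(inv_into (fst c) (snd c) (vec (y $ 1)), y $ 2) \<in> fst (prod_chart c)"
    using inv_into_into[OF y] by simp
  show "snd (prod_chart c) (inv_into (fst c) (snd c) (vec (y $ 1)), y $ 2) = y"
    using f_inv_into_f[OF y] by (simp add: snd_prod_chart)
qed

lemma in_prod_chart:
  fixes y :: "complex^2"
  assumes c: "c \<in> A" and y: "vec (y $ 1) \<in> snd c ` fst c"
  shows "in_chart (prod_chart c) F y = F (inv_into (fst c) (snd c) (vec (y $ 1)), y $ 2)"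
  unfolding in_chart_def inv_prod_chart[OF assms] ..

lemma open_prod_chart_image:
  assumes "c \<in> A" "open V" shows "open (snd (prod_chart c) ` ((fst c \<inter> V) \<times> UNIV))"
  unfolding prod_chart_image by (rule open_vimage[OF open_chart_image[OF assms] linear_continuous_on[OF bounded_linear_vec1]])

lemma prod_transition:
  fixes y :: "complex^2"
  assumes c: "c \<in> A" "c' \<in> A" and y: "vec (y $ 1) \<in> snd c ` (fst c \<inter> fst c')"
  shows "in_chart (prod_chart c) (snd (prod_chart c')) y = vector [in_chart c (snd c') (vec (y $ 1)) $ 1, y $ 2]"
  using y by (subst in_prod_chart[OF c(1)]) (auto simp: snd_prod_chart in_chart_def)

lemma prod_transition_has_derivative:
  assumes c: "c \<in> A" "c' \<in> A" and p: "p \<in> fst c" "p \<in> fst c'"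
  shows "(in_chart (prod_chart c) (snd (prod_chart c')) has_derivative 
    (\<lambda>v. vector [dir_deriv c (vec (v $ 1)) (snd c') p $ 1, v $ 2])) (at (snd (prod_chart c) (p, z)))"
proof -
  let ?y = "snd (prod_chart c) (p, z)"
  have y: "?y \<in> (\<lambda>y. vec (y $ 1)) -` (snd c ` (fst c \<inter> fst c'))" "vec (?y $ 1) = snd c p"
    using p by (auto simp: snd_prod_chart)
  have op: "open ((\<lambda>y::complex^2. vec (y $ 1)) -` (snd c ` (fst c \<inter> fst c')))"
    using open_prod_chart_image[OF c(1) chart_open[OF c(2)]] unfolding prod_chart_image .
  note T = transition_has_derivative(1)[OF c p, folded y(2)]
  have "((\<lambda>y. vector [in_chart c (snd c') (vec (y $ 1)) $ 1, y $ 2] :: complex^2) has_derivative 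
     (\<lambda>v. vector [dir_deriv c (vec (v $ 1)) (snd c') p $ 1, v $ 2])) (at ?y)"
    by (intro has_derivative_vector_2 bounded_linear.has_derivative[OF bounded_linear_vec_nth]
      has_derivative_compose[of "\<lambda>y. vec (y $ 1)", OF bounded_linear_imp_has_derivative[OF bounded_linear_vec1] T]
      bounded_linear_imp_has_derivative[OF bounded_linear_vec_nth])
  then show ?thesis
    by (rule has_derivative_transform_within_open[OF _ op y(1)]) (use prod_transition[OF c] in auto)
qed

lemma prod_homeomorphism:
  assumes c: "c \<in> A"
  shows "homeomorphism (fst (prod_chart c)) (snd (prod_chart c) ` fst (prod_chart c)) (snd (prod_chart c))
    (\<lambda>y. (inv_into (fst c) (snd c) (vec (y $ 1)), y $ 2))"
  unfolding homeomorphism_def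
proof (intro conjI ballI)
  have im: "snd (prod_chart c) ` fst (prod_chart c) = (\<lambda>y. vec (y $ 1)) -` (snd c ` fst c)"
    using prod_chart_image[of c "fst c"] by simp
  show "(inv_into (fst c) (snd c) (vec (snd (prod_chart c) p $ 1)), snd (prod_chart c) p $ 2) = p"
    if "p \<in> fst (prod_chart c)" for p using that c by (auto simp: snd_prod_chart)
  then show "(\<lambda>y. (inv_into (fst c) (snd c) (vec (y $ 1)), y $ 2)) ` (snd (prod_chart c) ` fst (prod_chart c)) = fst (prod_chart c)"
    by (auto simp: image_image image_iff)
  show "continuous_on (fst (prod_chart c)) (snd (prod_chart c))"
    unfolding snd_prod_chart case_prod_beta
    by (intro continuous_on_vector_2 continuous_on_component continuous_on_compose2[OF continuous_on_chart[OF c]] continuous_intros) auto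
  show "continuous_on (snd (prod_chart c) ` fst (prod_chart c)) (\<lambda>y. (inv_into (fst c) (snd c) (vec (y $ 1)), y $ 2))"
    unfolding im
    by (intro continuous_on_Pair continuous_on_component continuous_on_id 
        continuous_on_compose2[OF continuous_on_inv_chart[OF c] linear_continuous_on[OF bounded_linear_vec1]]) auto
  show "snd (prod_chart c) (inv_into (fst c) (snd c) (vec (y $ 1)), y $ 2) = y" if "y \<in> snd (prod_chart c) ` fst (prod_chart c)" for y
    using that unfolding im by (auto simp: snd_prod_chart f_inv_into_f)
qed simp

lemma smooth_atlas_times_line: "smooth_atlas (times_line_atlas A)"
proof
  show "complex_atlas (times_line_atlas A)"
    unfolding complex_atlas_def times_line_atlas_eq
  proof (intro conjI)
    show "(\<Union>c\<in>prod_chart ` A. fst c) = UNIV" using chart_cover by fastforce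
    have "open (fst (prod_chart c)) \<and> open (snd (prod_chart c) ` fst (prod_chart c)) \<and> 
       (\<exists>\<psi>. homeomorphism (fst (prod_chart c)) (snd (prod_chart c) ` fst (prod_chart c)) (snd (prod_chart c)) \<psi>)" 
      if "c \<in> A" for c
      using prod_homeomorphism[OF that] open_prod_chart_image[OF that open_UNIV] open_Times[OF chart_open[OF that] open_UNIV] by auto
    then show "\<forall>(U, \<phi>)\<in>prod_chart ` A. open U \<and> open (\<phi> ` U) \<and> (\<exists>\<psi>. homeomorphism U (\<phi> ` U) \<phi> \<psi>)"
      by (auto simp: case_prod_beta)
    have "cholomorphic_on (snd (prod_chart c) ` (fst (prod_chart c) \<inter> fst (prod_chart c'))) (in_chart (prod_chart c) (snd (prod_chart c')))"
      if c: "c \<in> A" "c' \<in> A" for c c'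
      unfolding cholomorphic_on_def
    proof
      fix y assume "y \<in> snd (prod_chart c) ` (fst (prod_chart c) \<inter> fst (prod_chart c'))"
      then obtain p z where p: "p \<in> fst c" "p \<in> fst c'" and y: "y = snd (prod_chart c) (p, z)" by auto
      note T = transition_has_derivative[OF c p]
      have "(in_chart (prod_chart c) (snd (prod_chart c')) has_derivative 
         (\<lambda>v. vector [dir_deriv c (vec (v $ 1)) (snd c') p $ 1, v $ 2])) (at y)"
        unfolding y by (rule prod_transition_has_derivative[OF c p])
      moreover have "vector [dir_deriv c (vec ((k *s v) $ 1)) (snd c') p $ 1, (k *s v) $ 2] = 
         k *s (vector [dir_deriv c (vec (v $ 1)) (snd c') p $ 1, v $ 2] :: complex^2)" for k v
      proof -
        have "(vec ((k *s v) $ 1) :: complex^1) = k *s vec (v $ 1)" by (simp add: vec_eq_iff)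
        then show ?thesis by (simp add: T(2) vec2_eq_iff)
      qed
      ultimately show "\<exists>f'. (in_chart (prod_chart c) (snd (prod_chart c')) has_derivative f') (at y) \<and> (\<forall>k v. f' (k *s v) = k *s f' v)"
        by blast
    qed
    then show "\<forall>(U, \<phi>)\<in>prod_chart ` A. \<forall>(V, \<psi>)\<in>prod_chart ` A. cholomorphic_on (\<phi> ` (U \<inter> V)) (in_chart (U, \<phi>) \<psi>)"
      by (auto simp: case_prod_beta)
  qed
  fix d d' assume "d \<in> times_line_atlas A" "d' \<in> times_line_atlas A"
  then obtain c c' where c: "c \<in> A" "c' \<in> A" and d: "d = prod_chart c" "d' = prod_chart c'" unfolding times_line_atlas_eq by blast
  have im: "snd d ` (fst d \<inter> fst d') = (\<lambda>y. vec (y $ 1)) -` (snd c ` (fst c \<inter> fst c'))"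
    using prod_chart_image[of c "fst c \<inter> fst c'"] by (simp add: d Times_Int_Times)
  have op: "open ((\<lambda>y::complex^2. vec (y $ 1)) -` (snd c ` (fst c \<inter> fst c')))"
    using open_prod_chart_image[OF c(1) chart_open[OF c(2)]] unfolding prod_chart_image .
  have "smooth_on ((\<lambda>y::complex^2. vec (y $ 1)) -` (snd c ` (fst c \<inter> fst c'))) (\<lambda>y. vector [in_chart c (snd c') (vec (y $ 1)) $ 1, y $ 2] :: complex^2)"
    by (intro smooth_on_vector_2 smooth_on_vec_nth op smooth_on_compose[OF smooth_transition[OF c] smooth_on_bounded_linear[OF bounded_linear_vec1] op]
      smooth_on_bounded_linear[OF bounded_linear_vec_nth]) auto
  then show "smooth_on (snd d ` (fst d \<inter> fst d')) (in_chart d (snd d'))"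
    unfolding im by (rule smooth_on_cong[OF op, THEN iffD1, rotated]) (use prod_transition[OF c] in \<open>simp add: d\<close>)
qed

sublocale T: smooth_atlas "times_line_atlas A" by (rule smooth_atlas_times_line)

lemma prod_chart_mem: "c \<in> A \<Longrightarrow> prod_chart c \<in> times_line_atlas A"
  by (simp add: times_line_atlas_eq)

lemma prod_chartE: "d \<in> times_line_atlas A \<Longrightarrow> (\<And>c. c \<in> A \<Longrightarrow> d = prod_chart c \<Longrightarrow> thesis) \<Longrightarrow> thesis"
  by (auto simp: times_line_atlas_eq)

lemma smooth_fun_pullback_fst:
  fixes f :: "'x \<Rightarrow> 'b::real_normed_vector"
  assumes f: "smooth_fun A W f" and W: "open W"
  shows "smooth_fun (times_line_atlas A) (W \<times> UNIV) (\<lambda>p. f (fst p))"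
proof (rule T.smooth_funI)
  fix d assume "d \<in> times_line_atlas A"
  then obtain c where c: "c \<in> A" and d: "d = prod_chart c" by (rule prod_chartE)
  have im: "snd d ` (fst d \<inter> (W \<times> UNIV)) = (\<lambda>y. vec (y $ 1)) -` (snd c ` (fst c \<inter> W))"
    using prod_chart_image[of c "fst c \<inter> W"] by (simp add: d Times_Int_Times)
  have op: "open ((\<lambda>y::complex^2. vec (y $ 1)) -` (snd c ` (fst c \<inter> W)))"
    using open_prod_chart_image[OF c W] unfolding prod_chart_image .
  have "smooth_on ((\<lambda>y::complex^2. vec (y $ 1)) -` (snd c ` (fst c \<inter> W))) (\<lambda>y. in_chart c f (vec (y $ 1)))"
    by (rule smooth_on_compose[OF smooth_funD[OF f c] smooth_on_bounded_linear[OF bounded_linear_vec1] op]) auto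
  then show "smooth_on (snd d ` (fst d \<inter> (W \<times> UNIV))) (in_chart d (\<lambda>p. f (fst p)))"
    unfolding im
  proof (rule smooth_on_cong[OF op, THEN iffD1, rotated])
    fix y :: "complex^2" assume "y \<in> (\<lambda>y. vec (y $ 1)) -` (snd c ` (fst c \<inter> W))"
    then have "vec (y $ 1) \<in> snd c ` fst c" by auto
    then show "in_chart c f (vec (y $ 1)) = in_chart d (\<lambda>p. f (fst p)) y"
      unfolding d by (simp add: in_prod_chart[OF c] in_chart_def[of c])
  qed
qed

lemma dir_deriv_pullback_fst:
  fixes f :: "'x \<Rightarrow> 'b::real_normed_vector"
  assumes f: "smooth_fun A W f" and c: "c \<in> A" and x: "x \<in> fst c" "x \<in> W"
  shows "dir_deriv (prod_chart c) v (\<lambda>p. f (fst p)) (x, z) = dir_deriv c (vec (v $ 1)) f x"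
proof (rule T.dir_derivI)
  let ?y = "snd (prod_chart c) (x, z)"
  have y: "vec (?y $ 1) = snd c x" "?y \<in> (\<lambda>y. vec (y $ 1)) -` (snd c ` fst c)" using x by (auto simp: snd_prod_chart)
  have op: "open ((\<lambda>y::complex^2. vec (y $ 1)) -` (snd c ` fst c))"
    using open_prod_chart_image[OF c open_UNIV] unfolding prod_chart_image by simp
  have "((\<lambda>y. in_chart c f (vec (y $ 1))) has_derivative (\<lambda>v. dir_deriv c (vec (v $ 1)) f x)) (at ?y)"
    by (rule has_derivative_compose[of "\<lambda>y. vec (y $ 1)", OF bounded_linear_imp_has_derivative[OF bounded_linear_vec1]])
      (unfold y(1), rule has_dir_deriv[OF f c x])
  then show "(in_chart (prod_chart c) (\<lambda>p. f (fst p)) has_derivative (\<lambda>v. dir_deriv c (vec (v $ 1)) f x)) (at ?y)"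
    by (rule has_derivative_transform_within_open[OF _ op y(2)]) (auto simp: in_prod_chart[OF c] in_chart_def[of c])
qed

lemma smooth_fun_snd: "smooth_fun (times_line_atlas A) W snd"
proof (rule T.smooth_fun_subset[of UNIV, OF T.smooth_funI])
  fix d assume "d \<in> times_line_atlas A"
  then obtain c where c: "c \<in> A" and d: "d = prod_chart c" by (rule prod_chartE)
  have im: "snd d ` (fst d \<inter> UNIV) = (\<lambda>y. vec (y $ 1)) -` (snd c ` fst c)"
    using prod_chart_image[of c "fst c"] by (simp add: d)
  have op: "open ((\<lambda>y::complex^2. vec (y $ 1)) -` (snd c ` fst c))"
    using open_prod_chart_image[OF c open_UNIV] unfolding prod_chart_image by simp
  show "smooth_on (snd d ` (fst d \<inter> UNIV)) (in_chart d snd)"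
    unfolding im by (rule smooth_on_cong[OF op, THEN iffD1, OF _ smooth_on_bounded_linear[OF bounded_linear_vec_nth[of 2]]])
     (auto simp: d in_prod_chart[OF c])
qed simp

lemma dir_deriv_snd:
  assumes c: "c \<in> A" and x: "x \<in> fst c"
  shows "dir_deriv (prod_chart c) v snd (x, z) = v $ 2"
proof (rule T.dir_derivI)
  let ?y = "snd (prod_chart c) (x, z)"
  have y: "?y \<in> (\<lambda>y. vec (y $ 1)) -` (snd c ` fst c)" using x by (auto simp: snd_prod_chart)
  have op: "open ((\<lambda>y::complex^2. vec (y $ 1)) -` (snd c ` fst c))"
    using open_prod_chart_image[OF c open_UNIV] unfolding prod_chart_image by simp
  show "(in_chart (prod_chart c) snd has_derivative (\<lambda>v. v $ 2)) (at ?y)"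
    by (rule has_derivative_transform_within_open[OF bounded_linear_imp_has_derivative[OF bounded_linear_vec_nth[of 2]] op y]) 
     (auto simp: in_prod_chart[OF c])
qed

lemma dir_deriv_cnj_z:
  assumes c: "c \<in> A" and x: "x \<in> fst c"
  shows "dir_deriv (prod_chart c) v (\<lambda>(x, z). cnj z) (x, z) = cnj (v $ 2)"
  using T.dir_deriv_linear_compose[OF bounded_linear_cnj smooth_fun_snd prod_chart_mem[OF c], of "(x, z)" UNIV v] x
  by (simp add: dir_deriv_snd[OF c x] case_prod_unfold)

lemma slice_chart:
  fixes F :: "'x \<times> complex \<Rightarrow> 'b::real_normed_vector"
  assumes c: "c \<in> A" and y: "y \<in> snd c ` fst c"
  shows "in_chart (prod_chart c) F (vector [y $ 1, z]) = in_chart c (\<lambda>x. F (x, z)) y"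
  using y by (subst in_prod_chart[OF c]) (simp_all add: in_chart_def)

lemma smooth_fun_slice:
  fixes F :: "'x \<times> complex \<Rightarrow> 'b::real_normed_vector"
  assumes F: "smooth_fun (times_line_atlas A) Q F" and W: "open W" and sub: "W \<times> {z} \<subseteq> Q"
  shows "smooth_fun A W (\<lambda>x. F (x, z))"
proof (rule smooth_funI)
  fix c assume c: "c \<in> A"
  note op = open_chart_image[OF c W]
  have "smooth_on (snd c ` (fst c \<inter> W)) (\<lambda>y. in_chart (prod_chart c) F (vector [y $ 1, z]))"
  proof (rule smooth_on_compose[OF T.smooth_funD[OF F prod_chart_mem[OF c]] _ op])
    show "smooth_on (snd c ` (fst c \<inter> W)) (\<lambda>y. vector [y $ 1, z] :: complex^2)"
      by (intro smooth_on_vector_2 op smooth_on_bounded_linear[OF bounded_linear_vec_nth] smooth_on_const)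
    show "(\<lambda>y. vector [y $ 1, z]) ` (snd c ` (fst c \<inter> W)) \<subseteq> snd (prod_chart c) ` (fst (prod_chart c) \<inter> Q)"
    proof clarify
      fix x assume x: "x \<in> fst c" "x \<in> W"
      have "vector [snd c x $ 1, z] = snd (prod_chart c) (x, z)" by (simp add: snd_prod_chart)
      moreover have "(x, z) \<in> fst (prod_chart c) \<inter> Q" using x sub by auto
      ultimately show "vector [snd c x $ 1, z] \<in> snd (prod_chart c) ` (fst (prod_chart c) \<inter> Q)" by blast
    qed
  qed
  then show "smooth_on (snd c ` (fst c \<inter> W)) (in_chart c (\<lambda>x. F (x, z)))"
    by (rule smooth_on_cong[OF op, THEN iffD1, rotated]) (use slice_chart[OF c] in auto)
qed

lemma dir_deriv_slice:
  fixes F :: "'x \<times> complex \<Rightarrow> 'b::real_normed_vector"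
  assumes F: "smooth_fun (times_line_atlas A) Q F" and c: "c \<in> A" and x: "x \<in> fst c" "(x, z) \<in> Q"
  shows "dir_deriv c v (\<lambda>x. F (x, z)) x = dir_deriv (prod_chart c) (vector [v $ 1, 0]) F (x, z)"
proof (rule dir_derivI)
  have d: "((\<lambda>y::complex^1. vector [y $ 1, z] :: complex^2) has_derivative (\<lambda>v. vector [v $ 1, 0])) (at (snd c x))"
    by (intro has_derivative_vector_2 bounded_linear_imp_has_derivative[OF bounded_linear_vec_nth] has_derivative_const)
  have "((\<lambda>y. in_chart (prod_chart c) F (vector [y $ 1, z])) has_derivative 
      (\<lambda>v. dir_deriv (prod_chart c) (vector [v $ 1, 0]) F (x, z))) (at (snd c x))"
    by (rule has_derivative_compose[OF d]) (use T.has_dir_deriv[OF F prod_chart_mem[OF c], of "(x, z)"] x in \<open>simp add: snd_prod_chart\<close>)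
  then show "(in_chart c (\<lambda>x. F (x, z)) has_derivative (\<lambda>v. dir_deriv (prod_chart c) (vector [v $ 1, 0]) F (x, z))) (at (snd c x))"
    by (rule has_derivative_transform_within_open[OF _ open_chart_image'[OF c]]) (use slice_chart[OF c] x in auto)
qed

end

text \<open>
  In one complex dimension holomorphic transition maps are smooth by the Cauchy integral formula.
\<close>

lemma complex_atlas_imp_riemann_surface:
  fixes A :: "('x::topological_space, 1) chart set"
  assumes A: "complex_atlas A" shows "riemann_surface A"
proof
  show "complex_atlas A" by (rule A)
  fix c c' assume c: "c \<in> A" "c' \<in> A"
  have hol: "cholomorphic_on (snd c ` (fst c \<inter> fst c')) (in_chart c (snd c'))"
    using A c unfolding complex_atlas_def by (cases c, cases c') fastforce
  have "open (fst c')" "open (snd c ` fst c)" using A c unfolding complex_atlas_def by auto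
  moreover obtain \<psi> where "homeomorphism (fst c) (snd c ` fst c) (snd c) \<psi>"
    using A c(1) unfolding complex_atlas_def by (cases c) fastforce
  ultimately have "open (snd c ` (fst c \<inter> fst c'))"
    using homeomorphism_imp_open_map[of "fst c" "snd c ` fst c" "snd c" \<psi> "fst c \<inter> fst c'"] openin_open_eq openin_open_Int by blast
  then show "smooth_on (snd c ` (fst c \<inter> fst c')) (in_chart c (snd c'))"
    by (rule cholomorphic_on_imp_smooth_on[OF hol])
qed

context riemann_surface begin

lemma holo_fun_imp_smooth_fun:
  assumes f: "holo_fun A W f" and W: "open W" shows "smooth_fun A W f"
proof (rule smooth_funI)
  fix c assume c: "c \<in> A"
  have "cholomorphic_on (snd c ` (fst c \<inter> W)) (in_chart c f)" using f c unfolding holo_fun_def by auto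
  then show "smooth_on (snd c ` (fst c \<inter> W)) (in_chart c f)" by (rule cholomorphic_on_imp_smooth_on[OF _ open_chart_image[OF c W]])
qed

lemma holomorphic_imp_hol_vbundle: 
  assumes "holomorphic_bundle A L" shows "hol_vbundle A L"
proof
  show "holomorphic_bundle A L" by (rule assms)
  have v: "vector_bundle L" and op: "\<And>W \<tau>. (W, \<tau>) \<in> btriv L \<Longrightarrow> open W" 
    using assms unfolding holomorphic_bundle_def vector_bundle_def by auto
  have "smooth_fun A (W \<inter> W') (\<lambda>p. \<tau>' (of_triv L \<tau> v p))" if "(W, \<tau>) \<in> btriv L" "(W', \<tau>') \<in> btriv L" for W \<tau> W' \<tau>' v
  proof (rule holo_fun_imp_smooth_fun)
    show "holo_fun A (W \<inter> W') (\<lambda>p. \<tau>' (of_triv L \<tau> v p))" 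
      using assms that unfolding holomorphic_bundle_def by fastforce
    show "open (W \<inter> W')" using op that by blast
  qed
  then show "smooth_bundle A L" unfolding smooth_bundle_def using v by auto
qed

end

section \<open>The bundles of the extension\<close>

lemma vector_bundle_trivD:
  assumes "vector_bundle E" "(W, \<tau>) \<in> btriv E" "p \<in> W"
  shows "of_triv E \<tau> v p \<in> fibre E p"
    "e \<in> fibre E p \<Longrightarrow> e' \<in> fibre E p \<Longrightarrow> \<tau> (badd E e e') = \<tau> e + \<tau> e'"
    "e \<in> fibre E p \<Longrightarrow> \<tau> (bscale E a e) = a *s \<tau> e"
proof -
  have *: "bij_betw \<tau> (fibre E p) UNIV \<and>
           (\<forall>e\<in>fibre E p. \<forall>e'\<in>fibre E p.
              badd E e e' \<in> fibre E p \<and> \<tau> (badd E e e') = \<tau> e + \<tau> e') \<and>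
           (\<forall>e\<in>fibre E p. \<forall>a.
              bscale E a e \<in> fibre E p \<and> \<tau> (bscale E a e) = a *s \<tau> e)"
    by (rule bspec[OF bspec[OF conjunct2[OF assms(1)[unfolded vector_bundle_def]] assms(2), unfolded prod.case, THEN conjunct2] assms(3)])
  have v: "v \<in> \<tau> ` fibre E p" using * by (simp add: bij_betw_def)
  show "of_triv E \<tau> v p \<in> fibre E p" unfolding of_triv_def by (rule inv_into_into[OF v])
  show "e \<in> fibre E p \<Longrightarrow> e' \<in> fibre E p \<Longrightarrow> \<tau> (badd E e e') = \<tau> e + \<tau> e'"
    "e \<in> fibre E p \<Longrightarrow> \<tau> (bscale E a e) = a *s \<tau> e" using * by blast+
qed

context smooth_vbundle begin

lemma smooth_fun_other_triv:
  assumes F: "vector_bundle F" "bproj F = bproj E" "badd F = badd E" "bscale F = bscale E"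
    and tr: "\<And>W \<tau> W' \<tau>' v. (W, \<tau>) \<in> btriv E \<Longrightarrow> (W', \<tau>') \<in> btriv F \<Longrightarrow> smooth_fun A (W \<inter> W') (\<lambda>p. \<tau>' (of_triv E \<tau> v p))"
    and w': "(W', \<tau>') \<in> btriv F" and U: "open U" "U \<subseteq> W'"
    and s: "\<And>p. p \<in> U \<Longrightarrow> s p \<in> fibre E p" "\<And>W \<tau>. (W, \<tau>) \<in> btriv E \<Longrightarrow> smooth_fun A (U \<inter> W) (\<lambda>p. \<tau> (s p))"
  shows "smooth_fun A U (\<lambda>p. \<tau>' (s p))"
proof (rule smooth_fun_Union[OF U(1)])
  fix p assume p: "p \<in> U"
  obtain W \<tau> where w: "(W, \<tau>) \<in> btriv E" "p \<in> W" using triv_cover by blast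
  have op: "open (U \<inter> W)" using U triv_open[OF w(1)] by auto
  have fib: "fibre F q = fibre E q" for q by (simp add: fibre_def F(2))
  have S: "smooth_fun A (U \<inter> W) (\<lambda>q. \<Sum>k\<in>UNIV. \<tau> (s q) $ k *s \<tau>' (of_triv E \<tau> (axis k 1) q))"
    by (intro smooth_fun_sum smooth_fun_smult smooth_fun_vec_nth op s(2)[OF w(1)] 
        smooth_fun_subset[OF tr[OF w(1) w']]) (use U(2) in auto)
  have e: "(\<Sum>k\<in>UNIV. \<tau> (s q) $ k *s \<tau>' (of_triv E \<tau> (axis k 1) q)) = \<tau>' (s q)" if q: "q \<in> U \<inter> W" for q
  proof -
    have "q \<in> W" "q \<in> U" "q \<in> W'" using q U(2) by auto
    show ?thesis
      by (rule triv_transition[OF w(1) \<open>q \<in> W\<close> s(1)[OF \<open>q \<in> U\<close>], symmetric])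
        (use vector_bundle_trivD(2,3)[OF F(1) w' \<open>q \<in> W'\<close>] in \<open>simp_all add: fib F\<close>)
  qed
  have "smooth_fun A (U \<inter> W) (\<lambda>q. \<tau>' (s q))" by (rule smooth_fun_cong[OF op e, THEN iffD1, OF _ S])
  then show "\<exists>N. open N \<and> p \<in> N \<and> smooth_fun A (U \<inter> N) (\<lambda>q. \<tau>' (s q))" using w triv_open[OF w(1)] by blast
qed

lemma smooth_section_other:
  assumes F: "vector_bundle F" "bproj F = bproj E" "badd F = badd E" "bscale F = bscale E"
    and tr: "\<And>W \<tau> W' \<tau>' v. (W, \<tau>) \<in> btriv E \<Longrightarrow> (W', \<tau>') \<in> btriv F \<Longrightarrow> smooth_fun A (W \<inter> W') (\<lambda>p. \<tau>' (of_triv E \<tau> v p))"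
    and s: "smooth_section A E U s"
  shows "smooth_section A F U s"
proof -
  have "smooth_fun A (U \<inter> W') (\<lambda>p. \<tau>' (s p))" if w': "(W', \<tau>') \<in> btriv F" for W' \<tau>'
  proof (rule smooth_fun_other_triv[OF F tr w'])
    have "open W'" using w' F(1) unfolding vector_bundle_def by auto
    then show op: "open (U \<inter> W')" using smooth_sectionD(1)[OF s] by auto
    show "smooth_fun A (U \<inter> W' \<inter> W) (\<lambda>p. \<tau> (s p))" if "(W, \<tau>) \<in> btriv E" for W \<tau>
      by (rule smooth_fun_subset[OF smooth_sectionD(3)[OF s that]]) auto
  qed (use smooth_sectionD(2)[OF s] in auto)
  then show ?thesis
    using smooth_sectionD(1,2)[OF s] unfolding smooth_section_def fibre_def by (auto simp: o_def F)
qed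

end

context smooth_vbundle begin

lemma bscale_one [simp]: "e \<in> fibre E p \<Longrightarrow> bscale E 1 e = e"
proof -
  assume e: "e \<in> fibre E p"
  obtain W \<tau> where w: "(W, \<tau>) \<in> btriv E" "p \<in> W" using triv_cover by blast
  show "bscale E 1 e = e"
    by (rule triv_inj[OF w]; use e in \<open>simp add: triv_add[OF w] triv_scale[OF w] triv_bzero[OF w] bzero_fibre bscale_fibre badd_fibre vector_smult_assoc\<close>)+
qed

lemma bscale_bscale: "e \<in> fibre E p \<Longrightarrow> bscale E a (bscale E b e) = bscale E (a * b) e"
proof -
  assume e: "e \<in> fibre E p"
  obtain W \<tau> where w: "(W, \<tau>) \<in> btriv E" "p \<in> W" using triv_cover by blast
  show "bscale E a (bscale E b e) = bscale E (a * b) e"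
    by (rule triv_inj[OF w]; use e in \<open>simp add: triv_add[OF w] triv_scale[OF w] triv_bzero[OF w] bzero_fibre bscale_fibre badd_fibre vector_smult_assoc\<close>)+
qed

lemma bscale_0: "e \<in> fibre E p \<Longrightarrow> bscale E 0 e = bzero E p"
proof -
  assume e: "e \<in> fibre E p"
  obtain W \<tau> where w: "(W, \<tau>) \<in> btriv E" "p \<in> W" using triv_cover by blast
  show "bscale E 0 e = bzero E p"
    by (rule triv_inj[OF w]; use e in \<open>simp add: triv_add[OF w] triv_scale[OF w] triv_bzero[OF w] bzero_fibre bscale_fibre badd_fibre vector_smult_assoc\<close>)+
qed

lemma badd_bzero: 
  assumes e: "e \<in> fibre E p"
  shows "badd E e (bzero E p) = e" "badd E (bzero E p) e = e"
proof -
  obtain W \<tau> where w: "(W, \<tau>) \<in> btriv E" "p \<in> W" using triv_cover by blast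
  show "badd E e (bzero E p) = e" "badd E (bzero E p) e = e"
    by (rule triv_inj[OF w]; use e in \<open>simp add: triv_add[OF w] triv_scale[OF w] triv_bzero[OF w] bzero_fibre bscale_fibre badd_fibre vector_smult_assoc\<close>)+
qed

lemma bscale_bzero [simp]: "bscale E a (bzero E p) = bzero E p"
proof -
  obtain W \<tau> where w: "(W, \<tau>) \<in> btriv E" "p \<in> W" using triv_cover by blast
  show ?thesis
    by (rule triv_inj[OF w]) (simp_all add: triv_scale[OF w] triv_bzero[OF w] bzero_fibre bscale_fibre)
qed

lemma bscale_badd: "e \<in> fibre E p \<Longrightarrow> e' \<in> fibre E p \<Longrightarrow> bscale E a (badd E e e') = badd E (bscale E a e) (bscale E a e')"
proof -
  assume e: "e \<in> fibre E p" "e' \<in> fibre E p"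
  obtain W \<tau> where w: "(W, \<tau>) \<in> btriv E" "p \<in> W" using triv_cover by blast
  show ?thesis
    by (rule triv_inj[OF w]) (use e in \<open>auto simp: triv_add[OF w] triv_scale[OF w] vector_add_ldistrib bscale_fibre badd_fibre\<close>)
qed

end

context smooth_atlas begin

text \<open>
  The identity \<open>delbar\<^sup>2 = 0\<close> for coordinate fields. Applied to a section of \<open>E\<close> it turns into the holomorphy of the section \<open>\<phi>\<close>.
\<close>

lemma delbar_commute:
  assumes f: "smooth_fun A W f" and c: "c \<in> A" and p: "p \<in> fst c" "p \<in> W" and W: "open W"
  shows "delbar c u (delbar c v f) p = delbar c v (delbar c u f) p"
proof -
  have op: "open (fst c \<inter> W)" using chart_open[OF c] W by auto
  have pp: "p \<in> fst c \<inter> W" using p by simp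
  note d = smooth_fun_dir_deriv[OF f c W]
  have e: "dir_deriv c u (delbar c v f) p = (dir_deriv c u (dir_deriv c v f) p + \<i> * dir_deriv c u (dir_deriv c (\<i> *s v) f) p) / 2" for u v
  proof -
    have "dir_deriv c u (delbar c v f) p = dir_deriv c u (\<lambda>q. (1/2) * dir_deriv c v f q + (\<i>/2) * dir_deriv c (\<i> *s v) f q) p"
      by (rule arg_cong[of _ _ "\<lambda>g. dir_deriv c u g p"]) (simp add: delbar_def[abs_def] fun_eq_iff field_simps)
    also have "\<dots> = (1/2) * dir_deriv c u (dir_deriv c v f) p + (\<i>/2) * dir_deriv c u (dir_deriv c (\<i> *s v) f) p"
      using dir_deriv_add[OF smooth_fun_mult[OF smooth_fun_const d op] smooth_fun_mult[OF smooth_fun_const d op] c p(1) pp,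
          of u "1/2" v "\<i>/2" "\<i> *s v"]
      unfolding dir_deriv_mult[OF smooth_fun_const d c p(1) pp] dir_deriv_const mult_zero_left add_0_right .
    finally show ?thesis by (simp add: field_simps)
  qed
  show ?thesis
    unfolding delbar_def[of c u "delbar c v f"] delbar_def[of c v "delbar c u f"] e
      dir_deriv_commute[OF f c p W, of v u] dir_deriv_commute[OF f c p W, of v "\<i> *s u"] 
      dir_deriv_commute[OF f c p W, of "\<i> *s v" u] dir_deriv_commute[OF f c p W, of "\<i> *s v" "\<i> *s u"] 
    by (simp add: field_simps)
qed

lemma smooth_fun_imp_continuous_on:
  assumes f: "smooth_fun A W f" and W: "open W"
  shows "continuous_on W f"
proof -
  have "continuous_on (fst c \<inter> W) f" if c: "c \<in> A" for c
  proof -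
    have "continuous_on (fst c \<inter> W) (\<lambda>q. in_chart c f (snd c q))"
      by (rule continuous_on_compose2[OF smooth_on_imp_continuous_on[OF smooth_funD[OF f c]]
           continuous_on_subset[OF continuous_on_chart[OF c]]]) auto
    then show ?thesis by (rule continuous_on_eq) (use c in auto)
  qed
  then have "continuous_on (\<Union>c\<in>A. fst c \<inter> W) f"
    by (intro continuous_on_open_UN) (use chart_open W in auto)
  moreover have "(\<Union>c\<in>A. fst c \<inter> W) = W" using chart_cover by blast
  ultimately show ?thesis by simp
qed

end

context hol_vbundle begin

lemma smooth_section_dolbeault:
  assumes s: "smooth_section A E W s" and c: "c \<in> A"
  shows "smooth_section A E (fst c \<inter> W) (dolbeault E c v s)"
proof (rule smooth_section_Union)
  show op: "open (fst c \<inter> W)" using chart_open[OF c] smooth_sectionD(1)[OF s] by auto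
  fix p assume p: "p \<in> fst c \<inter> W"
  obtain W0 \<tau> where w: "(W0, \<tau>) \<in> btriv E" "p \<in> W0" using triv_cover by blast
  have V: "open (W \<inter> W0)" using smooth_sectionD(1)[OF s] triv_open[OF w(1)] by auto
  have N: "open (fst c \<inter> W \<inter> W0)" using op triv_open[OF w(1)] by auto
  have "smooth_section A E (fst c \<inter> W \<inter> W0) (dolbeault E c v s)"
  proof (rule smooth_sectionI[OF w(1) N])
    show "smooth_fun A (fst c \<inter> W \<inter> W0) (\<lambda>p. \<tau> (dolbeault E c v s p))"
      unfolding smooth_fun_vec_iff[OF N]
    proof
      fix j
      have "smooth_fun A (fst c \<inter> W \<inter> W0) (delbar c v (\<lambda>q. \<tau> (s q) $ j))"
        unfolding Int_assoc by (rule smooth_fun_del(2)[OF smooth_fun_vec_nth[OF smooth_sectionD(3)[OF s w(1)] V] c V])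
      then show "smooth_fun A (fst c \<inter> W \<inter> W0) (\<lambda>p. \<tau> (dolbeault E c v s p) $ j)"
        by (rule smooth_fun_cong[OF N, THEN iffD1, rotated]) (use dolbeault_triv(2)[OF s c _ _ w(1)] in auto)
    qed
  qed (use dolbeault_triv(1)[OF s c] in auto)
  then show "\<exists>N. open N \<and> p \<in> N \<and> smooth_section A E (fst c \<inter> W \<inter> N) (dolbeault E c v s)"
    using triv_open[OF w(1)] w(2) by blast
qed

end

text \<open>
  In holomorphic frames the bundle map has holomorphic coefficients, which delbar does not see.
\<close>

lemma dolbeault_holomorphic_map:
  assumes E: "hol_vbundle A E" and F: "hol_vbundle A F" and f: "holomorphic_bundle_map A E F f"
    and sm: "\<And>W s. smooth_section A E W s \<Longrightarrow> smooth_section A F W (\<lambda>q. f (s q))"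
    and s: "smooth_section A E W s" and c: "c \<in> A" and p: "p \<in> fst c" "p \<in> W"
  shows "f (dolbeault E c v s p) = dolbeault F c v (\<lambda>q. f (s q)) p"
proof -
  interpret E: hol_vbundle A E by (rule E)
  interpret F: hol_vbundle A F by (rule F)
  obtain W1 \<tau> where w: "(W1, \<tau>) \<in> btriv E" "p \<in> W1" using E.triv_cover by blast
  obtain W2 \<sigma> where w': "(W2, \<sigma>) \<in> btriv F" "p \<in> W2" using F.triv_cover by blast
  note fs = sm[OF s]
  have ff: "f e \<in> fibre F q" if "e \<in> fibre E q" for e q
    using f that unfolding holomorphic_bundle_map_def fibre_def by auto
  have fadd: "f (badd E e e') = badd F (f e) (f e')" if "e \<in> fibre E q" "e' \<in> fibre E q" for e e' q
    using f that unfolding holomorphic_bundle_map_def fibre_def by auto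
  have fscale: "f (bscale E a e) = bscale F a (f e)" for a e
    using f unfolding holomorphic_bundle_map_def by auto
  have lin: "\<sigma> (f e) = (\<Sum>k\<in>UNIV. \<tau> e $ k *s \<sigma> (f (of_triv E \<tau> (axis k 1) q)))"
    if q: "q \<in> W1" "q \<in> W2" "e \<in> fibre E q" for e q
    by (rule E.triv_transition[OF w(1) q(1,3)])
      (use F.triv_add(2)[OF w'(1) q(2)] F.triv_scale(2)[OF w'(1) q(2)] in \<open>auto simp: fadd fscale ff\<close>)
  define V where "V = W \<inter> (W1 \<inter> W2)"
  have V: "open V" "p \<in> V" using E.smooth_sectionD(1)[OF s] E.triv_open[OF w(1)] F.triv_open[OF w'(1)] p w w' by (auto simp: V_def)
  have Fk: "smooth_fun A V (\<lambda>q. \<tau> (s q) $ k)" for k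
    by (rule E.smooth_fun_vec_nth[OF E.smooth_fun_subset[OF E.smooth_sectionD(3)[OF s w(1)]] V(1)]) (auto simp: V_def)
  have g0: "smooth_fun A (W1 \<inter> W2) (\<lambda>q. \<sigma> (f (of_triv E \<tau> a q)))" for a
    by (rule F.smooth_sectionD(3)[OF sm[OF E.smooth_section_frame[OF w(1)]] w'(1)])
  have g: "smooth_fun A V (\<lambda>q. \<sigma> (f (of_triv E \<tau> (axis k 1) q)) $ j)" for k j
    by (rule E.smooth_fun_vec_nth[OF E.smooth_fun_subset[OF g0] V(1)]) (auto simp: V_def)
  have hol: "holo_fun A (W1 \<inter> W2) (\<lambda>q. \<sigma> (f (of_triv E \<tau> a q)))" for a
    using f w(1) w'(1) unfolding holomorphic_bundle_map_def by fastforce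
  have d0: "delbar c v (\<lambda>q. \<sigma> (f (of_triv E \<tau> a q)) $ j) p = 0" for a j
    by (rule E.delbar_holo[OF hol g0 c p(1)]) (use w w' in auto)
  have "delbar c v (\<lambda>q. \<sigma> (f (s q)) $ j) p = delbar c v (\<lambda>q. \<Sum>k\<in>UNIV. \<tau> (s q) $ k * \<sigma> (f (of_triv E \<tau> (axis k 1) q)) $ j) p" for j
  proof (rule E.del_cong(2)[OF V(1) c p(1) V(2)])
    fix q assume q: "q \<in> V"
    then have "q \<in> W1" "q \<in> W2" "s q \<in> fibre E q" using E.smooth_sectionD(2)[OF s] by (auto simp: V_def)
    from lin[OF this]
    show "\<sigma> (f (s q)) $ j = (\<Sum>k\<in>UNIV. \<tau> (s q) $ k * \<sigma> (f (of_triv E \<tau> (axis k 1) q)) $ j)" by simp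
  qed
  also have "\<dots> j = (\<Sum>k\<in>UNIV. delbar c v (\<lambda>q. \<tau> (s q) $ k * \<sigma> (f (of_triv E \<tau> (axis k 1) q)) $ j) p)" for j
    by (rule E.del_sum(2)[OF _ c p(1) V(2,1)]) (intro E.smooth_fun_mult Fk g V(1))
  finally have D: "delbar c v (\<lambda>q. \<sigma> (f (s q)) $ j) p = (\<Sum>k\<in>UNIV. delbar c v (\<lambda>q. \<tau> (s q) $ k) p * \<sigma> (f (of_triv E \<tau> (axis k 1) p)) $ j)" for j
    by (simp add: E.del_mult(2)[OF Fk g c p(1) V(2)] d0)
  note ds = E.dolbeault_triv(1)[OF s c p]
  show ?thesis
  proof (rule F.triv_inj[OF w' ff[OF ds] F.dolbeault_triv(1)[OF fs c p]])
    show "\<sigma> (f (dolbeault E c v s p)) = \<sigma> (dolbeault F c v (\<lambda>q. f (s q)) p)"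
      by (simp add: vec_eq_iff lin[OF w(2) w'(2) ds] F.dolbeault_triv(2)[OF fs c p w'] D E.dolbeault_triv(2)[OF s c p w])
  qed
qed

context riemann_surface begin

lemma vec_i: "vec ((k *s v) $ 1) = (k *s vec ((v::complex^2) $ 1) :: complex^1)"
  by (simp add: vec_eq_iff)

lemma del_pullback_fst:
  assumes f: "smooth_fun A W f" and c: "c \<in> A" and x: "x \<in> fst c" "x \<in> W"
  shows "del (prod_chart c) v (\<lambda>p. f (fst p)) (x, z) = del c (vec (v $ 1)) f x"
    "delbar (prod_chart c) v (\<lambda>p. f (fst p)) (x, z) = delbar c (vec (v $ 1)) f x"
  by (simp_all add: del_def delbar_def dir_deriv_pullback_fst[OF assms] vec_i del: vec_nth_1 vector_smult_component)

lemma tensor_Ln_simps [simp]: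
  "bproj (tensor_Ln L) (l, z) = (bproj L l, z)"
  "badd (tensor_Ln L) (l, z) (l', z') = (badd L l l', z)"
  "bscale (tensor_Ln L) a (l, z) = (bscale L a l, z)"
  "(l, z) \<in> fibre (tensor_Ln L) (x, z') \<longleftrightarrow> l \<in> fibre L x \<and> z = z'"
  by (auto simp: tensor_Ln_def fibre_def)

lemma tensor_Ln_triv: "(W, \<tau>) \<in> btriv L \<Longrightarrow> (W \<times> UNIV, \<lambda>(l, z). \<tau> l) \<in> btriv (tensor_Ln L)"
  by (force simp: tensor_Ln_def)

lemma tensor_Ln_trivE: 
  assumes "(W', \<tau>') \<in> btriv (tensor_Ln L)"
  obtains W \<tau> where "(W, \<tau>) \<in> btriv L" "W' = W \<times> UNIV" "\<tau>' = (\<lambda>(l, z). \<tau> l)"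
  using assms by (auto simp: tensor_Ln_def)

lemma sum_bundle_simps [simp]:
  "bproj (sum_bundle L) (l, z, w) = (bproj L l, z)"
  "badd (sum_bundle L) (l, z, w) (l', z', w') = (badd L l l', z, w + w')"
  "bscale (sum_bundle L) a (l, z, w) = (bscale L a l, z, a * w)"
  "(l, z, w) \<in> fibre (sum_bundle L) (x, z') \<longleftrightarrow> l \<in> fibre L x \<and> z = z'"
  by (auto simp: sum_bundle_def fibre_def)

lemma sum_bundle_triv: "(W, \<tau>) \<in> btriv L \<Longrightarrow> (W \<times> UNIV, \<lambda>(l, z, w). vector [\<tau> l $ 1, w]) \<in> btriv (sum_bundle L)"
  by (force simp: sum_bundle_def)

lemma sum_bundle_trivE: 
  assumes "(W', \<tau>') \<in> btriv (sum_bundle L)"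
  obtains W \<tau> where "(W, \<tau>) \<in> btriv L" "W' = W \<times> UNIV" "\<tau>' = (\<lambda>(l, z, w). vector [\<tau> l $ 1, w])"
  using assms by (auto simp: sum_bundle_def)

lemma trivial_line_simps [simp]:
  "bproj trivial_line (p, w) = p"
  "badd trivial_line (p, w) (p', w') = (p, w + w')"
  "bscale trivial_line a (p, w) = (p, a * w)"
  "(p', w) \<in> fibre trivial_line p \<longleftrightarrow> p' = p"
  "btriv trivial_line = {(UNIV, \<lambda>(p, w). \<chi> i. w)}"
  by (auto simp: trivial_line_def fibre_def)

end

lemma hol_vbundleI:
  assumes "smooth_atlas A" "smooth_bundle A E" "holomorphic_bundle A E" shows "hol_vbundle A E"
  using assms by (intro hol_vbundle.intro smooth_vbundle.intro hol_vbundle_axioms.intro smooth_vbundle_axioms.intro)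

locale extension_bundle = riemann_surface A for A :: "('x::topological_space, 1) chart set" +
  fixes L :: "('l, 'x, 1) vbundle"
    and E :: "('l \<times> complex \<times> complex, 'x \<times> complex, 2) vbundle"
  assumes hol_L: "holomorphic_bundle A L" and split_ext: "split_extension A L E"
begin

sublocale L: hol_vbundle A L by (rule holomorphic_imp_hol_vbundle[OF hol_L])

abbreviation "TA \<equiv> times_line_atlas A"
abbreviation "V \<equiv> sum_bundle L"
abbreviation "N \<equiv> tensor_Ln L"

lemma hol_structure: "holomorphic_structure_on TA V E"
  and extension: "holomorphic_extension TA N E trivial_line sum_incl (sum_snd L)"
  using split_ext unfolding split_extension_def by auto

sublocale V: smooth_vbundle TA V
  using hol_structure unfolding holomorphic_structure_on_def
  by (intro smooth_vbundle.intro smooth_vbundle_axioms.intro T.smooth_atlas_axioms) auto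

lemma E_ops: "bproj E = bproj V" "badd E = badd V" "bscale E = bscale V"
  using hol_structure unfolding holomorphic_structure_on_def by auto

lemma fibre_E [simp]: "fibre E p = fibre V p" by (simp add: fibre_def E_ops)

lemma E_transitions:
  "(W, \<tau>) \<in> btriv V \<Longrightarrow> (W', \<tau>') \<in> btriv E \<Longrightarrow> smooth_fun TA (W \<inter> W') (\<lambda>p. \<tau>' (of_triv V \<tau> v p))"
  "(W', \<tau>') \<in> btriv E \<Longrightarrow> (W, \<tau>) \<in> btriv V \<Longrightarrow> smooth_fun TA (W' \<inter> W) (\<lambda>p. \<tau> (of_triv E \<tau>' v p))"
proof -
  have *: "\<forall>(W, \<tau>)\<in>btriv V. \<forall>(W', \<tau>')\<in>btriv E. \<forall>v.
        smooth_fun TA (W \<inter> W') (\<lambda>p. \<tau>' (of_triv V \<tau> v p)) \<and>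
        smooth_fun TA (W \<inter> W') (\<lambda>p. \<tau> (of_triv E \<tau>' v p))"
    using hol_structure unfolding holomorphic_structure_on_def by blast
  show "(W, \<tau>) \<in> btriv V \<Longrightarrow> (W', \<tau>') \<in> btriv E \<Longrightarrow> smooth_fun TA (W \<inter> W') (\<lambda>p. \<tau>' (of_triv V \<tau> v p))"
    using * by fastforce
  show "(W', \<tau>') \<in> btriv E \<Longrightarrow> (W, \<tau>) \<in> btriv V \<Longrightarrow> smooth_fun TA (W' \<inter> W) (\<lambda>p. \<tau> (of_triv E \<tau>' v p))"
    using * by (subst Int_commute) fastforce
qed

lemma E_hol: "holomorphic_bundle TA E" and E_vb: "vector_bundle E"
  using hol_structure unfolding holomorphic_structure_on_def holomorphic_bundle_def by auto

sublocale E: hol_vbundle TA E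
proof (rule hol_vbundleI[OF T.smooth_atlas_axioms _ E_hol])
  have "smooth_fun TA (W1 \<inter> W2) (\<lambda>p. \<tau>2 (of_triv E \<tau>1 v p))" 
    if w: "(W1, \<tau>1) \<in> btriv E" "(W2, \<tau>2) \<in> btriv E" for W1 \<tau>1 W2 \<tau>2 v
  proof (rule V.smooth_fun_other_triv[OF E_vb E_ops E_transitions(1) w(2)])
    show "open (W1 \<inter> W2)" using E_vb w unfolding vector_bundle_def by auto
    show "of_triv E \<tau>1 v p \<in> fibre V p" if "p \<in> W1 \<inter> W2" for p 
      using vector_bundle_trivD(1)[OF E_vb w(1), of p v] that by simp
    show "smooth_fun TA (W1 \<inter> W2 \<inter> W) (\<lambda>p. \<tau> (of_triv E \<tau>1 v p))" if "(W, \<tau>) \<in> btriv V" for W \<tau>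
      by (rule T.smooth_fun_subset[OF E_transitions(2)[OF w(1) that]]) auto
  qed auto
  then show "smooth_bundle TA E" unfolding smooth_bundle_def using E_vb by auto
qed

lemma smooth_section_E: "smooth_section TA E = smooth_section TA V"
proof (intro ext iffI)
  fix W s
  show "smooth_section TA E W s \<Longrightarrow> smooth_section TA V W s"
    by (rule E.smooth_section_other[OF V.vbundle E_ops(1)[symmetric] E_ops(2)[symmetric] E_ops(3)[symmetric] E_transitions(2)])
  show "smooth_section TA V W s \<Longrightarrow> smooth_section TA E W s"
    by (rule V.smooth_section_other[OF E_vb E_ops E_transitions(1)])
qed

lemma N_vb: "vector_bundle N"
proof -
  have "bij_betw (\<lambda>(l, z). \<tau> l) (fibre N p) UNIV" if w: "(W, \<tau>) \<in> btriv L" "fst p \<in> W" for W \<tau> p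
  proof -
    obtain x z where p: "p = (x, z)" by (cases p)
    have "inj_on (\<lambda>(l, z). \<tau> l) (fibre N p)"
      using L.triv_inj[OF w(1)] w(2) by (auto simp: inj_on_def p)
    moreover have "v \<in> (\<lambda>(l, z). \<tau> l) ` fibre N p" for v
      by (rule image_eqI[of _ _ "(of_triv L \<tau> v x, z)"]) (use L.of_triv[OF w, of v] in \<open>auto simp: p\<close>)
    ultimately show ?thesis unfolding bij_betw_def by auto
  qed
  moreover have "(\<Union>w\<in>btriv N. fst w) = UNIV" 
  proof -
    have "p \<in> (\<Union>w\<in>btriv N. fst w)" for p
    proof -
      obtain W \<tau> where "(W, \<tau>) \<in> btriv L" "fst p \<in> W" using L.triv_cover by blast
      then show ?thesis using tensor_Ln_triv[of W \<tau> L] by (force simp: mem_Times_iff)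
    qed
    then show ?thesis by auto
  qed
  ultimately show ?thesis
    unfolding vector_bundle_def
    by (auto elim!: tensor_Ln_trivE simp: L.triv_open open_Times L.triv_add L.triv_scale)
qed

lemma of_triv_N:
  assumes w: "(W, \<tau>) \<in> btriv L" "x \<in> W"
  shows "of_triv N (\<lambda>(l, z). \<tau> l) v (x, z) = (of_triv L \<tau> v x, z)"
proof -
  have "bij_betw (\<lambda>(l, z). \<tau> l) (fibre N (x, z)) UNIV"
    using N_vb tensor_Ln_triv[OF w(1)] w(2) unfolding vector_bundle_def by fastforce
  then show ?thesis unfolding of_triv_def[of N]
    by (intro inv_into_f_eq) (auto simp: bij_betw_def L.of_triv[OF w])
qed

lemma N_transition:
  assumes w: "(W, \<tau>) \<in> btriv L" "(W', \<tau>') \<in> btriv L"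
  shows "smooth_fun TA ((W \<times> UNIV) \<inter> (W' \<times> UNIV)) (\<lambda>p. (\<lambda>(l, z). \<tau>' l) (of_triv N (\<lambda>(l, z). \<tau> l) v p))"
    "holo_fun TA ((W \<times> UNIV) \<inter> (W' \<times> UNIV)) (\<lambda>p. (\<lambda>(l, z). \<tau>' l) (of_triv N (\<lambda>(l, z). \<tau> l) v p))"
proof -
  have op: "open (W \<inter> W')" "open ((W \<inter> W') \<times> (UNIV::complex set))" using L.triv_open w by (auto intro: open_Times)
  have eq: "(\<lambda>(l, z). \<tau>' l) (of_triv N (\<lambda>(l, z). \<tau> l) v p) = \<tau>' (of_triv L \<tau> v (fst p))" if "p \<in> (W \<inter> W') \<times> UNIV" for p
    using that of_triv_N[OF w(1), of "fst p" v "snd p"] by (cases p) auto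
  have sets: "(W \<times> (UNIV::complex set)) \<inter> (W' \<times> UNIV) = (W \<inter> W') \<times> UNIV" by auto
  have sm: "smooth_fun TA ((W \<inter> W') \<times> UNIV) (\<lambda>p. \<tau>' (of_triv L \<tau> v (fst p)))"
    by (rule smooth_fun_pullback_fst[OF L.smooth_transition_triv[OF w] op(1)])
  then show sm': "smooth_fun TA ((W \<times> UNIV) \<inter> (W' \<times> UNIV)) (\<lambda>p. (\<lambda>(l, z). \<tau>' l) (of_triv N (\<lambda>(l, z). \<tau> l) v p))"
    unfolding sets by (rule T.smooth_fun_cong[OF op(2), THEN iffD1, rotated]) (use eq in auto)
  show "holo_fun TA ((W \<times> UNIV) \<inter> (W' \<times> UNIV)) (\<lambda>p. (\<lambda>(l, z). \<tau>' l) (of_triv N (\<lambda>(l, z). \<tau> l) v p))"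
  proof (rule T.holo_funI[OF sm'])
    fix d p u j assume d: "d \<in> TA" and p: "p \<in> fst d" "p \<in> W \<times> UNIV \<inter> W' \<times> UNIV"
    then obtain c where c: "c \<in> A" "d = prod_chart c" by (auto elim: prod_chartE)
    obtain x z where xz: "p = (x, z)" "x \<in> fst c" "x \<in> W" "x \<in> W'" using p c by (cases p) auto
    have "delbar d u (\<lambda>q. (\<lambda>(l, z). \<tau>' l) (of_triv N (\<lambda>(l, z). \<tau> l) v q) $ j) p = delbar d u (\<lambda>q. \<tau>' (of_triv L \<tau> v (fst q)) $ j) p"
      by (rule T.del_cong(2)[OF op(2) d p(1)]) (use p eq in auto)
    also have "\<dots> = delbar c (vec (u $ 1)) (\<lambda>q. \<tau>' (of_triv L \<tau> v q) $ j) x"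
      unfolding c(2) xz(1) 
      by (rule del_pullback_fst(2)[OF smooth_fun_vec_nth[OF L.smooth_transition_triv[OF w] op(1)] c(1) xz(2)]) (use xz in auto)
    also have "\<dots> = 0" by (rule L.delbar_transition[OF w c(1) xz(2-4)])
    finally show "delbar d u (\<lambda>q. (\<lambda>(l, z). \<tau>' l) (of_triv N (\<lambda>(l, z). \<tau> l) v q) $ j) p = 0" .
  qed
qed

sublocale N: hol_vbundle TA N
proof (rule hol_vbundleI[OF T.smooth_atlas_axioms])
  show "smooth_bundle TA N" unfolding smooth_bundle_def using N_vb N_transition(1) by (auto elim!: tensor_Ln_trivE)
  show "holomorphic_bundle TA N" unfolding holomorphic_bundle_def using N_vb N_transition(2) by (auto elim!: tensor_Ln_trivE)
qed

lemma Q_vb: "vector_bundle (trivial_line :: (('x \<times> complex) \<times> complex, 'x \<times> complex, 1) vbundle)"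
proof -
  have "bij_betw (\<lambda>(p, w). \<chi> i::1. w) (fibre trivial_line q) UNIV" for q :: "'x \<times> complex"
  proof -
    have "v \<in> (\<lambda>(p, w). \<chi> i::1. w) ` fibre trivial_line q" for v
      by (rule image_eqI[of _ _ "(q, v $ 1)"]) (auto simp: vec_eq_iff forall_1)
    then show ?thesis by (auto simp: bij_betw_def inj_on_def vec_eq_iff)
  qed
  then show ?thesis unfolding vector_bundle_def by (auto simp: vec_eq_iff)
qed

sublocale Q: hol_vbundle TA trivial_line
proof (rule hol_vbundleI[OF T.smooth_atlas_axioms])
  have eq: "(\<lambda>(p, w). \<chi> i::1. w) (of_triv trivial_line (\<lambda>(p, w). \<chi> i. w) v p) = v" for v and p :: "'x \<times> complex"
    unfolding of_triv_def
    by (rule f_inv_into_f[of v "\<lambda>(p, w). \<chi> i. w"], rule image_eqI[of _ _ "(p, v $ 1)"]) (auto simp: vec_eq_iff forall_1)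
  show "smooth_bundle TA trivial_line" unfolding smooth_bundle_def using Q_vb by (simp add: eq)
  show "holomorphic_bundle TA trivial_line" unfolding holomorphic_bundle_def using Q_vb 
    by (auto simp: eq intro: T.holo_funI)
qed

end

section \<open>The second fundamental form of the extension\<close>

context extension_bundle begin

lemma V_sectionI:
  assumes "open W" "\<And>p. p \<in> W \<Longrightarrow> s p \<in> fibre V p"
    "\<And>W0 \<tau>. (W0, \<tau>) \<in> btriv L \<Longrightarrow> smooth_fun TA (W \<inter> W0 \<times> UNIV) (\<lambda>p. \<tau> (fst (s p)) $ 1)"
    "smooth_fun TA W (\<lambda>p. snd (snd (s p)))"
  shows "smooth_section TA V W s"
  unfolding smooth_section_def
proof (intro conjI assms(1) ballI)
  fix p assume "p \<in> W" then show "s p \<in> fibre V p" by (rule assms(2))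
next
  fix t assume "t \<in> btriv V"
  then obtain W0 \<tau> where w: "(W0, \<tau>) \<in> btriv L" and t: "t = (W0 \<times> UNIV, \<lambda>(l, z, w). vector [\<tau> l $ 1, w])"
    by (cases t) (auto elim: sum_bundle_trivE)
  have op: "open (W \<inter> W0 \<times> UNIV)" using assms(1) L.triv_open[OF w] by (auto intro: open_Times)
  have "smooth_fun TA (W \<inter> W0 \<times> UNIV) (\<lambda>p. (\<lambda>(l, z, w). vector [\<tau> l $ 1, w] :: complex^2) (s p))"
    unfolding T.smooth_fun_vec_iff[OF op] forall_2
    using assms(3)[OF w] T.smooth_fun_subset[OF assms(4), of "W \<inter> W0 \<times> UNIV"] by (simp add: case_prod_beta)
  then show "case t of (W', \<tau>) \<Rightarrow> smooth_fun TA (W \<inter> W') (\<tau> \<circ> s)" by (simp add: t o_def)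
qed

lemma V_sectionD:
  assumes s: "smooth_section TA V W s"
  shows "(W0, \<tau>) \<in> btriv L \<Longrightarrow> smooth_fun TA (W \<inter> W0 \<times> UNIV) (\<lambda>p. \<tau> (fst (s p)) $ 1)"
    "smooth_fun TA W (\<lambda>p. snd (snd (s p)))"
proof -
  have *: "smooth_fun TA (W \<inter> W0 \<times> UNIV) (\<lambda>p. \<tau> (fst (s p)) $ 1)" 
     "smooth_fun TA (W \<inter> W0 \<times> UNIV) (\<lambda>p. snd (snd (s p)))" if w: "(W0, \<tau>) \<in> btriv L" for W0 \<tau>
  proof -
    have op: "open (W \<inter> W0 \<times> UNIV)" using V.smooth_sectionD(1)[OF s] L.triv_open[OF w] by (auto intro: open_Times)
    show "smooth_fun TA (W \<inter> W0 \<times> UNIV) (\<lambda>p. \<tau> (fst (s p)) $ 1)" 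
     "smooth_fun TA (W \<inter> W0 \<times> UNIV) (\<lambda>p. snd (snd (s p)))"
      using V.smooth_sectionD(3)[OF s sum_bundle_triv[OF w]] unfolding T.smooth_fun_vec_iff[OF op] forall_2
      by (simp_all add: case_prod_beta)
  qed
  then show "(W0, \<tau>) \<in> btriv L \<Longrightarrow> smooth_fun TA (W \<inter> W0 \<times> UNIV) (\<lambda>p. \<tau> (fst (s p)) $ 1)" by blast
  show "smooth_fun TA W (\<lambda>p. snd (snd (s p)))"
  proof (rule T.smooth_fun_Union[OF V.smooth_sectionD(1)[OF s]])
    fix p assume "p \<in> W"
    obtain W0 \<tau> where w: "(W0, \<tau>) \<in> btriv L" "fst p \<in> W0" using L.triv_cover by blast
    show "\<exists>N. open N \<and> p \<in> N \<and> smooth_fun TA (W \<inter> N) (\<lambda>p. snd (snd (s p)))"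
      by (rule exI[of _ "W0 \<times> UNIV"]) (use w *(2)[OF w(1)] L.triv_open[OF w(1)] in \<open>auto simp: mem_Times_iff intro: open_Times\<close>)
  qed
qed

lemma N_sectionI:
  assumes "open W" "\<And>p. p \<in> W \<Longrightarrow> s p \<in> fibre N p"
    "\<And>W0 \<tau>. (W0, \<tau>) \<in> btriv L \<Longrightarrow> smooth_fun TA (W \<inter> W0 \<times> UNIV) (\<lambda>p. \<tau> (fst (s p)) $ 1)"
  shows "smooth_section TA N W s"
  unfolding smooth_section_def
proof (intro conjI assms(1) ballI)
  fix p assume "p \<in> W" then show "s p \<in> fibre N p" by (rule assms(2))
next
  fix t assume "t \<in> btriv N"
  then obtain W0 \<tau> where w: "(W0, \<tau>) \<in> btriv L" and t: "t = (W0 \<times> UNIV, \<lambda>(l, z). \<tau> l)"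
    by (cases t) (auto elim: tensor_Ln_trivE)
  have op: "open (W \<inter> W0 \<times> UNIV)" using assms(1) L.triv_open[OF w] by (auto intro: open_Times)
  have "smooth_fun TA (W \<inter> W0 \<times> UNIV) (\<lambda>p. (\<lambda>(l, z). \<tau> l) (s p))"
    unfolding T.smooth_fun_vec_iff[OF op] forall_1 using assms(3)[OF w] by (simp add: case_prod_beta)
  then show "case t of (W', \<tau>) \<Rightarrow> smooth_fun TA (W \<inter> W') (\<tau> \<circ> s)" by (simp add: t o_def)
qed

lemma N_sectionD:
  assumes s: "smooth_section TA N W s" and w: "(W0, \<tau>) \<in> btriv L" 
  shows "smooth_fun TA (W \<inter> W0 \<times> UNIV) (\<lambda>p. \<tau> (fst (s p)) $ 1)"
proof -
  have op: "open (W \<inter> W0 \<times> UNIV)" using N.smooth_sectionD(1)[OF s] L.triv_open[OF w] by (auto intro: open_Times)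
  show ?thesis using N.smooth_sectionD(3)[OF s tensor_Ln_triv[OF w]] unfolding T.smooth_fun_vec_iff[OF op] forall_1
    by (simp add: case_prod_beta)
qed

lemma fibre_N_iff: "s \<in> fibre N p \<longleftrightarrow> fst s \<in> fibre L (fst p) \<and> snd s = snd p"
  by (cases s; cases p) simp

lemma fibre_V_iff: "s \<in> fibre V p \<longleftrightarrow> fst s \<in> fibre L (fst p) \<and> fst (snd s) = snd p"
  by (cases s; cases p) simp

lemma smooth_sum_incl: "smooth_section TA N W s \<Longrightarrow> smooth_section TA E W (\<lambda>q. sum_incl (s q))"
  unfolding smooth_section_E
  by (rule V_sectionI) (use N.smooth_sectionD(1,2) N_sectionD in \<open>auto simp: sum_incl_def case_prod_beta fibre_N_iff fibre_V_iff\<close>)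

lemma smooth_sum_fst: "smooth_section TA V W s \<Longrightarrow> smooth_section TA N W (\<lambda>q. sum_fst (s q))"
  by (rule N_sectionI) (use V.smooth_sectionD(1,2) V_sectionD in \<open>auto simp: sum_fst_def case_prod_beta fibre_N_iff fibre_V_iff\<close>)

lemma smooth_sum_snd: "smooth_section TA E W s \<Longrightarrow> smooth_section TA trivial_line W (\<lambda>q. sum_snd L (s q))"
  unfolding smooth_section_E
proof -
  assume s: "smooth_section TA V W s"
  have op: "open W" by (rule V.smooth_sectionD(1)[OF s])
  have "smooth_fun TA W (\<lambda>q. (\<lambda>(p, w). \<chi> i::1. w) (sum_snd L (s q)))"
    unfolding T.smooth_fun_vec_iff[OF op] forall_1 using V_sectionD(2)[OF s] by (simp add: sum_snd_def case_prod_beta)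
  moreover have "sum_snd L (s p) \<in> fibre trivial_line p" if "p \<in> W" for p
    using V.smooth_sectionD(2)[OF s that] by (cases "s p"; cases p) (auto simp: sum_snd_def fibre_def trivial_line_def)
  ultimately show ?thesis unfolding smooth_section_def using op by (auto simp: o_def)
qed

text \<open>
  The smooth lift to \<open>E\<close>, through the splitting, of the holomorphic section \<open>1\<close> of the trivial quotient.
\<close>

definition unit_section :: "'x \<times> complex \<Rightarrow> 'l \<times> complex \<times> complex" where
  "unit_section p = (bzero L (fst p), snd p, 1)"

lemma smooth_unit_section: "smooth_section TA E UNIV unit_section"
  unfolding smooth_section_E
proof (rule V_sectionI)
  fix W0 \<tau> assume w: "(W0, \<tau>) \<in> btriv L"
  have op: "open (UNIV \<inter> W0 \<times> (UNIV :: complex set))" using L.triv_open[OF w] by (auto intro: open_Times)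
  show "smooth_fun TA (UNIV \<inter> W0 \<times> UNIV) (\<lambda>p. \<tau> (fst (unit_section p)) $ 1)"
    by (rule T.smooth_fun_cong[OF op, THEN iffD1, OF _ T.smooth_fun_const[of _ 0]])
      (auto simp: unit_section_def L.triv_bzero[OF w])
qed (auto simp: unit_section_def fibre_V_iff L.bzero_fibre)

lemma dolbeault_trivial_line:
  assumes s: "smooth_section TA trivial_line W s" and c: "c \<in> TA" and p: "p \<in> fst c" "p \<in> W"
  shows "dolbeault trivial_line c v s p = (p, delbar c v (\<lambda>q. snd (s q)) p)"
proof -
  have "(\<lambda>(p, w). \<chi> i::1. w) (dolbeault trivial_line c v s p) $ 1 = delbar c v (\<lambda>q. (\<lambda>(p, w). \<chi> i::1. w) (s q) $ 1) p"
    by (rule Q.dolbeault_triv(2)[OF s c p]) auto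
  then show ?thesis using Q.dolbeault_triv(1)[OF s c p, of v]
    by (cases "dolbeault trivial_line c v s p") (auto simp: case_prod_beta)
qed

lemma sum_incl_hol: "holomorphic_bundle_map TA N E sum_incl"
  and sum_snd_hol: "holomorphic_bundle_map TA E trivial_line (sum_snd L)"
  using extension unfolding holomorphic_extension_def by auto

lemma dolbeault_incl:
  assumes "smooth_section TA N W s" "c \<in> TA" "p \<in> fst c" "p \<in> W"
  shows "dolbeault E c v (\<lambda>q. sum_incl (s q)) p = sum_incl (dolbeault N c v s p)"
  by (rule dolbeault_holomorphic_map[OF N.hol_vbundle_axioms E.hol_vbundle_axioms sum_incl_hol smooth_sum_incl assms, symmetric])

lemma dolbeault_snd:
  assumes "smooth_section TA E W s" "c \<in> TA" "p \<in> fst c" "p \<in> W"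
  shows "sum_snd L (dolbeault E c v s p) = dolbeault trivial_line c v (\<lambda>q. sum_snd L (s q)) p"
  by (rule dolbeault_holomorphic_map[OF E.hol_vbundle_axioms Q.hol_vbundle_axioms sum_snd_hol smooth_sum_snd assms])

text \<open>
  The second fundamental form of the extension: the failure of the lifted unit section to be holomorphic. It takes values in the subbundle because the projection to the quotient is holomorphic and maps the lift to the holomorphic section \<open>1\<close>.
\<close>

definition bform :: "('x \<times> complex, 2) chart \<Rightarrow> complex^2 \<Rightarrow> 'x \<times> complex \<Rightarrow> 'l" where
  "bform c v p = fst (dolbeault E c v unit_section p)"

lemma dolbeault_unit:
  assumes c: "c \<in> TA" and p: "p \<in> fst c"
  shows "dolbeault E c v unit_section p = (bform c v p, snd p, 0)" "bform c v p \<in> fibre L (fst p)"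
proof -
  note d = E.dolbeault_triv(1)[OF smooth_unit_section c p UNIV_I, of v, unfolded fibre_E fibre_V_iff]
  show "bform c v p \<in> fibre L (fst p)" using d by (simp add: bform_def)
  have "sum_snd L (dolbeault E c v unit_section p) = (p, delbar c v (\<lambda>q. snd (sum_snd L (unit_section q))) p)"
    unfolding dolbeault_snd[OF smooth_unit_section c p UNIV_I] 
    by (rule dolbeault_trivial_line[OF smooth_sum_snd[OF smooth_unit_section] c p UNIV_I])
  also have "delbar c v (\<lambda>q. snd (sum_snd L (unit_section q))) p = 0"
    by (simp add: unit_section_def sum_snd_def)
  finally have "snd (snd (dolbeault E c v unit_section p)) = 0" by (simp add: sum_snd_def case_prod_beta)
  then show "dolbeault E c v unit_section p = (bform c v p, snd p, 0)"
    using d by (simp add: bform_def prod_eq_iff)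
qed

text \<open>
  Every section is a section of the subbundle plus a function times the unit section, so the Leibniz rule gives the upper triangular shape of the operator with \<open>bform\<close> as its off-diagonal entry.
\<close>

lemma dolbeault_decomp:
  assumes s: "smooth_section TA V W s" and c: "c \<in> TA" and p: "p \<in> fst c" "p \<in> W"
  shows "dolbeault E c v s p = 
     (badd L (fst (dolbeault N c v (\<lambda>q. sum_fst (s q)) p)) (bscale L (snd (snd (s p))) (bform c v p)),
      snd p, delbar c v (\<lambda>q. snd (snd (s q))) p)"
proof -
  obtain W' \<tau> where w: "(W', \<tau>) \<in> btriv E" "p \<in> W'" using E.triv_cover by blast
  let ?i = "\<lambda>q. sum_incl (sum_fst (s q))" and ?w = "\<lambda>q. snd (snd (s q))"
  have i: "smooth_section TA E W ?i" by (rule smooth_sum_incl[OF smooth_sum_fst[OF s]])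
  have u: "smooth_section TA E W unit_section" 
    by (rule E.smooth_section_subset[OF smooth_unit_section V.smooth_sectionD(1)[OF s]]) auto
  have sw: "smooth_fun TA W ?w" by (rule V_sectionD(2)[OF s])
  have wu: "smooth_section TA E W (\<lambda>q. bscale E (?w q) (unit_section q))" by (rule E.smooth_section_bscale[OF u sw])
  have t: "smooth_section TA E W (\<lambda>q. badd E (?i q) (bscale E (?w q) (unit_section q)))" by (rule E.smooth_section_badd[OF i wu])
  have sE: "smooth_section TA E W s" using s by (simp add: smooth_section_E)
  have eq: "s q = badd E (?i q) (bscale E (?w q) (unit_section q))" if q: "q \<in> W" for q
  proof -
    obtain l z w' where sq: "s q = (l, z, w')" by (cases "s q") auto
    have "l \<in> fibre L (fst q)" using V.smooth_sectionD(2)[OF s q] by (simp add: sq fibre_V_iff)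
    then show ?thesis
      by (simp add: sq E_ops sum_incl_def sum_fst_def unit_section_def L.badd_bzero)
  qed
  note d = E.dolbeault_triv(1)[OF sE c p] E.dolbeault_triv(1)[OF i c p] E.dolbeault_triv(1)[OF u c p] E.smooth_sectionD(2)[OF u p(2)]
  have R: "dolbeault E c v s p = badd E (dolbeault E c v ?i p) (badd E (bscale E (delbar c v ?w p) (unit_section p)) (bscale E (?w p) (dolbeault E c v unit_section p)))"
  proof (rule E.triv_inj[OF w d(1)])
    show "badd E (dolbeault E c v ?i p) (badd E (bscale E (delbar c v ?w p) (unit_section p)) (bscale E (?w p) (dolbeault E c v unit_section p))) \<in> fibre E p"
      by (intro E.badd_fibre E.bscale_fibre d)
    have "\<tau> (dolbeault E c v s p) = \<tau> (dolbeault E c v (\<lambda>q. badd E (?i q) (bscale E (?w q) (unit_section q))) p)"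
      by (rule E.dolbeault_rules(5)[OF t c p w]) (rule eq)
    then show "\<tau> (dolbeault E c v s p) = \<tau> (badd E (dolbeault E c v ?i p) (badd E (bscale E (delbar c v ?w p) (unit_section p)) (bscale E (?w p) (dolbeault E c v unit_section p))))"
      unfolding E.dolbeault_rules(3)[OF i c p w wu t] E.dolbeault_rules(4)[OF u c p w sw wu] 
      by (simp only: E.triv_add(2)[OF w d(2) E.badd_fibre[OF E.bscale_fibre[OF d(4)] E.bscale_fibre[OF d(3)]]]
        E.triv_add(2)[OF w E.bscale_fibre[OF d(4)] E.bscale_fibre[OF d(3)]] E.triv_scale(2)[OF w d(4)] E.triv_scale(2)[OF w d(3)])
  qed
  have N: "dolbeault N c v (\<lambda>q. sum_fst (s q)) p \<in> fibre N p" by (rule N.dolbeault_triv(1)[OF smooth_sum_fst[OF s] c p])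
  then obtain l where l: "dolbeault N c v (\<lambda>q. sum_fst (s q)) p = (l, snd p)" "l \<in> fibre L (fst p)"
    by (cases "dolbeault N c v (\<lambda>q. sum_fst (s q)) p") (auto simp: fibre_N_iff)
  note b = dolbeault_unit[OF c p(1), of v]
  show ?thesis
    unfolding R dolbeault_incl[OF smooth_sum_fst[OF s] c p]  b(1) l(1)
    using l(2) L.badd_bzero(2)[OF L.bscale_fibre[OF b(2)]]
    by (simp add: E_ops sum_incl_def unit_section_def)
qed

lemma phi_alpha_eq:
  assumes "c \<in> A" "x \<in> fst c"
  shows "phi_alpha L \<phi> (prod_chart c) v (x, z) = (bscale L (cnj (v $ 2)) (\<phi> x), z)"
  unfolding phi_alpha_def by (simp add: dir_deriv_cnj_z[OF assms])

lemma dolbeault_matrixI: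
  assumes \<phi>: "\<And>x. \<phi> x \<in> fibre L x"
    and b: "\<And>c x z v. c \<in> A \<Longrightarrow> x \<in> fst c \<Longrightarrow> bform (prod_chart c) v (x, z) = bscale L (of_real (1 / (2 * sqrt 2)) * cnj (v $ 2)) (\<phi> x)"
  shows "dolbeault_matrix A L E \<phi>"
  unfolding dolbeault_matrix_def
proof (intro ballI allI impI)
  fix d W s p v assume d: "d \<in> TA" and s: "smooth_section TA V W s" and "p \<in> fst d \<inter> W"
  then have p: "p \<in> fst d" "p \<in> W" by auto
  obtain c where c: "c \<in> A" "d = prod_chart c" using d by (rule prod_chartE)
  obtain x z where xz: "p = (x, z)" "x \<in> fst c" using p c by (cases p) auto
  have N: "dolbeault N d v (\<lambda>q. sum_fst (s q)) p \<in> fibre N p" by (rule N.dolbeault_triv(1)[OF smooth_sum_fst[OF s] d p])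
  have w: "snd (sum_snd L (s p)) = snd (snd (s p))" by (simp add: sum_snd_def case_prod_beta)
  have 1: "sum_fst (dolbeault E d v s p) =
             badd N (dolbeault N d v (sum_fst \<circ> s) p)
               (bscale N (of_real (1 / (2 * sqrt 2)) * snd (sum_snd L (s p))) (phi_alpha L \<phi> d v p))"
    unfolding dolbeault_decomp[OF s d p] w unfolding c(2) xz(1) phi_alpha_eq[OF c(1) xz(2)] b[OF c(1) xz(2)]
    using N unfolding c(2) xz(1)
    by (cases "dolbeault N (prod_chart c) v (\<lambda>q. sum_fst (s q)) (x, z)")
      (simp add: sum_fst_def o_def L.bscale_bscale[OF \<phi>] mult_ac)
  have t: "smooth_section TA trivial_line W (\<lambda>q. sum_snd L (s q))" 
    by (rule smooth_sum_snd) (use s in \<open>simp add: smooth_section_E\<close>)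
  have "snd (sum_snd L (dolbeault E d v s p)) = delbar d v (\<lambda>q. snd (snd (s q))) p"
    unfolding dolbeault_decomp[OF s d p] by (simp add: sum_snd_def)
  have 2: "sum_snd L (dolbeault E d v s p) = dolbeault trivial_line d v (sum_snd L \<circ> s) p"
    unfolding o_def by (rule dolbeault_snd[OF _ d p]) (use s in \<open>simp add: smooth_section_E\<close>)
  show "sum_fst (dolbeault E d v s p) =
             badd N (dolbeault N d v (sum_fst \<circ> s) p)
               (bscale N (of_real (1 / (2 * sqrt 2)) * snd (sum_snd L (s p))) (phi_alpha L \<phi> d v p)) \<and>
           sum_snd L (dolbeault E d v s p) = dolbeault trivial_line d v (sum_snd L \<circ> s) p"
    using 1 2 by blast
qed

lemma dolbeault_matrixD:
  assumes D: "dolbeault_matrix A L E \<phi>" and \<phi>: "\<And>x. \<phi> x \<in> fibre L x" and c: "c \<in> A" and x: "x \<in> fst c"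
  shows "bform (prod_chart c) v (x, z) = bscale L (of_real (1 / (2 * sqrt 2)) * cnj (v $ 2)) (\<phi> x)"
proof -
  let ?d = "prod_chart c" and ?p = "(x, z)"
  have u: "smooth_section TA V UNIV unit_section" using smooth_unit_section by (simp add: smooth_section_E)
  have d: "?d \<in> TA" and p: "?p \<in> fst ?d" using c x by (auto intro: prod_chart_mem)
  have "sum_fst (dolbeault E ?d v unit_section ?p) =
             badd N (dolbeault N ?d v (sum_fst \<circ> unit_section) ?p)
               (bscale N (of_real (1 / (2 * sqrt 2)) * snd (sum_snd L (unit_section ?p))) (phi_alpha L \<phi> ?d v ?p))"
    using D d u p unfolding dolbeault_matrix_def by blast
  moreover have "dolbeault N ?d v (sum_fst \<circ> unit_section) ?p = (bzero L x, z)"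
  proof -
    note us = smooth_sum_fst[OF u]
    obtain W0 \<tau> where w: "(W0, \<tau>) \<in> btriv L" "x \<in> W0" using L.triv_cover by blast
    have pw: "?p \<in> W0 \<times> UNIV" using w by simp
    have op: "open (W0 \<times> (UNIV::complex set))" using L.triv_open[OF w(1)] by (auto intro: open_Times)
    have z: "(bzero L x, z) \<in> fibre N ?p" by (simp add: fibre_N_iff L.bzero_fibre)
    show ?thesis unfolding o_def
    proof (rule N.triv_inj[OF tensor_Ln_triv[OF w(1)] pw N.dolbeault_triv(1)[OF us d p UNIV_I] z])
      have "delbar ?d v (\<lambda>q. (\<lambda>(l, z). \<tau> l) (sum_fst (unit_section q)) $ j) ?p = delbar ?d v (\<lambda>q. 0) ?p" for j
        by (rule T.del_cong(2)[OF op d p pw]) (auto simp: sum_fst_def unit_section_def L.triv_bzero[OF w(1)])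
      then show "(\<lambda>(l, z). \<tau> l) (dolbeault N ?d v (\<lambda>q. sum_fst (unit_section q)) ?p) = (\<lambda>(l, z). \<tau> l) (bzero L x, z)"
        using N.dolbeault_triv(2)[OF us d p UNIV_I tensor_Ln_triv[OF w(1)] pw]
        by (simp add: vec_eq_iff L.triv_bzero[OF w])
    qed
  qed
  ultimately have "(bform ?d v ?p, z) = (badd L (bzero L x) (bscale L (of_real (1 / (2 * sqrt 2)) * cnj (v $ 2)) (\<phi> x)), z)"
    unfolding phi_alpha_eq[OF c x] dolbeault_unit(1)[OF d p]
    by (simp add: sum_fst_def sum_snd_def unit_section_def L.bscale_bscale[OF \<phi>])
  then show ?thesis by (simp add: L.badd_bzero(2)[OF L.bscale_fibre[OF \<phi>]])
qed

lemma bform_smult: 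
  assumes c: "c \<in> TA" and p: "p \<in> fst c"
  shows "bform c (k *s v) p = bscale L (cnj k) (bform c v p)"
    "bform c (u + v) p = badd L (bform c u p) (bform c v p)"
proof -
  obtain W' \<tau> where w: "(W', \<tau>) \<in> btriv E" "p \<in> W'" using E.triv_cover by blast
  note f = E.dolbeault_triv(1)[OF smooth_unit_section c p UNIV_I]
  have "dolbeault E c (k *s v) unit_section p = bscale E (cnj k) (dolbeault E c v unit_section p)"
    by (rule E.triv_inj[OF w f E.bscale_fibre[OF f]])
      (simp add: E.triv_scale(2)[OF w f] E.dolbeault_rules(2)[OF smooth_unit_section c p UNIV_I w])
  then show "bform c (k *s v) p = bscale L (cnj k) (bform c v p)"
    unfolding dolbeault_unit(1)[OF c p] by (simp add: E_ops)
  have "dolbeault E c (u + v) unit_section p = badd E (dolbeault E c u unit_section p) (dolbeault E c v unit_section p)"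
    by (rule E.triv_inj[OF w f E.badd_fibre[OF f f]])
      (simp add: E.triv_add(2)[OF w f f] E.dolbeault_rules(1)[OF smooth_unit_section c p UNIV_I w])
  then show "bform c (u + v) p = badd L (bform c u p) (bform c v p)"
    unfolding dolbeault_unit(1)[OF c p] by (simp add: E_ops)
qed

end

section \<open>Equivariant holomorphic structures and invariant metrics\<close>

context extension_bundle begin

lemma se2_act_simps:
  "e \<in> fibre V p \<Longrightarrow> se2_act L (a, u) e \<in> fibre V (fst p, a + u * snd p)"
  "e \<in> fibre V p \<Longrightarrow> e' \<in> fibre V p \<Longrightarrow> se2_act L (a, u) (badd V e e') = badd V (se2_act L (a, u) e) (se2_act L (a, u) e')"
  "e \<in> fibre V p \<Longrightarrow> se2_act L (a, u) (bscale V k e) = bscale V k (se2_act L (a, u) e)"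
  by (cases e; cases e'; cases p; force simp: se2_act_def L.bscale_fibre L.bscale_badd L.bscale_bscale mult.commute)+

lemma se2_act_unit: "se2_act L (a, u) (unit_section p) = unit_section (fst p, a + u * snd p)"
  by (simp add: se2_act_def unit_section_def)

lemma bounded_linear_emb: "bounded_linear (\<lambda>v::complex^2. \<chi> i::2+2. case i of Inl j \<Rightarrow> v $ j | Inr m \<Rightarrow> 0)"
  by (rule linear_conv_bounded_linear[THEN iffD1]) (auto simp: linear_iff vec_eq_iff split: sum.splits)

lemma action_matrix_holomorphic:
  assumes act: "holo_map (total_atlas TA E) (total_atlas TA E) F"
    and d: "d \<in> TA" and p: "p \<in> fst d" and w1: "(W1, \<tau>1) \<in> btriv E" "p \<in> W1" and w2: "(W2, \<tau>2) \<in> btriv E" 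
    and Fp: "bproj E (F (of_triv E \<tau>1 a p)) \<in> fst d" "bproj E (F (of_triv E \<tau>1 a p)) \<in> W2"
  shows "\<exists>T. (in_chart d (\<lambda>q. \<tau>2 (F (of_triv E \<tau>1 a q)) $ j) has_derivative T) (at (snd d p)) \<and> (\<forall>k v. T (k *s v) = k * T v)"
proof -
  define \<Phi> where "\<Phi> \<tau> e = (\<chi> i::2+2. case i of Inl j \<Rightarrow> snd d (bproj E e) $ j | Inr k \<Rightarrow> \<tau> e $ k)" 
    for \<tau> :: "'l \<times> complex \<times> complex \<Rightarrow> complex^2" and e
  define C where "C W \<tau> = (bproj E -` (fst d \<inter> W), \<Phi> \<tau>)" for W \<tau>
  have C: "C W \<tau> \<in> total_atlas TA E" if "(W, \<tau>) \<in> btriv E" for W \<tau>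
    unfolding total_atlas_def C_def \<Phi>_def[abs_def] using d that by (cases d) auto
  define \<kappa> where "\<kappa> y = (\<chi> i::2+2. case i of Inl j \<Rightarrow> y $ j | Inr m \<Rightarrow> a $ m)" for y :: "complex^2"
  define \<kappa>' where "\<kappa>' v = (\<chi> i::2+2. case i of Inl j \<Rightarrow> v $ j | Inr m \<Rightarrow> 0)" for v :: "complex^2"
  let ?e = "of_triv E \<tau>1 a"
  have e: "bproj E (?e q) = q" "\<tau>1 (?e q) = a" if "q \<in> W1" for q 
    using E.of_triv[OF w1(1) that, of a] by (auto simp: E.of_triv fibre_def E_ops)
  have \<kappa>: "\<Phi> \<tau>1 (?e q) = \<kappa> (snd d q)" if "q \<in> W1" for q
    unfolding \<Phi>_def \<kappa>_def e[OF that] ..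
  have d\<kappa>: "(\<kappa> has_derivative \<kappa>') (at y)" for y
  proof -
    have "((\<lambda>y. \<kappa>' y + \<kappa> 0) has_derivative \<kappa>') (at y)"
      unfolding \<kappa>'_def[abs_def] by (rule has_derivative_add_const[OF bounded_linear_imp_has_derivative[OF bounded_linear_emb]])
    moreover have "(\<lambda>y. \<kappa>' y + \<kappa> 0) = \<kappa>" by (auto simp: fun_eq_iff vec_eq_iff \<kappa>_def \<kappa>'_def split: sum.splits)
    ultimately show ?thesis by simp
  qed
  let ?D = "fst (C W1 \<tau>1) \<inter> F -` fst (C W2 \<tau>2)"
  have "cholomorphic_on (snd (C W1 \<tau>1) ` ?D) (in_chart (C W1 \<tau>1) (snd (C W2 \<tau>2) \<circ> F))"
    using act C[OF w1(1)] C[OF w2(1)] unfolding holo_map_def by (cases "C W1 \<tau>1"; cases "C W2 \<tau>2") fastforce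
  moreover have "?e p \<in> ?D" using p w1 Fp by (auto simp: C_def e)
  ultimately have "\<exists>f'. (in_chart (C W1 \<tau>1) (snd (C W2 \<tau>2) \<circ> F) has_derivative f') (at (snd (C W1 \<tau>1) (?e p))) \<and>
     (\<forall>k v. f' (k *s v) = k *s f' v)"
    unfolding cholomorphic_on_def by blast
  moreover have "snd (C W1 \<tau>1) (?e p) = \<Phi> \<tau>1 (?e p)" by (simp add: C_def)
  ultimately obtain f' where f': "(in_chart (C W1 \<tau>1) (snd (C W2 \<tau>2) \<circ> F) has_derivative f') (at (\<Phi> \<tau>1 (?e p)))"
     "\<And>k v. f' (k *s v) = k *s f' v"
    by metis
  have inv: "inv_into (fst (C W1 \<tau>1)) (\<Phi> \<tau>1) (\<Phi> \<tau>1 (?e q)) = ?e q" if q: "q \<in> fst d" "q \<in> W1" for q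
  proof (rule inv_into_f_f)
    show "inj_on (\<Phi> \<tau>1) (fst (C W1 \<tau>1))"
    proof (rule inj_onI)
      fix x y assume x: "x \<in> fst (C W1 \<tau>1)" and y: "y \<in> fst (C W1 \<tau>1)" and eq: "\<Phi> \<tau>1 x = \<Phi> \<tau>1 y"
      have "snd d (bproj E x) $ j = snd d (bproj E y) $ j" for j
        using arg_cong[OF eq, of "\<lambda>v. v $ Inl j"] by (simp add: \<Phi>_def)
      then have "snd d (bproj E x) = snd d (bproj E y)" by (simp add: vec_eq_iff)
      then have b: "bproj E x = bproj E y" using T.chart_inj[OF d] x y by (auto simp: inj_on_def C_def)
      have "\<tau>1 x $ j = \<tau>1 y $ j" for j
        using arg_cong[OF eq, of "\<lambda>v. v $ Inr j"] by (simp add: \<Phi>_def)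
      then have "\<tau>1 x = \<tau>1 y" by (simp add: vec_eq_iff)
      moreover have "x \<in> fibre E (bproj E x)" "y \<in> fibre E (bproj E x)" unfolding fibre_def using b by simp_all
      moreover have "bproj E x \<in> W1" using x by (simp add: C_def)
      ultimately show "x = y" using E.triv_inj[OF w1(1)] by blast
    qed
    show "?e q \<in> fst (C W1 \<tau>1)" using q by (simp add: C_def e)
  qed
  have "((\<lambda>y. in_chart (C W1 \<tau>1) (snd (C W2 \<tau>2) \<circ> F) (\<kappa> y)) has_derivative (\<lambda>v. f' (\<kappa>' v))) (at (snd d p))"
    by (rule has_derivative_compose[OF d\<kappa>]) (rule f'(1)[unfolded \<kappa>[OF w1(2)]])
  then have D: "((\<lambda>y. in_chart (C W1 \<tau>1) (snd (C W2 \<tau>2) \<circ> F) (\<kappa> y) $ Inr j) has_derivative (\<lambda>v. f' (\<kappa>' v) $ Inr j)) (at (snd d p))"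
    by (rule bounded_linear.has_derivative[OF bounded_linear_vec_nth])
  have op: "open (snd d ` (fst d \<inter> W1))" by (rule T.open_chart_image[OF d E.triv_open[OF w1(1)]])
  have "(in_chart d (\<lambda>q. \<tau>2 (F (?e q)) $ j) has_derivative (\<lambda>v. f' (\<kappa>' v) $ Inr j)) (at (snd d p))"
  proof (rule has_derivative_transform_within_open[OF D op])
    show "snd d p \<in> snd d ` (fst d \<inter> W1)" using p w1 by blast
    fix y assume "y \<in> snd d ` (fst d \<inter> W1)"
    then obtain q where q: "q \<in> fst d" "q \<in> W1" "y = snd d q" by blast
    have "in_chart (C W1 \<tau>1) (snd (C W2 \<tau>2) \<circ> F) (\<kappa> y) = \<Phi> \<tau>2 (F (?e q))"
      unfolding q(3) \<kappa>[OF q(2), symmetric] using inv[OF q(1,2)] by (simp add: in_chart_def C_def)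
    then show "in_chart (C W1 \<tau>1) (snd (C W2 \<tau>2) \<circ> F) (\<kappa> y) $ Inr j = in_chart d (\<lambda>q. \<tau>2 (F (?e q)) $ j) y"
      by (simp add: \<Phi>_def q T.in_chart_at[OF d q(1)])
  qed
  moreover have "\<kappa>' (k *s v) = k *s \<kappa>' v" for k v by (auto simp: \<kappa>'_def vec_eq_iff split: sum.splits)
  ultimately show ?thesis using f'(2) by (intro exI[of _ "\<lambda>v. f' (\<kappa>' v) $ Inr j"]) simp
qed

lemma has_derivative_base_action:
  assumes c: "c \<in> A" and x: "x \<in> fst c" and f: "smooth_fun TA W f" and p: "(x, a + u * z) \<in> W" and W: "open W"
  shows "(in_chart (prod_chart c) (\<lambda>q. f (fst q, a + u * snd q)) has_derivative 
    (\<lambda>v. dir_deriv (prod_chart c) (vector [v $ 1, u * v $ 2]) f (x, a + u * z))) (at (snd (prod_chart c) (x, z)))"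
proof -
  let ?d = "prod_chart c" and ?p' = "(x, a + u * z)"
  let ?G = "\<lambda>y::complex^2. vector [y $ 1, a + u * y $ 2] :: complex^2"
  have G: "?G (snd ?d (x, z)) = snd ?d ?p'" by (simp add: snd_prod_chart)
  have dG: "(?G has_derivative (\<lambda>v. vector [v $ 1, u * v $ 2])) (at y)" for y
    by (rule has_derivative_vector_2) (auto intro!: derivative_eq_intros bounded_linear_imp_has_derivative[OF bounded_linear_vec_nth])
  have "((\<lambda>y. in_chart ?d f (?G y)) has_derivative 
    (\<lambda>v. dir_deriv ?d (vector [v $ 1, u * v $ 2]) f ?p')) (at (snd ?d (x, z)))"
    by (rule has_derivative_compose[OF dG]) (unfold G, rule T.has_dir_deriv[OF f prod_chart_mem[OF c]], use x p in auto)
  then show ?thesis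
  proof (rule has_derivative_transform_within_open)
    show "open (snd ?d ` (fst c \<times> UNIV))" using open_prod_chart_image[OF c open_UNIV] by simp
    show "snd ?d (x, z) \<in> snd ?d ` (fst c \<times> UNIV)" using x by blast
    fix y assume "y \<in> snd ?d ` (fst c \<times> UNIV)"
    then have y: "vec (y $ 1) \<in> snd c ` fst c" unfolding prod_chart_image by simp
    then have y': "vec (?G y $ 1) \<in> snd c ` fst c" by simp
    show "in_chart ?d f (?G y) = in_chart ?d (\<lambda>q. f (fst q, a + u * snd q)) y"
      unfolding in_prod_chart[OF c y] in_prod_chart[OF c y'] by simp
  qed
qed

text \<open>
  A group element fixes the unit section and acts holomorphically, hence it carries the second fundamental form at a point to the one at the image point; on the line \<open>L\<^sub>-\<^sub>1\<close> it acts by the inverse of \<open>u\<close>.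
\<close>

lemma bform_equivariant:
  assumes act: "holo_map (total_atlas TA E) (total_atlas TA E) (se2_act L (a, u))"
    and c: "c \<in> A" and x: "x \<in> fst c"
  shows "bform (prod_chart c) (vector [v $ 1, u * v $ 2]) (x, a + u * z) = bscale L (u powi (-1)) (bform (prod_chart c) v (x, z))"
proof -
  let ?d = "prod_chart c" and ?p = "(x, z)" and ?p' = "(x, a + u * z)" and ?F = "se2_act L (a, u)"
  let ?g = "\<lambda>q::'x \<times> complex. (fst q, a + u * snd q)"
  have d: "?d \<in> TA" and p: "?p \<in> fst ?d" and p': "?p' \<in> fst ?d" using c x by (auto intro: prod_chart_mem)
  obtain W1 \<tau>1 where w1: "(W1, \<tau>1) \<in> btriv E" "?p \<in> W1" using E.triv_cover by blast
  obtain W2 \<tau>2 where w2: "(W2, \<tau>2) \<in> btriv E" "?p' \<in> W2" using E.triv_cover by blast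
  define M where "M k q = \<tau>2 (?F (of_triv E \<tau>1 (axis k 1) q))" for k q
  have Ff: "?F e \<in> fibre E (?g q)" if "e \<in> fibre E q" for e q using se2_act_simps(1) that by simp
  have Flin: "\<tau>2 (?F e) = (\<Sum>k\<in>UNIV. \<tau>1 e $ k *s M k q)" if q: "q \<in> W1" "?g q \<in> W2" "e \<in> fibre E q" for e q
    unfolding M_def
  proof (rule E.triv_transition[OF w1(1) q(1,3)])
    fix e1 e2 assume e: "e1 \<in> fibre E q" "e2 \<in> fibre E q"
    show "\<tau>2 (?F (badd E e1 e2)) = \<tau>2 (?F e1) + \<tau>2 (?F e2)"
      using E.triv_add(2)[OF w2(1) q(2) Ff[OF e(1)] Ff[OF e(2)]] se2_act_simps(2)[of e1 q e2] e by (simp add: E_ops)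
  next
    fix k e1 assume e: "e1 \<in> fibre E q"
    show "\<tau>2 (?F (bscale E k e1)) = k *s \<tau>2 (?F e1)"
      using E.triv_scale(2)[OF w2(1) q(2) Ff[OF e]] se2_act_simps(3)[of e1 q a u k] e by (simp add: E_ops)
  qed
  have "\<exists>T. (in_chart ?d (\<lambda>q. M k q $ j) has_derivative T) (at (snd ?d ?p)) \<and> (\<forall>k v. T (k *s v) = k * T v)" for k j
    unfolding M_def
  proof (rule action_matrix_holomorphic[OF act d p w1 w2(1)])
    have "bproj E (?F (of_triv E \<tau>1 (axis k 1) ?p)) = ?p'"
      using Ff[OF E.of_triv(1)[OF w1]] by (auto simp: fibre_def E_ops)
    then show "bproj E (?F (of_triv E \<tau>1 (axis k 1) ?p)) \<in> fst ?d" "bproj E (?F (of_triv E \<tau>1 (axis k 1) ?p)) \<in> W2"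
      using p' w2 by simp_all
  qed
  then obtain T where T: "\<And>k j. (in_chart ?d (\<lambda>q. M k q $ j) has_derivative T k j) (at (snd ?d ?p))" 
    "\<And>k j a v. T k j (a *s v) = a * T k j v" by metis
  define t where "t k q = \<tau>1 (unit_section q) $ k" for k q
  have st: "smooth_fun TA W1 (t k)" for k unfolding t_def[abs_def]
    using T.smooth_fun_vec_nth[OF E.smooth_sectionD(3)[OF smooth_unit_section w1(1)]] E.triv_open[OF w1(1)] by simp
  define s where "s j q = \<tau>2 (unit_section q) $ j" for j q
  have ss: "smooth_fun TA W2 (s j)" for j unfolding s_def[abs_def]
    using T.smooth_fun_vec_nth[OF E.smooth_sectionD(3)[OF smooth_unit_section w2(1)]] E.triv_open[OF w2(1)] by simp
  have D1: "(in_chart ?d (\<lambda>q. s j (?g q)) has_derivative 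
    (\<lambda>v. dir_deriv ?d (vector [v $ 1, u * v $ 2]) (s j) ?p')) (at (snd ?d ?p))" for j
    by (rule has_derivative_base_action[OF c x ss w2(2) E.triv_open[OF w2(1)]])
  have D2: "((\<lambda>y. \<Sum>k\<in>UNIV. in_chart ?d (t k) y * in_chart ?d (\<lambda>q. M k q $ j) y) has_derivative 
    (\<lambda>v. \<Sum>k\<in>UNIV. t k ?p * T k j v + dir_deriv ?d v (t k) ?p * M k ?p $ j)) (at (snd ?d ?p))" for j
  proof (rule has_derivative_sum)
    fix k
    show "((\<lambda>y. in_chart ?d (t k) y * in_chart ?d (\<lambda>q. M k q $ j) y) has_derivative 
      (\<lambda>v. t k ?p * T k j v + dir_deriv ?d v (t k) ?p * M k ?p $ j)) (at (snd ?d ?p))"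
      using has_derivative_mult[OF T.has_dir_deriv[OF st d p w1(2)] T(1)] unfolding T.in_chart_at[OF d p] .
  qed
  have D3: "(in_chart ?d (\<lambda>q. s j (?g q)) has_derivative 
    (\<lambda>v. \<Sum>k\<in>UNIV. t k ?p * T k j v + dir_deriv ?d v (t k) ?p * M k ?p $ j)) (at (snd ?d ?p))" for j
  proof (rule has_derivative_transform_within_open[OF D2])
    have "continuous_on UNIV ?g" by (intro continuous_intros)
    then have "open (?g -` W2)" by (rule open_vimage[OF E.triv_open[OF w2(1)]])
    then have op: "open (W1 \<inter> ?g -` W2)" using E.triv_open[OF w1(1)] by auto
    show "open (snd ?d ` (fst ?d \<inter> (W1 \<inter> ?g -` W2)))" by (rule T.open_chart_image[OF d op])
    show "snd ?d ?p \<in> snd ?d ` (fst ?d \<inter> (W1 \<inter> ?g -` W2))" using p w1 w2 by (intro imageI) auto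
    fix y assume "y \<in> snd ?d ` (fst ?d \<inter> (W1 \<inter> ?g -` W2))"
    then obtain q where q: "q \<in> fst ?d" "q \<in> W1" "?g q \<in> W2" "y = snd ?d q" by blast
    have "unit_section q \<in> fibre E q" using E.smooth_sectionD(2)[OF smooth_unit_section] by blast
    from Flin[OF q(2,3) this]
    show "(\<Sum>k\<in>UNIV. in_chart ?d (t k) y * in_chart ?d (\<lambda>q. M k q $ j) y) = in_chart ?d (\<lambda>q. s j (?g q)) y"
      unfolding q(4) T.in_chart_at[OF d q(1)] se2_act_unit by (simp add: t_def s_def)
  qed
  have eq: "dir_deriv ?d (vector [v $ 1, u * v $ 2]) (s j) ?p' = (\<Sum>k\<in>UNIV. t k ?p * T k j v + dir_deriv ?d v (t k) ?p * M k ?p $ j)" for v j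
    using fun_cong[OF has_derivative_unique[OF D1 D3]] .
  have iv: "\<i> *s (vector [v $ 1, u * v $ 2] :: complex^2) = vector [(\<i> *s v) $ 1, u * (\<i> *s v) $ 2]" for v
    by (simp add: vec2_eq_iff)
  have db: "delbar ?d (vector [v $ 1, u * v $ 2]) (s j) ?p' = (\<Sum>k\<in>UNIV. delbar ?d v (t k) ?p * M k ?p $ j)" for j
    unfolding delbar_def iv eq T(2) 
    by (simp add: sum_divide_distrib[symmetric] sum_distrib_left sum.distrib[symmetric] algebra_simps)
  have uf: "dolbeault E ?d v unit_section ?p \<in> fibre E ?p" for v by (rule E.dolbeault_triv(1)[OF smooth_unit_section d p UNIV_I])
  have "dolbeault E ?d (vector [v $ 1, u * v $ 2]) unit_section ?p' = ?F (dolbeault E ?d v unit_section ?p)"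
  proof (rule E.triv_inj[OF w2 E.dolbeault_triv(1)[OF smooth_unit_section d p' UNIV_I]])
    show "?F (dolbeault E ?d v unit_section ?p) \<in> fibre E ?p'" using Ff[OF uf] by simp
    show "\<tau>2 (dolbeault E ?d (vector [v $ 1, u * v $ 2]) unit_section ?p') = \<tau>2 (?F (dolbeault E ?d v unit_section ?p))"
      using db Flin[OF w1(2) _ uf] w2(2)
      by (simp add: vec_eq_iff E.dolbeault_triv(2)[OF smooth_unit_section d p' UNIV_I w2] 
          E.dolbeault_triv(2)[OF smooth_unit_section d p UNIV_I w1] s_def[abs_def] t_def[abs_def])
  qed
  then show ?thesis unfolding dolbeault_unit(1)[OF d p] dolbeault_unit(1)[OF d p'] by (simp add: se2_act_def)
qed

text \<open>
  Translations make the second fundamental form independent of \<open>z\<close>. A rotation by \<open>u\<close> multiplies its values by the inverse of \<open>u\<close>; the antilinear form \<open>d(cnj z)\<close> scales in the same way, whereas forms pulled back from \<open>X\<close> do not, so only the \<open>d(cnj z)\<close>-component survives. Its coefficient is a section of \<open>L\<close>, and \<open>delbar\<^sup>2 = 0\<close> makes it holomorphic.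
\<close>

theorem equivariant_dolbeault:
  assumes eq: "se2_equivariant A L E"
  shows "\<exists>\<phi>. holomorphic_section A L \<phi> \<and> dolbeault_matrix A L E \<phi>"
proof -
  have act: "holo_map (total_atlas TA E) (total_atlas TA E) (se2_act L (a, u))" if "cmod u = 1" for a u
    using eq that unfolding se2_equivariant_def biholomorphic_def SE2_def by auto
  have B: "bform (prod_chart c) (vector [v $ 1, u * v $ 2]) (x, a + u * z) = bscale L (u powi (-1)) (bform (prod_chart c) v (x, z))"
    if "cmod u = 1" "c \<in> A" "x \<in> fst c" for u c x v a z
    by (rule bform_equivariant[OF act[OF that(1)] that(2,3)])
  have bf: "bform (prod_chart c) v (x, z) \<in> fibre L x" if "c \<in> A" "x \<in> fst c" for c x v z
    using dolbeault_unit(2)[of "prod_chart c" "(x, z)"] that by (simp add: prod_chart_mem)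
  \<comment> \<open>the rotation by \<open>-1\<close> about \<open>z\<close>\<close>
  have horizontal: "bform (prod_chart c) (vector [1, 0]) (x, z) = bzero L x" if c: "c \<in> A" "x \<in> fst c" for c x z
  proof -
    obtain W \<tau> where w: "(W, \<tau>) \<in> btriv L" "x \<in> W" using L.triv_cover by blast
    have "bform (prod_chart c) (vector [1, 0]) (x, z) = bscale L (-1) (bform (prod_chart c) (vector [1, 0]) (x, z))"
      using B[of "-1" c x "vector [1, 0]" "2 * z" z] c by simp
    then have "\<tau> (bform (prod_chart c) (vector [1, 0]) (x, z)) = (-1) *s \<tau> (bform (prod_chart c) (vector [1, 0]) (x, z))"
      by (metis L.triv_scale(2)[OF w bf[OF c]])
    then have "\<tau> (bform (prod_chart c) (vector [1, 0]) (x, z)) = 0" by (simp add: vec_eq_iff)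
    then show ?thesis by (intro L.triv_inj[OF w bf[OF c] L.bzero_fibre]) (simp add: L.triv_bzero[OF w])
  qed
  have transl: "bform (prod_chart c) v (x, z) = bform (prod_chart c) v (x, 0)" if c: "c \<in> A" "x \<in> fst c" for c x z v
    using B[of 1 c x v z 0] c by (simp add: L.bscale_one[OF bf[OF c]])
  have bv: "bform (prod_chart c) v (x, z) = bscale L (cnj (v $ 2)) (bform (prod_chart c) (vector [0, 1]) (x, 0))"
    if c: "c \<in> A" "x \<in> fst c" for c x z v
  proof -
    have d: "prod_chart c \<in> TA" "(x, z) \<in> fst (prod_chart c)" using c by (auto intro: prod_chart_mem)
    have v: "v = v $ 1 *s vector [1, 0] + v $ 2 *s vector [0, 1]" by (simp add: vec2_eq_iff)
    have "bform (prod_chart c) v (x, z) = badd L (bscale L (cnj (v $ 1)) (bform (prod_chart c) (vector [1, 0]) (x, z)))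
       (bscale L (cnj (v $ 2)) (bform (prod_chart c) (vector [0, 1]) (x, z)))"
      by (subst v) (simp only: bform_smult[OF d])
    then show ?thesis
      by (simp add: horizontal[OF c] L.badd_bzero(2)[OF L.bscale_fibre[OF bf[OF c]]] transl[OF c, of _ z])
  qed
  have chart_indep: "bform (prod_chart c) (vector [0, 1]) (x, z) = bform (prod_chart c') (vector [0, 1]) (x, z)"
    if c: "c \<in> A" "x \<in> fst c" and c': "c' \<in> A" "x \<in> fst c'" for c c' x z
  proof -
    have d: "prod_chart c \<in> TA" "(x, z) \<in> fst (prod_chart c)" and d': "prod_chart c' \<in> TA" "(x, z) \<in> fst (prod_chart c')" 
      using c c' by (auto intro: prod_chart_mem)
    obtain W' \<tau> where w: "(W', \<tau>) \<in> btriv E" "(x, z) \<in> W'" using E.triv_cover by blast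
    have "dir_deriv c (vec 0) (snd c') x = 0"
      using transition_has_derivative(2)[OF c(1) c'(1) c(2) c'(2), of 0 "vec 0"] by simp
    then have v: "dir_deriv (prod_chart c) (vector [0, 1]) (snd (prod_chart c')) (x, z) = vector [0, 1]"
      using T.dir_derivI[OF prod_transition_has_derivative[OF c(1) c'(1) c(2) c'(2), of z], of "vector [0, 1]"] by simp
    have "\<tau> (dolbeault E (prod_chart c') (vector [0, 1]) unit_section (x, z)) = \<tau> (dolbeault E (prod_chart c) (vector [0, 1]) unit_section (x, z))"
      using E.dolbeault_rules(6)[OF smooth_unit_section d UNIV_I w d', of "vector [0, 1]"] unfolding v .
    then have "dolbeault E (prod_chart c') (vector [0, 1]) unit_section (x, z) = dolbeault E (prod_chart c) (vector [0, 1]) unit_section (x, z)"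
      by (rule E.triv_inj[OF w E.dolbeault_triv(1)[OF smooth_unit_section d' UNIV_I] E.dolbeault_triv(1)[OF smooth_unit_section d UNIV_I]])
    then show ?thesis by (simp add: bform_def)
  qed
  define \<phi> where "\<phi> x = bscale L (of_real (2 * sqrt 2)) (bform (prod_chart (SOME c. c \<in> A \<and> x \<in> fst c)) (vector [0, 1]) (x, 0))" for x
  have \<phi>: "\<phi> x = bscale L (of_real (2 * sqrt 2)) (bform (prod_chart c) (vector [0, 1]) (x, 0))" if c: "c \<in> A" "x \<in> fst c" for c x
  proof -
    have s: "(SOME c. c \<in> A \<and> x \<in> fst c) \<in> A \<and> x \<in> fst (SOME c. c \<in> A \<and> x \<in> fst c)"
      by (rule someI[of "\<lambda>c. c \<in> A \<and> x \<in> fst c" c]) (use c in blast)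
    show ?thesis unfolding \<phi>_def by (simp only: chart_indep[OF conjunct1[OF s] conjunct2[OF s] c])
  qed
  have \<phi>f: "\<phi> x \<in> fibre L x" for x
  proof -
    obtain c where c: "c \<in> A" "x \<in> fst c" using chart_cover by blast
    show ?thesis unfolding \<phi>[OF c] by (rule L.bscale_fibre[OF bf[OF c]])
  qed
  have DM: "dolbeault_matrix A L E \<phi>"
  proof (rule dolbeault_matrixI[OF \<phi>f])
    fix c x z v assume c: "c \<in> A" "x \<in> fst c"
    have "of_real (1 / (2 * sqrt 2)) * k * of_real (2 * sqrt 2) = (k::complex)" for k by simp
    then show "bform (prod_chart c) v (x, z) = bscale L (of_real (1 / (2 * sqrt 2)) * cnj (v $ 2)) (\<phi> x)"
      unfolding \<phi>[OF c] bv[OF c, of v z] by (simp add: L.bscale_bscale[OF bf[OF c]])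
  qed
  have "holo_fun A W (\<lambda>x. \<tau> (\<phi> x))" if w: "(W, \<tau>) \<in> btriv L" for W \<tau>
  proof -
    have opW: "open W" by (rule L.triv_open[OF w])
    define S where "S c q = dolbeault E (prod_chart c) (vector [0, 1]) unit_section q" for c q
    define F where "F c q = \<tau> (fst (S c q)) $ 1" for c q
    have S: "smooth_section TA V (fst c \<times> UNIV) (S c)" if c: "c \<in> A" for c
      using E.smooth_section_dolbeault[OF smooth_unit_section prod_chart_mem[OF c], of "vector [0, 1]"]
      unfolding S_def[abs_def] smooth_section_E by simp
    have F: "smooth_fun TA (fst c \<times> UNIV \<inter> W \<times> UNIV) (F c)" if c: "c \<in> A" for c
      unfolding F_def[abs_def] by (rule V_sectionD(1)[OF S[OF c] w])
    have \<tau>\<phi>: "\<tau> (\<phi> x) $ 1 = of_real (2 * sqrt 2) * F c (x, 0)" if c: "c \<in> A" "x \<in> fst c" and x: "x \<in> W" for c x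
      unfolding \<phi>[OF c] L.triv_scale(2)[OF w x bf[OF c]] by (simp add: F_def S_def bform_def)
    have opc: "open (fst c \<inter> W)" if "c \<in> A" for c using chart_open[OF that] opW by auto
    have sl: "smooth_fun A (fst c \<inter> W) (\<lambda>x. F c (x, 0))" if c: "c \<in> A" for c
      by (rule smooth_fun_slice[OF F[OF c] opc[OF c]]) auto
    have sm1: "smooth_fun A (fst c \<inter> W) (\<lambda>x. \<tau> (\<phi> x) $ 1)" if c: "c \<in> A" for c
      by (rule smooth_fun_cong[OF opc[OF c], THEN iffD1, OF _ smooth_fun_mult[OF smooth_fun_const sl[OF c] opc[OF c]]])
        (use \<tau>\<phi>[OF c] in auto)
    have sm: "smooth_fun A W (\<lambda>x. \<tau> (\<phi> x))"
      unfolding smooth_fun_vec_iff[OF opW] forall_1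
    proof (rule smooth_fun_Union[OF opW])
      fix x assume "x \<in> W"
      obtain c where c: "c \<in> A" "x \<in> fst c" using chart_cover by blast
      show "\<exists>N. open N \<and> x \<in> N \<and> smooth_fun A (W \<inter> N) (\<lambda>x. \<tau> (\<phi> x) $ 1)"
        using sm1[OF c(1)] chart_open[OF c(1)] c(2) by (auto simp: Int_commute)
    qed
    show ?thesis
    proof (rule holo_funI[OF sm])
      fix c x and v :: "complex^1" and j :: 1 assume c: "c \<in> A" "x \<in> fst c" and x: "x \<in> W"
      let ?d = "prod_chart c" and ?w = "vector [v $ 1, 0] :: complex^2" and ?p = "(x, 0::complex)"
      have d: "?d \<in> TA" "?p \<in> fst ?d" using c by (auto intro: prod_chart_mem)
      have xi: "x \<in> fst c \<inter> W" using c x by simp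
      have pF: "?p \<in> fst c \<times> UNIV \<inter> W \<times> UNIV" using c x by simp
      have iv: "\<i> *s ?w = vector [(\<i> *s v) $ 1, 0]" by (simp add: vec2_eq_iff)
      have "delbar c v (\<lambda>x. \<tau> (\<phi> x) $ 1) x = delbar c v (\<lambda>x. of_real (2 * sqrt 2) * F c (x, 0)) x"
        by (rule del_cong(2)[OF opc[OF c(1)] c xi]) (use \<tau>\<phi>[OF c(1)] in auto)
      also have "\<dots> = of_real (2 * sqrt 2) * delbar c v (\<lambda>x. F c (x, 0)) x"
        by (rule del_cmult(2)[OF sl[OF c(1)] c xi])
      also have "delbar c v (\<lambda>x. F c (x, 0)) x = delbar ?d ?w (F c) ?p"
        unfolding delbar_def iv dir_deriv_slice[OF F[OF c(1)] c pF] ..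
      \<comment> \<open>the two commuting Dolbeault derivatives of the unit section\<close>
      also have "\<dots> = \<tau> (fst (dolbeault E ?d ?w (S c) ?p)) $ 1"
      proof -
        have pU: "?p \<in> fst c \<times> UNIV" using c by simp
        note NS = smooth_sum_fst[OF S[OF c(1)]]
        have SE: "smooth_section TA E (fst c \<times> UNIV) (S c)" using S[OF c(1)] by (simp add: smooth_section_E)
        have iS: "S c q = sum_incl (sum_fst (S c q))" if "q \<in> fst c \<times> UNIV" for q
          using dolbeault_unit(1)[OF d(1), of q "vector [0, 1]"] that by (simp add: S_def sum_incl_def sum_fst_def)
        obtain W' \<sigma> where w': "(W', \<sigma>) \<in> btriv E" "?p \<in> W'" using E.triv_cover by blast
        have iSE: "smooth_section TA E (fst c \<times> UNIV) (\<lambda>q. sum_incl (sum_fst (S c q)))" by (rule smooth_sum_incl[OF NS])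
        have "dolbeault E ?d ?w (S c) ?p = dolbeault E ?d ?w (\<lambda>q. sum_incl (sum_fst (S c q))) ?p"
          by (rule E.triv_inj[OF w' E.dolbeault_triv(1)[OF SE d pU] E.dolbeault_triv(1)[OF iSE d pU]], 
              rule E.dolbeault_rules(5)[OF iSE d pU w'], rule iS)
        also have "\<dots> = sum_incl (dolbeault N ?d ?w (\<lambda>q. sum_fst (S c q)) ?p)"
          by (rule dolbeault_incl[OF NS d pU])
        finally have "fst (dolbeault E ?d ?w (S c) ?p) = fst (dolbeault N ?d ?w (\<lambda>q. sum_fst (S c q)) ?p)"
          by (simp add: sum_incl_def case_prod_beta)
        moreover have "?p \<in> W \<times> UNIV" using x by simp
        from N.dolbeault_triv(2)[OF NS d pU tensor_Ln_triv[OF w] this, of ?w 1]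
        have "\<tau> (fst (dolbeault N ?d ?w (\<lambda>q. sum_fst (S c q)) ?p)) $ 1 = delbar ?d ?w (F c) ?p"
          by (simp add: F_def[abs_def] case_prod_beta sum_fst_def)
        ultimately show ?thesis by simp
      qed
      also have "dolbeault E ?d ?w (S c) ?p = bzero E ?p"
      proof -
        obtain W' \<sigma> where w': "(W', \<sigma>) \<in> btriv E" "?p \<in> W'" using E.triv_cover by blast
        have opW': "open W'" by (rule E.triv_open[OF w'(1)])
        have SE: "smooth_section TA E (fst c \<times> UNIV) (S c)" using S[OF c(1)] by (simp add: smooth_section_E)
        have op: "open (fst c \<times> UNIV \<inter> W')" using opW' chart_open[OF c(1)] by (auto intro: open_Times)
        have pU: "?p \<in> fst c \<times> UNIV" using c by simp
        have pI: "?p \<in> fst c \<times> UNIV \<inter> W'" using c w' by simp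
        have wz: "dolbeault E ?d ?w unit_section q = bzero E q" if q: "q \<in> fst c \<times> UNIV" for q
        proof -
          have "fst q \<in> fst c" using q by (auto simp: mem_Times_iff)
          then have "bform ?d ?w q = bzero L (fst q)" using bv[OF c(1), of "fst q" ?w "snd q"] 
            by (simp add: L.bscale_0[OF bf[OF c(1)]])
          then have "dolbeault E ?d ?w unit_section q = (bzero L (fst q), snd q, 0)"
            using dolbeault_unit(1)[OF d(1), of q ?w] q by simp
          moreover have "bzero E q = (bzero L (fst q), snd q, 0)"
          proof -
            have "unit_section q \<in> fibre E q" using E.smooth_sectionD(2)[OF smooth_unit_section] by blast
            then show ?thesis using E.bscale_0[of "unit_section q" q] by (simp add: E_ops unit_section_def)
          qed
          ultimately show ?thesis by simp
        qed
        have sU: "smooth_fun TA W' (\<lambda>q. \<sigma> (unit_section q) $ j)" for j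
          using T.smooth_fun_vec_nth[OF E.smooth_sectionD(3)[OF smooth_unit_section w'(1)]] opW' by simp
        have "\<sigma> (dolbeault E ?d ?w (S c) ?p) $ j = 0" for j
        proof -
          have "\<sigma> (dolbeault E ?d ?w (S c) ?p) $ j = delbar ?d ?w (\<lambda>q. \<sigma> (S c q) $ j) ?p"
            by (rule E.dolbeault_triv(2)[OF SE d pU w'])
          also have "\<dots> = delbar ?d ?w (delbar ?d (vector [0, 1]) (\<lambda>q. \<sigma> (unit_section q) $ j)) ?p"
            by (rule T.del_cong(2)[OF op d pI])
              (use E.dolbeault_triv(2)[OF smooth_unit_section d(1) _ UNIV_I w'(1)] in \<open>auto simp: S_def\<close>)
          also have "\<dots> = delbar ?d (vector [0, 1]) (delbar ?d ?w (\<lambda>q. \<sigma> (unit_section q) $ j)) ?p"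
            by (rule T.delbar_commute[OF sU d w'(2) opW'])
          also have "\<dots> = delbar ?d (vector [0, 1]) (\<lambda>q. 0) ?p"
          proof (rule T.del_cong(2)[OF op d pI])
            fix q assume q: "q \<in> fst c \<times> UNIV \<inter> W'"
            then have "q \<in> fst ?d" "q \<in> W'" by auto
            from E.dolbeault_triv(2)[OF smooth_unit_section d(1) this(1) UNIV_I w'(1) this(2), of ?w j]
            show "delbar ?d ?w (\<lambda>q. \<sigma> (unit_section q) $ j) q = 0"
              using wz[of q] q E.triv_bzero[OF w'(1), of q] by simp
          qed
          finally show ?thesis by simp
        qed
        then show ?thesis
          by (intro E.triv_inj[OF w' E.dolbeault_triv(1)[OF SE d pU] E.bzero_fibre]) (simp add: vec_eq_iff E.triv_bzero[OF w'])
      qed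
      also have "\<tau> (fst (bzero E ?p)) $ 1 = 0"
      proof -
        have "unit_section ?p \<in> fibre E ?p" using E.smooth_sectionD(2)[OF smooth_unit_section] by blast
        then have "bzero E ?p = (bzero L x, 0, 0)" using E.bscale_0[of "unit_section ?p" ?p] by (simp add: E_ops unit_section_def)
        then show ?thesis using L.triv_bzero[OF w x] by simp
      qed
      finally have "delbar c v (\<lambda>x. \<tau> (\<phi> x) $ 1) x = 0" by simp
      then show "delbar c v (\<lambda>x. \<tau> (\<phi> x) $ j) x = 0" by (metis (full_types) num1_eq1)
    qed
  qed
  then have "holomorphic_section A L \<phi>"
    unfolding holomorphic_section_def using \<phi>f by (auto simp: o_def)
  with DM show ?thesis by blast
qed

lemma hermitian_form_E: "hermitian_form TA E h \<longleftrightarrow> hermitian_form TA V h"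
  unfolding hermitian_form_def by (simp add: E_ops smooth_section_E)

lemma bzero_E: "bzero E p = bzero V p"
  unfolding bzero_def by (simp add: E_ops)

lemma bzero_V: "bzero V p = (bzero L (fst p), snd p, 0)"
proof -
  have "unit_section p \<in> fibre V p" by (simp add: fibre_V_iff unit_section_def L.bzero_fibre)
  from V.bscale_0[OF this] show ?thesis by (simp add: unit_section_def)
qed

lemma pseudo_hermitian_bundle_E:
  assumes "pseudo_hermitian_metric TA V m n h"
  shows "pseudo_hermitian_bundle TA E h"
proof (intro pseudo_hermitian_bundle.intro E.hol_vbundle_axioms pseudo_hermitian_bundle_axioms.intro)
  show "hermitian_form TA E h" using assms unfolding pseudo_hermitian_metric_def hermitian_form_E by blast
  show "(\<forall>f. bproj E f = bproj E e \<longrightarrow> h e f = 0) \<Longrightarrow> e = bzero E (bproj E e)" for e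
    using assms unfolding pseudo_hermitian_metric_def E_ops(1) bzero_E by blast
qed

text \<open>
  Translations make the metric independent of \<open>z\<close>; a rotation acts on the two summands with different weights, so that they are orthogonal. The two diagonal entries are real and without zeros, of opposite sign by the signature, and of constant sign because \<open>X\<close> is connected.
\<close>

theorem invariant_metric:
  assumes conn: "connected (UNIV :: 'x set)"
    and ph: "pseudo_hermitian_metric TA V 1 1 h" and inv: "se2_invariant L h"
  shows "\<exists>hL hX C0 C1. hermitian_metric A L hL \<and> positive_smooth A hX \<and>
           (C0, C1) \<in> {(1, -1), (-1, 1)} \<and> metric_matrix L hL hX C0 C1 h"
proof -
  interpret H: pseudo_hermitian_bundle TA E h by (rule pseudo_hermitian_bundle_E[OF ph])
  have g: "h (bscale L (u powi (-1)) l, a + u * z, w) (bscale L (u powi (-1)) l', a + u * z, w') = h (l, z, w) (l', z, w')"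
    if "cmod u = 1" "l \<in> fibre L x" "l' \<in> fibre L x" for u a l l' x z w w'
    using inv[unfolded se2_invariant_def, rule_format, of "(a, u)" "(l, z, w)" "(l', z, w')"] that
    by (simp add: SE2_def se2_act_def fibre_def)
  have shift: "h (l, z, w) (l', z, w') = h (l, 0, w) (l', 0, w')" if "l \<in> fibre L x" "l' \<in> fibre L x" for l l' x z w w'
    using g[of 1 l x l' z 0 w w'] that by (simp add: L.bscale_one[of _ x])
  define k where "k x = Re (h (unit_section (x, 0)) (unit_section (x, 0)))" for x
  define H where "H l l' = h (l, 0, 0) (l', 0, 0)" for l l'
  have uf: "unit_section p \<in> fibre E p" for p using E.smooth_sectionD(2)[OF smooth_unit_section] by blast
  have lf: "(l, z, 0) \<in> fibre E (x, z)" if "l \<in> fibre L x" for l x z using that by (simp add: fibre_V_iff)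
  have kc: "h (unit_section (x, 0)) (unit_section (x, 0)) = of_real (k x)" for x
    using H.h_sym[OF uf uf] by (metis k_def complex_cnj_cancel_iff Reals_cnj_iff of_real_Re)
  have cross: "h (l, 0, 0) (unit_section (x, 0)) = 0" "h (unit_section (x, 0)) (l, 0, 0) = 0" if l: "l \<in> fibre L x" for l x
  proof -
    have "h (l, 0, 0) (unit_section (x, 0)) = h (bscale L (-1) l, 0, 0) (unit_section (x, 0))"
      using g[of "-1" l x "bzero L x" 0 0 0 1] l by (simp add: unit_section_def L.bzero_fibre)
    also have "\<dots> = h (bscale E (-1) (l, 0, 0)) (unit_section (x, 0))" by (simp add: E_ops)
    also have "\<dots> = - h (l, 0, 0) (unit_section (x, 0))" using H.h_scale[OF lf[OF l, of 0] uf, of "-1"] by simp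
    finally show "h (l, 0, 0) (unit_section (x, 0)) = 0" by simp
    then show "h (unit_section (x, 0)) (l, 0, 0) = 0" using H.h_sym[OF lf[OF l, of 0] uf] by simp
  qed
  have split: "(l, 0, w) = badd E (l, 0, 0) (bscale E w (unit_section (x, 0)))" if "l \<in> fibre L x" for l x w
    using that by (simp add: E_ops unit_section_def L.badd_bzero)
  have diag: "h (l, z, w) (l', z, w') = H l l' + of_real (k x) * (w * cnj w')" if l: "l \<in> fibre L x" "l' \<in> fibre L x" for l l' x z w w'
  proof -
    have f: "(l, 0, 0) \<in> fibre E (x, 0)" "(l', 0, 0) \<in> fibre E (x, 0)" "bscale E w (unit_section (x, 0)) \<in> fibre E (x, 0)"
      "bscale E w' (unit_section (x, 0)) \<in> fibre E (x, 0)" 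
      using lf l E.bscale_fibre[OF uf] by blast+
    have "h (l, z, w) (l', z, w') = h (l, 0, w) (l', 0, w')" by (rule shift[OF l])
    also have "\<dots> = h (badd E (l, 0, 0) (bscale E w (unit_section (x, 0)))) (badd E (l', 0, 0) (bscale E w' (unit_section (x, 0))))"
      using split[OF l(1), of w] split[OF l(2), of w'] by simp
    also have "\<dots> = H l l' + of_real (k x) * (w * cnj w')"
      using cross[OF l(1)] cross[OF l(2)]
      by (simp add: H.h_add[OF f(1,3) E.badd_fibre[OF f(2,4)]] H.h_add_right[OF f(2,4,1)] H.h_add_right[OF f(2,4,3)]
        H.h_scale[OF uf f(2)] H.h_scale[OF uf f(4)] H.h_scale_right[OF uf f(1)] H.h_scale_right[OF uf uf] kc H_def)
    finally show ?thesis .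
  qed
  have Hs: "H (bscale L a l) (bscale L a l) = of_real ((cmod a)\<^sup>2) * H l l" if l: "l \<in> fibre L x" for a l x
  proof -
    have "(bscale L a l, 0, 0) = bscale E a (l, 0, 0)" by (simp add: E_ops)
    then have "H (bscale L a l) (bscale L a l) = a * (cnj a * H l l)"
      unfolding H_def using H.h_scale[OF lf[OF l, of 0] E.bscale_fibre[OF lf[OF l, of 0]], of a a] H.h_scale_right[OF lf[OF l, of 0] lf[OF l, of 0], of a] by simp
    then show ?thesis by (simp only: complex_norm_square mult.assoc)
  qed
  have HR: "H l l = of_real (Re (H l l))" if l: "l \<in> fibre L x" for l x
    using H.h_sym[OF lf[OF l, of 0] lf[OF l, of 0]] unfolding H_def by (metis Reals_cnj_iff of_real_Re)
  \<comment> \<open>the two diagonal entries have opposite signs\<close>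
  have sign: "k x \<noteq> 0 \<and> (\<forall>l\<in>fibre L x. l \<noteq> bzero L x \<longrightarrow> k x * Re (H l l) < 0)" for x
  proof -
    obtain W \<tau> where w: "(W, \<tau>) \<in> btriv L" "x \<in> W" using L.triv_cover by blast
    define l0 where "l0 = of_triv L \<tau> (vec 1) x"
    have l0: "l0 \<in> fibre L x" "\<tau> l0 = vec 1" using L.of_triv[OF w] by (auto simp: l0_def)
    have l: "l = bscale L (\<tau> l $ 1) l0" if "l \<in> fibre L x" for l
      by (rule L.triv_inj[OF w that L.bscale_fibre[OF l0(1)]]) (simp add: L.triv_scale[OF w l0(1)] l0 vec_eq_iff forall_1)
    define r where "r = Re (H l0 l0)"
    have val: "Re (h e e) = (cmod (\<tau> (fst e) $ 1))\<^sup>2 * r + k x * (cmod (snd (snd e)))\<^sup>2" if e: "e \<in> fibre E (x, 0)" for e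
    proof -
      obtain m w' where m: "e = (m, 0, w')" "m \<in> fibre L x" using e by (cases e) (auto simp: fibre_V_iff)
      have "H m m = of_real ((cmod (\<tau> m $ 1))\<^sup>2) * H l0 l0" using Hs[OF l0(1), of "\<tau> m $ 1"] l[OF m(2)] by simp
      moreover have "w' * cnj w' = of_real ((cmod w')\<^sup>2)" by (rule complex_norm_square[symmetric])
      ultimately show ?thesis using diag[OF m(2,2), of 0 w' w'] by (simp add: m(1) r_def del: of_real_power)
    qed
    note basis = spec[OF conjunct2[OF conjunct2[OF ph[unfolded pseudo_hermitian_metric_def]]], of "(x, 0)"]
    then obtain b where b: "fibre_basis V (x, 0) b" "card {i. Re (h (b i) (b i)) > 0} = 1" "card {i. Re (h (b i) (b i)) < 0} = 1"
      by (elim exE conjE)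
    have bf: "b i \<in> fibre E (x, 0)" for i using b(1) unfolding fibre_basis_def by simp
    obtain i where "{i. Re (h (b i) (b i)) > 0} = {i}" using b(2) by (rule card_1_singletonE)
    then have i: "Re (h (b i) (b i)) > 0" by blast
    obtain j where "{i. Re (h (b i) (b i)) < 0} = {j}" using b(3) by (rule card_1_singletonE)
    then have j: "Re (h (b j) (b j)) < 0" by blast
    have neg: "k x * r < 0"
    proof -
      define a1 where "a1 = (cmod (\<tau> (fst (b i)) $ 1))\<^sup>2"
      define a2 where "a2 = (cmod (snd (snd (b i))))\<^sup>2"
      define a3 where "a3 = (cmod (\<tau> (fst (b j)) $ 1))\<^sup>2"
      define a4 where "a4 = (cmod (snd (snd (b j))))\<^sup>2"
      have nn: "a1 \<ge> 0" "a2 \<ge> 0" "a3 \<ge> 0" "a4 \<ge> 0" by (auto simp: a1_def a2_def a3_def a4_def)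
      have p1: "a1 * r + k x * a2 > 0" using i val[OF bf, of i] by (simp add: a1_def a2_def)
      have p2: "a3 * r + k x * a4 < 0" using j val[OF bf, of j] by (simp add: a3_def a4_def)
      have "\<not> (r \<ge> 0 \<and> k x \<ge> 0)" using p2 nn by (smt (verit) mult_nonneg_nonneg)
      moreover have "\<not> (r \<le> 0 \<and> k x \<le> 0)" using p1 nn by (smt (verit) mult_nonneg_nonpos mult_nonpos_nonneg)
      moreover have "r \<noteq> 0"
      proof
        assume r0: "r = 0"
        have "h (l0, 0, 0) f = 0" if f: "f \<in> fibre E (x, 0)" for f
        proof -
          obtain m w' where m: "f = (m, 0, w')" "m \<in> fibre L x" using f by (cases f) (auto simp: fibre_V_iff)
          have "h (l0, 0, 0) (m, 0, w') = H l0 m" using diag[OF l0(1) m(2), of 0 0 w'] by simp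
          also have "\<dots> = h (l0, 0, 0) (bscale E (\<tau> m $ 1) (l0, 0, 0))" using l[OF m(2)] by (simp add: H_def E_ops)
          also have "\<dots> = cnj (\<tau> m $ 1) * H l0 l0" using H.h_scale_right[OF lf[OF l0(1), of 0] lf[OF l0(1), of 0], of "\<tau> m $ 1"] by (simp add: H_def)
          also have "H l0 l0 = 0" using HR[OF l0(1)] r0 by (simp add: r_def)
          finally show ?thesis by (simp add: m)
        qed
        then have "(l0, 0, 0) = bzero E (x, 0)" using H.nondegenerate[of "(l0, 0, 0)"] lf[OF l0(1), of 0] by (auto simp: fibre_def E_ops)
        then have "l0 = bzero L x" by (simp add: bzero_E bzero_V)
        then show False using l0(2) L.triv_bzero[OF w] by (simp add: vec_eq_iff)
      qed
      moreover have "k x \<noteq> 0"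
      proof
        assume k0: "k x = 0"
        have "h (unit_section (x, 0)) f = 0" if f: "f \<in> fibre E (x, 0)" for f
        proof -
          obtain m w' where m: "f = (m, 0, w')" "m \<in> fibre L x" using f by (cases f) (auto simp: fibre_V_iff)
          have z: "(bzero L x, 0, 0) = bscale E 0 (m, 0, 0)" using L.bscale_0[OF m(2)] by (simp add: E_ops)
          have "H (bzero L x) m = 0" unfolding H_def z using H.h_scale[OF lf[OF m(2), of 0] lf[OF m(2), of 0], of 0] by simp
          then show ?thesis using diag[OF L.bzero_fibre m(2), of 0 1 w'] k0 by (simp add: m unit_section_def)
        qed
        then have "unit_section (x, 0) = bzero E (x, 0)" using H.nondegenerate[of "unit_section (x, 0)"] uf[of "(x, 0)"] by (auto simp: fibre_def E_ops)
        then show False by (simp add: bzero_E bzero_V unit_section_def)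
      qed
      ultimately show ?thesis by (auto simp: mult_less_0_iff)
    qed
    moreover have "k x * Re (H m m) < 0" if m: "m \<in> fibre L x" "m \<noteq> bzero L x" for m
    proof -
      have "\<tau> m $ 1 \<noteq> 0"
      proof
        assume "\<tau> m $ 1 = 0"
        then have "m = bscale L 0 l0" using l[OF m(1)] by simp
        then show False using m(2) L.bscale_0[OF l0(1)] by simp
      qed
      moreover have "Re (H m m) = (cmod (\<tau> m $ 1))\<^sup>2 * r"
        using Hs[OF l0(1), of "\<tau> m $ 1"] l[OF m(1)] by (simp add: r_def del: of_real_power)
      ultimately show ?thesis using neg by (simp add: mult_less_0_iff zero_less_mult_iff)
    qed
    ultimately show ?thesis by force
  qed
  have ksm: "smooth_fun A UNIV k"
  proof -
    have "smooth_fun TA UNIV (\<lambda>p. h (unit_section p) (unit_section p))" by (rule H.h_smooth[OF smooth_unit_section smooth_unit_section])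
    then have "smooth_fun A UNIV (\<lambda>x. h (unit_section (x, 0)) (unit_section (x, 0)))"
      by (rule smooth_fun_slice) auto
    then show ?thesis unfolding k_def[abs_def] by (rule smooth_fun_Re) simp
  qed
  have k_sign: "(\<forall>x. k x > 0) \<or> (\<forall>x. k x < 0)"
  proof (rule ccontr)
    assume "\<not> ?thesis"
    then obtain x y where xy: "k x < 0" "k y > 0" using sign by (metis linorder_neqE_linordered_idom)
    have "connected (k ` UNIV)" by (rule connected_continuous_image[OF smooth_fun_imp_continuous_on[OF ksm open_UNIV] conn])
    then have "0 \<in> k ` UNIV" using xy unfolding connected_iff_interval by (metis less_eq_real_def rangeI)
    then show False using sign by auto
  qed
  define C1 :: real where "C1 = (if (\<forall>x. k x > 0) then 1 else -1)"
  have C: "(- C1, C1) \<in> {(1, -1), (-1, 1)}" "C1 * C1 = 1" by (auto simp: C1_def)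
  define hX where "hX x = C1 * k x" for x
  have hX: "hX x > 0" for x
  proof (cases "\<forall>x. k x > 0")
    case True then show ?thesis by (simp add: hX_def C1_def)
  next
    case False
    then have "k x < 0" using k_sign by blast
    then show ?thesis unfolding hX_def C1_def if_not_P[OF False] by simp
  qed
  have hXs: "smooth_fun A UNIV hX" unfolding hX_def[abs_def] by (rule smooth_fun_mult[OF smooth_fun_const ksm]) simp
  define hL where "hL l l' = of_real (- C1) * H l l' / of_real (hX (bproj L l))" for l l'
  have "hermitian_metric A L hL"
    unfolding hermitian_metric_def hermitian_form_def
  proof (intro conjI allI ballI impI)
    fix x e e' f a assume e: "e \<in> fibre L x" "e' \<in> fibre L x" "f \<in> fibre L x"
    have b: "bproj L (badd L e e') = x" "bproj L e = x" "bproj L e' = x" "bproj L (bscale L a e) = x" "bproj L f = x"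
      using e L.badd_fibre[OF e(1,2)] L.bscale_fibre[OF e(1)] by (auto simp: fibre_def)
    have "H (badd L e e') f = H e f + H e' f"
      unfolding H_def using H.h_add[OF lf[OF e(1), of 0] lf[OF e(2), of 0] lf[OF e(3), of 0]] by (simp add: E_ops)
    then show "hL (badd L e e') f = hL e f + hL e' f" by (simp add: hL_def b add_divide_distrib diff_divide_distrib distrib_left)
    have "H (bscale L a e) f = a * H e f"
      unfolding H_def using H.h_scale[OF lf[OF e(1), of 0] lf[OF e(3), of 0], of a] by (simp add: E_ops)
    then show "hL (bscale L a e) f = a * hL e f" by (simp add: hL_def b)
    have "H f e = cnj (H e f)"
      unfolding H_def by (rule H.h_sym[OF lf[OF e(1), of 0] lf[OF e(3), of 0]])
    then show "hL f e = cnj (hL e f)" by (simp add: hL_def b)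
  next
    fix W s t assume s: "smooth_section A L W s" and t: "smooth_section A L W t"
    have opW: "open W" by (rule L.smooth_sectionD(1)[OF s])
    have lift: "smooth_section TA E (W \<times> UNIV) (\<lambda>p. (s (fst p), snd p, 0))" if s: "smooth_section A L W s" for s
      unfolding smooth_section_E
    proof (rule V_sectionI)
      show "open (W \<times> (UNIV::complex set))" using opW by (auto intro: open_Times)
      fix W0 \<tau> assume w: "(W0, \<tau>) \<in> btriv L"
      have op: "open (W \<inter> W0)" using opW L.triv_open[OF w] by auto
      have "smooth_fun TA ((W \<inter> W0) \<times> UNIV) (\<lambda>p. \<tau> (s (fst p)) $ 1)"
        by (rule smooth_fun_pullback_fst[OF smooth_fun_vec_nth[OF L.smooth_sectionD(3)[OF s w] op] op])
      then show "smooth_fun TA (W \<times> UNIV \<inter> W0 \<times> UNIV) (\<lambda>p. \<tau> (fst (s (fst p), snd p, 0::complex)) $ 1)"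
        by (simp add: Times_Int_Times)
    qed (use L.smooth_sectionD(2)[OF s] in \<open>auto simp: fibre_V_iff\<close>)
    have "smooth_fun TA (W \<times> UNIV) (\<lambda>p. h (s (fst p), snd p, 0) (t (fst p), snd p, 0))"
      by (rule H.h_smooth[OF lift[OF s] lift[OF t]])
    then have "smooth_fun A W (\<lambda>x. H (s x) (t x))"
      unfolding H_def using smooth_fun_slice[of "W \<times> UNIV" "\<lambda>p. h (s (fst p), snd p, 0) (t (fst p), snd p, 0)" W 0] opW by auto
    then have "smooth_fun A W (\<lambda>x. of_real (- C1) * H (s x) (t x) / of_real (hX x))"
      using hX by (intro smooth_fun_divide smooth_fun_mult smooth_fun_const smooth_fun_of_real smooth_fun_subset[OF hXs] opW)
        (auto simp: less_imp_neq[symmetric])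
    then show "smooth_fun A W (\<lambda>p. hL (s p) (t p))"
    proof (rule smooth_fun_cong[OF opW, THEN iffD1, rotated])
      fix x assume "x \<in> W"
      then have "bproj L (s x) = x" using L.smooth_sectionD(2)[OF s] by (auto simp: fibre_def)
      then show "of_real (- C1) * H (s x) (t x) / of_real (hX x) = hL (s x) (t x)" by (simp add: hL_def)
    qed
  next
    fix e assume e: "e \<noteq> bzero L (bproj L e)"
    have f: "e \<in> fibre L (bproj L e)" by (simp add: fibre_def)
    have "k (bproj L e) * Re (H e e) < 0" using sign[of "bproj L e"] f e by blast
    then have "- C1 * Re (H e e) > 0" using hX[of "bproj L e"] by (auto simp: hX_def zero_less_mult_iff mult_less_0_iff)
    moreover have "Re (hL e e) = - C1 * Re (H e e) / hX (bproj L e)" by (simp add: hL_def)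
    ultimately show "Re (hL e e) > 0" using hX[of "bproj L e"] by (simp add: divide_neg_pos)
  qed
  moreover have "positive_smooth A hX" unfolding positive_smooth_def using hX hXs by blast
  moreover have "metric_matrix L hL hX (- C1) C1 h"
    unfolding metric_matrix_def
  proof (intro allI impI)
    fix l l' z w w' assume eq: "bproj L l = bproj L l'"
    let ?x = "bproj L l"
    have f: "l \<in> fibre L ?x" "l' \<in> fibre L ?x" using eq by (auto simp: fibre_def)
    have "complex_of_real (- C1 * hX ?x) * hL l l' = of_real (C1 * C1) * H l l'" 
      using hX[of ?x] by (simp add: hL_def)
    also have "\<dots> = H l l'" by (simp add: C)
    finally have 1: "complex_of_real (- C1 * hX ?x) * hL l l' = H l l'" .
    have "C1 * hX ?x = k ?x" using C(2) by (simp add: hX_def mult.assoc[symmetric])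
    then show "h (l, z, w) (l', z, w') = of_real (- C1 * hX ?x) * hL l l' + of_real (C1 * hX ?x) * (w * cnj w')"
      unfolding 1 diag[OF f] by simp
  qed
  ultimately show ?thesis using C(1) by blast
qed

end

section \<open>Curvature and the Einstein equation\<close>

lemma bounded_linear_complex_of_real: "bounded_linear complex_of_real"
  by (rule bounded_linear_of_real)

context riemann_surface begin

text \<open>
  The coefficient of the curvature of a line bundle in a holomorphic frame of square norm \<open>\<rho>\<close>: the derivative delbar of the logarithmic derivative of \<open>\<rho>\<close>, evaluated on the two real coordinate directions.
\<close>

definition log_curvature :: "('x, 1) chart \<Rightarrow> ('x \<Rightarrow> complex) \<Rightarrow> 'x \<Rightarrow> complex" where
  "log_curvature c \<rho> x = 2 * \<i> * delbar c (vec 1) (\<lambda>x. del c (vec 1) \<rho> x / \<rho> x) x"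

definition laplace :: "('x, 1) chart \<Rightarrow> ('x \<Rightarrow> real) \<Rightarrow> 'x \<Rightarrow> real" where
  "laplace c g x = dir_deriv c (vec 1) (dir_deriv c (vec 1) g) x + dir_deriv c (\<i> *s vec 1) (dir_deriv c (\<i> *s vec 1) g) x"

lemma vec_smult_one: "vec \<beta> = \<beta> *s (vec 1 :: complex^1)"
  by (simp add: vec_eq_iff)

lemma curl_log:
  assumes a: "smooth_fun A W a" and c: "c \<in> A" and x: "x \<in> fst c" "x \<in> W"
  shows "\<i> * \<beta> * dir_deriv c (vec \<beta>) a x - \<beta> * dir_deriv c (\<i> *s vec \<beta>) a x = of_real ((cmod \<beta>)\<^sup>2) * (2 * \<i> * delbar c (vec 1) a x)"
proof -
  have "\<i> * \<beta> * dir_deriv c (vec \<beta>) a x - \<beta> * dir_deriv c (\<i> *s vec \<beta>) a x = 2 * \<i> * \<beta> * delbar c (vec \<beta>) a x"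
    by (simp add: delbar_def field_simps)
  also have "delbar c (vec \<beta>) a x = cnj \<beta> * delbar c (vec 1) a x"
    unfolding vec_smult_one[of \<beta>] by (rule delbar_smult[OF a c x])
  finally show ?thesis by (simp only: complex_norm_square) (simp add: mult_ac)
qed

lemma smooth_log_derivative:
  assumes \<rho>: "smooth_fun A W \<rho>" "\<And>x. x \<in> W \<Longrightarrow> \<rho> x \<noteq> 0" and W: "open W" and c: "c \<in> A"
  shows "smooth_fun A (fst c \<inter> W) (\<lambda>x. del c v \<rho> x / \<rho> x)"
  by (rule smooth_fun_divide[OF smooth_fun_del(1)[OF \<rho>(1) c W] smooth_fun_subset[OF \<rho>(1)]])
    (use \<rho>(2) W chart_open[OF c] in auto)

lemma log_curvature_mult:
  assumes f: "smooth_fun A W f" "\<And>x. x \<in> W \<Longrightarrow> f x \<noteq> 0" and g: "smooth_fun A W g" "\<And>x. x \<in> W \<Longrightarrow> g x \<noteq> 0"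
    and W: "open W" and c: "c \<in> A" and x: "x \<in> fst c" "x \<in> W"
  shows "log_curvature c (\<lambda>x. f x * g x) x = log_curvature c f x + log_curvature c g x"
proof -
  have op: "open (fst c \<inter> W)" and xi: "x \<in> fst c \<inter> W" using W chart_open[OF c] x by auto
  have "delbar c (vec 1) (\<lambda>x. del c (vec 1) (\<lambda>x. f x * g x) x / (f x * g x)) x
     = delbar c (vec 1) (\<lambda>x. del c (vec 1) f x / f x + del c (vec 1) g x / g x) x"
    by (rule del_cong(2)[OF op c x(1) xi]) (use f(2) g(2) in \<open>auto simp: del_mult[OF f(1) g(1) c] field_simps\<close>)
  also have "\<dots> = delbar c (vec 1) (\<lambda>x. del c (vec 1) f x / f x) x + delbar c (vec 1) (\<lambda>x. del c (vec 1) g x / g x) x"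
    by (rule del_add(2)[OF smooth_log_derivative[OF f W c] smooth_log_derivative[OF g W c] c x(1) xi])
  finally show ?thesis by (simp add: log_curvature_def distrib_left)
qed

lemma log_curvature_real:
  assumes g: "smooth_fun A W g" "\<And>x. x \<in> W \<Longrightarrow> g x > 0" and W: "open W" and c: "c \<in> A" and x: "x \<in> fst c" "x \<in> W"
  shows "log_curvature c (\<lambda>x. of_real (g x)) x = (\<i> / 2) * of_real (laplace c (\<lambda>x. ln (g x)) x)"
proof -
  have op: "open (fst c \<inter> W)" and xi: "x \<in> fst c \<inter> W" using W chart_open[OF c] x by auto
  let ?G = "\<lambda>x. ln (g x)"
  have G: "smooth_fun A W ?G" by (rule smooth_fun_ln[OF g(1) W g(2)])
  have dG: "smooth_fun A (fst c \<inter> W) (dir_deriv c v ?G)" for v by (rule smooth_fun_dir_deriv[OF G c W])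
  have dGc: "smooth_fun A (fst c \<inter> W) (\<lambda>x. complex_of_real (dir_deriv c v ?G x))" for v by (rule smooth_fun_of_real[OF dG op])
  have a: "del c (vec 1) (\<lambda>x. complex_of_real (g x)) y / of_real (g y) = 
     (1/2) * of_real (dir_deriv c (vec 1) ?G y) + (- \<i> / 2) * of_real (dir_deriv c (\<i> *s vec 1) ?G y)"
    if y: "y \<in> fst c" "y \<in> W" for y
  proof -
    have 1: "dir_deriv c v (\<lambda>x. complex_of_real (g x)) y = of_real (dir_deriv c v g y)" for v
      by (rule dir_deriv_linear_compose[OF bounded_linear_complex_of_real g(1) c y])
    have 2: "dir_deriv c v ?G y = dir_deriv c v g y / g y" for v
      using dir_deriv_compose_real[OF g(1) c y DERIV_ln[OF g(2)[OF y(2)]]] by (simp add: field_simps)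
    show ?thesis using g(2)[OF y(2)] unfolding del_def 1 2 by (simp add: field_simps)
  qed
  have m: "dir_deriv c u (\<lambda>y. k * of_real (dir_deriv c v ?G y)) x = k * of_real (dir_deriv c u (dir_deriv c v ?G) x)" for k :: complex and u v
    using dir_deriv_mult[OF smooth_fun_const dGc c x(1) xi, of u k v] dir_deriv_linear_compose[OF bounded_linear_complex_of_real dG c x(1) xi, of u v]
    by simp
  have "delbar c (vec 1) (\<lambda>x. del c (vec 1) (\<lambda>x. complex_of_real (g x)) x / of_real (g x)) x =
     delbar c (vec 1) (\<lambda>y. (1/2) * of_real (dir_deriv c (vec 1) ?G y) + (- \<i> / 2) * of_real (dir_deriv c (\<i> *s vec 1) ?G y)) x"
    by (rule del_cong(2)[OF op c x(1) xi]) (use a in auto)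
  also have "\<dots> = (1/4) * of_real (laplace c ?G x)"
    unfolding delbar_def dir_deriv_add[OF smooth_fun_mult[OF smooth_fun_const dGc op] smooth_fun_mult[OF smooth_fun_const dGc op] c x(1) xi] m
      laplace_def dir_deriv_commute[OF G c x W, of "\<i> *s vec 1" "vec 1"]
    by (simp add: algebra_simps)
  finally have E: "delbar c (vec 1) (\<lambda>x. del c (vec 1) (\<lambda>x. complex_of_real (g x)) x / of_real (g x)) x = (1/4) * of_real (laplace c ?G x)" .
  show ?thesis unfolding log_curvature_def E by simp
qed

lemma kaehler_dim1:
  assumes \<omega>: "kaehler_form A \<omega>" and c: "c \<in> A" and x: "x \<in> fst c"
  shows "\<omega> c x (vec a) (vec b) = \<omega> c x (vec 1) (\<i> *s vec 1) * Im (cnj a * b)" "\<omega> c x (vec 1) (\<i> *s vec 1) > 0"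
proof -
  have lin: "linear (\<lambda>u. \<omega> c x u v)" and anti: "\<omega> c x u v = - \<omega> c x v u" and pos: "v \<noteq> 0 \<Longrightarrow> \<omega> c x v (\<i> *s v) > 0" for u v
    using \<omega> c x unfolding kaehler_form_def by blast+
  show "\<omega> c x (vec 1) (\<i> *s vec 1) > 0" by (rule pos) (simp add: vec_eq_iff)
  have v: "vec a = Re a *\<^sub>R (vec 1 :: complex^1) + Im a *\<^sub>R (\<i> *s vec 1)" for a 
    unfolding vec_smult_one[of a] by (rule vector_smult_complex)
  have z: "\<omega> c x u u = 0" for u using anti[of u u] by simp
  have l: "\<omega> c x (vec a) w = Re a * \<omega> c x (vec 1) w + Im a * \<omega> c x (\<i> *s vec 1) w" for a w
    unfolding v[of a] by (simp only: linear_add[OF lin] linear_scale[OF lin] real_scaleR_def)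
  have r: "\<omega> c x u (vec b) = Re b * \<omega> c x u (vec 1) + Im b * \<omega> c x u (\<i> *s vec 1)" for u
    using l[of b u] anti[of u "vec b"] anti[of "vec 1" u] anti[of "\<i> *s vec 1" u] by simp
  show "\<omega> c x (vec a) (vec b) = \<omega> c x (vec 1) (\<i> *s vec 1) * Im (cnj a * b)"
    unfolding l[of a] r z using anti[of "\<i> *s vec 1" "vec 1"] by (simp add: algebra_simps)
qed

text \<open>
  Unitary vectors in one dimension differ by a factor of modulus one, on which the value of the form on \<open>v\<close> and \<open>\<i> v\<close> does not depend.
\<close>

lemma contraction_dim1:
  fixes F :: "complex^1 \<Rightarrow> complex^1 \<Rightarrow> complex"
  assumes \<omega>: "kaehler_form A \<omega>" and c: "c \<in> A" and x: "x \<in> fst c"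
    and F: "\<And>\<beta>. F (vec \<beta>) (\<i> *s vec \<beta>) = of_real ((cmod \<beta>)\<^sup>2) * K"
  shows "contraction (\<omega> c x) F = K / of_real (\<omega> c x (vec 1) (\<i> *s vec 1))"
proof -
  define r where "r = \<omega> c x (vec 1) (\<i> *s vec 1)"
  have w: "\<omega> c x (vec a) (vec b) = r * Im (cnj a * b)" and r: "r > 0" for a b
    using kaehler_dim1[OF assms(1-3)] by (auto simp: r_def)
  have iv: "\<i> *s vec b = (vec (\<i> * b) :: complex^1)" for b by (simp add: vec_eq_iff)
  define b where "b = (SOME b. unitary_basis (\<omega> c x) b)"
  have "unitary_basis (\<omega> c x) (\<lambda>_. vec (of_real (1 / sqrt r)))"
    unfolding unitary_basis_def iv w using r by (auto simp: power2_eq_square[symmetric] field_simps)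
  then have "unitary_basis (\<omega> c x) b" unfolding b_def by (rule someI[where P="unitary_basis (\<omega> c x)"])
  then have "\<omega> c x (b 1) (\<i> *s b 1) = 1" unfolding unitary_basis_def by auto
  moreover obtain \<beta> where \<beta>: "b 1 = vec \<beta>" using vec_nth_1[of "b 1"] by metis
  ultimately have "r * Im (cnj \<beta> * (\<i> * \<beta>)) = 1" by (simp only: iv w)
  moreover have "Im (cnj \<beta> * (\<i> * \<beta>)) = (cmod \<beta>)\<^sup>2" unfolding cmod_power2 by (simp add: power2_eq_square)
  ultimately have "r * (cmod \<beta>)\<^sup>2 = 1" by simp
  then have "(cmod \<beta>)\<^sup>2 = 1 / r" using r by (simp add: field_simps)
  then show ?thesis unfolding contraction_def Let_def b_def[symmetric] using F[of \<beta>] \<beta> by (simp add: r_def)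
qed

lemma unitary_dim2:
  fixes b :: "2 \<Rightarrow> complex^2"
  assumes \<Omega>: "\<And>u v. \<Omega> u v = r * Im (cnj (u $ 1) * v $ 1) + Im (cnj (u $ 2) * v $ 2)" and r: "r > 0"
    and b: "unitary_basis \<Omega> b"
  shows "(cmod (b 1 $ 1))\<^sup>2 + (cmod (b 2 $ 1))\<^sup>2 = 1 / r" "(cmod (b 1 $ 2))\<^sup>2 + (cmod (b 2 $ 2))\<^sup>2 = 1"
proof -
  have b': "of_real r * (cnj (b j $ 1) * b k $ 1) + cnj (b j $ 2) * b k $ 2 = (if j = k then 1 else 0)" for j k
  proof -
    have "\<Omega> (b j) (b k) = 0" "\<Omega> (b j) (\<i> *s b k) = (if j = k then 1 else 0)" using b unfolding unitary_basis_def by blast+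
    then show ?thesis unfolding \<Omega> by (auto simp: complex_eq_iff algebra_simps)
  qed
  define s where "s = complex_of_real (sqrt r)"
  have s: "s * s = of_real r" using r by (simp add: s_def of_real_mult[symmetric])
  define M :: "complex^2^2" where "M = (\<chi> j i. if i = 1 then s * cnj (b j $ 1) else cnj (b j $ 2))"
  define M' :: "complex^2^2" where "M' = (\<chi> i k. if i = 1 then s * b k $ 1 else b k $ 2)"
  have "(M ** M') $ j $ k = mat 1 $ j $ k" for j k
  proof -
    have "(M ** M') $ j $ k = s * s * (cnj (b j $ 1) * b k $ 1) + cnj (b j $ 2) * b k $ 2"
      by (simp add: matrix_matrix_mult_def sum_2 M_def M'_def)
    then show ?thesis using b'[of j k] unfolding s by (simp add: mat_def)
  qed
  then have "M ** M' = mat 1" by (simp add: vec_eq_iff)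
  then have M: "M' ** M = mat 1" by (simp add: matrix_left_right_inverse)
  have "(M' ** M) $ 1 $ 1 = s * s * (b 1 $ 1 * cnj (b 1 $ 1) + b 2 $ 1 * cnj (b 2 $ 1))"
    "(M' ** M) $ 2 $ 2 = b 1 $ 2 * cnj (b 1 $ 2) + b 2 $ 2 * cnj (b 2 $ 2)"
    by (simp_all add: matrix_matrix_mult_def sum_2 M_def M'_def algebra_simps)
  then have "of_real r * (b 1 $ 1 * cnj (b 1 $ 1) + b 2 $ 1 * cnj (b 2 $ 1)) = 1" 
    "b 1 $ 2 * cnj (b 1 $ 2) + b 2 $ 2 * cnj (b 2 $ 2) = 1"
    unfolding M s by (simp_all add: mat_def)
  then have "complex_of_real (r * ((cmod (b 1 $ 1))\<^sup>2 + (cmod (b 2 $ 1))\<^sup>2)) = of_real 1"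
    "complex_of_real ((cmod (b 1 $ 2))\<^sup>2 + (cmod (b 2 $ 2))\<^sup>2) = of_real 1"
    by (simp_all only: of_real_mult of_real_add complex_norm_square of_real_1)
  then have "r * ((cmod (b 1 $ 1))\<^sup>2 + (cmod (b 2 $ 1))\<^sup>2) = 1" "(cmod (b 1 $ 2))\<^sup>2 + (cmod (b 2 $ 2))\<^sup>2 = 1"
    unfolding of_real_eq_iff .
  then show "(cmod (b 1 $ 1))\<^sup>2 + (cmod (b 2 $ 1))\<^sup>2 = 1 / r" "(cmod (b 1 $ 2))\<^sup>2 + (cmod (b 2 $ 2))\<^sup>2 = 1"
    using r by (simp_all add: field_simps)
qed

lemma product_form_eq:
  assumes \<omega>: "kaehler_form A \<omega>" and c: "c \<in> A" and x: "x \<in> fst c"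
  shows "product_form A \<omega> (prod_chart c) (x, z) u v = 
    \<omega> c x (vec 1) (\<i> *s vec 1) * Im (cnj (u $ 1) * v $ 1) + Im (cnj (u $ 2) * v $ 2)"
proof -
  let ?e = "SOME d. d \<in> A \<and> fst (x, z) \<in> fst d"
  have e: "?e \<in> A \<and> x \<in> fst ?e" using someI[of "\<lambda>d. d \<in> A \<and> fst (x, z) \<in> fst d" c] c x by simp
  have sm: "smooth_fun A (fst ?e) (snd ?e)"
    by (rule smooth_funI) (use smooth_transition e in blast)
  have d: "dir_deriv (prod_chart c) u (snd ?e \<circ> fst) (x, z) = dir_deriv c (vec (u $ 1)) (snd ?e) x" for u
    unfolding o_def by (rule dir_deriv_pullback_fst[OF sm c x]) (use e in blast)
  have comp: "\<omega> c' p (dir_deriv c u (snd c') p) (dir_deriv c v (snd c') p) = \<omega> c p u v"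
    if "c \<in> A" "c' \<in> A" "p \<in> fst c" "p \<in> fst c'" for c c' p u v
    using \<omega> that unfolding kaehler_form_def by blast
  have 1: "pullback2 A fst \<omega> (prod_chart c) (x, z) u v = \<omega> c x (vec (u $ 1)) (vec (v $ 1))"
    unfolding pullback2_def Let_def d using comp[of c ?e x] e c x by simp
  let ?f = "SOME d. d \<in> complex_line_atlas \<and> snd (x, z) \<in> fst d"
  have f: "?f = (UNIV, \<lambda>z. \<chi> i. z)" by (rule some_equality) (auto simp: complex_line_atlas_def)
  have bl: "bounded_linear (\<lambda>z::complex. \<chi> i::1. z)"
    by (rule linear_conv_bounded_linear[THEN iffD1]) (auto simp: linear_iff vec_eq_iff)
  have d2: "dir_deriv (prod_chart c) u ((\<lambda>z. \<chi> i::1. z) \<circ> snd) (x, z) = (\<chi> i. u $ 2)" for u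
    unfolding o_def
    by (subst T.dir_deriv_linear_compose[OF bl smooth_fun_snd prod_chart_mem[OF c], of _ UNIV]) (use x in \<open>auto simp: dir_deriv_snd[OF c x]\<close>)
  have 2: "pullback2 complex_line_atlas snd omega_can (prod_chart c) (x, z) u v = Im (cnj (u $ 2) * v $ 2)"
    unfolding pullback2_def Let_def f unfolding snd_conv d2 omega_can_def by (simp add: field_simps)
  show ?thesis unfolding product_form_def 1 2 kaehler_dim1(1)[OF assms] ..
qed

end

locale hermitian_line_bundle = riemann_surface A + L: hol_vbundle A L
  for A :: "('x::topological_space, 1) chart set" and L :: "('l, 'x, 1) vbundle" +
  fixes hL :: "'l \<Rightarrow> 'l \<Rightarrow> complex"
  assumes metric: "hermitian_metric A L hL"
begin

sublocale H: pseudo_hermitian_bundle A L hL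
proof
  show "hermitian_form A L hL" using metric by (simp add: hermitian_metric_def)
  fix e assume e: "\<forall>f. bproj L f = bproj L e \<longrightarrow> hL e f = 0"
  then have "hL e e = 0" by blast
  then show "e = bzero L (bproj L e)" using metric unfolding hermitian_metric_def by (metis less_irrefl zero_complex.sel(1))
qed

definition frame :: "('l \<Rightarrow> complex^1) \<Rightarrow> 'x \<Rightarrow> 'l" where
  "frame \<tau> x = of_triv L \<tau> (vec 1) x"

definition weight :: "('l \<Rightarrow> complex^1) \<Rightarrow> 'x \<Rightarrow> real" where
  "weight \<tau> x = Re (hL (frame \<tau> x) (frame \<tau> x))"

lemma frame_fibre:
  assumes w: "(W, \<tau>) \<in> btriv L" "x \<in> W"
  shows "frame \<tau> x \<in> fibre L x" "\<tau> (frame \<tau> x) = vec 1"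
  using L.of_triv[OF w] by (auto simp: frame_def)

lemma fibre_frame:
  assumes w: "(W, \<tau>) \<in> btriv L" "x \<in> W" and l: "l \<in> fibre L x"
  shows "l = bscale L (\<tau> l $ 1) (frame \<tau> x)"
  by (rule L.triv_inj[OF w l L.bscale_fibre[OF frame_fibre(1)[OF w]]])
    (simp add: L.triv_scale[OF w frame_fibre(1)[OF w]] frame_fibre[OF w] vec_eq_iff forall_1)

lemma weight:
  assumes w: "(W, \<tau>) \<in> btriv L" "x \<in> W"
  shows "hL (frame \<tau> x) (frame \<tau> x) = of_real (weight \<tau> x)" "weight \<tau> x > 0"
proof -
  note f = frame_fibre[OF w]
  show "hL (frame \<tau> x) (frame \<tau> x) = of_real (weight \<tau> x)"
    using H.h_sym[OF f(1) f(1)] unfolding weight_def by (metis Reals_cnj_iff of_real_Re)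
  have "frame \<tau> x \<noteq> bzero L x" using f(2) L.triv_bzero[OF w] by (auto simp: vec_eq_iff)
  moreover have "bproj L (frame \<tau> x) = x" using f(1) by (simp add: fibre_def)
  ultimately show "weight \<tau> x > 0" using metric unfolding hermitian_metric_def weight_def by metis
qed

lemma hL_frame:
  assumes w: "(W, \<tau>) \<in> btriv L" "x \<in> W"
  shows "hL (bscale L a (frame \<tau> x)) (bscale L b (frame \<tau> x)) = a * cnj b * of_real (weight \<tau> x)"
proof -
  note f = frame_fibre(1)[OF w]
  show ?thesis by (simp add: H.h_scale[OF f L.bscale_fibre[OF f]] H.h_scale_right[OF f f] weight(1)[OF w])
qed

lemma smooth_frame: "(W, \<tau>) \<in> btriv L \<Longrightarrow> smooth_section A L W (frame \<tau>)"
  unfolding frame_def[abs_def] by (rule L.smooth_section_frame)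

lemma smooth_weight:
  assumes w: "(W, \<tau>) \<in> btriv L"
  shows "smooth_fun A W (weight \<tau>)"
  unfolding weight_def[abs_def] by (rule smooth_fun_Re[OF H.h_smooth[OF smooth_frame[OF w] smooth_frame[OF w]] L.triv_open[OF w]])

lemma smooth_weight_complex:
  assumes w: "(W, \<tau>) \<in> btriv L"
  shows "smooth_fun A W (\<lambda>x. complex_of_real (weight \<tau> x))"
  by (rule smooth_fun_of_real[OF smooth_weight[OF w] L.triv_open[OF w]])

lemma axis_1_1: "axis (1::1) (a::complex) = vec a"
  by (simp add: vec_eq_iff axis_def forall_1)

lemma dolbeault_frame:
  assumes w: "(W, \<tau>) \<in> btriv L" and c: "c \<in> A" and x: "x \<in> fst c" "x \<in> W"
  shows "dolbeault L c v (frame \<tau>) x = bzero L x"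
proof (rule L.triv_inj[OF w x(2) L.dolbeault_triv(1)[OF smooth_frame[OF w] c x] L.bzero_fibre])
  have "delbar c v (\<lambda>q. \<tau> (frame \<tau> q) $ j) x = delbar c v (\<lambda>q. 1) x" for j
    by (rule del_cong(2)[OF L.triv_open[OF w] c x]) (simp add: frame_fibre[OF w])
  then show "\<tau> (dolbeault L c v (frame \<tau>) x) = \<tau> (bzero L x)"
    by (simp add: vec_eq_iff L.dolbeault_triv(2)[OF smooth_frame[OF w] c x w x(2)] L.triv_bzero[OF w x(2)])
qed

lemma chern_coeff:
  assumes w: "(W, \<tau>) \<in> btriv L" and c: "c \<in> A" and x: "x \<in> fst c" "x \<in> W"
  shows "conn_coeff L \<tau> (chern_connection A L hL) c v 1 x $ 1 = del c v (\<lambda>x. of_real (weight \<tau> x)) x / of_real (weight \<tau> x)"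
proof -
  let ?D = "chern_connection A L hL"
  note s = smooth_frame[OF w] and f = frame_fibre(1)[OF w x(2)]
  have Df: "?D c v (frame \<tau>) x \<in> fibre L x" by (rule L.connection_fibre[OF H.chern_connection(1) c s x])
  have z: "hL (bzero L x) (frame \<tau> x) = 0" "hL (frame \<tau> x) (bzero L x) = 0"
    using H.h_scale[OF f f, of 0] H.h_scale_right[OF f f, of 0] L.bscale_0[OF f] by auto
  have "hL (?D c v (frame \<tau>) x) (frame \<tau> x) = del c v (\<lambda>x. hL (frame \<tau> x) (frame \<tau> x)) x"
    using H.h_connection[OF H.chern_connection(2,3,1) s s c x, of v] unfolding dolbeault_frame[OF w c x] z by simp
  also have "\<dots> = del c v (\<lambda>x. of_real (weight \<tau> x)) x"
    by (rule del_cong(1)[OF L.triv_open[OF w] c x]) (rule weight(1)[OF w])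
  also have "hL (?D c v (frame \<tau>) x) (frame \<tau> x) = \<tau> (?D c v (frame \<tau>) x) $ 1 * of_real (weight \<tau> x)"
    using H.h_scale[OF f f, of "\<tau> (?D c v (frame \<tau>) x) $ 1"] fibre_frame[OF w x(2) Df] weight(1)[OF w x(2)] by simp
  finally have "\<tau> (?D c v (frame \<tau>) x) $ 1 * of_real (weight \<tau> x) = del c v (\<lambda>x. of_real (weight \<tau> x)) x" .
  then show ?thesis using weight(2)[OF w x(2)] unfolding conn_coeff_def axis_1_1 frame_def[abs_def] by (simp add: field_simps)
qed

lemma line_curvature_eq:
  assumes w: "(W, \<tau>) \<in> btriv L" and c: "c \<in> A" and x: "x \<in> fst c" "x \<in> W"
  shows "line_curvature A L hL c x (vec \<beta>) (\<i> *s vec \<beta>) = 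
    of_real ((cmod \<beta>)\<^sup>2) * log_curvature c (\<lambda>x. of_real (weight \<tau> x)) x"
proof -
  let ?D = "chern_connection A L hL" and ?\<rho> = "\<lambda>x. complex_of_real (weight \<tau> x)"
  let ?a = "\<lambda>x. del c (vec 1) ?\<rho> x / ?\<rho> x"
  have op: "open (fst c \<inter> W)" and xi: "x \<in> fst c \<inter> W" using L.triv_open[OF w] chart_open[OF c] x by auto
  note sm = smooth_weight_complex[OF w]
  have a: "smooth_fun A (fst c \<inter> W) ?a"
    by (rule smooth_log_derivative[OF sm _ L.triv_open[OF w] c]) (use weight(2)[OF w] in \<open>auto simp: less_imp_neq[symmetric]\<close>)
  have G: "dir_deriv c u (\<lambda>q. conn_coeff L \<tau> ?D c (vec b) 1 q $ 1) x = b * dir_deriv c u ?a x" for u b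
  proof -
    have "dir_deriv c u (\<lambda>q. conn_coeff L \<tau> ?D c (vec b) 1 q $ 1) x = dir_deriv c u (\<lambda>q. b * ?a q) x"
      by (rule dir_deriv_cong[OF op c x(1) xi])
        (auto simp: chern_coeff[OF w c] vec_smult_one[of b] del_smult[OF sm c])
    then show ?thesis using dir_deriv_mult[OF smooth_fun_const a c x(1) xi, of u b] by simp
  qed
  have iv: "\<i> *s vec \<beta> = (vec (\<i> * \<beta>) :: complex^1)" by (simp add: vec_eq_iff)
  have K: "curv_coeff L \<tau> ?D c (vec \<beta>) (\<i> *s vec \<beta>) 1 1 x = of_real ((cmod \<beta>)\<^sup>2) * log_curvature c ?\<rho> x"
    unfolding curv_coeff_def log_curvature_def curl_log[OF a c x(1) xi, symmetric]
    unfolding iv G by (simp add: algebra_simps)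
  let ?F = "curvature A L ?D c x (vec \<beta>) (\<i> *s vec \<beta>)" 
  let ?k = "curv_coeff L \<tau> ?D c (vec \<beta>) (\<i> *s vec \<beta>) 1 1 x"
  have F: "?F e = bscale L ?k e" if e: "e \<in> fibre L x" for e
    by (rule L.triv_inj[OF w x(2) L.curvature_triv(1)[OF H.chern_connection(1) w e c x] L.bscale_fibre[OF e]])
      (simp add: vec_eq_iff forall_1 L.curvature_triv(2)[OF H.chern_connection(1) w e c x] L.triv_scale[OF w x(2) e] mult.commute)
  have "line_curvature A L hL c x (vec \<beta>) (\<i> *s vec \<beta>) = ?k"
    unfolding line_curvature_def
  proof (rule the_equality)
    show "\<forall>e\<in>fibre L x. ?F e = bscale L ?k e" using F by blast
    fix k assume k: "\<forall>e\<in>fibre L x. ?F e = bscale L k e"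
    note f = frame_fibre[OF w x(2)]
    have "bscale L k (frame \<tau> x) = bscale L ?k (frame \<tau> x)" using k F f(1) by metis
    then have "\<tau> (bscale L k (frame \<tau> x)) $ 1 = \<tau> (bscale L ?k (frame \<tau> x)) $ 1" by simp
    then show "k = ?k" by (simp add: L.triv_scale[OF w x(2) f(1)] f(2))
  qed
  then show ?thesis unfolding K .
qed

lemma line_curvature_laplace:
  assumes w: "(W, \<tau>) \<in> btriv L" and c: "c \<in> A" and x: "x \<in> fst c" "x \<in> W"
  shows "line_curvature A L hL c x (vec 1) (\<i> *s vec 1) = (\<i> / 2) * of_real (laplace c (\<lambda>x. ln (weight \<tau> x)) x)"
  using line_curvature_eq[OF assms, of 1] log_curvature_real[OF smooth_weight[OF w] weight(2)[OF w] L.triv_open[OF w] c x] by simp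

end

context extension_bundle begin

lemma connection_E: "connection TA E D \<longleftrightarrow> connection TA V D"
  unfolding connection_def smooth_section_E E_ops ..

lemma curvature_E: "curvature TA E D = curvature TA V D"
  unfolding curvature_def[abs_def] smooth_section_E E_ops ..

abbreviation sumtriv :: "('l \<Rightarrow> complex^1) \<Rightarrow> 'l \<times> complex \<times> complex \<Rightarrow> complex^2" where
  "sumtriv \<tau> \<equiv> (\<lambda>(l, z, w). vector [\<tau> l $ 1, w])"

lemma of_triv_V:
  assumes w: "(W, \<tau>) \<in> btriv L" "x \<in> W"
  shows "of_triv V (sumtriv \<tau>) a (x, z) = (of_triv L \<tau> (vec (a $ 1)) x, z, a $ 2)"
proof (rule V.triv_inj[OF sum_bundle_triv[OF w(1)] _ V.of_triv(1)[OF sum_bundle_triv[OF w(1)]]])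
  show "(x, z) \<in> W \<times> UNIV" "(x, z) \<in> W \<times> UNIV" using w by auto
  then show "sumtriv \<tau> (of_triv V (sumtriv \<tau>) a (x, z)) = sumtriv \<tau> (of_triv L \<tau> (vec (a $ 1)) x, z, a $ 2)"
    using V.of_triv(2)[OF sum_bundle_triv[OF w(1)], of "(x, z)" a] by (simp add: L.of_triv[OF w])
  show "(of_triv L \<tau> (vec (a $ 1)) x, z, a $ 2) \<in> fibre V (x, z)" by (simp add: fibre_V_iff L.of_triv[OF w])
qed

lemma dolbeault_sum_frame:
  assumes w: "(W, \<tau>) \<in> btriv L" and d: "d \<in> TA" and p: "p \<in> fst d" "fst p \<in> W"
  shows "dolbeault E d v (of_triv V (sumtriv \<tau>) a) p = (bscale L (a $ 2) (bform d v p), snd p, 0)"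
proof -
  have p': "p \<in> W \<times> UNIV" using p by (simp add: mem_Times_iff)
  have op: "open (W \<times> (UNIV :: complex set))" using L.triv_open[OF w] by (auto intro: open_Times)
  let ?s = "of_triv V (sumtriv \<tau>) a"
  have s: "smooth_section TA V (W \<times> UNIV) ?s" by (rule V.smooth_section_frame[OF sum_bundle_triv[OF w]])
  have sq: "?s q = (of_triv L \<tau> (vec (a $ 1)) (fst q), snd q, a $ 2)" if "q \<in> W \<times> UNIV" for q
    using of_triv_V[OF w, of "fst q" a "snd q"] that by (auto simp: mem_Times_iff)
  note N = smooth_sum_fst[OF s]
  have "dolbeault N d v (\<lambda>q. sum_fst (?s q)) p = (bzero L (fst p), snd p)"
  proof (rule N.triv_inj[OF tensor_Ln_triv[OF w] p' N.dolbeault_triv(1)[OF N d p(1) p']])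
    show "(bzero L (fst p), snd p) \<in> fibre N p" by (simp add: fibre_N_iff L.bzero_fibre)
    have "delbar d v (\<lambda>q. (\<lambda>(l, z). \<tau> l) (sum_fst (?s q)) $ j) p = delbar d v (\<lambda>q. a $ 1) p" for j
      by (rule T.del_cong(2)[OF op d p(1) p']) (auto simp: sq sum_fst_def L.of_triv[OF w])
    then show "(\<lambda>(l, z). \<tau> l) (dolbeault N d v (\<lambda>q. sum_fst (?s q)) p) = (\<lambda>(l, z). \<tau> l) (bzero L (fst p), snd p)"
      by (simp add: vec_eq_iff N.dolbeault_triv(2)[OF N d p(1) p' tensor_Ln_triv[OF w] p'] L.triv_bzero[OF w p(2)])
  qed
  moreover have "delbar d v (\<lambda>q. snd (snd (?s q))) p = delbar d v (\<lambda>q. a $ 2) p"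
    by (rule T.del_cong(2)[OF op d p(1) p']) (simp add: sq)
  ultimately show ?thesis
    unfolding dolbeault_decomp[OF s d p(1) p'] 
    by (simp add: sq[OF p'] L.badd_bzero(2)[OF L.bscale_fibre[OF dolbeault_unit(2)[OF d p(1)]]])
qed

end

locale invariant_metric_data = extension_bundle A L E + hermitian_line_bundle A L hL
  for A :: "('x::topological_space, 1) chart set" and L :: "('l, 'x, 1) vbundle"
    and E :: "('l \<times> complex \<times> complex, 'x \<times> complex, 2) vbundle" and hL :: "'l \<Rightarrow> 'l \<Rightarrow> complex" +
  fixes h :: "'l \<times> complex \<times> complex \<Rightarrow> 'l \<times> complex \<times> complex \<Rightarrow> complex"
    and hX :: "'x \<Rightarrow> real" and C0 C1 :: real and \<phi> :: "'x \<Rightarrow> 'l"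
  assumes ph: "pseudo_hermitian_metric (times_line_atlas A) (sum_bundle L) 1 1 h"
    and hX: "positive_smooth A hX"
    and C: "(C0, C1) \<in> {(1, -1), (-1, 1)}"
    and mat: "metric_matrix L hL hX C0 C1 h"
    and \<phi>_fibre: "\<And>x. \<phi> x \<in> fibre L x"
    and dol: "dolbeault_matrix A L E \<phi>"
begin

sublocale HE: pseudo_hermitian_bundle "times_line_atlas A" E h by (rule pseudo_hermitian_bundle_E[OF ph])

definition DE :: "('l \<times> complex \<times> complex, 'x \<times> complex, 2) conn" where
  "DE = chern_connection (times_line_atlas A) E h"

lemma DE: "connection TA E DE" "compatible TA E h DE" "has_dolbeault_part TA E DE"
  unfolding DE_def by (rule HE.chern_connection)+

lemma DE_V: "connection TA V DE" using DE(1) by (simp add: connection_E)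

lemma hX_pos: "hX x > 0" and hX_smooth: "smooth_fun A UNIV hX"
  using hX unfolding positive_smooth_def by auto

lemma C01: "C0 \<noteq> 0" "C1 \<noteq> 0" "C0 = - C1"
  using C by auto

text \<open>
  The coefficient of \<open>d(cnj z)\<close> in the second fundamental form, in the frame of \<open>L\<close> given by \<open>\<tau>\<close>.
\<close>

definition fcoef :: "('l \<Rightarrow> complex^1) \<Rightarrow> 'x \<Rightarrow> complex" where
  "fcoef \<tau> x = of_real (1 / (2 * sqrt 2)) * \<tau> (\<phi> x) $ 1"

abbreviation rho1 :: "('l \<Rightarrow> complex^1) \<Rightarrow> 'x \<Rightarrow> complex" where
  "rho1 \<tau> x \<equiv> complex_of_real (hX x) * complex_of_real (weight \<tau> x)"

lemma h_frame:
  assumes w: "(W, \<tau>) \<in> btriv L" "x \<in> W"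
  shows "h (bscale L a (frame \<tau> x), z, b) (bscale L a' (frame \<tau> x), z, b') = 
    of_real C0 * (a * cnj a' * rho1 \<tau> x) + of_real C1 * (b * cnj b' * of_real (hX x))"
proof -
  note f = frame_fibre(1)[OF w]
  have "bproj L (bscale L a (frame \<tau> x)) = x" "bproj L (bscale L a' (frame \<tau> x)) = x"
    using L.bscale_fibre[OF f] unfolding fibre_def by blast+
  then show ?thesis using mat[unfolded metric_matrix_def, rule_format, of "bscale L a (frame \<tau> x)" "bscale L a' (frame \<tau> x)" z b b']
    by (simp add: hL_frame[OF w] mult_ac)
qed

lemma of_triv_L_frame:
  assumes w: "(W, \<tau>) \<in> btriv L" "x \<in> W"
  shows "of_triv L \<tau> (vec a) x = bscale L a (frame \<tau> x)"
  by (rule L.triv_inj[OF w L.of_triv(1)[OF w] L.bscale_fibre[OF frame_fibre(1)[OF w]]])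
    (simp add: L.of_triv[OF w] L.triv_scale[OF w frame_fibre(1)[OF w]] frame_fibre[OF w] vec_eq_iff)

lemma chern_coeffs_E:
  fixes z :: complex
  assumes w: "(W, \<tau>) \<in> btriv L" and c: "c \<in> A" and x: "x \<in> fst c" "x \<in> W"
  defines "G \<equiv> \<lambda>v i. conn_coeff V (sumtriv \<tau>) DE (prod_chart c) v i (x, z)"
  shows "G v 1 $ 1 = del c (vec (v $ 1)) (rho1 \<tau>) x / rho1 \<tau> x"
    "G v 1 $ 2 = cnj (fcoef \<tau> x) * v $ 2 * of_real (weight \<tau> x)"
    "G v 2 $ 1 = fcoef \<tau> x * cnj (v $ 2)"
    "G v 2 $ 2 = del c (vec (v $ 1)) (\<lambda>x. of_real (hX x)) x / of_real (hX x)"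
proof -
  let ?d = "prod_chart c" and ?p = "(x, z)" and ?\<sigma> = "sumtriv \<tau>"
  have d: "?d \<in> TA" and p: "?p \<in> fst ?d" "?p \<in> W \<times> UNIV" using c x by (auto intro: prod_chart_mem)
  have W: "open W" "open (W \<times> (UNIV::complex set))" using L.triv_open[OF w] by (auto intro: open_Times)
  define s where "s i = of_triv V ?\<sigma> (axis i 1)" for i
  have s: "smooth_section TA E (W \<times> UNIV) (s i)" for i 
    unfolding s_def smooth_section_E by (rule V.smooth_section_frame[OF sum_bundle_triv[OF w]])
  have sv: "s i (y, z) = (bscale L (axis i 1 $ 1) (frame \<tau> y), z, axis i 1 $ 2)" if "y \<in> W" for i y z
    unfolding s_def of_triv_V[OF w that] of_triv_L_frame[OF w that] ..
  note f = frame_fibre(1)[OF w x(2)]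
  have Ds: "DE ?d v (s i) ?p = (bscale L (G v i $ 1) (frame \<tau> x), z, G v i $ 2)" for i
  proof -
    have fib: "DE ?d v (s i) ?p \<in> fibre V ?p" using E.connection_fibre[OF DE(1) d s p] by simp
    then obtain m b where m: "DE ?d v (s i) ?p = (m, z, b)" "m \<in> fibre L x" 
      by (cases "DE ?d v (s i) ?p") (auto simp: fibre_V_iff)
    have "G v i = vector [\<tau> m $ 1, b]" unfolding G_def conn_coeff_def s_def[symmetric] m(1) by simp
    then show ?thesis using m fibre_frame[OF w x(2) m(2)] by simp
  qed
  have dols: "dolbeault E ?d v (s i) ?p = (bscale L (axis i 1 $ 2 * (fcoef \<tau> x * cnj (v $ 2))) (frame \<tau> x), z, 0)" for i
  proof -
    have "bform ?d v ?p = bscale L (of_real (1 / (2 * sqrt 2)) * cnj (v $ 2)) (bscale L (\<tau> (\<phi> x) $ 1) (frame \<tau> x))"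
      unfolding dolbeault_matrixD[OF dol \<phi>_fibre c x(1)] using fibre_frame[OF w x(2) \<phi>_fibre] by simp
    then have "bform ?d v ?p = bscale L (fcoef \<tau> x * cnj (v $ 2)) (frame \<tau> x)"
      unfolding L.bscale_bscale[OF f] fcoef_def by (simp add: mult_ac)
    then show ?thesis unfolding s_def using dolbeault_sum_frame[OF w d p(1), of v "axis i 1"] x(2) by (simp add: L.bscale_bscale[OF f])
  qed
  have R: "smooth_fun A W (rho1 \<tau>)"
    by (intro smooth_fun_mult smooth_weight_complex[OF w] smooth_fun_of_real smooth_fun_subset[OF hX_smooth] W) auto
  have X: "smooth_fun A W (\<lambda>x. complex_of_real (hX x))"
    by (intro smooth_fun_of_real smooth_fun_subset[OF hX_smooth] W) auto
  have XT: "smooth_fun TA (W \<times> UNIV) (\<lambda>q. rho1 \<tau> (fst q))" "smooth_fun TA (W \<times> UNIV) (\<lambda>q. complex_of_real (hX (fst q)))"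
    by (rule smooth_fun_pullback_fst[OF R W(1)], rule smooth_fun_pullback_fst[OF X W(1)])
  have eqn: "h (DE ?d v (s i) ?p) (s j ?p) = h (dolbeault E ?d v (s i) ?p) (s j ?p) + 
      (of_real C0 * (axis i 1 $ 1 * cnj (axis j 1 $ 1)) * del c (vec (v $ 1)) (rho1 \<tau>) x
       + of_real C1 * (axis i 1 $ 2 * cnj (axis j 1 $ 2)) * del c (vec (v $ 1)) (\<lambda>x. of_real (hX x)) x)
      - h (s i ?p) (dolbeault E ?d v (s j) ?p)" for i j
  proof -
    have "del ?d v (\<lambda>q. h (s i q) (s j q)) ?p = del ?d v (\<lambda>q. of_real C0 * (axis i 1 $ 1 * cnj (axis j 1 $ 1)) * rho1 \<tau> (fst q)
       + of_real C1 * (axis i 1 $ 2 * cnj (axis j 1 $ 2)) * of_real (hX (fst q))) ?p"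
    proof (rule T.del_cong(1)[OF W(2) d p])
      fix q :: "'x \<times> complex" assume "q \<in> W \<times> UNIV"
      then obtain y u where q: "q = (y, u)" "y \<in> W" by auto
      show "h (s i q) (s j q) = of_real C0 * (axis i 1 $ 1 * cnj (axis j 1 $ 1)) * rho1 \<tau> (fst q)
       + of_real C1 * (axis i 1 $ 2 * cnj (axis j 1 $ 2)) * of_real (hX (fst q))"
        unfolding q(1) sv[OF q(2)] h_frame[OF w q(2)] by simp
    qed
    also have "\<dots> = of_real C0 * (axis i 1 $ 1 * cnj (axis j 1 $ 1)) * del ?d v (\<lambda>q. rho1 \<tau> (fst q)) ?p
       + of_real C1 * (axis i 1 $ 2 * cnj (axis j 1 $ 2)) * del ?d v (\<lambda>q. of_real (hX (fst q))) ?p"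
      by (subst T.del_add(1)[OF T.smooth_fun_mult[OF T.smooth_fun_const XT(1) W(2)] T.smooth_fun_mult[OF T.smooth_fun_const XT(2) W(2)] d p])
        (simp only: T.del_cmult(1)[OF XT(1) d p] T.del_cmult(1)[OF XT(2) d p])
    finally show ?thesis
      using HE.h_connection[OF DE(2,3,1) s s d p, of v i j] 
      unfolding del_pullback_fst(1)[OF R c x] del_pullback_fst(1)[OF X c x] by (simp only: diff_conv_add_uminus)
  qed
  have wp: "complex_of_real (weight \<tau> x) \<noteq> 0" "complex_of_real (hX x) \<noteq> 0" "complex_of_real C0 \<noteq> 0" "complex_of_real C1 \<noteq> 0"
    using weight(2)[OF w x(2)] hX_pos[of x] C01 by auto
  note E = eqn[unfolded Ds dols sv[OF x(2)] h_frame[OF w x(2)]]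
  show "G v 1 $ 1 = del c (vec (v $ 1)) (rho1 \<tau>) x / rho1 \<tau> x"
    using E[of 1 1] wp by (simp add: axis_def field_simps)
  show "G v 1 $ 2 = cnj (fcoef \<tau> x) * v $ 2 * of_real (weight \<tau> x)"
    using E[of 1 2] wp by (simp add: axis_def C01(3) field_simps)
  show "G v 2 $ 1 = fcoef \<tau> x * cnj (v $ 2)"
    using E[of 2 1] wp by (simp add: axis_def field_simps)
  show "G v 2 $ 2 = del c (vec (v $ 1)) (\<lambda>x. of_real (hX x)) x / of_real (hX x)"
    using E[of 2 2] wp by (simp add: axis_def field_simps)
qed

lemma curvature_diagonal:
  assumes w: "(W, \<tau>) \<in> btriv L" and c: "c \<in> A" and x: "x \<in> fst c" "x \<in> W"
  shows "curv_coeff V (sumtriv \<tau>) DE (prod_chart c) u (\<i> *s u) 1 1 (x, z) = 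
      of_real ((cmod (u $ 1))\<^sup>2) * log_curvature c (rho1 \<tau>) x
      + of_real ((cmod (u $ 2))\<^sup>2) * (2 * \<i> * (of_real ((cmod (fcoef \<tau> x))\<^sup>2) * of_real (weight \<tau> x)))"
    "curv_coeff V (sumtriv \<tau>) DE (prod_chart c) u (\<i> *s u) 2 2 (x, z) = 
      of_real ((cmod (u $ 1))\<^sup>2) * log_curvature c (\<lambda>x. of_real (hX x)) x
      - of_real ((cmod (u $ 2))\<^sup>2) * (2 * \<i> * (of_real ((cmod (fcoef \<tau> x))\<^sup>2) * of_real (weight \<tau> x)))"
proof -
  let ?d = "prod_chart c" and ?p = "(x, z)" and ?\<sigma> = "sumtriv \<tau>"
  let ?U = "fst c \<inter> W"
  have d: "?d \<in> TA" and p: "?p \<in> fst ?d" "?p \<in> ?U \<times> UNIV" using c x by (auto intro: prod_chart_mem)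
  have U: "open ?U" "open (?U \<times> (UNIV::complex set))" "x \<in> ?U" using L.triv_open[OF w] chart_open[OF c] x by (auto intro: open_Times)
  note Gs = chern_coeffs_E[OF w c]
  have R: "smooth_fun A W (rho1 \<tau>)"
    by (intro smooth_fun_mult smooth_weight_complex[OF w] smooth_fun_of_real smooth_fun_subset[OF hX_smooth] L.triv_open[OF w]) auto
  have X: "smooth_fun A W (\<lambda>x. complex_of_real (hX x))"
    by (intro smooth_fun_of_real smooth_fun_subset[OF hX_smooth] L.triv_open[OF w]) auto
  have nz: "rho1 \<tau> y \<noteq> 0" "complex_of_real (hX y) \<noteq> 0" if "y \<in> W" for y
    using weight(2)[OF w that] hX_pos[of y] by auto
  have D: "dir_deriv ?d u' (\<lambda>q. conn_coeff V ?\<sigma> DE ?d v i q $ i) ?p = v $ 1 * dir_deriv c (vec (u' $ 1)) (\<lambda>x. del c (vec 1) \<rho> x / \<rho> x) x"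
    if G: "\<And>y z. y \<in> ?U \<Longrightarrow> conn_coeff V ?\<sigma> DE ?d v i (y, z) $ i = del c (vec (v $ 1)) \<rho> y / \<rho> y"
      and \<rho>: "smooth_fun A W \<rho>" "\<And>y. y \<in> W \<Longrightarrow> \<rho> y \<noteq> 0" for u' v i \<rho>
  proof -
    let ?a = "\<lambda>x. del c (vec 1) \<rho> x / \<rho> x"
    have a: "smooth_fun A ?U ?a" by (rule smooth_log_derivative[OF \<rho> L.triv_open[OF w] c])
    have "dir_deriv ?d u' (\<lambda>q. conn_coeff V ?\<sigma> DE ?d v i q $ i) ?p = dir_deriv ?d u' (\<lambda>q. v $ 1 * ?a (fst q)) ?p"
    proof (rule T.dir_deriv_cong[OF U(2) d p])
      fix q :: "'x \<times> complex" assume "q \<in> ?U \<times> UNIV"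
      then obtain y b where q: "q = (y, b)" "y \<in> ?U" by auto
      then have y: "y \<in> fst c" "y \<in> W" by auto
      show "conn_coeff V ?\<sigma> DE ?d v i q $ i = v $ 1 * ?a (fst q)"
        unfolding q(1) G[OF q(2)] unfolding vec_smult_one[of "v $ 1"] del_smult[OF \<rho>(1) c y] by simp
    qed
    also have "\<dots> = v $ 1 * dir_deriv ?d u' (\<lambda>q. ?a (fst q)) ?p"
      using T.dir_deriv_mult[OF T.smooth_fun_const smooth_fun_pullback_fst[OF a U(1)] d p, of u' "v $ 1"] by simp
    finally show ?thesis unfolding dir_deriv_pullback_fst[OF a c x(1) U(3)] .
  qed
  have L: "v $ 1 = \<i> * u $ 1 \<Longrightarrow> v $ 1 * dir_deriv c (vec (u $ 1)) (\<lambda>x. del c (vec 1) \<rho> x / \<rho> x) x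
      - u $ 1 * dir_deriv c (vec (v $ 1)) (\<lambda>x. del c (vec 1) \<rho> x / \<rho> x) x = of_real ((cmod (u $ 1))\<^sup>2) * log_curvature c \<rho> x"
    if \<rho>: "smooth_fun A W \<rho>" "\<And>y. y \<in> W \<Longrightarrow> \<rho> y \<noteq> 0" for v :: "complex^2" and \<rho>
  proof -
    assume v: "v $ 1 = \<i> * u $ 1"
    have iv: "(vec (\<i> * u $ 1) :: complex^1) = \<i> *s vec (u $ 1)" by (simp add: vec_eq_iff)
    show ?thesis unfolding v iv log_curvature_def
      by (rule curl_log[OF smooth_log_derivative[OF \<rho> L.triv_open[OF w] c] c x(1) U(3)])
  qed
  have iu: "(\<i> *s u) $ 1 = \<i> * u $ 1" "(\<i> *s u) $ 2 = \<i> * u $ 2" by simp_all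
  have n: "of_real ((cmod a)\<^sup>2) = a * cnj a" for a by (rule complex_norm_square)
  have G1: "y \<in> ?U \<Longrightarrow> conn_coeff V ?\<sigma> DE ?d v 1 (y, z) $ 1 = del c (vec (v $ 1)) (rho1 \<tau>) y / rho1 \<tau> y"
    and G2: "y \<in> ?U \<Longrightarrow> conn_coeff V ?\<sigma> DE ?d v 2 (y, z) $ 2 = del c (vec (v $ 1)) (\<lambda>x. of_real (hX x)) y / of_real (hX y)" for y z v
    using Gs(1,4)[where x=y and z=z and v=v] by auto
  have D1: "dir_deriv ?d u' (\<lambda>q. conn_coeff V ?\<sigma> DE ?d v 1 q $ 1) ?p = 
      v $ 1 * dir_deriv c (vec (u' $ 1)) (\<lambda>x. del c (vec 1) (rho1 \<tau>) x / rho1 \<tau> x) x" for u' v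
    by (rule D[OF G1 R nz(1)])
  have D2: "dir_deriv ?d u' (\<lambda>q. conn_coeff V ?\<sigma> DE ?d v 2 q $ 2) ?p = 
      v $ 1 * dir_deriv c (vec (u' $ 1)) (\<lambda>x. del c (vec 1) (\<lambda>x. of_real (hX x)) x / of_real (hX x)) x" for u' v
    by (rule D[OF G2 X nz(2)])
  have L1: "(\<i> *s u) $ 1 * dir_deriv c (vec (u $ 1)) (\<lambda>x. del c (vec 1) (rho1 \<tau>) x / rho1 \<tau> x) x
      - u $ 1 * dir_deriv c (vec ((\<i> *s u) $ 1)) (\<lambda>x. del c (vec 1) (rho1 \<tau>) x / rho1 \<tau> x) x = of_real ((cmod (u $ 1))\<^sup>2) * log_curvature c (rho1 \<tau>) x"
    by (rule L[OF R nz(1) iu(1)])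
  have L2: "(\<i> *s u) $ 1 * dir_deriv c (vec (u $ 1)) (\<lambda>x. del c (vec 1) (\<lambda>x. of_real (hX x)) x / of_real (hX x)) x
      - u $ 1 * dir_deriv c (vec ((\<i> *s u) $ 1)) (\<lambda>x. del c (vec 1) (\<lambda>x. of_real (hX x)) x / of_real (hX x)) x 
      = of_real ((cmod (u $ 1))\<^sup>2) * log_curvature c (\<lambda>x. of_real (hX x)) x"
    by (rule L[OF X nz(2) iu(1)])
  show "curv_coeff V (sumtriv \<tau>) DE (prod_chart c) u (\<i> *s u) 1 1 (x, z) = 
      of_real ((cmod (u $ 1))\<^sup>2) * log_curvature c (rho1 \<tau>) x
      + of_real ((cmod (u $ 2))\<^sup>2) * (2 * \<i> * (of_real ((cmod (fcoef \<tau> x))\<^sup>2) * of_real (weight \<tau> x)))"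
    unfolding curv_coeff_def D1 sum_2 Gs(2,3)[OF x] L1 unfolding n
    by (simp add: algebra_simps)
  show "curv_coeff V (sumtriv \<tau>) DE (prod_chart c) u (\<i> *s u) 2 2 (x, z) = 
      of_real ((cmod (u $ 1))\<^sup>2) * log_curvature c (\<lambda>x. of_real (hX x)) x
      - of_real ((cmod (u $ 2))\<^sup>2) * (2 * \<i> * (of_real ((cmod (fcoef \<tau> x))\<^sup>2) * of_real (weight \<tau> x)))"
    unfolding curv_coeff_def D2 sum_2 Gs(2,3)[OF x] L2 unfolding n
    by (simp add: algebra_simps)
qed

text \<open>
  The diagonal entries of the Einstein equation. The square norm of the second fundamental form enters them with opposite signs; the indefiniteness of the metric reverses both signs compared with the Hermitian case, which is the source of the exotic sign in the vortex equation.
\<close>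

lemma einstein_equations:
  assumes \<omega>: "kaehler_form A \<omega>"
    and HE: "pseudo_hermitian_einstein (times_line_atlas A) (product_form A \<omega>) E h lam"
    and w: "(W, \<tau>) \<in> btriv L" and c: "c \<in> A" and x: "x \<in> fst c" "x \<in> W"
  defines "r \<equiv> complex_of_real (\<omega> c x (vec 1) (\<i> *s vec 1))"
    and "K \<equiv> complex_of_real ((cmod (fcoef \<tau> x))\<^sup>2) * of_real (weight \<tau> x)"
  shows "\<i> * log_curvature c (rho1 \<tau>) x / r - 2 * K = lam"
    "\<i> * log_curvature c (\<lambda>x. of_real (hX x)) x / r + 2 * K = lam"
proof -
  let ?d = "prod_chart c" and ?p = "(x, 0::complex)" and ?\<sigma> = "sumtriv \<tau>"
  have d: "?d \<in> TA" and p: "?p \<in> fst ?d" "?p \<in> W \<times> UNIV" using c x by (auto intro: prod_chart_mem)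
  note wV = sum_bundle_triv[OF w]
  define r' where "r' = \<omega> c x (vec 1) (\<i> *s vec 1)"
  have r': "r' > 0" "r = of_real r'" using kaehler_dim1(2)[OF \<omega> c x(1)] by (auto simp: r'_def r_def)
  define \<Omega> where "\<Omega> = product_form A \<omega> ?d ?p"
  have \<Omega>: "\<Omega> u v = r' * Im (cnj (u $ 1) * v $ 1) + Im (cnj (u $ 2) * v $ 2)" for u v
    unfolding \<Omega>_def r'_def by (rule product_form_eq[OF \<omega> c x(1)])
  define b where "b = (SOME b. unitary_basis \<Omega> b)"
  have "unitary_basis \<Omega> (\<lambda>j. if j = 1 then vector [of_real (1 / sqrt r'), 0] else vector [0, 1])"
    unfolding unitary_basis_def \<Omega> forall_2 using r' by (auto simp: power2_eq_square[symmetric] field_simps)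
  then have ub: "unitary_basis \<Omega> b" unfolding b_def by (rule someI[where P="unitary_basis \<Omega>"])
  note B = unitary_dim2[OF \<Omega> r'(1) ub]
  obtain W' \<tau>' where w': "(W', \<tau>') \<in> btriv E" "?p \<in> W'" using E.triv_cover by blast
  have main: "\<i> * (\<Sum>j\<in>UNIV. curv_coeff V ?\<sigma> DE ?d (b j) (\<i> *s b j) m m ?p) = lam" for m
  proof -
    define e where "e = of_triv V ?\<sigma> (axis m 1) ?p"
    have e: "e \<in> fibre V ?p" "?\<sigma> e = axis m 1" using V.of_triv[OF wV p(2)] by (auto simp: e_def)
    define X where "X j = curvature TA E DE ?d ?p (b j) (\<i> *s b j) e" for j
    have X: "X j \<in> fibre V ?p" "?\<sigma> (X j) $ m = curv_coeff V ?\<sigma> DE ?d (b j) (\<i> *s b j) m m ?p" for j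
      unfolding X_def curvature_E using V.curvature_triv[OF DE_V wV e(1) d p]
      by (auto simp: e(2) axis_def if_distrib[of "\<lambda>a. a * _"] cong: if_cong)
    have "\<i> *s contraction \<Omega> (\<lambda>u v. \<tau>' (curvature TA E DE ?d ?p u v e)) = lam *s \<tau>' e"
      using HE d w' p(1) e(1) unfolding pseudo_hermitian_einstein_def hermitian_yang_mills_def DE_def[symmetric] \<Omega>_def
      by fastforce
    then have eq: "\<i> *s (\<tau>' (X 1) + \<tau>' (X 2)) = lam *s \<tau>' e"
      unfolding contraction_def Let_def b_def[symmetric] X_def by (simp add: sum_2)
    have XE: "X j \<in> fibre E ?p" for j using X(1) by simp
    have eE: "e \<in> fibre E ?p" using e by simp
    have "bscale E \<i> (badd E (X 1) (X 2)) = bscale E lam e"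
      by (rule E.triv_inj[OF w' E.bscale_fibre[OF E.badd_fibre[OF XE XE]] E.bscale_fibre[OF eE]])
        (simp only: E.triv_scale(2)[OF w' E.badd_fibre[OF XE XE]] E.triv_add(2)[OF w' XE XE] E.triv_scale(2)[OF w' eE] eq)
    then have "?\<sigma> (bscale V \<i> (badd V (X 1) (X 2))) = ?\<sigma> (bscale V lam e)" by (simp only: E_ops)
    then have "\<i> *s (?\<sigma> (X 1) + ?\<sigma> (X 2)) = lam *s ?\<sigma> e"
      by (simp only: V.triv_scale(2)[OF wV p(2) V.badd_fibre[OF X(1) X(1)]] V.triv_add(2)[OF wV p(2) X(1) X(1)] V.triv_scale(2)[OF wV p(2) e(1)])
    then have "\<i> * (?\<sigma> (X 1) $ m + ?\<sigma> (X 2) $ m) = lam * ?\<sigma> e $ m"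
      using arg_cong[of _ _ "\<lambda>v. v $ m"] unfolding vector_smult_component[symmetric] vector_add_component[symmetric] by blast
    then show ?thesis unfolding X(2) e(2) by (simp add: sum_2 axis_def)
  qed
  have B1: "of_real ((cmod (b 1 $ 1))\<^sup>2) * P + of_real ((cmod (b 2 $ 1))\<^sup>2) * P = P / r" for P
    unfolding distrib_right[symmetric] of_real_add[symmetric] B(1) r'(2) by simp
  have B2: "of_real ((cmod (b 1 $ 2))\<^sup>2) * P + of_real ((cmod (b 2 $ 2))\<^sup>2) * P = (P :: complex)" for P
    unfolding distrib_right[symmetric] of_real_add[symmetric] B(2) by simp
  have "lam = \<i> * ((of_real ((cmod (b 1 $ 1))\<^sup>2) * log_curvature c (rho1 \<tau>) x + of_real ((cmod (b 2 $ 1))\<^sup>2) * log_curvature c (rho1 \<tau>) x)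
     + (of_real ((cmod (b 1 $ 2))\<^sup>2) * (2 * \<i> * K) + of_real ((cmod (b 2 $ 2))\<^sup>2) * (2 * \<i> * K)))"
    unfolding main[of 1, symmetric] sum_2 curvature_diagonal(1)[OF w c x] K_def[symmetric] by (simp only: add_ac)
  then show "\<i> * log_curvature c (rho1 \<tau>) x / r - 2 * K = lam"
    unfolding B1 B2 by (simp add: algebra_simps)
  have "lam = \<i> * ((of_real ((cmod (b 1 $ 1))\<^sup>2) * log_curvature c (\<lambda>x. of_real (hX x)) x + of_real ((cmod (b 2 $ 1))\<^sup>2) * log_curvature c (\<lambda>x. of_real (hX x)) x)
     - (of_real ((cmod (b 1 $ 2))\<^sup>2) * (2 * \<i> * K) + of_real ((cmod (b 2 $ 2))\<^sup>2) * (2 * \<i> * K)))"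
    unfolding main[of 2, symmetric] sum_2 curvature_diagonal(2)[OF w c x] K_def[symmetric] by (simp only: diff_conv_add_uminus minus_add_distrib add_ac)
  then show "\<i> * log_curvature c (\<lambda>x. of_real (hX x)) x / r + 2 * K = lam"
    unfolding B1 B2 by (simp add: algebra_simps)
qed

text \<open>
  The difference of the two diagonal Einstein equations eliminates \<open>hX\<close> and \<open>lam\<close> and is the vortex equation; their sum eliminates \<open>\<phi>\<close> and expresses the curvature of \<open>L\<close> by \<open>lam\<close> up to a Laplacian.
\<close>

theorem vortex_and_curvature:
  assumes \<omega>: "kaehler_form A \<omega>"
    and HE: "pseudo_hermitian_einstein (times_line_atlas A) (product_form A \<omega>) E h lam"
  shows "exotic_vortex A \<omega> L \<phi> hL 0"
    "c \<in> A \<Longrightarrow> x \<in> fst c \<Longrightarrow> \<i> * line_curvature A L hL c x (vec 1) (\<i> *s vec 1) =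
       2 * lam * of_real (\<omega> c x (vec 1) (\<i> *s vec 1)) + of_real (laplace c (\<lambda>x. ln (hX x)) x)"
proof -
  have loc: "\<i> * log_curvature c (\<lambda>x. of_real (weight \<tau> x)) x / of_real (\<omega> c x (vec 1) (\<i> *s vec 1)) = (1/2) * hL (\<phi> x) (\<phi> x)"
    "\<i> * log_curvature c (\<lambda>x. of_real (weight \<tau> x)) x =
       2 * lam * of_real (\<omega> c x (vec 1) (\<i> *s vec 1)) + of_real (laplace c (\<lambda>x. ln (hX x)) x)"
    if w: "(W, \<tau>) \<in> btriv L" and c: "c \<in> A" and x: "x \<in> fst c" "x \<in> W" for W \<tau> c x
  proof -
    define r where "r = complex_of_real (\<omega> c x (vec 1) (\<i> *s vec 1))"
    have r: "r \<noteq> 0" using kaehler_dim1(2)[OF \<omega> c x(1)] by (simp add: r_def)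
    define K where "K = complex_of_real ((cmod (fcoef \<tau> x))\<^sup>2) * of_real (weight \<tau> x)"
    let ?kL = "log_curvature c (\<lambda>x. complex_of_real (weight \<tau> x)) x" and ?kX = "log_curvature c (\<lambda>x. complex_of_real (hX x)) x"
    have X: "smooth_fun A W (\<lambda>x. complex_of_real (hX x))"
      by (intro smooth_fun_of_real smooth_fun_subset[OF hX_smooth] L.triv_open[OF w]) auto
    have k1: "log_curvature c (rho1 \<tau>) x = ?kX + ?kL"
      by (rule log_curvature_mult[OF X _ smooth_weight_complex[OF w] _ L.triv_open[OF w] c x])
        (use hX_pos weight(2)[OF w] in \<open>auto simp: less_imp_neq[symmetric]\<close>)
    have kX: "?kX = (\<i> / 2) * of_real (laplace c (\<lambda>x. ln (hX x)) x)"
      by (rule log_curvature_real[OF hX_smooth hX_pos open_UNIV c x(1) UNIV_I])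
    have e: "\<i> * (?kX + ?kL) / r - 2 * K = lam" "\<i> * ?kX / r + 2 * K = lam"
      using einstein_equations[OF \<omega> HE w c x] unfolding k1 r_def K_def by blast+
    have hK: "hL (\<phi> x) (\<phi> x) = 8 * K"
    proof -
      have "hL (\<phi> x) (\<phi> x) = \<tau> (\<phi> x) $ 1 * cnj (\<tau> (\<phi> x) $ 1) * of_real (weight \<tau> x)"
        using hL_frame[OF w x(2), of "\<tau> (\<phi> x) $ 1" "\<tau> (\<phi> x) $ 1"] fibre_frame[OF w x(2) \<phi>_fibre] by simp
      moreover have "8 * of_real ((cmod (fcoef \<tau> x))\<^sup>2) = \<tau> (\<phi> x) $ 1 * cnj (\<tau> (\<phi> x) $ 1)"
      proof -
        have "(cmod (fcoef \<tau> x))\<^sup>2 = (cmod (\<tau> (\<phi> x) $ 1))\<^sup>2 / 8"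
          by (simp add: fcoef_def norm_mult norm_divide power_mult_distrib power_divide)
        then have "8 * (cmod (fcoef \<tau> x))\<^sup>2 = (cmod (\<tau> (\<phi> x) $ 1))\<^sup>2" by simp
        then have "complex_of_real (8 * (cmod (fcoef \<tau> x))\<^sup>2) = of_real ((cmod (\<tau> (\<phi> x) $ 1))\<^sup>2)" by (rule arg_cong)
        then show ?thesis unfolding complex_norm_square[of "\<tau> (\<phi> x) $ 1", symmetric] of_real_mult of_real_numeral .
      qed
      ultimately show ?thesis by (simp add: K_def)
    qed
    have aux: "b = 4 * K" if "a + b - 2 * K = l" "a + 2 * K = l" for a b l :: complex
    proof -
      have "b = (a + b - 2 * K) - (a + 2 * K) + 4 * K" by (simp add: algebra_simps)
      then show ?thesis using that by simp
    qed
    have e1: "\<i> * ?kX / r + \<i> * ?kL / r - 2 * K = lam"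
      using e(1) by (simp only: distrib_left add_divide_distrib)
    have "\<i> * ?kL / r = 4 * K" by (rule aux[OF e1 e(2)])
    then show "\<i> * ?kL / of_real (\<omega> c x (vec 1) (\<i> *s vec 1)) = (1/2) * hL (\<phi> x) (\<phi> x)"
      unfolding hK r_def by simp
    have aux2: "b + 2 * a = 2 * l * r" if "a / r + b / r - 2 * K = l" "a / r + 2 * K = l" for a b l :: complex
    proof -
      have "(b + 2 * a) / r = (a / r + b / r - 2 * K) + (a / r + 2 * K)" by (simp add: add_divide_distrib)
      then have "(b + 2 * a) / r = 2 * l" unfolding that by simp
      then show ?thesis using r by (simp add: field_simps)
    qed
    have "\<i> * ?kL + 2 * \<i> * ?kX = 2 * lam * r" using aux2[OF e1 e(2)] by (simp add: mult.assoc)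
    moreover have "2 * \<i> * ?kX = - of_real (laplace c (\<lambda>x. ln (hX x)) x)" unfolding kX by simp
    ultimately show "\<i> * ?kL = 2 * lam * of_real (\<omega> c x (vec 1) (\<i> *s vec 1)) + of_real (laplace c (\<lambda>x. ln (hX x)) x)"
      unfolding r_def by (simp add: algebra_simps)
  qed
  have one: "line_curvature A L hL c x (vec 1) (\<i> *s vec 1) = log_curvature c (\<lambda>x. of_real (weight \<tau> x)) x"
    if w: "(W, \<tau>) \<in> btriv L" and c: "c \<in> A" and x: "x \<in> fst c" "x \<in> W" for W \<tau> c x
    using line_curvature_eq[OF w c x, of 1] by simp
  show "exotic_vortex A \<omega> L \<phi> hL 0"
    unfolding exotic_vortex_def
  proof (intro ballI)
    fix c x assume c: "c \<in> A" and x: "x \<in> fst c"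
    obtain W \<tau> where w: "(W, \<tau>) \<in> btriv L" "x \<in> W" using L.triv_cover by blast
    have "contraction (\<omega> c x) (line_curvature A L hL c x) = log_curvature c (\<lambda>x. of_real (weight \<tau> x)) x / of_real (\<omega> c x (vec 1) (\<i> *s vec 1))"
      by (rule contraction_dim1[OF \<omega> c x]) (rule line_curvature_eq[OF w(1) c x w(2)])
    then show "\<i> * contraction (\<omega> c x) (line_curvature A L hL c x) - (1/2) * hL (\<phi> x) (\<phi> x) - of_real 0 / 2 = 0"
      using loc(1)[OF w(1) c x w(2)] by simp
  qed
  show "c \<in> A \<Longrightarrow> x \<in> fst c \<Longrightarrow> \<i> * line_curvature A L hL c x (vec 1) (\<i> *s vec 1) =
       2 * lam * of_real (\<omega> c x (vec 1) (\<i> *s vec 1)) + of_real (laplace c (\<lambda>x. ln (hX x)) x)"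
  proof -
    assume c: "c \<in> A" and x: "x \<in> fst c"
    obtain W \<tau> where w: "(W, \<tau>) \<in> btriv L" "x \<in> W" using L.triv_cover by blast
    show ?thesis unfolding one[OF w(1) c x w(2)] by (rule loc(2)[OF w(1) c x w(2)])
  qed
qed

end

section \<open>Partitions of unity\<close>

text \<open>
  The powers of \<open>inverse x\<close> make the family closed under differentiation up to linear combinations, so that smoothness of all its members follows by one induction.
\<close>

definition bump_fun :: "nat \<Rightarrow> real \<Rightarrow> real" where
  "bump_fun n x = (if x > 0 then inverse x ^ n * exp (- inverse x) else 0)"

lemma bump_fun_tendsto: "(bump_fun n \<longlongrightarrow> 0) (at 0)"
proof -
  have "((\<lambda>x::real. x ^ n / exp x) \<longlongrightarrow> 0) at_top" by (rule tendsto_power_div_exp_0)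
  then have 1: "((\<lambda>x. inverse x ^ n / exp (inverse x)) \<longlongrightarrow> 0) (at_right (0::real))"
    by (rule filterlim_compose) (rule filterlim_inverse_at_top_right)
  have "(bump_fun n \<longlongrightarrow> 0) (at_right 0)"
    by (rule Lim_transform_eventually[OF 1])
      (auto simp: eventually_at_filter bump_fun_def exp_minus field_simps)
  moreover have "(bump_fun n \<longlongrightarrow> 0) (at_left 0)"
    by (rule tendsto_eventually) (auto simp: eventually_at_filter bump_fun_def)
  ultimately show ?thesis by (simp add: filterlim_split_at)
qed

lemma bump_fun_deriv:
  "(bump_fun n has_real_derivative (- real n * bump_fun (Suc n) x + bump_fun (n + 2) x)) (at x)"
proof (cases x "0::real" rule: linorder_cases)
  case greater
  have pw: "real n * (- (i ^ Suc (Suc 0)) * i ^ (n - Suc 0)) = - real n * i ^ Suc n" for i :: real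
    by (cases n) (simp_all add: algebra_simps)
  have inv: "(inverse has_real_derivative - (inverse x ^ Suc (Suc 0))) (at x)"
    by (rule DERIV_inverse) (use greater in simp)
  have d1: "((\<lambda>x. inverse x ^ n) has_real_derivative - real n * inverse x ^ Suc n) (at x)"
    using DERIV_power[OF inv, of n] unfolding pw .
  have d2: "((\<lambda>x. exp (- inverse x)) has_real_derivative exp (- inverse x) * (- (- (inverse x ^ Suc (Suc 0))))) (at x)"
    by (rule DERIV_chain2[OF DERIV_exp DERIV_minus[OF inv]])
  have "((\<lambda>x. inverse x ^ n * exp (- inverse x)) has_real_derivative
      (- real n * bump_fun (Suc n) x + bump_fun (n + 2) x)) (at x)"
    using greater by (intro DERIV_cong[OF DERIV_mult[OF d1 d2]]) (simp add: bump_fun_def algebra_simps)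
  then show ?thesis
    by (rule has_field_derivative_transform_within_open[where S = "{0<..}"])
      (use greater in \<open>auto simp: bump_fun_def\<close>)
next
  case equal
  have "bump_fun (Suc n) = (\<lambda>y. (bump_fun n y - bump_fun n 0) / (y - 0))"
    by (auto simp: bump_fun_def field_simps)
  then have "((\<lambda>y. (bump_fun n y - bump_fun n 0) / (y - 0)) \<longlongrightarrow> 0) (at 0)"
    using bump_fun_tendsto[of "Suc n"] by simp
  then show ?thesis using equal by (simp add: has_field_derivative_iff bump_fun_def)
next
  case less
  have "((\<lambda>x. 0) has_real_derivative (- real n * bump_fun (Suc n) x + bump_fun (n + 2) x)) (at x)"
    using less by (simp add: bump_fun_def)
  then show ?thesis
    by (rule has_field_derivative_transform_within_open[where S = "{..<0}"])
      (use less in \<open>auto simp: bump_fun_def\<close>)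
qed

lemma k_smooth_on_bump: "k_smooth_on k UNIV (bump_fun n)"
proof (induction k arbitrary: n)
  case 0
  show ?case unfolding k_smooth_on.simps
    by (rule DERIV_continuous_on) (rule bump_fun_deriv)
next
  case (Suc k)
  show ?case
  proof (rule k_smooth_on_SucI)
    fix x show "(bump_fun n has_derivative (\<lambda>v. (- real n * bump_fun (Suc n) x + bump_fun (n + 2) x) * v)) (at x)"
      using bump_fun_deriv[of n x] by (simp add: has_field_derivative_def)
  next
    fix v
    show "k_smooth_on k UNIV (\<lambda>x. (- real n * bump_fun (Suc n) x + bump_fun (n + 2) x) * v)"
      by (intro bounded_bilinear.k_smooth_on_prod[OF bounded_bilinear_mult] k_smooth_on_add
          k_smooth_on_const Suc.IH) auto
  qed auto
qed

locale compact_surface = riemann_surface A for A :: "('x::t2_space, 1) chart set" +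
  assumes compact_space: "compact (UNIV :: 'x set)"
begin

lemma smooth_bump:
  "\<exists>b. \<exists>c\<in>A. smooth_fun A UNIV b \<and> (\<forall>q. b q \<ge> (0::real)) \<and> b p > 0 \<and> closure {q. b q \<noteq> 0} \<subseteq> fst c"
proof -
  obtain c where c: "c \<in> A" "p \<in> fst c" using chart_cover by blast
  define y0 where "y0 = snd c p"
  have "open (snd c ` fst c)" "y0 \<in> snd c ` fst c" using open_chart_image'[OF c(1)] c(2) by (auto simp: y0_def)
  then obtain r where r: "r > 0" "cball y0 r \<subseteq> snd c ` fst c" by (meson open_contains_cball)
  define K where "K = inv_into (fst c) (snd c) ` cball y0 r"
  have "compact K" unfolding K_def
    by (intro compact_continuous_image continuous_on_subset[OF continuous_on_inv_chart[OF c(1)] r(2)]) simp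
  then have K: "closed K" by (rule compact_imp_closed)
  have Kc: "K \<subseteq> fst c" using r(2) by (auto simp: K_def intro!: inv_into_into)
  define b where "b q = (if q \<in> fst c then bump_fun 0 (r\<^sup>2 - (snd c q - y0) \<bullet> (snd c q - y0)) else 0)" for q
  have nz: "{q. b q \<noteq> 0} \<subseteq> K"
  proof
    fix q assume "q \<in> {q. b q \<noteq> 0}"
    then have q: "q \<in> fst c" "(snd c q - y0) \<bullet> (snd c q - y0) < r\<^sup>2"
      by (auto simp: b_def bump_fun_def split: if_splits)
    then have "(norm (snd c q - y0))\<^sup>2 < r\<^sup>2" by (simp add: power2_norm_eq_inner)
    then have "norm (snd c q - y0) < r" using r(1) by (simp add: power2_less_imp_less)
    then have "snd c q \<in> cball y0 r" by (simp add: dist_norm norm_minus_commute)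
    then show "q \<in> K" using inv_chart[OF c(1) q(1)] unfolding K_def by (metis image_eqI)
  qed
  have "smooth_fun A UNIV b"
  proof (rule smooth_fun_Union[OF open_UNIV])
    fix q :: 'x
    show "\<exists>N. open N \<and> q \<in> N \<and> smooth_fun A (UNIV \<inter> N) b"
    proof (cases "q \<in> fst c")
      case True
      have sq: "smooth_on (snd c ` fst c) (\<lambda>y. r\<^sup>2 - (y - y0) \<bullet> (y - y0))"
        by (intro smooth_on_diff smooth_on_inner smooth_on_const open_chart_image'[OF c(1)]
            smooth_on_bounded_linear bounded_linear_ident)
      have "smooth_on (snd c ` fst c) (\<lambda>y. bump_fun 0 (r\<^sup>2 - (y - y0) \<bullet> (y - y0)))"
        by (rule smooth_on_compose[OF _ sq open_chart_image'[OF c(1)] subset_UNIV])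
          (simp add: smooth_on_def k_smooth_on_bump)
      moreover have eq: "in_chart c b y = bump_fun 0 (r\<^sup>2 - (y - y0) \<bullet> (y - y0))" if "y \<in> snd c ` fst c" for y
        using that by (auto simp: in_chart_at[OF c(1)] b_def)
      ultimately have "smooth_on (snd c ` fst c) (in_chart c b)"
        using smooth_on_cong[OF open_chart_image'[OF c(1)] eq] by simp
      then have "smooth_fun A (fst c) b"
        using c(1) chart_open[OF c(1)] by (intro smooth_funI_local bexI[of _ c] exI[of _ "fst c"]) auto
      then show ?thesis using True chart_open[OF c(1)] by (intro exI[of _ "fst c"]) simp
    next
      case False
      have o: "open (- K)" using K by (simp add: open_Compl)
      have "smooth_fun A (- K) b"
        using smooth_fun_cong[OF o, of b "\<lambda>_. 0"] nz by auto
      then show ?thesis using False Kc o by (intro exI[of _ "- K"]) auto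
    qed
  qed
  moreover have "b q \<ge> 0" for q by (simp add: b_def bump_fun_def)
  moreover have "b p > 0" using c r(1) by (simp add: b_def bump_fun_def y0_def)
  moreover have "closure {q. b q \<noteq> 0} \<subseteq> fst c" using closure_minimal[OF nz K] Kc by blast
  ultimately show ?thesis using c(1) by blast
qed

text \<open>
  The integral over the surface is a description quantifying over partitions of unity, so it has a determined value only because one exists.
\<close>

lemma partition_of_unity_exists: "\<exists>N c f. partition_of_unity A N c f"
proof -
  obtain b c where bc: "\<And>p. c p \<in> A" "\<And>p. smooth_fun A UNIV (b p)" "\<And>p q. b p q \<ge> (0::real)" "\<And>p. b p p > 0"
      "\<And>p. closure {q. b p q \<noteq> 0} \<subseteq> fst (c p)"
    using smooth_bump by metis
  have op: "open {q. b p q > 0}" for p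
    by (intro open_Collect_less smooth_fun_imp_continuous_on[OF bc(2)]) auto
  obtain C where C: "finite C" "UNIV \<subseteq> (\<Union>p\<in>C. {q. b p q > 0})"
    by (rule compactE_image[OF compact_space, of UNIV "\<lambda>p. {q. b p q > 0}"]) (use op bc(4) in auto)
  obtain e where e: "bij_betw e {0..<card C} C" using ex_bij_betw_nat_finite[OF C(1)] by blast
  define s where "s q = (\<Sum>k<card C. b (e k) q)" for q
  have s: "s q > 0" for q
  proof -
    obtain p where p: "p \<in> C" "b p q > 0" using C(2) by blast
    then have "p \<in> e ` {0..<card C}" using e by (simp add: bij_betw_def)
    then obtain k where k: "k < card C" "e k = p" by auto
    show ?thesis unfolding s_def
      by (rule sum_pos2[of _ k]) (use k p bc(3) in auto)
  qed
  have ss: "smooth_fun A UNIV s" unfolding s_def[abs_def] by (intro smooth_fun_sum bc(2)) simp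
  have "partition_of_unity A (card C) (\<lambda>k. c (e k)) (\<lambda>k q. b (e k) q / s q)"
    unfolding partition_of_unity_def
  proof (intro conjI allI impI)
    fix k p
    show "c (e k) \<in> A" by (rule bc(1))
    show "smooth_fun A UNIV (\<lambda>q. b (e k) q / s q)"
      by (rule smooth_fun_divide[OF bc(2) ss open_UNIV]) (use s in \<open>auto simp: less_imp_neq[symmetric]\<close>)
    show "b (e k) p / s p \<ge> 0" using bc(3) s[of p] by simp
    have "closure {p. b (e k) p / s p \<noteq> 0} \<subseteq> closure {p. b (e k) p \<noteq> 0}" by (rule closure_mono) auto
    then show "closure {p. b (e k) p / s p \<noteq> 0} \<subseteq> fst (c (e k))" using bc(5) by blast
    show "(\<Sum>k<card C. b (e k) p / s p) = 1"
      using s[of p] unfolding sum_divide_distrib[symmetric] s_def[symmetric] by simp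
  qed
  then show ?thesis by blast
qed

end

section \<open>Change of variables\<close>

text \<open>
  An isometry that transports Lebesgue measure to \<open>real^2\<close>, where Jacobian determinants are those of real matrices.
\<close>

definition plane_to_line :: "real^2 \<Rightarrow> complex^1" where
  "plane_to_line v = vec (Complex (v$1) (v$2))"

definition line_to_plane :: "complex^1 \<Rightarrow> real^2" where
  "line_to_plane z = vector [Re (z$1), Im (z$1)]"

lemma plane_line [simp]: "plane_to_line (line_to_plane z) = z" "line_to_plane (plane_to_line v) = v"
  by (simp_all add: plane_to_line_def line_to_plane_def vec_eq_iff forall_2 forall_1)

lemma bounded_linear_plane_line: "bounded_linear plane_to_line" "bounded_linear line_to_plane"
  by (auto intro!: linear_conv_bounded_linear[THEN iffD1] linearI
      simp: plane_to_line_def line_to_plane_def vec_eq_iff forall_2 complex_eq_iff)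

lemma continuous_plane_line: "continuous_on S plane_to_line" "continuous_on T line_to_plane"
  using bounded_linear_plane_line by (auto intro: linear_continuous_on)

lemma Basis_complex_1: "(Basis :: (complex^1) set) = {axis 1 1, axis 1 \<i>}"
  by (auto simp: Basis_vec_def UNIV_1 Basis_complex_def)

lemma Basis_real_2: "(Basis :: (real^2) set) = {axis 1 1, axis 2 1}"
  by (auto simp: Basis_vec_def UNIV_2)

lemma lborel_plane_to_line: "lborel = distr lborel borel plane_to_line"
proof (rule lborel_eqI)
  fix l u :: "complex^1" assume lu: "\<And>b. b \<in> Basis \<Longrightarrow> l \<bullet> b \<le> u \<bullet> b"
  have lu': "Re (l $ 1) \<le> Re (u $ 1)" "Im (l $ 1) \<le> Im (u $ 1)"
    using lu[of "axis 1 1"] lu[of "axis 1 \<i>"] by (simp_all add: Basis_complex_1 inner_axis inner_complex_def)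
  have m: "plane_to_line \<in> borel_measurable borel"
    by (rule borel_measurable_continuous_onI) (rule continuous_plane_line)
  have "plane_to_line -` box l u = box (line_to_plane l) (line_to_plane u)"
    by (auto simp: box_def Basis_complex_1 Basis_real_2 inner_axis plane_to_line_def line_to_plane_def inner_complex_def)
  then have "emeasure (distr lborel borel plane_to_line) (box l u) = emeasure lborel (box (line_to_plane l) (line_to_plane u))"
    using m by (subst emeasure_distr) auto
  also have "\<dots> = (\<Prod>b\<in>Basis. (line_to_plane u - line_to_plane l) \<bullet> b)"
    by (rule emeasure_lborel_box)
      (use lu' in \<open>auto simp: Basis_real_2 inner_axis line_to_plane_def\<close>)
  also have "(\<Prod>b\<in>Basis. (line_to_plane u - line_to_plane l) \<bullet> b) = (\<Prod>b\<in>Basis. (u - l) \<bullet> b)"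
    unfolding Basis_complex_1 Basis_real_2
    by (subst prod.insert, simp, simp add: axis_eq_axis, subst (2) prod.insert, simp, simp add: axis_eq_axis)
      (simp add: inner_axis line_to_plane_def inner_complex_def)
  finally show "emeasure (distr lborel borel plane_to_line) (box l u) = ennreal (\<Prod>b\<in>Basis. (u - l) \<bullet> b)" .
qed simp

lemma set_integral_plane:
  fixes f :: "complex^1 \<Rightarrow> real"
  assumes S: "compact S" and f: "continuous_on S f"
  shows "set_lebesgue_integral lborel S f = integral (line_to_plane ` S) (\<lambda>x. f (plane_to_line x))"
proof -
  have i: "integrable lborel (\<lambda>x. indicator S x *\<^sub>R f x)" by (rule borel_integrable_compact[OF S f])
  have ind: "indicator S (plane_to_line x) = (indicator (line_to_plane ` S) x :: real)" for x
    by (auto simp: indicator_def) (metis image_eqI plane_line(2))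
  have "set_lebesgue_integral lborel S f = (\<integral>x. indicator S x *\<^sub>R f x \<partial>distr lborel borel plane_to_line)"
    unfolding set_lebesgue_integral_def lborel_plane_to_line[symmetric] ..
  also have "\<dots> = (\<integral>x. indicator S (plane_to_line x) *\<^sub>R f (plane_to_line x) \<partial>lborel)"
    by (rule integral_distr)
      (use borel_measurable_integrable[OF i] in \<open>auto intro!: borel_measurable_continuous_onI continuous_plane_line\<close>)
  also have "\<dots> = set_lebesgue_integral lborel (line_to_plane ` S) (\<lambda>x. f (plane_to_line x))"
    unfolding ind set_lebesgue_integral_def ..
  also have "\<dots> = integral (line_to_plane ` S) (\<lambda>x. f (plane_to_line x))"
  proof (rule set_borel_integral_eq_integral(2))
    have "continuous_on (line_to_plane ` S) (\<lambda>x. f (plane_to_line x))"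
      by (rule continuous_on_compose2[OF f continuous_plane_line(1)]) auto
    then show "set_integrable lborel (line_to_plane ` S) (\<lambda>x. f (plane_to_line x))"
      unfolding set_integrable_def
      by (intro borel_integrable_compact compact_continuous_image continuous_plane_line S)
  qed
  finally show ?thesis .
qed

text \<open>
  Multiplication by a complex number \<open>a\<close> is a real linear map of the plane with determinant \<open>\<bar>a\<bar>\<^sup>2\<close>.
\<close>

lemma holomorphic_change_of_variables:
  fixes T :: "complex^1 \<Rightarrow> complex^1" and f :: "complex^1 \<Rightarrow> real"
  assumes K: "compact K" and T: "\<And>y. y \<in> K \<Longrightarrow> (T has_derivative (\<lambda>v. a y *s v)) (at y)"
    and inj: "inj_on T K" and f: "continuous_on (T ` K) f"
    and af: "continuous_on K (\<lambda>y. (cmod (a y))\<^sup>2 * f (T y))"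
  shows "set_lebesgue_integral lborel (T ` K) f = set_lebesgue_integral lborel K (\<lambda>y. (cmod (a y))\<^sup>2 * f (T y))"
proof -
  define P where "P = line_to_plane ` K"
  define g where "g x = line_to_plane (T (plane_to_line x))" for x
  define g' where "g' x v = line_to_plane (a (plane_to_line x) *s plane_to_line v)" for x v
  define F :: "real^2 \<Rightarrow> real^1" where "F x = vec (f (plane_to_line x))" for x
  have cT: "continuous_on K T"
    using T by (meson continuous_at_imp_continuous_on has_derivative_continuous)
  have TK: "compact (T ` K)" by (rule compact_continuous_image[OF cT K])
  have cP: "compact P" unfolding P_def by (intro compact_continuous_image continuous_plane_line K)
  have gP: "g ` P = line_to_plane ` T ` K" by (auto simp: g_def P_def image_image)
  have der: "(g has_derivative g' x) (at x within P)" if "x \<in> P" for x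
  proof -
    have "plane_to_line x \<in> K" using that by (auto simp: P_def)
    note t = T[OF this]
    have "((\<lambda>x. T (plane_to_line x)) has_derivative (\<lambda>v. a (plane_to_line x) *s plane_to_line v)) (at x)"
      by (rule has_derivative_compose[OF bounded_linear_imp_has_derivative[OF bounded_linear_plane_line(1)] t])
    then have "(g has_derivative g' x) (at x)" unfolding g_def[abs_def] g'_def[abs_def]
      by (rule bounded_linear.has_derivative[OF bounded_linear_plane_line(2)])
    then show ?thesis by (rule has_derivative_at_withinI)
  qed
  have injg: "inj_on g P"
    using inj by (auto simp: inj_on_def g_def P_def) (metis plane_line(1))
  have det: "\<bar>det (matrix (g' x))\<bar> = (cmod (a (plane_to_line x)))\<^sup>2" for x
  proof -
    have "det (matrix (g' x)) = (cmod (a (plane_to_line x)))\<^sup>2"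
      by (simp add: det_2 matrix_def g'_def line_to_plane_def plane_to_line_def axis_def cmod_def power2_eq_square)
    then show ?thesis by simp
  qed
  have "continuous_on (g ` P) F"
    unfolding gP F_def[abs_def]
    by (intro continuous_on_vec_lambda[of _ "\<lambda>_. \<lambda>x. f (plane_to_line x)", folded vec_def] 
        continuous_on_compose2[OF f continuous_plane_line(1)]) auto
  moreover have "compact (g ` P)" unfolding gP by (intro compact_continuous_image continuous_plane_line TK)
  ultimately have iF: "integrable lborel (\<lambda>x. indicator (g ` P) x *\<^sub>R F x)" by (intro borel_integrable_compact)
  then have aF: "F absolutely_integrable_on (g ` P)"
    unfolding set_integrable_def using integrable_completion[OF borel_measurable_integrable[OF iF]] by simp
  have cov: "(\<lambda>x. \<bar>det (matrix (g' x))\<bar> *\<^sub>R F (g x)) absolutely_integrable_on P"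
    "integral P (\<lambda>x. \<bar>det (matrix (g' x))\<bar> *\<^sub>R F (g x)) = integral (g ` P) F"
    using has_absolute_integral_change_of_variables_compact[OF cP der injg, of F "integral (g ` P) F"] aF by auto
  have "set_lebesgue_integral lborel (T ` K) f = integral (g ` P) (\<lambda>x. F x $ 1)"
    unfolding set_integral_plane[OF TK f] gP F_def by simp
  also have "\<dots> = integral (g ` P) F $ 1"
    by (rule integral_component_eq_cart) (rule set_lebesgue_integral_eq_integral(1)[OF aF])
  also have "\<dots> = integral P (\<lambda>x. (\<bar>det (matrix (g' x))\<bar> *\<^sub>R F (g x)) $ 1)"
    unfolding cov(2)[symmetric]
    by (rule integral_component_eq_cart[symmetric]) (rule set_lebesgue_integral_eq_integral(1)[OF cov(1)])
  also have "\<dots> = integral P (\<lambda>x. (cmod (a (plane_to_line x)))\<^sup>2 * f (T (plane_to_line x)))"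
    unfolding det F_def g_def by simp
  also have "\<dots> = set_lebesgue_integral lborel K (\<lambda>y. (cmod (a y))\<^sup>2 * f (T y))"
    unfolding P_def by (rule set_integral_plane[OF K af, symmetric])
  finally show ?thesis .
qed

section \<open>Integration over a compact Riemann surface\<close>

definition chart_integral :: "('x, 1) chart \<Rightarrow> ('x \<Rightarrow> real) \<Rightarrow> real" where
  "chart_integral c g = set_lebesgue_integral lborel (snd c ` fst c) (in_chart c g)"

definition total_integral ::
  "nat \<Rightarrow> (nat \<Rightarrow> ('x, 1) chart) \<Rightarrow> (nat \<Rightarrow> 'x \<Rightarrow> real) \<Rightarrow> (('x, 1) chart \<Rightarrow> 'x \<Rightarrow> real) \<Rightarrow> real" where
  "total_integral N c f D = (\<Sum>k<N. chart_integral (c k) (\<lambda>p. f k p * D (c k) p))"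

context compact_surface
begin

text \<open>
  The coefficient of a 2-form with respect to the coordinates of each chart: under a holomorphic change of coordinates it is multiplied by the Jacobian determinant.
\<close>

definition density :: "(('x, 1) chart \<Rightarrow> 'x \<Rightarrow> real) \<Rightarrow> bool" where
  "density D \<longleftrightarrow> (\<forall>c\<in>A. continuous_on (fst c) (D c)) \<and>
     (\<forall>c\<in>A. \<forall>c'\<in>A. \<forall>p\<in>fst c \<inter> fst c'.
        D c p = (cmod (dir_deriv c (vec 1) (snd c') p $ 1))\<^sup>2 * D c' p)"

lemma densityD:
  assumes "density D" "c \<in> A"
  shows "continuous_on (fst c) (D c)"
    "c' \<in> A \<Longrightarrow> p \<in> fst c \<Longrightarrow> p \<in> fst c' \<Longrightarrow> D c p = (cmod (dir_deriv c (vec 1) (snd c') p $ 1))\<^sup>2 * D c' p"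
  using assms unfolding density_def by blast+

lemma density_mult: "density D \<Longrightarrow> continuous_on UNIV g \<Longrightarrow> density (\<lambda>c p. g p * D c p)"
  unfolding density_def
proof (intro conjI ballI)
  assume D: "(\<forall>c\<in>A. continuous_on (fst c) (D c)) \<and> (\<forall>c\<in>A. \<forall>c'\<in>A. \<forall>p\<in>fst c \<inter> fst c'.
        D c p = (cmod (dir_deriv c (vec 1) (snd c') p $ 1))\<^sup>2 * D c' p)" and g: "continuous_on UNIV g"
  fix c assume c: "c \<in> A"
  show "continuous_on (fst c) (\<lambda>p. g p * D c p)"
    by (rule continuous_on_mult[OF continuous_on_subset[OF g subset_UNIV]]) (use D c in blast)
  fix c' p assume "c' \<in> A" "p \<in> fst c \<inter> fst c'"
  then have "D c p = (cmod (dir_deriv c (vec 1) (snd c') p $ 1))\<^sup>2 * D c' p" using D c by blast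
  then show "g p * D c p = (cmod (dir_deriv c (vec 1) (snd c') p $ 1))\<^sup>2 * (g p * D c' p)" by simp
qed

lemma density_add: "density D \<Longrightarrow> density D' \<Longrightarrow> density (\<lambda>c p. D c p + D' c p)"
  unfolding density_def
proof (intro conjI ballI)
  assume D: "(\<forall>c\<in>A. continuous_on (fst c) (D c)) \<and> (\<forall>c\<in>A. \<forall>c'\<in>A. \<forall>p\<in>fst c \<inter> fst c'.
        D c p = (cmod (dir_deriv c (vec 1) (snd c') p $ 1))\<^sup>2 * D c' p)"
    and D': "(\<forall>c\<in>A. continuous_on (fst c) (D' c)) \<and> (\<forall>c\<in>A. \<forall>c'\<in>A. \<forall>p\<in>fst c \<inter> fst c'.
        D' c p = (cmod (dir_deriv c (vec 1) (snd c') p $ 1))\<^sup>2 * D' c' p)"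
  fix c assume c: "c \<in> A"
  show "continuous_on (fst c) (\<lambda>p. D c p + D' c p)"
    by (rule continuous_on_add) (use D D' c in blast)+
  fix c' p assume q: "c' \<in> A" "p \<in> fst c \<inter> fst c'"
  have "D c p = (cmod (dir_deriv c (vec 1) (snd c') p $ 1))\<^sup>2 * D c' p" using D c q by blast
  moreover have "D' c p = (cmod (dir_deriv c (vec 1) (snd c') p $ 1))\<^sup>2 * D' c' p" using D' c q by blast
  ultimately show "D c p + D' c p = (cmod (dir_deriv c (vec 1) (snd c') p $ 1))\<^sup>2 * (D c' p + D' c' p)"
    by (simp only: distrib_left)
qed

lemma continuous_in_chart:
  assumes c: "c \<in> A" and g: "continuous_on (fst c) g"
  shows "continuous_on (snd c ` fst c) (in_chart c g)"
  unfolding in_chart_def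
  by (rule continuous_on_compose2[OF g continuous_on_inv_chart[OF c]]) (auto intro: inv_into_into)

lemma indicator_in_chart:
  assumes c: "c \<in> A" and K: "K \<subseteq> fst c" and z: "\<And>q. q \<in> fst c \<Longrightarrow> q \<notin> K \<Longrightarrow> g q = (0::real)"
  shows "indicator (snd c ` fst c) y *\<^sub>R in_chart c g y = indicator (snd c ` K) y *\<^sub>R in_chart c g y"
proof (cases "y \<in> snd c ` fst c")
  case True
  then obtain q where q: "q \<in> fst c" "y = snd c q" by blast
  show ?thesis
  proof (cases "q \<in> K")
    case True then show ?thesis using q by (simp add: indicator_def)
  next
    case False then show ?thesis using z[OF q(1)] by (simp add: q(2) in_chart_at[OF c q(1)])
  qed
next
  case False then show ?thesis using K by (auto simp: indicator_def)
qed

lemma chart_integral_compact: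
  assumes "c \<in> A" "K \<subseteq> fst c" "\<And>q. q \<in> fst c \<Longrightarrow> q \<notin> K \<Longrightarrow> g q = 0"
  shows "chart_integral c g = set_lebesgue_integral lborel (snd c ` K) (in_chart c g)"
  unfolding chart_integral_def set_lebesgue_integral_def
  by (rule Bochner_Integration.integral_cong[OF refl]) (rule indicator_in_chart[OF assms])

lemma chart_integrable:
  fixes g :: "'x \<Rightarrow> real"
  assumes c: "c \<in> A" and K: "compact K" "K \<subseteq> fst c" and z: "\<And>q. q \<in> fst c \<Longrightarrow> q \<notin> K \<Longrightarrow> g q = 0"
    and g: "continuous_on (fst c) g"
  shows "integrable lborel (\<lambda>y. indicator (snd c ` fst c) y *\<^sub>R in_chart c g y)"
proof -
  have *: "(\<lambda>y. indicator (snd c ` fst c) y *\<^sub>R in_chart c g y) = (\<lambda>y. indicator (snd c ` K) y *\<^sub>R in_chart c g y)"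
    by (rule ext) (rule indicator_in_chart[OF c K(2) z])
  show ?thesis unfolding *
    by (intro borel_integrable_compact compact_continuous_image K(1)
        continuous_on_subset[OF continuous_on_chart[OF c] K(2)]
        continuous_on_subset[OF continuous_in_chart[OF c g]] image_mono K(2))
qed

lemma chart_integral_change:
  assumes D: "density D" and c: "c \<in> A" "c' \<in> A" and K: "compact K" "K \<subseteq> fst c" "K \<subseteq> fst c'"
    and z: "\<And>q. q \<in> fst c \<Longrightarrow> q \<notin> K \<Longrightarrow> D c q = 0" "\<And>q. q \<in> fst c' \<Longrightarrow> q \<notin> K \<Longrightarrow> D c' q = 0"
  shows "chart_integral c (D c) = chart_integral c' (D c')"
proof -
  define T where "T = in_chart c (snd c')"
  define a where "a = in_chart c (\<lambda>q. dir_deriv c (vec 1) (snd c') q $ 1)"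
  have T: "T (snd c q) = snd c' q" and a: "a (snd c q) = dir_deriv c (vec 1) (snd c') q $ 1" if "q \<in> K" for q
    using in_chart_at[OF c(1)] K(2) that by (auto simp: T_def a_def)
  have TK: "T ` snd c ` K = snd c' ` K" using T by (auto simp: image_image)
  have cK: "compact (snd c ` K)"
    by (intro compact_continuous_image K(1) continuous_on_subset[OF continuous_on_chart[OF c(1)] K(2)])
  have cont: "continuous_on (snd c ` K) (in_chart c (D c))" "continuous_on (snd c' ` K) (in_chart c' (D c'))"
    by (intro continuous_on_subset[OF continuous_in_chart] c densityD(1)[OF D] image_mono K(2,3))+
  have pt: "(cmod (a y))\<^sup>2 * in_chart c' (D c') (T y) = in_chart c (D c) y" if "y \<in> snd c ` K" for y
  proof -
    obtain q where q: "q \<in> K" "y = snd c q" using \<open>y \<in> snd c ` K\<close> by blast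
    then have q': "q \<in> fst c" "q \<in> fst c'" using K by auto
    have "D c q = (cmod (dir_deriv c (vec 1) (snd c') q $ 1))\<^sup>2 * D c' q"
      by (rule densityD(2)[OF D c q'])
    then show ?thesis by (simp only: q(2) T[OF q(1)] a[OF q(1)] in_chart_at[OF c(1) q'(1)] in_chart_at[OF c(2) q'(2)])
  qed
  have "chart_integral c' (D c') = set_lebesgue_integral lborel (T ` snd c ` K) (in_chart c' (D c'))"
    unfolding TK by (rule chart_integral_compact[OF c(2) K(3) z(2)])
  also have "\<dots> = set_lebesgue_integral lborel (snd c ` K) (\<lambda>y. (cmod (a y))\<^sup>2 * in_chart c' (D c') (T y))"
  proof (rule holomorphic_change_of_variables[OF cK])
    fix y assume "y \<in> snd c ` K"
    then obtain q where q: "q \<in> K" "y = snd c q" by blast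
    then have q': "q \<in> fst c" "q \<in> fst c'" using K by auto
    have "dir_deriv c v (snd c') q = a y *s v" for v
    proof -
      have v: "v $ 1 *s vec 1 = v" by (simp add: vec_eq_iff forall_1)
      have *: "dir_deriv c v (snd c') q = v $ 1 *s dir_deriv c (vec 1) (snd c') q"
        using transition_has_derivative(2)[OF c q', of "v $ 1" "vec 1"] unfolding v .
      show ?thesis unfolding * q(2) a[OF q(1)] by (simp add: vec_eq_iff forall_1 mult.commute)
    qed
    then show "(T has_derivative (\<lambda>v. a y *s v)) (at y)"
      using transition_has_derivative(1)[OF c q'] by (simp add: T_def q(2))
  next
    show "inj_on T (snd c ` K)"
      using chart_inj[OF c(2)] K(3) by (auto simp: inj_on_def T subset_iff)
    show "continuous_on (T ` snd c ` K) (in_chart c' (D c'))" unfolding TK by (rule cont)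
    show "continuous_on (snd c ` K) (\<lambda>y. (cmod (a y))\<^sup>2 * in_chart c' (D c') (T y))"
      using cont(1) pt by (simp cong: continuous_on_cong)
  qed
  also have "\<dots> = set_lebesgue_integral lborel (snd c ` K) (in_chart c (D c))"
    by (rule set_lebesgue_integral_cong) (use cK pt in \<open>auto simp: borel_compact\<close>)
  also have "\<dots> = chart_integral c (D c)"
    by (rule chart_integral_compact[OF c(1) K(2) z(1), symmetric])
  finally show ?thesis by simp
qed

lemma partition_of_unityD:
  assumes "partition_of_unity A N c f" "k < N"
  shows "c k \<in> A" "smooth_fun A UNIV (f k)" "continuous_on UNIV (f k)" "compact (closure {p. f k p \<noteq> 0})"
    "closure {p. f k p \<noteq> 0} \<subseteq> fst (c k)" "q \<notin> closure {p. f k p \<noteq> 0} \<Longrightarrow> f k q = 0"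
proof -
  show s: "c k \<in> A" "smooth_fun A UNIV (f k)" "closure {p. f k p \<noteq> 0} \<subseteq> fst (c k)"
    using assms by (auto simp: partition_of_unity_def)
  show "continuous_on UNIV (f k)" by (rule smooth_fun_imp_continuous_on[OF s(2) open_UNIV])
  show "compact (closure {p. f k p \<noteq> 0})"
    using closed_Int_compact[OF closed_closure compact_space] by simp
  show "q \<notin> closure {p. f k p \<noteq> 0} \<Longrightarrow> f k q = 0" 
    using subsetD[OF closure_subset, of q "{p. f k p \<noteq> 0}"] by blast
qed

lemma partition_of_unity_sum: "partition_of_unity A N c f \<Longrightarrow> (\<Sum>k<N. f k p) = 1"
  by (simp add: partition_of_unity_def)

text \<open>
  All terms may be moved to the chart that contains the support, where the functions of the partition add up to one.
\<close>

lemma total_integral_localize: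
  assumes P: "partition_of_unity A N c f" and D: "density D" and c': "c' \<in> A" and K: "compact K" "K \<subseteq> fst c'"
    and z: "\<And>c q. c \<in> A \<Longrightarrow> q \<in> fst c \<Longrightarrow> q \<notin> K \<Longrightarrow> D c q = 0"
  shows "total_integral N c f D = chart_integral c' (D c')"
proof -
  have "chart_integral (c k) (\<lambda>p. f k p * D (c k) p) = chart_integral c' (\<lambda>p. f k p * D c' p)" if k: "k < N" for k
  proof (rule chart_integral_change[where D = "\<lambda>c p. f k p * D c p" and K = "closure {p. f k p \<noteq> 0} \<inter> K"])
    note p = partition_of_unityD[OF P k]
    show "density (\<lambda>c p. f k p * D c p)" by (rule density_mult[OF D p(3)])
    show "compact (closure {p. f k p \<noteq> 0} \<inter> K)" by (rule closed_Int_compact[OF closed_closure K(1)])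
    show "c k \<in> A" by (rule p(1))
    show "closure {p. f k p \<noteq> 0} \<inter> K \<subseteq> fst (c k)" using p(5) by blast
    show "closure {p. f k p \<noteq> 0} \<inter> K \<subseteq> fst c'" using K(2) by blast
    show "f k q * D (c k) q = 0" if "q \<in> fst (c k)" "q \<notin> closure {p. f k p \<noteq> 0} \<inter> K" for q
      using that p(6)[of q] z[OF p(1), of q] by auto
    show "f k q * D c' q = 0" if "q \<in> fst c'" "q \<notin> closure {p. f k p \<noteq> 0} \<inter> K" for q
      using that p(6)[of q] z[OF c', of q] by auto
  qed (rule c')
  then have "total_integral N c f D = (\<Sum>k<N. chart_integral c' (\<lambda>p. f k p * D c' p))"
    unfolding total_integral_def by (intro sum.cong) auto
  also have "\<dots> = (\<integral>y. (\<Sum>k<N. indicator (snd c' ` fst c') y *\<^sub>R in_chart c' (\<lambda>p. f k p * D c' p) y) \<partial>lborel)"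
    unfolding chart_integral_def set_lebesgue_integral_def
  proof (rule Bochner_Integration.integral_sum[symmetric])
    fix k assume "k \<in> {..<N}"
    then have k: "k < N" by simp
    show "integrable lborel (\<lambda>y. indicator (snd c' ` fst c') y *\<^sub>R in_chart c' (\<lambda>p. f k p * D c' p) y)"
      by (rule chart_integrable[OF c' K _ densityD(1)[OF density_mult[OF D partition_of_unityD(3)[OF P k]] c']])
        (simp add: z[OF c'])
  qed
  also have "(\<lambda>y. (\<Sum>k<N. indicator (snd c' ` fst c') y *\<^sub>R in_chart c' (\<lambda>p. f k p * D c' p) y)) =
      (\<lambda>y. indicator (snd c' ` fst c') y *\<^sub>R in_chart c' (D c') y)"
    unfolding in_chart_def scaleR_sum_right[symmetric] sum_distrib_right[symmetric] partition_of_unity_sum[OF P] by simp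
  finally show ?thesis unfolding chart_integral_def set_lebesgue_integral_def .
qed

text \<open>
  Inserting each of the two partitions into the integral formed with the other one gives the same double sum.
\<close>

lemma total_integral_unique:
  assumes P: "partition_of_unity A N c f" and P': "partition_of_unity A N' c' f'" and D: "density D"
  shows "total_integral N c f D = total_integral N' c' f' D"
proof -
  have 1: "total_integral N c f D = (\<Sum>k<N. \<Sum>l<N'. chart_integral (c' l) (\<lambda>p. f' l p * (f k p * D (c' l) p)))"
    if P: "partition_of_unity A N c f" and P': "partition_of_unity A N' c' f'" for N c f N' c' f'
    unfolding total_integral_def[of N]
  proof (rule sum.cong[OF refl])
    fix k assume "k \<in> {..<N}"
    then have k: "k < N" by simp
    note p = partition_of_unityD[OF P k]
    have "total_integral N' c' f' (\<lambda>c p. f k p * D c p) = chart_integral (c k) (\<lambda>p. f k p * D (c k) p)"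
    proof (rule total_integral_localize[OF P' density_mult[OF D p(3)] p(1,4,5)])
      show "f k q * D d q = 0" if "q \<notin> closure {p. f k p \<noteq> 0}" for d q
        unfolding p(6)[OF that] by simp
    qed
    then show "chart_integral (c k) (\<lambda>p. f k p * D (c k) p) = (\<Sum>l<N'. chart_integral (c' l) (\<lambda>p. f' l p * (f k p * D (c' l) p)))"
      by (simp add: total_integral_def)
  qed
  have 2: "chart_integral (c' l) (\<lambda>p. f' l p * (f k p * D (c' l) p)) = chart_integral (c k) (\<lambda>p. f k p * (f' l p * D (c k) p))"
    if k: "k < N" and l: "l < N'" for k l
  proof -
    note p = partition_of_unityD[OF P k] and q = partition_of_unityD[OF P' l]
    have "chart_integral (c' l) (\<lambda>p. f' l p * (f k p * D (c' l) p)) = chart_integral (c k) (\<lambda>p. f' l p * (f k p * D (c k) p))"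
    proof (rule chart_integral_change[where D = "\<lambda>c p. f' l p * (f k p * D c p)" and K = "closure {p. f' l p \<noteq> 0} \<inter> closure {p. f k p \<noteq> 0}"])
      show "density (\<lambda>c p. f' l p * (f k p * D c p))" by (intro density_mult D p q)
      show "compact (closure {p. f' l p \<noteq> 0} \<inter> closure {p. f k p \<noteq> 0})" by (rule closed_Int_compact[OF closed_closure p(4)])
      show "c' l \<in> A" "c k \<in> A" by (rule q(1), rule p(1))
      show "closure {p. f' l p \<noteq> 0} \<inter> closure {p. f k p \<noteq> 0} \<subseteq> fst (c' l)"
        "closure {p. f' l p \<noteq> 0} \<inter> closure {p. f k p \<noteq> 0} \<subseteq> fst (c k)" using p(5) q(5) by blast+
      have "f' l x = 0 \<or> f k x = 0" if "x \<notin> closure {p. f' l p \<noteq> 0} \<inter> closure {p. f k p \<noteq> 0}" for x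
        using that p(6)[of x] q(6)[of x] by blast
      then show "f' l x * (f k x * D (c' l) x) = 0" "f' l x * (f k x * D (c k) x) = 0"
        if "x \<notin> closure {p. f' l p \<noteq> 0} \<inter> closure {p. f k p \<noteq> 0}" for x
        using that by (metis mult_zero_left mult_zero_right)+
    qed
    then show ?thesis by (simp only: mult.left_commute[of "f' l _"])
  qed
  have "(\<Sum>k<N. \<Sum>l<N'. chart_integral (c' l) (\<lambda>p. f' l p * (f k p * D (c' l) p))) =
      (\<Sum>l<N'. \<Sum>k<N. chart_integral (c k) (\<lambda>p. f k p * (f' l p * D (c k) p)))"
    by (subst sum.swap) (intro sum.cong refl 2, auto)
  then show ?thesis unfolding 1[OF P P'] 1[OF P' P] .
qed

lemma surface_integral_eq:
  assumes P: "partition_of_unity A N c f" and D: "density (\<lambda>c p. \<eta> c p (axis 1 1) (axis 1 \<i>))"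
  shows "surface_integral A \<eta> = total_integral N c f (\<lambda>c p. \<eta> c p (axis 1 1) (axis 1 \<i>))"
  unfolding surface_integral_def
proof (rule the_equality)
  show "\<exists>N' c' f'. partition_of_unity A N' c' f' \<and> total_integral N c f (\<lambda>c p. \<eta> c p (axis 1 1) (axis 1 \<i>)) =
      (\<Sum>k<N'. set_lebesgue_integral lborel (snd (c' k) ` fst (c' k)) (in_chart (c' k) (\<lambda>p. f' k p * \<eta> (c' k) p (axis 1 1) (axis 1 \<i>))))"
    using P unfolding total_integral_def chart_integral_def by blast
next
  fix I assume "\<exists>N c f. partition_of_unity A N c f \<and> I =
      (\<Sum>k<N. set_lebesgue_integral lborel (snd (c k) ` fst (c k)) (in_chart (c k) (\<lambda>p. f k p * \<eta> (c k) p (axis 1 1) (axis 1 \<i>))))"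
  then obtain N' c' f' where P': "partition_of_unity A N' c' f'"
    and I: "I = total_integral N' c' f' (\<lambda>c p. \<eta> c p (axis 1 1) (axis 1 \<i>))"
    unfolding total_integral_def chart_integral_def by blast
  show "I = total_integral N c f (\<lambda>c p. \<eta> c p (axis 1 1) (axis 1 \<i>))"
    unfolding I by (rule total_integral_unique[OF P' P D])
qed

lemma partition_integrable:
  assumes P: "partition_of_unity A N c f" and D: "density D" and k: "k < N"
  shows "integrable lborel (\<lambda>y. indicator (snd (c k) ` fst (c k)) y *\<^sub>R in_chart (c k) (\<lambda>p. f k p * D (c k) p) y)"
proof -
  note p = partition_of_unityD[OF P k]
  show ?thesis
  proof (rule chart_integrable[OF p(1,4,5) _ densityD(1)[OF density_mult[OF D p(3)] p(1)]])
    show "f k q * D (c k) q = 0" if "q \<notin> closure {p. f k p \<noteq> 0}" for q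
      unfolding p(6)[OF that] by simp
  qed
qed

lemma total_integral_add:
  assumes P: "partition_of_unity A N c f" and D: "density D" "density D'"
  shows "total_integral N c f (\<lambda>c p. D c p + D' c p) = total_integral N c f D + total_integral N c f D'"
proof -
  have "chart_integral (c k) (\<lambda>p. f k p * (D (c k) p + D' (c k) p)) =
      chart_integral (c k) (\<lambda>p. f k p * D (c k) p) + chart_integral (c k) (\<lambda>p. f k p * D' (c k) p)" if k: "k < N" for k
    unfolding chart_integral_def set_lebesgue_integral_def
      Bochner_Integration.integral_add[OF partition_integrable[OF P D(1) k] partition_integrable[OF P D(2) k], symmetric]
    by (simp add: in_chart_def algebra_simps)
  then show ?thesis by (simp add: total_integral_def sum.distrib)
qed

lemma total_integral_cmult: "total_integral N c f (\<lambda>c p. a * D c p) = a * total_integral N c f D"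
proof -
  have "chart_integral (c k) (\<lambda>p. f k p * (a * D (c k) p)) = a * chart_integral (c k) (\<lambda>p. f k p * D (c k) p)" for k
    unfolding chart_integral_def set_lebesgue_integral_def integral_mult_right_zero[symmetric]
    by (simp add: in_chart_def algebra_simps)
  then show ?thesis by (simp add: total_integral_def sum_distrib_left)
qed

lemma total_integral_sum:
  assumes P: "partition_of_unity A N c f" and D: "\<And>j. j < n \<Longrightarrow> density (D j)"
  shows "density (\<lambda>c p. \<Sum>j<n. D j c p) \<and> total_integral N c f (\<lambda>c p. \<Sum>j<n. D j c p) = (\<Sum>j<(n::nat). total_integral N c f (D j))"
  using D
proof (induction n)
  case 0
  have "total_integral N c f (\<lambda>c p. 0) = 0" using total_integral_cmult[of N c f 0 "\<lambda>_ _. 0"] by simp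
  then show ?case by (simp add: density_def)
next
  case (Suc n)
  then have "density (\<lambda>c p. \<Sum>j<n. D j c p)" "density (D n)" "total_integral N c f (\<lambda>c p. \<Sum>j<n. D j c p) = (\<Sum>j<n. total_integral N c f (D j))" by auto
  then show ?case using density_add[of "\<lambda>c p. \<Sum>j<n. D j c p" "D n"] total_integral_add[OF P, of "\<lambda>c p. \<Sum>j<n. D j c p" "D n"] by simp
qed

lemma total_integral_cong:
  assumes P: "partition_of_unity A N c f" and e: "\<And>c p. c \<in> A \<Longrightarrow> p \<in> fst c \<Longrightarrow> D c p = D' c p"
  shows "total_integral N c f D = total_integral N c f D'"
  unfolding total_integral_def
proof (rule sum.cong[OF refl])
  fix k assume "k \<in> {..<N}"
  then have ck: "c k \<in> A" using partition_of_unityD(1)[OF P] by simp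
  have "indicator (snd (c k) ` fst (c k)) y *\<^sub>R in_chart (c k) (\<lambda>p. f k p * D (c k) p) y =
      indicator (snd (c k) ` fst (c k)) y *\<^sub>R in_chart (c k) (\<lambda>p. f k p * D' (c k) p) y" for y
  proof (cases "y \<in> snd (c k) ` fst (c k)")
    case True
    then obtain q where "q \<in> fst (c k)" "y = snd (c k) q" by blast
    then show ?thesis using e[OF ck] by (simp add: in_chart_at[OF ck])
  qed simp
  then show "chart_integral (c k) (\<lambda>p. f k p * D (c k) p) = chart_integral (c k) (\<lambda>p. f k p * D' (c k) p)"
    unfolding chart_integral_def set_lebesgue_integral_def by (intro Bochner_Integration.integral_cong refl)
qed

lemma density_cong:
  assumes "density D" "\<And>c p. c \<in> A \<Longrightarrow> p \<in> fst c \<Longrightarrow> D c p = D' c p" shows "density D'"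
  unfolding density_def
proof (intro conjI ballI)
  fix c assume c: "c \<in> A"
  show "continuous_on (fst c) (D' c)"
    by (rule continuous_on_eq[OF densityD(1)[OF assms(1) c] assms(2)[OF c]])
  fix c' p assume "c' \<in> A" "p \<in> fst c \<inter> fst c'"
  then show "D' c p = (cmod (dir_deriv c (vec 1) (snd c') p $ 1))\<^sup>2 * D' c' p"
    using densityD(2)[OF assms(1) c, of c' p] assms(2)[OF c, of p] assms(2)[of c' p] by simp
qed

end

section \<open>The Laplacian integrates to zero\<close>

lemma has_derivative_imp_directional:
  fixes w :: "'a::real_normed_vector \<Rightarrow> real"
  assumes w: "(w has_derivative w') (at (y + t *\<^sub>R e))"
  shows "((\<lambda>t. w (y + t *\<^sub>R e)) has_real_derivative w' e) (at t)"
proof -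
  have "((\<lambda>t. y + t *\<^sub>R e) has_derivative (\<lambda>t. t *\<^sub>R e)) (at t)"
    by (auto intro!: derivative_eq_intros)
  from has_derivative_compose[OF this w]
  have "((\<lambda>t. w (y + t *\<^sub>R e)) has_derivative (\<lambda>t. w' (t *\<^sub>R e))) (at t)" .
  moreover have "w' (t *\<^sub>R e) = w' e * t" for t
    using linear_scale[OF has_derivative_linear[OF w]] by simp
  ultimately show ?thesis by (simp add: has_field_derivative_def)
qed

text \<open>
  Difference quotients have integral zero by translation invariance, and by the mean value theorem they are dominated by a multiple of the indicator of a ball; the derivative is their limit.
\<close>

lemma integral_directional_derivative_eq_0:
  fixes w :: "'a::euclidean_space \<Rightarrow> real"
  assumes w: "\<And>y. (w has_derivative w' y) (at y)" and cont: "continuous_on UNIV (\<lambda>y. w' y e)"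
    and K: "compact K" and z: "\<And>y. y \<notin> K \<Longrightarrow> w y = 0"
  shows "integrable lborel (\<lambda>y. w' y e)" "(\<integral>y. w' y e \<partial>lborel) = 0"
proof -
  have z': "w' y e = 0" if "y \<notin> K" for y
  proof -
    have o: "open (- K)" using compact_imp_closed[OF K] by (simp add: open_Compl)
    have "(w has_derivative (\<lambda>_. 0)) (at y)"
      by (rule has_derivative_transform_within_open[OF has_derivative_const o]) (use that z in auto)
    from has_derivative_unique[OF w this] show ?thesis by simp
  qed
  have cw: "continuous_on UNIV w" by (rule has_derivative_continuous_on) (use w has_derivative_at_withinI in blast)
  have supp: "(\<lambda>y. u y) = (\<lambda>y. indicator K y *\<^sub>R u y)" if "\<And>y. y \<notin> K \<Longrightarrow> u y = 0" for u :: "'a \<Rightarrow> real"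
  proof (rule ext)
    fix y show "u y = indicator K y *\<^sub>R u y" using that[of y] by (cases "y \<in> K") auto
  qed
  have iw: "integrable lborel w"
    by (rule back_subst[where P = "integrable lborel", OF borel_integrable_compact[OF K continuous_on_subset[OF cw subset_UNIV]]])
      (rule supp[OF z, symmetric])
  show "integrable lborel (\<lambda>y. w' y e)"
    by (rule back_subst[where P = "integrable lborel", OF borel_integrable_compact[OF K continuous_on_subset[OF cont subset_UNIV]]])
      (rule supp[OF z', symmetric])
  obtain R where R: "\<And>y. y \<in> K \<Longrightarrow> norm y \<le> R" using compact_imp_bounded[OF K] by (auto simp: bounded_iff)
  have "bounded ((\<lambda>y. w' y e) ` K)"
    by (intro compact_imp_bounded compact_continuous_image K continuous_on_subset[OF cont]) simp
  then obtain B0 where B0: "\<And>y. y \<in> K \<Longrightarrow> \<bar>w' y e\<bar> \<le> B0" by (auto simp: bounded_iff)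
  define B where "B = max B0 0"
  have B: "\<bar>w' y e\<bar> \<le> B" "B \<ge> 0" for y using B0[of y] z'[of y] by (cases "y \<in> K"; auto simp: B_def)+
  define s where "s n = inverse (real (Suc n))" for n
  have s: "0 < s n" "s n \<le> 1" for n by (auto simp: s_def field_simps)
  define q where "q n y = (w (s n *\<^sub>R e + y) - w y) / s n" for n y
  have shift: "integrable lborel (\<lambda>y. w (a + y))" "(\<integral>y. w (a + y) \<partial>lborel) = (\<integral>y. w y \<partial>lborel)" for a
  proof -
    have m: "(+) a \<in> measurable lborel borel" "w \<in> borel_measurable borel"
      using borel_measurable_continuous_onI[OF cw] by auto
    have "integrable (distr lborel borel ((+) a)) w" unfolding lborel_distr_plus by (rule iw)
    then show "integrable lborel (\<lambda>y. w (a + y))" by (rule integrable_distr[OF m(1)])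
    show "(\<integral>y. w (a + y) \<partial>lborel) = (\<integral>y. w y \<partial>lborel)"
      using integral_distr[OF m] unfolding lborel_distr_plus by simp
  qed
  have q0: "(\<integral>y. q n y \<partial>lborel) = 0" for n
    unfolding q_def by (simp add: Bochner_Integration.integral_diff[OF shift(1) iw] shift(2))
  have lim: "(\<lambda>n. q n y) \<longlonglongrightarrow> w' y e" for y
  proof -
    have "((\<lambda>t. w (y + t *\<^sub>R e)) has_real_derivative w' y e) (at 0)"
      by (rule has_derivative_imp_directional) (simp add: w)
    then have d: "((\<lambda>t. (w (y + t *\<^sub>R e) - w y) / t) \<longlongrightarrow> w' y e) (at 0)"
      by (simp add: has_field_derivative_iff)
    have "filterlim s (at 0) sequentially"
      by (rule filterlim_atI) (use LIMSEQ_inverse_real_of_nat s(1) in \<open>auto simp: s_def[abs_def] simp del: of_nat_Suc\<close>)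
    from filterlim_compose[OF d this] show ?thesis by (simp add: q_def[abs_def] add.commute)
  qed
  have bound: "norm (q n y) \<le> B * indicator (cball 0 (R + norm e)) y" for n y
  proof -
    have "\<exists>t. 0 < t \<and> t < s n \<and> w (y + s n *\<^sub>R e) - w (y + 0 *\<^sub>R e) = (s n - 0) * w' (y + t *\<^sub>R e) e"
      by (rule MVT2[OF s(1)]) (rule has_derivative_imp_directional[OF w])
    then obtain t where t: "0 < t" "t < s n" "w (y + s n *\<^sub>R e) - w y = s n * w' (y + t *\<^sub>R e) e" by auto
    then have qt: "q n y = w' (y + t *\<^sub>R e) e" using s(1)[of n] by (simp add: q_def add.commute)
    show ?thesis
    proof (cases "y \<in> cball 0 (R + norm e)")
      case True then show ?thesis using B(1) by (simp add: qt)
    next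
      case False
      have "y + t *\<^sub>R e \<notin> K"
      proof
        assume "y + t *\<^sub>R e \<in> K"
        then have "norm (y + t *\<^sub>R e) \<le> R" by (rule R)
        moreover have "norm y \<le> norm (y + t *\<^sub>R e) + norm (t *\<^sub>R e)"
          using norm_triangle_ineq4[of "y + t *\<^sub>R e" "t *\<^sub>R e"] by simp
        moreover have "norm (t *\<^sub>R e) \<le> norm e"
          using t s(2)[of n] mult_right_mono[of "\<bar>t\<bar>" 1 "norm e"] by simp
        ultimately show False using False by simp
      qed
      then show ?thesis using z' B(2) by (simp add: qt)
    qed
  qed
  have "(\<lambda>n. \<integral>y. q n y \<partial>lborel) \<longlonglongrightarrow> (\<integral>y. w' y e \<partial>lborel)"
  proof (rule integral_dominated_convergence)
    show "(\<lambda>y. w' y e) \<in> borel_measurable lborel" using borel_measurable_continuous_onI[OF cont] by simp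
    show "q n \<in> borel_measurable lborel" for n
      unfolding q_def using shift(1) iw by (auto intro!: borel_measurable_divide borel_measurable_diff dest: borel_measurable_integrable)
    have "integrable lborel (\<lambda>y. indicator (cball (0::'a) (R + norm e)) y :: real)"
      using borel_integrable_compact[of "cball (0::'a) (R + norm e)" "\<lambda>_. 1::real"] by simp
    then show "integrable lborel (\<lambda>y. B * indicator (cball (0::'a) (R + norm e)) y :: real)"
      by (rule integrable_mult_right)
    show "AE y in lborel. (\<lambda>n. q n y) \<longlonglongrightarrow> w' y e" using lim by simp
    show "AE y in lborel. norm (q n y) \<le> B * indicator (cball 0 (R + norm e)) y" for n using bound by simp
  qed
  then have "(\<lambda>n. 0) \<longlonglongrightarrow> (\<integral>y. w' y e \<partial>lborel)" unfolding q0 .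
  then show "(\<integral>y. w' y e \<partial>lborel) = 0" using LIMSEQ_unique tendsto_const by blast
qed

context compact_surface
begin

lemma smooth_fun_chart:
  assumes c: "c \<in> A" shows "smooth_fun A (fst c) (snd c)"
proof (rule smooth_funI_local[OF chart_open[OF c]])
  have "in_chart c (snd c) y = y" if "y \<in> snd c ` fst c" for y
    using that by (auto simp: in_chart_at[OF c])
  then have "smooth_on (snd c ` fst c) (in_chart c (snd c))"
    using smooth_on_cong[OF open_chart_image'[OF c], of "in_chart c (snd c)" "\<lambda>y. y"]
      smooth_on_bounded_linear[OF bounded_linear_ident] by simp
  then show "\<exists>d\<in>A. \<exists>N. open N \<and> p \<in> N \<and> N \<subseteq> fst d \<inter> fst c \<and> smooth_on (snd d ` N) (in_chart d (snd c))" if "p \<in> fst c" for p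
    using c chart_open[OF c] that by (intro bexI[of _ c] exI[of _ "fst c"]) auto
qed

lemma smooth_fun_laplace:
  assumes g: "smooth_fun A UNIV g" and c: "c \<in> A" shows "smooth_fun A (fst c) (laplace c g)"
proof -
  have 1: "smooth_fun A (fst c) (dir_deriv c v g)" for v using smooth_fun_dir_deriv[OF g c open_UNIV] by simp
  have 2: "smooth_fun A (fst c) (dir_deriv c v (dir_deriv c v g))" for v
    using smooth_fun_dir_deriv[OF 1 c chart_open[OF c]] by simp
  show ?thesis unfolding laplace_def[abs_def] by (rule smooth_fun_add[OF 2 2 chart_open[OF c]])
qed

text \<open>
  The Cauchy-Riemann equations for the derivative of the transition map cancel the first-order terms.
\<close>

lemma laplace_change_chart:
  assumes g: "smooth_fun A UNIV g" and c: "c \<in> A" "c' \<in> A" and p: "p \<in> fst c" "p \<in> fst c'"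
  shows "laplace c g p = (cmod (dir_deriv c (vec 1) (snd c') p $ 1))\<^sup>2 * laplace c' g p"
proof -
  define W where "W = fst c \<inter> fst c'"
  have W: "open W" "p \<in> W" using open_Int[OF chart_open[OF c(1)] chart_open[OF c(2)]] p by (auto simp: W_def)
  define x where "x = (\<lambda>q. snd c' q $ 1)"
  define t where "t = dir_deriv c (vec 1) x"
  have xs: "smooth_fun A (fst c') x" unfolding x_def by (rule smooth_fun_vec_nth[OF smooth_fun_chart[OF c(2)] chart_open[OF c(2)]])
  have ts: "smooth_fun A W t" using smooth_fun_dir_deriv[OF xs c(1) chart_open[OF c(2)]] by (simp add: t_def W_def)
  have dx: "dir_deriv c v x q = v $ 1 * t q" and tq: "t q = dir_deriv c (vec 1) (snd c') q $ 1"
    and dv: "dir_deriv c v (snd c') q = (v $ 1 * t q) *s vec 1" if q: "q \<in> W" for v q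
  proof -
    have q': "q \<in> fst c" "q \<in> fst c'" using q by (auto simp: W_def)
    have n: "dir_deriv c v x q = dir_deriv c v (snd c') q $ 1" for v
      unfolding x_def by (rule dir_deriv_linear_compose[OF bounded_linear_vec_nth smooth_fun_chart[OF c(2)] c(1) q'])
    show tq: "t q = dir_deriv c (vec 1) (snd c') q $ 1" by (simp only: t_def n)
    have v: "v $ 1 *s vec 1 = v" by (simp add: vec_eq_iff forall_1)
    have *: "dir_deriv c v (snd c') q = v $ 1 *s dir_deriv c (vec 1) (snd c') q"
      using transition_has_derivative(2)[OF c q', of "v $ 1" "vec 1"] unfolding v .
    show "dir_deriv c v x q = v $ 1 * t q" unfolding n tq * by simp
    show "dir_deriv c v (snd c') q = (v $ 1 * t q) *s vec 1" unfolding tq * by (simp add: vec_eq_iff forall_1)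
  qed
  let ?e = "vec 1 :: complex^1" and ?j = "\<i> *s vec 1 :: complex^1"
  define g1 where "g1 = dir_deriv c' ?e g"
  define g2 where "g2 = dir_deriv c' ?j g"
  have gs: "smooth_fun A W g1" "smooth_fun A W g2"
    using smooth_fun_dir_deriv[OF g c(2) open_UNIV] by (auto simp: g1_def g2_def W_def intro: smooth_fun_subset)
  define a where "a q = Re (t q)" for q
  define b where "b q = Im (t q)" for q
  have as: "smooth_fun A W a" and bs: "smooth_fun A W b"
    unfolding a_def[abs_def] b_def[abs_def] by (intro smooth_fun_linear[OF _ ts W(1)] bounded_linear_Re bounded_linear_Im)+
  have lin: "dir_deriv c' (k *s ?e) f q = Re k * dir_deriv c' ?e f q + Im k * dir_deriv c' ?j f q"
    if f: "smooth_fun A W f" and q: "q \<in> W" for k q and f :: "'x \<Rightarrow> real"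
  proof -
    have q': "q \<in> fst c'" using q by (simp add: W_def)
    note l = dir_deriv_linear[OF f c(2) q' q]
    have "k *s ?e = Re k *\<^sub>R ?e + Im k *\<^sub>R ?j" by (simp add: vec_eq_iff forall_1 complex_eq_iff)
    then show ?thesis using linear_add[OF l] linear_scale[OF l] by simp
  qed
  have D1: "dir_deriv c ?e f q = a q * dir_deriv c' ?e f q + b q * dir_deriv c' ?j f q"
    and D2: "dir_deriv c ?j f q = - b q * dir_deriv c' ?e f q + a q * dir_deriv c' ?j f q"
    if f: "smooth_fun A W f" and q: "q \<in> W" for f :: "'x \<Rightarrow> real" and q
  proof -
    have q': "q \<in> fst c" "q \<in> fst c'" using q by (auto simp: W_def)
    have ch: "dir_deriv c v f q = dir_deriv c' ((v $ 1 * t q) *s ?e) f q" for v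
      using dir_deriv_change_chart[OF f c q' q W(1), of v] unfolding dv[OF q] by simp
    have *: "dir_deriv c v f q = Re (v $ 1 * t q) * dir_deriv c' ?e f q + Im (v $ 1 * t q) * dir_deriv c' ?j f q" for v
      by (rule trans[OF ch lin[OF f q]])
    show "dir_deriv c ?e f q = a q * dir_deriv c' ?e f q + b q * dir_deriv c' ?j f q"
      unfolding * by (simp add: a_def b_def)
    show "dir_deriv c ?j f q = - b q * dir_deriv c' ?e f q + a q * dir_deriv c' ?j f q"
      unfolding * by (simp add: a_def b_def)
  qed
  have gW: "smooth_fun A W g" by (rule smooth_fun_subset[OF g]) simp
  have CR: "dir_deriv c ?j t p = \<i> * dir_deriv c ?e t p"
  proof -
    have "dir_deriv c ?j t p = dir_deriv c ?e (dir_deriv c ?j x) p"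
      unfolding t_def by (rule dir_deriv_commute[OF xs c(1) p chart_open[OF c(2)]])
    also have "\<dots> = dir_deriv c ?e (\<lambda>q. \<i> * t q) p"
      by (rule dir_deriv_cong[OF W(1) c(1) p(1) W(2)]) (simp add: dx)
    also have "\<dots> = \<i> * dir_deriv c ?e t p"
      by (rule dir_deriv_linear_compose[OF bounded_linear_mult_right ts c(1) p(1) W(2)])
    finally show ?thesis .
  qed
  have ab: "dir_deriv c v a p = Re (dir_deriv c v t p)" "dir_deriv c v b p = Im (dir_deriv c v t p)" for v
    unfolding a_def[abs_def] b_def[abs_def]
    by (rule dir_deriv_linear_compose[OF bounded_linear_Re ts c(1) p(1) W(2)], rule dir_deriv_linear_compose[OF bounded_linear_Im ts c(1) p(1) W(2)])
  have CR': "dir_deriv c ?j a p = - dir_deriv c ?e b p" "dir_deriv c ?j b p = dir_deriv c ?e a p"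
    unfolding ab CR by simp_all
  have sm: "smooth_fun A W (\<lambda>q. u q * v q)" if "smooth_fun A W u" "smooth_fun A W v" for u v :: "'x \<Rightarrow> real"
    by (rule smooth_fun_mult[OF that W(1)])
  have prod2: "dir_deriv c v (\<lambda>q. u q * g1 q + w q * g2 q) p =
      (u p * dir_deriv c v g1 p + dir_deriv c v u p * g1 p) + (w p * dir_deriv c v g2 p + dir_deriv c v w p * g2 p)"
    if "smooth_fun A W u" "smooth_fun A W w" for u w v
    unfolding dir_deriv_add[OF sm[OF that(1) gs(1)] sm[OF that(2) gs(2)] c(1) p(1) W(2)]
      dir_deriv_mult[OF that(1) gs(1) c(1) p(1) W(2)] dir_deriv_mult[OF that(2) gs(2) c(1) p(1) W(2)] ..
  have "dir_deriv c ?e (dir_deriv c ?e g) p = dir_deriv c ?e (\<lambda>q. a q * g1 q + b q * g2 q) p"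
    by (rule dir_deriv_cong[OF W(1) c(1) p(1) W(2)]) (simp only: D1[OF gW] g1_def g2_def)
  then have 1: "dir_deriv c ?e (dir_deriv c ?e g) p = (a p * dir_deriv c ?e g1 p + dir_deriv c ?e a p * g1 p) + (b p * dir_deriv c ?e g2 p + dir_deriv c ?e b p * g2 p)"
    unfolding prod2[OF as bs] .
  have nb: "smooth_fun A W (\<lambda>q. - b q)" by (rule smooth_fun_minus[OF bs W(1)])
  have mb: "dir_deriv c v (\<lambda>q. - b q) p = - dir_deriv c v b p" for v
    by (rule dir_deriv_linear_compose[OF bounded_linear_minus[OF bounded_linear_ident] bs c(1) p(1) W(2)])
  have "dir_deriv c ?j (dir_deriv c ?j g) p = dir_deriv c ?j (\<lambda>q. (- b q) * g1 q + a q * g2 q) p"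
    by (rule dir_deriv_cong[OF W(1) c(1) p(1) W(2)]) (simp only: D2[OF gW] g1_def g2_def)
  then have 2: "dir_deriv c ?j (dir_deriv c ?j g) p = (- b p * dir_deriv c ?j g1 p - dir_deriv c ?j b p * g1 p) + (a p * dir_deriv c ?j g2 p + dir_deriv c ?j a p * g2 p)"
    unfolding prod2[OF nb as] mb by simp
  have fin: "(cmod (t p))\<^sup>2 = (a p)\<^sup>2 + (b p)\<^sup>2" by (simp add: a_def b_def cmod_power2)
  show ?thesis
    unfolding laplace_def[of c] laplace_def[of c'] tq[OF W(2), symmetric] fin 1 2 CR'
      D1[OF gs(1) W(2)] D1[OF gs(2) W(2)] D2[OF gs(1) W(2)] D2[OF gs(2) W(2)] g1_def[symmetric] g2_def[symmetric]
    by (simp add: algebra_simps power2_eq_square)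
qed

lemma laplace_density: assumes g: "smooth_fun A UNIV g" shows "density (\<lambda>c p. laplace c g p)"
  unfolding density_def
proof (intro conjI ballI)
  fix c assume c: "c \<in> A"
  show "continuous_on (fst c) (\<lambda>p. laplace c g p)"
    by (rule smooth_fun_imp_continuous_on[OF smooth_fun_laplace[OF g c] chart_open[OF c]])
  fix c' p assume c': "c' \<in> A" "p \<in> fst c \<inter> fst c'"
  show "laplace c g p = (cmod (dir_deriv c (vec 1) (snd c') p $ 1))\<^sup>2 * laplace c' g p"
    by (rule laplace_change_chart[OF g c c'(1)]) (use c'(2) in auto)
qed

lemma laplace_cong:
  assumes "open W" "c \<in> A" "p \<in> fst c" "p \<in> W" "\<And>q. q \<in> W \<Longrightarrow> f q = g q"
  shows "laplace c f p = laplace c g p"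
proof -
  have o: "open (W \<inter> fst c)" using assms(1) chart_open[OF assms(2)] by blast
  have 1: "dir_deriv c v f q = dir_deriv c v g q" if "q \<in> W \<inter> fst c" for v q
    by (rule dir_deriv_cong[OF assms(1,2) _ _ assms(5)]) (use that in auto)
  have 2: "dir_deriv c v (dir_deriv c v f) p = dir_deriv c v (dir_deriv c v g) p" for v
    by (rule dir_deriv_cong[OF o assms(2,3) _ 1]) (use assms in auto)
  show ?thesis unfolding laplace_def 2 ..
qed

lemma laplace_const [simp]: "laplace c (\<lambda>p. k) p = 0"
proof -
  have "dir_deriv c v (\<lambda>p. k) = (\<lambda>p. 0)" for v by (rule ext) simp
  then show ?thesis by (simp add: laplace_def)
qed

lemma laplace_sum:
  assumes g: "\<And>j. j \<in> J \<Longrightarrow> smooth_fun A UNIV (g j)" and c: "c \<in> A" "p \<in> fst c"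
  shows "laplace c (\<lambda>q. \<Sum>j\<in>J. g j q) p = (\<Sum>j\<in>J. laplace c (g j) p)"
proof -
  have 1: "smooth_fun A (fst c) (dir_deriv c v (g j))" if "j \<in> J" for j v
    using smooth_fun_dir_deriv[OF g[OF that] c(1) open_UNIV] by simp
  have 2: "dir_deriv c v (dir_deriv c v (\<lambda>q. \<Sum>j\<in>J. g j q)) p = (\<Sum>j\<in>J. dir_deriv c v (dir_deriv c v (g j)) p)" for v
  proof -
    have "dir_deriv c v (dir_deriv c v (\<lambda>q. \<Sum>j\<in>J. g j q)) p = dir_deriv c v (\<lambda>q. \<Sum>j\<in>J. dir_deriv c v (g j) q) p"
      by (rule dir_deriv_cong[OF chart_open[OF c(1)] c c(2)]) (rule dir_deriv_sum[OF g c(1) _ UNIV_I open_UNIV])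
    also have "\<dots> = (\<Sum>j\<in>J. dir_deriv c v (dir_deriv c v (g j)) p)"
      by (rule dir_deriv_sum[OF 1 c c(2) chart_open[OF c(1)]])
    finally show ?thesis .
  qed
  show ?thesis unfolding laplace_def 2 sum.distrib ..
qed

lemma chart_integral_laplace:
  assumes u: "smooth_fun A UNIV u" and c: "c \<in> A" and K: "compact K" "K \<subseteq> fst c" and z: "\<And>q. q \<notin> K \<Longrightarrow> u q = 0"
  shows "chart_integral c (laplace c u) = 0"
proof -
  define V where "V = snd c ` fst c"
  define K' where "K' = snd c ` K"
  have V: "open V" unfolding V_def by (rule open_chart_image'[OF c])
  have K': "compact K'" "K' \<subseteq> V" unfolding K'_def V_def
    using K by (auto intro!: compact_continuous_image continuous_on_subset[OF continuous_on_chart[OF c]])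
  define w where "w y = (if y \<in> V then in_chart c u y else 0)" for y
  have w0: "w y = 0" if "y \<notin> K'" for y
    using that by (auto simp: w_def V_def K'_def in_chart_at[OF c] intro!: z)
  have oK: "open (- K')" using compact_imp_closed[OF K'(1)] by (simp add: open_Compl)
  have sw: "smooth_on UNIV w"
  proof (rule smooth_on_open_Union[OF open_UNIV])
    fix y :: "complex^1"
    show "\<exists>T. open T \<and> y \<in> T \<and> smooth_on (UNIV \<inter> T) w"
    proof (cases "y \<in> V")
      case True
      have "smooth_on V (in_chart c u)" using smooth_funD[OF u c] by (simp add: V_def)
      then have "smooth_on V w" using smooth_on_cong[OF V, of "in_chart c u" w] by (simp add: w_def)
      then show ?thesis using True V by (intro exI[of _ V]) simp
    next
      case False
      have "smooth_on (- K') w" using smooth_on_cong[OF oK, of w "\<lambda>_. 0"] w0 by simp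
      then show ?thesis using False K'(2) oK by (intro exI[of _ "- K'"]) auto
    qed
  qed
  define d where "d v y = frechet_derivative w (at y) v" for v y
  have sd: "smooth_on UNIV (d v)" for v unfolding d_def[abs_def] by (rule smooth_on_frechet_derivative[OF sw])
  have d0: "d v y = 0" if "y \<notin> K'" for v y
    using frechet_derivative_cong(1)[OF oK, of y w "\<lambda>_. 0"] that w0 by (simp add: d_def)
  have I: "integrable lborel (\<lambda>y. frechet_derivative (d v) (at y) v)" "(\<integral>y. frechet_derivative (d v) (at y) v \<partial>lborel) = 0" for v
    by (rule integral_directional_derivative_eq_0[OF smooth_on_imp_has_derivative[OF sd UNIV_I]
          smooth_on_imp_continuous_on[OF smooth_on_frechet_derivative[OF sd]] K'(1) d0], assumption)+
  have dd: "in_chart c (dir_deriv c v u) y = d v y" if "y \<in> V" for v y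
  proof -
    have "in_chart c (dir_deriv c v u) y = frechet_derivative (in_chart c u) (at y) v"
      by (rule in_chart_dir_deriv[OF c]) (use that in \<open>simp add: V_def\<close>)
    also have "frechet_derivative (in_chart c u) (at y) = frechet_derivative w (at y)"
      by (rule frechet_derivative_cong(1)[OF V that]) (simp add: w_def)
    finally show ?thesis by (simp add: d_def)
  qed
  have ddd: "in_chart c (dir_deriv c v (dir_deriv c v u)) y = frechet_derivative (d v) (at y) v" if "y \<in> V" for v y
  proof -
    have "in_chart c (dir_deriv c v (dir_deriv c v u)) y = frechet_derivative (in_chart c (dir_deriv c v u)) (at y) v"
      by (rule in_chart_dir_deriv[OF c]) (use that in \<open>simp add: V_def\<close>)
    also have "frechet_derivative (in_chart c (dir_deriv c v u)) (at y) = frechet_derivative (d v) (at y)"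
      by (rule frechet_derivative_cong(1)[OF V that]) (rule dd)
    finally show ?thesis .
  qed
  have dd0: "frechet_derivative (d v) (at y) v = 0" if "y \<notin> V" for v y
  proof -
    have yk: "y \<in> - K'" using that K'(2) by blast
    have "frechet_derivative (d v) (at y) = frechet_derivative (\<lambda>_. 0::real) (at y)"
      by (rule frechet_derivative_cong(1)[OF oK yk]) (simp add: d0)
    then show ?thesis by simp
  qed
  have "indicator V y *\<^sub>R in_chart c (laplace c u) y =
      frechet_derivative (d (vec 1)) (at y) (vec 1) + frechet_derivative (d (\<i> *s vec 1)) (at y) (\<i> *s vec 1)" for y
  proof (cases "y \<in> V")
    case True
    have "in_chart c (laplace c u) y = in_chart c (dir_deriv c (vec 1) (dir_deriv c (vec 1) u)) y + in_chart c (dir_deriv c (\<i> *s vec 1) (dir_deriv c (\<i> *s vec 1) u)) y"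
      by (simp only: in_chart_def laplace_def)
    then show ?thesis using True unfolding ddd[OF True] by simp
  next
    case False then show ?thesis using dd0[OF False] by simp
  qed
  then show ?thesis
    unfolding chart_integral_def set_lebesgue_integral_def V_def[symmetric]
    using Bochner_Integration.integral_add[OF I(1)[of "vec 1"] I(1)[of "\<i> *s vec 1"]] I(2) by simp
qed

text \<open>
  A partition of unity splits the function into pieces supported in one chart, and there the Laplacian is a sum of directional derivatives of functions with compact support.
\<close>

theorem total_integral_laplace:
  assumes P: "partition_of_unity A N c f" and g: "smooth_fun A UNIV g"
  shows "total_integral N c f (\<lambda>c p. laplace c g p) = 0"
proof -
  have sj: "smooth_fun A UNIV (\<lambda>q. f j q * g q)" if "j < N" for j
    by (rule smooth_fun_mult[OF partition_of_unityD(2)[OF P that] g open_UNIV])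
  have eq: "g = (\<lambda>q. \<Sum>j\<in>{..<N}. f j q * g q)"
    by (rule ext) (simp add: sum_distrib_right[symmetric] partition_of_unity_sum[OF P])
  have "total_integral N c f (\<lambda>c p. laplace c g p) = total_integral N c f (\<lambda>c p. \<Sum>j<N. laplace c (\<lambda>q. f j q * g q) p)"
    by (rule total_integral_cong[OF P], subst eq, rule laplace_sum) (use sj in auto)
  also have "\<dots> = (\<Sum>j<N. total_integral N c f (\<lambda>c p. laplace c (\<lambda>q. f j q * g q) p))"
    by (rule conjunct2[OF total_integral_sum[OF P laplace_density[OF sj]]])
  also have "\<dots> = 0"
  proof (rule sum.neutral, rule ballI)
    fix j assume "j \<in> {..<N}"
    then have j: "j < N" by simp
    note p = partition_of_unityD[OF P j]
    let ?K = "closure {p. f j p \<noteq> 0}"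
    have o: "open (- ?K)" by (simp add: open_Compl)
    have "total_integral N c f (\<lambda>c p. laplace c (\<lambda>q. f j q * g q) p) = chart_integral (c j) (laplace (c j) (\<lambda>q. f j q * g q))"
    proof (rule total_integral_localize[OF P laplace_density[OF sj[OF j]] p(1,4,5)])
      fix d q assume d: "d \<in> A" "q \<in> fst d" "q \<notin> ?K"
      have "laplace d (\<lambda>q. f j q * g q) q = laplace d (\<lambda>q. 0) q"
      proof (rule laplace_cong[OF o d(1,2)])
        show "q \<in> - ?K" using d(3) by simp
        fix q' assume "q' \<in> - ?K"
        then have "q' \<notin> ?K" by simp
        then show "f j q' * g q' = 0" unfolding p(6)[OF \<open>q' \<notin> ?K\<close>] by simp
      qed
      then show "laplace d (\<lambda>q. f j q * g q) q = 0" by simp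
    qed
    also have "\<dots> = 0"
    proof (rule chart_integral_laplace[OF sj[OF j] p(1,4,5)])
      show "f j q * g q = 0" if "q \<notin> ?K" for q unfolding p(6)[OF that] by simp
    qed
    finally show "total_integral N c f (\<lambda>c p. laplace c (\<lambda>q. f j q * g q) p) = 0" .
  qed
  finally show ?thesis .
qed

end

section \<open>The degree of a line bundle\<close>

lemma (in hermitian_line_bundle) weight_change:
  assumes w: "(W, \<tau>) \<in> btriv L" "x \<in> W" and w': "(W', \<tau>') \<in> btriv L" "x \<in> W'"
  shows "weight \<tau> x = (cmod (\<tau>' (frame \<tau> x) $ 1))\<^sup>2 * weight \<tau>' x"
proof -
  let ?k = "\<tau>' (frame \<tau> x) $ 1"
  have "hL (frame \<tau> x) (frame \<tau> x) = ?k * cnj ?k * of_real (weight \<tau>' x)"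
    using hL_frame[OF w'(1,2), of ?k ?k] fibre_frame[OF w'(1,2) frame_fibre(1)[OF w]] by simp
  also have "\<dots> = of_real ((cmod ?k)\<^sup>2 * weight \<tau>' x)"
    unfolding complex_norm_square[symmetric] of_real_mult ..
  finally show ?thesis by (simp add: weight_def[of \<tau>])
qed

context compact_surface
begin

lemma laplace_add:
  assumes fg: "smooth_fun A W f" "smooth_fun A W g" and W: "open W" and c: "c \<in> A" "p \<in> fst c" "p \<in> W"
  shows "laplace c (\<lambda>q. f q + g q) p = laplace c f p + laplace c g p"
proof -
  have o: "open (fst c \<inter> W)" by (rule open_Int[OF chart_open[OF c(1)] W])
  have 2: "dir_deriv c v (dir_deriv c v (\<lambda>q. f q + g q)) p = dir_deriv c v (dir_deriv c v f) p + dir_deriv c v (dir_deriv c v g) p" for v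
  proof -
    have "dir_deriv c v (dir_deriv c v (\<lambda>q. f q + g q)) p = dir_deriv c v (\<lambda>q. dir_deriv c v f q + dir_deriv c v g q) p"
      by (rule dir_deriv_cong[OF o c(1,2)]) (use c in \<open>auto intro: dir_deriv_add[OF fg c(1)]\<close>)
    also have "\<dots> = dir_deriv c v (dir_deriv c v f) p + dir_deriv c v (dir_deriv c v g) p"
      by (rule dir_deriv_add[OF smooth_fun_dir_deriv[OF fg(1) c(1) W] smooth_fun_dir_deriv[OF fg(2) c(1) W] c(1,2)]) (use c in simp)
    finally show ?thesis .
  qed
  show ?thesis unfolding laplace_def 2 by simp
qed

text \<open>
  A change of frame multiplies the square norms with respect to both metrics by the same factor, so the logarithm of their quotient is a global function, and the curvatures differ by its Laplacian.
\<close>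

lemma metric_ratio:
  assumes H: "hermitian_line_bundle A L hL" and H': "hermitian_line_bundle A L h'"
  shows "\<exists>g. smooth_fun A UNIV g \<and> (\<forall>c\<in>A. \<forall>x\<in>fst c.
    line_curvature A L h' c x (vec 1) (\<i> *s vec 1) =
      line_curvature A L hL c x (vec 1) (\<i> *s vec 1) + (\<i> / 2) * of_real (laplace c g x))"
proof -
  interpret H: hermitian_line_bundle A L hL by (rule H)
  interpret H': hermitian_line_bundle A L h' by (rule H')
  define T where "T x = (SOME w. w \<in> btriv L \<and> x \<in> fst w)" for x
  have T: "T x \<in> btriv L" "x \<in> fst (T x)" for x
  proof -
    obtain W \<tau> where "(W, \<tau>) \<in> btriv L" "x \<in> W" using H.L.triv_cover by blast
    then have "\<exists>w. w \<in> btriv L \<and> x \<in> fst w" by (intro exI[of _ "(W, \<tau>)"]) simp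
    then have "T x \<in> btriv L \<and> x \<in> fst (T x)"
      unfolding T_def by (rule someI_ex[where P = "\<lambda>w. w \<in> btriv L \<and> x \<in> fst w"])
    then show "T x \<in> btriv L" "x \<in> fst (T x)" by blast+
  qed
  define g where "g x = ln (H'.weight (snd (T x)) x) - ln (H.weight (snd (T x)) x)" for x
  have g: "g x = ln (H'.weight \<tau> x) - ln (H.weight \<tau> x)" if w: "(W, \<tau>) \<in> btriv L" "x \<in> W" for W \<tau> x
  proof -
    have t: "(fst (T x), snd (T x)) \<in> btriv L" "x \<in> fst (T x)" using T by simp_all
    define k where "k = (cmod (snd (T x) (H.frame \<tau> x) $ 1))\<^sup>2"
    have e: "H.weight \<tau> x = k * H.weight (snd (T x)) x" "H'.weight \<tau> x = k * H'.weight (snd (T x)) x"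
      unfolding k_def by (rule H.weight_change[OF w t], rule H'.weight_change[OF w t])
    have p: "H.weight \<tau> x > 0" "H.weight (snd (T x)) x > 0" "H'.weight (snd (T x)) x > 0"
      by (rule H.weight(2)[OF w], rule H.weight(2)[OF t], rule H'.weight(2)[OF t])
    have "k > 0" using p(1,2) e(1) by (simp add: zero_less_mult_iff)
    then show ?thesis unfolding g_def e using p by (simp add: ln_mult)
  qed
  have sl: "smooth_fun A W (\<lambda>x. ln (H.weight \<tau> x))" "smooth_fun A W (\<lambda>x. ln (H'.weight \<tau> x))" if w: "(W, \<tau>) \<in> btriv L" for W \<tau>
    by (rule smooth_fun_ln[OF H.smooth_weight[OF w] H.L.triv_open[OF w] H.weight(2)[OF w]], assumption)
      (rule smooth_fun_ln[OF H'.smooth_weight[OF w] H.L.triv_open[OF w] H'.weight(2)[OF w]], assumption)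
  have gW: "smooth_fun A W g" if w: "(W, \<tau>) \<in> btriv L" for W \<tau>
    using smooth_fun_cong[OF H.L.triv_open[OF w], of g] g[OF w] smooth_fun_diff[OF sl(2)[OF w] sl(1)[OF w] H.L.triv_open[OF w]]
    by simp
  have "smooth_fun A UNIV g"
  proof (rule smooth_fun_Union[OF open_UNIV])
    fix x :: 'x
    obtain W \<tau> where w: "(W, \<tau>) \<in> btriv L" "x \<in> W" using H.L.triv_cover by blast
    then show "\<exists>N. open N \<and> x \<in> N \<and> smooth_fun A (UNIV \<inter> N) g"
      using gW[OF w(1)] H.L.triv_open[OF w(1)] by (intro exI[of _ W]) simp
  qed
  moreover have "line_curvature A L h' c x (vec 1) (\<i> *s vec 1) =
      line_curvature A L hL c x (vec 1) (\<i> *s vec 1) + (\<i> / 2) * of_real (laplace c g x)" if c: "c \<in> A" "x \<in> fst c" for c x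
  proof -
    obtain W \<tau> where w: "(W, \<tau>) \<in> btriv L" "x \<in> W" using H.L.triv_cover by blast
    note oW = H.L.triv_open[OF w(1)]
    have "laplace c (\<lambda>x. ln (H'.weight \<tau> x)) x = laplace c (\<lambda>x. g x + ln (H.weight \<tau> x)) x"
      by (rule laplace_cong[OF oW c w(2)]) (simp add: g[OF w(1)])
    also have "\<dots> = laplace c g x + laplace c (\<lambda>x. ln (H.weight \<tau> x)) x"
      by (rule laplace_add[OF gW[OF w(1)] sl(1)[OF w(1)] oW c w(2)])
    finally show ?thesis
      unfolding H.line_curvature_laplace[OF w(1) c w(2)] H'.line_curvature_laplace[OF w(1) c w(2)]
      by (simp add: algebra_simps)
  qed
  ultimately show ?thesis by blast
qed

lemma axis_coordinates: "axis (1::1) (1::complex) = vec 1" "axis (1::1) \<i> = \<i> *s vec 1"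
  by (simp_all add: vec_eq_iff forall_1 axis_def)

lemma kaehler_density:
  assumes \<omega>: "kaehler_form A \<omega>"
  shows "density (\<lambda>c p. \<omega> c p (vec 1) (\<i> *s vec 1))"
  unfolding density_def
proof (intro conjI ballI)
  fix c assume c: "c \<in> A"
  have "smooth_on (snd c ` fst c) (in_chart c (\<lambda>p. \<omega> c p (vec 1) (\<i> *s vec 1)))"
    using \<omega> c unfolding kaehler_form_def by blast
  then have "continuous_on (fst c) (\<lambda>p. in_chart c (\<lambda>p. \<omega> c p (vec 1) (\<i> *s vec 1)) (snd c p))"
    by (intro continuous_on_compose2[OF smooth_on_imp_continuous_on continuous_on_chart[OF c]]) auto
  then show "continuous_on (fst c) (\<lambda>p. \<omega> c p (vec 1) (\<i> *s vec 1))"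
    by (rule continuous_on_eq) (rule in_chart_at[OF c])
  fix c' p assume c': "c' \<in> A" and p: "p \<in> fst c \<inter> fst c'"
  define t where "t = dir_deriv c (vec 1) (snd c') p $ 1"
  have t: "dir_deriv c (vec 1) (snd c') p = vec t" by (simp add: t_def vec_eq_iff forall_1)
  have "dir_deriv c (\<i> *s vec 1) (snd c') p = \<i> *s vec t"
    using transition_has_derivative(2)[OF c c', of p "\<i>" "vec 1"] p unfolding t by blast
  then have it: "dir_deriv c (\<i> *s vec 1) (snd c') p = vec (\<i> * t)" by (simp add: vec_eq_iff)
  have "\<omega> c' p (dir_deriv c (vec 1) (snd c') p) (dir_deriv c (\<i> *s vec 1) (snd c') p) = \<omega> c p (vec 1) (\<i> *s vec 1)"
    using \<omega> c c' p unfolding kaehler_form_def by blast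
  then have "\<omega> c p (vec 1) (\<i> *s vec 1) = \<omega> c' p (vec t) (vec (\<i> * t))" unfolding t it by simp
  also have "\<dots> = \<omega> c' p (vec 1) (\<i> *s vec 1) * Im (cnj t * (\<i> * t))"
    by (rule kaehler_dim1(1)[OF \<omega> c']) (use p in blast)
  also have "Im (cnj t * (\<i> * t)) = (cmod t)\<^sup>2" unfolding cmod_power2 by (simp add: power2_eq_square)
  finally show "\<omega> c p (vec 1) (\<i> *s vec 1) = (cmod (dir_deriv c (vec 1) (snd c') p $ 1))\<^sup>2 * \<omega> c' p (vec 1) (\<i> *s vec 1)"
    unfolding t_def by simp
qed

text \<open>
  For the given metric the first Chern form is \<open>Re lam / pi\<close> times the Kaehler form plus a Laplacian, and any other metric changes it by a Laplacian only. Laplacians integrate to zero and the volume is one, so that every metric yields the same number. The constant is real since the curvature form of a line bundle is imaginary.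
\<close>

lemma degree_eq:
  assumes \<omega>: "kaehler_form A \<omega>" "surface_integral A \<omega> = 1"
    and H: "hermitian_line_bundle A L hL" and u: "smooth_fun A UNIV u"
    and F: "\<And>c x. c \<in> A \<Longrightarrow> x \<in> fst c \<Longrightarrow> \<i> * line_curvature A L hL c x (vec 1) (\<i> *s vec 1) =
       2 * lam * of_real (\<omega> c x (vec 1) (\<i> *s vec 1)) + of_real (laplace c u x)"
  shows "lam = of_real (pi * degree_of A L)"
proof -
  obtain N c f where P: "partition_of_unity A N c f" using partition_of_unity_exists by blast
  let ?w = "\<lambda>c p. \<omega> c p (vec 1) (\<i> *s vec 1)"
  note dw = kaehler_density[OF \<omega>(1)]
  have w1: "total_integral N c f ?w = 1"
    using surface_integral_eq[OF P, of \<omega>] dw \<omega>(2) unfolding axis_coordinates by simp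
  interpret H: hermitian_line_bundle A L hL by (rule H)
  have im: "Im lam = 0"
  proof -
    fix x :: 'x
    obtain d where d: "d \<in> A" "x \<in> fst d" using chart_cover by blast
    obtain W \<tau> where w: "(W, \<tau>) \<in> btriv L" "x \<in> W" using H.L.triv_cover by blast
    have "Im (\<i> * ((\<i> / 2) * of_real (laplace d (\<lambda>x. ln (H.weight \<tau> x)) x))) = Im (2 * lam * of_real (?w d x) + of_real (laplace d u x))"
      using F[OF d] unfolding H.line_curvature_laplace[OF w(1) d w(2)] by (rule arg_cong)
    then have "Im lam * ?w d x = 0" by simp
    then show ?thesis using kaehler_dim1(2)[OF \<omega>(1) d] by simp
  qed
  have S: "surface_integral A (\<lambda>c p u v. Re (\<i> / (2 * of_real pi) * line_curvature A L h' c p u v)) = Re lam / pi"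
    if h': "hermitian_metric A L h'" for h'
  proof -
    have H': "hermitian_line_bundle A L h'"
      by (intro hermitian_line_bundle.intro hermitian_line_bundle_axioms.intro h'
          hermitian_line_bundle.axioms(1)[OF H] hermitian_line_bundle.axioms(2)[OF H])
    obtain g where g: "smooth_fun A UNIV g" and F': "\<And>c x. c \<in> A \<Longrightarrow> x \<in> fst c \<Longrightarrow>
        line_curvature A L h' c x (vec 1) (\<i> *s vec 1) =
        line_curvature A L hL c x (vec 1) (\<i> *s vec 1) + (\<i> / 2) * of_real (laplace c g x)"
      using metric_ratio[OF H H'] by blast
    define D where "D c p = (Re lam / pi) * ?w c p + ((1 / (2 * pi)) * laplace c u p + (- 1 / (4 * pi)) * laplace c g p)" for c p
    have pt: "D c p = Re (\<i> / (2 * of_real pi) * line_curvature A L h' c p (vec 1) (\<i> *s vec 1))" if c: "c \<in> A" "p \<in> fst c" for c p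
    proof -
      have "\<i> * line_curvature A L h' c p (vec 1) (\<i> *s vec 1) =
          (2 * lam * of_real (?w c p) + of_real (laplace c u p)) + \<i> * ((\<i> / 2) * of_real (laplace c g p))"
        unfolding F'[OF c] F[OF c, symmetric] by (rule distrib_left)
      then have *: "\<i> / (2 * of_real pi) * line_curvature A L h' c p (vec 1) (\<i> *s vec 1) =
          ((2 * lam * of_real (?w c p) + of_real (laplace c u p)) + \<i> * ((\<i> / 2) * of_real (laplace c g p))) / of_real (2 * pi)"
        by (metis (no_types) of_real_mult of_real_numeral times_divide_eq_left)
      have r: "Re ((2 * lam * of_real (?w c p) + of_real (laplace c u p)) + \<i> * ((\<i> / 2) * of_real (laplace c g p))) =
          2 * Re lam * ?w c p + laplace c u p - laplace c g p / 2"
        by simp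
      show ?thesis unfolding * Re_divide_of_real r D_def by (simp add: field_simps)
    qed
    note dm = density_mult[OF _ continuous_on_const]
    have d: "density (\<lambda>c p. (Re lam / pi) * ?w c p)" "density (\<lambda>c p. (1 / (2 * pi)) * laplace c u p)" "density (\<lambda>c p. (- 1 / (4 * pi)) * laplace c g p)"
      by (rule dm[OF dw], rule dm[OF laplace_density[OF u]], rule dm[OF laplace_density[OF g]])
    have dD: "density D" unfolding D_def[abs_def] by (intro density_add d)
    have "total_integral N c f D = Re lam / pi"
      unfolding D_def[abs_def] total_integral_add[OF P d(1) density_add[OF d(2,3)]] total_integral_add[OF P d(2,3)]
        total_integral_cmult w1 total_integral_laplace[OF P u] total_integral_laplace[OF P g] by simp
    moreover have "surface_integral A (\<lambda>c p u v. Re (\<i> / (2 * of_real pi) * line_curvature A L h' c p u v)) =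
        total_integral N c f (\<lambda>c p. Re (\<i> / (2 * of_real pi) * line_curvature A L h' c p (axis 1 1) (axis 1 \<i>)))"
      by (rule surface_integral_eq[OF P]) (unfold axis_coordinates, rule density_cong[OF dD pt])
    moreover have "total_integral N c f (\<lambda>c p. Re (\<i> / (2 * of_real pi) * line_curvature A L h' c p (axis 1 1) (axis 1 \<i>))) = total_integral N c f D"
      unfolding axis_coordinates by (rule total_integral_cong[OF P]) (rule pt[symmetric])
    ultimately show ?thesis by simp
  qed
  have "degree_of A L = Re lam / pi"
    unfolding degree_of_def
  proof (rule the_equality)
    show "\<exists>h. hermitian_metric A L h \<and> Re lam / pi = surface_integral A (\<lambda>c p u v. Re (\<i> / (2 * of_real pi) * line_curvature A L h c p u v))"
      by (intro exI[of _ hL] conjI H.metric S[symmetric])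
  next
    fix d assume "\<exists>h. hermitian_metric A L h \<and> d = surface_integral A (\<lambda>c p u v. Re (\<i> / (2 * of_real pi) * line_curvature A L h c p u v))"
    then obtain h' where "hermitian_metric A L h'" "d = surface_integral A (\<lambda>c p u v. Re (\<i> / (2 * of_real pi) * line_curvature A L h' c p u v))" by blast
    then show "d = Re lam / pi" using S by simp
  qed
  then have "pi * degree_of A L = Re lam" by simp
  then show ?thesis using im by (simp only: complex_eq_iff Re_complex_of_real Im_complex_of_real)
qed

end

section \<open>Invariant Einstein metrics are vortices\<close>

theorem theorem3p6:
  fixes A :: "('x::t2_space, 1) chart set"
    and \<omega> :: "('x, 1, real) two_form"
    and L :: "('l, 'x, 1) vbundle"
    and E :: "('l \<times> complex \<times> complex, 'x \<times> complex, 2) vbundle"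
  assumes "complex_atlas A"
    and "compact (UNIV :: 'x set)" and "connected (UNIV :: 'x set)"
    and "kaehler_form A \<omega>" and "surface_integral A \<omega> = 1"
    and "holomorphic_bundle A L"
    and "split_extension A L E"
  shows
    "(se2_equivariant A L E \<longrightarrow>
        (\<exists>\<phi>. holomorphic_section A L \<phi> \<and> dolbeault_matrix A L E \<phi>))
     \<and>
     (\<forall>h. pseudo_hermitian_metric (times_line_atlas A) (sum_bundle L) 1 1 h \<and> se2_invariant L h \<longrightarrow>
        (\<exists>hL hX C0 C1. hermitian_metric A L hL \<and> positive_smooth A hX \<and>
           (C0, C1) \<in> {(1, -1), (-1, 1)} \<and> metric_matrix L hL hX C0 C1 h))
     \<and>
     (\<forall>h \<phi> hL hX C0 C1 lam.
        se2_equivariant A L E \<and>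
        pseudo_hermitian_metric (times_line_atlas A) (sum_bundle L) 1 1 h \<and> se2_invariant L h \<and>
        holomorphic_section A L \<phi> \<and> dolbeault_matrix A L E \<phi> \<and>
        hermitian_metric A L hL \<and> positive_smooth A hX \<and>
        (C0, C1) \<in> {(1, -1), (-1, 1)} \<and> metric_matrix L hL hX C0 C1 h \<and>
        pseudo_hermitian_einstein (times_line_atlas A) (product_form A \<omega>) E h lam \<longrightarrow>
        exotic_vortex A \<omega> L \<phi> hL 0 \<and> lam = of_real (pi * degree_of A L))"
proof (intro conjI allI impI)
  have R: "riemann_surface A" by (rule complex_atlas_imp_riemann_surface) fact
  have EB: "extension_bundle A L E"
    by (intro extension_bundle.intro R extension_bundle_axioms.intro) fact+
  have CS: "compact_surface A"
    by (intro compact_surface.intro R compact_surface_axioms.intro) fact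
  show "\<exists>\<phi>. holomorphic_section A L \<phi> \<and> dolbeault_matrix A L E \<phi>" if "se2_equivariant A L E"
    by (rule extension_bundle.equivariant_dolbeault[OF EB that])
  show "\<exists>hL hX C0 C1. hermitian_metric A L hL \<and> positive_smooth A hX \<and>
      (C0, C1) \<in> {(1, -1), (-1, 1)} \<and> metric_matrix L hL hX C0 C1 h"
    if "pseudo_hermitian_metric (times_line_atlas A) (sum_bundle L) 1 1 h \<and> se2_invariant L h" for h
    by (rule extension_bundle.invariant_metric[OF EB \<open>connected UNIV\<close>]) (use that in blast)+
  fix h \<phi> hL hX C0 C1 lam
  assume as: "se2_equivariant A L E \<and>
        pseudo_hermitian_metric (times_line_atlas A) (sum_bundle L) 1 1 h \<and> se2_invariant L h \<and>
        holomorphic_section A L \<phi> \<and> dolbeault_matrix A L E \<phi> \<and>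
        hermitian_metric A L hL \<and> positive_smooth A hX \<and>
        (C0, C1) \<in> {(1, -1), (-1, 1)} \<and> metric_matrix L hL hX C0 C1 h \<and>
        pseudo_hermitian_einstein (times_line_atlas A) (product_form A \<omega>) E h lam"
  have HL: "hermitian_line_bundle A L hL"
    by (intro hermitian_line_bundle.intro hermitian_line_bundle_axioms.intro R
        riemann_surface.holomorphic_imp_hol_vbundle[OF R \<open>holomorphic_bundle A L\<close>]) (use as in blast)
  have fib: "\<phi> x \<in> fibre L x" for x using as unfolding holomorphic_section_def by blast
  have I: "invariant_metric_data A L E hL h hX C0 C1 \<phi>"
    by (intro invariant_metric_data.intro EB HL invariant_metric_data_axioms.intro fib) (use as in blast)+
  have HE: "pseudo_hermitian_einstein (times_line_atlas A) (product_form A \<omega>) E h lam" using as by blast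
  note vc = invariant_metric_data.vortex_and_curvature[OF I \<open>kaehler_form A \<omega>\<close> HE]
  show "exotic_vortex A \<omega> L \<phi> hL 0" by (rule vc(1))
  have hX: "smooth_fun A UNIV hX" "\<And>x. hX x > 0" using as unfolding positive_smooth_def by blast+
  interpret compact_surface A by (rule CS)
  show "lam = of_real (pi * degree_of A L)"
    by (rule degree_eq[OF \<open>kaehler_form A \<omega>\<close> \<open>surface_integral A \<omega> = 1\<close> HL smooth_fun_ln[OF hX(1) open_UNIV hX(2)] vc(2)])
qed

end
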